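(* Let $\Delta$ be a $(d-1)$-dimensional pseudomanifold with homologically isolated singularities. If $d\geq 5$, then $$g_2(\Delta)\geq \binom{d+1}{2}\left[\beta_{d-2}(\Delta)-\beta_{d-1}(\Delta)+1\right] +d \cdot\mathcal{K}_{d-2}(\Delta)- d\sum_{v\in V}\left[\beta_{d-3}(\operatorname{lk} v)-\beta_{d-2}(\operatorname{lk} v)+1\right].$$ The same assertion also holds if $d=4$ and $\Delta$ has at most 5 singularities.
   Context: Fix an infinite field $k$. $g_2=h_2-h_1$ with $h$ the $h$-vector; $\beta_i=\dim_k\tilde H_i(\cdot;k)$. A pseudomanifold with isolated singularities is a pure complex whose vertex links are $k$-homology manifolds; it has homologically isolated singularities if moreover, for $0\le i\le d-2$, the images of the inclusion-induced maps $\iota^*:H^i(\Delta,\{F:v\notin F\};k)\to\tilde H^i(\Delta;k)$, $v\in V$, are linearly independent subspaces. $\mathcal{K}_i(\Delta)$ is the dimension of the kernel of $\sum_v a_v\iota^*:\bigoplus_v H^i(\Delta,\{F:v\notin F\};k)\to\tilde H^i(\Delta;k)$ (any nonzero $a_v$). Singular vertices are those whose link is not a $k$-homology sphere. *)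

theory Defs
  imports "Jordan_Normal_Form.VS_Connect" "HOL-Algebra.AbelCoset"
begin

definition fun_space :: "'a set \<Rightarrow> ('k::field, 'a \<Rightarrow> 'k) module" where
  "fun_space S =
    \<lparr>carrier = {f. \<forall>x. x \<notin> S \<longrightarrow> f x = 0}, mult = undefined, one = undefined,
     zero = (\<lambda>_. 0), add = (\<lambda>f g x. f x + g x), smult = (\<lambda>c f x. c * f x)\<rparr>"

definition quot_space :: "('r, 'a, 'b) module_scheme \<Rightarrow> 'a set \<Rightarrow> ('r, 'a set) module" where
  "quot_space V B =
    \<lparr>carrier = a_rcosets\<^bsub>V\<^esub> B, mult = undefined, one = undefined,
     zero = B, add = (<+>\<^bsub>V\<^esub>), smult = (\<lambda>c X. \<Union>x\<in>X. B +>\<^bsub>V\<^esub> (c \<odot>\<^bsub>V\<^esub> x))\<rparr>"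

definition direct_sum_space :: "'i set \<Rightarrow> ('i \<Rightarrow> ('r, 'a, 'b) module_scheme) \<Rightarrow> ('r, 'i \<Rightarrow> 'a) module" where
  "direct_sum_space I M =
    \<lparr>carrier = (\<Pi>\<^sub>E i\<in>I. carrier (M i)), mult = undefined, one = undefined,
     zero = (\<lambda>i\<in>I. \<zero>\<^bsub>M i\<^esub>), add = (\<lambda>x y. \<lambda>i\<in>I. x i \<oplus>\<^bsub>M i\<^esub> y i),
     smult = (\<lambda>c x. \<lambda>i\<in>I. c \<odot>\<^bsub>M i\<^esub> x i)\<rparr>"

definition independent_subspaces :: "('r, 'a, 'b) module_scheme \<Rightarrow> 'i set \<Rightarrow> ('i \<Rightarrow> 'a set) \<Rightarrow> bool" where
  "independent_subspaces V I W \<longleftrightarrow>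
    (\<forall>x \<in> \<Pi>\<^sub>E i\<in>I. W i. (\<Oplus>\<^bsub>V\<^esub> i\<in>I. x i) = \<zero>\<^bsub>V\<^esub> \<longrightarrow> (\<forall>i\<in>I. x i = \<zero>\<^bsub>V\<^esub>))"

abbreviation vs_dim :: "('k::field, 'a, 'b) module_scheme \<Rightarrow> nat" where
  "vs_dim V \<equiv> vectorspace.dim class_ring V"

definition simplicial_complex :: "'v set set \<Rightarrow> bool" where
  "simplicial_complex \<Delta> \<longleftrightarrow>
    finite \<Delta> \<and> {} \<in> \<Delta> \<and> (\<forall>F\<in>\<Delta>. finite F \<and> (\<forall>G. G \<subseteq> F \<longrightarrow> G \<in> \<Delta>))"

definition vertices :: "'v set set \<Rightarrow> 'v set" where
  "vertices \<Delta> = {v. {v} \<in> \<Delta>}"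

definition faces :: "'v set set \<Rightarrow> int \<Rightarrow> 'v set set" where
  "faces \<Delta> i = {F \<in> \<Delta>. int (card F) = i + 1}"

definition sdim :: "'v set set \<Rightarrow> int" where
  "sdim \<Delta> = int (Max (card ` \<Delta>)) - 1"

definition facets :: "'v set set \<Rightarrow> 'v set set" where
  "facets \<Delta> = {F \<in> \<Delta>. \<forall>G\<in>\<Delta>. F \<subseteq> G \<longrightarrow> F = G}"

definition pure :: "'v set set \<Rightarrow> bool" where
  "pure \<Delta> \<longleftrightarrow> (\<forall>F\<in>facets \<Delta>. int (card F) - 1 = sdim \<Delta>)"

definition link :: "'v set set \<Rightarrow> 'v set \<Rightarrow> 'v set set" where
  "link \<Delta> F = {G. G \<inter> F = {} \<and> G \<union> F \<in> \<Delta>}"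

definition costar :: "'v set set \<Rightarrow> 'v \<Rightarrow> 'v set set" where
  "costar \<Delta> v = {F \<in> \<Delta>. v \<notin> F}"

definition h_num :: "'v set set \<Rightarrow> nat \<Rightarrow> int" where
  "h_num \<Delta> j = (let d = nat (sdim \<Delta> + 1) in
    \<Sum>i\<le>j. (-1) ^ (j - i) * int ((d - i) choose (j - i)) * int (card (faces \<Delta> (int i - 1))))"

definition g2 :: "'v set set \<Rightarrow> int" where
  "g2 \<Delta> = h_num \<Delta> 2 - h_num \<Delta> 1"

text \<open>Faces are oriented by the order on the vertices.  The empty face is a face of dimension
  \<open>-1\<close>, so the groups attached to a complex are the reduced ones.\<close>

definition face_sign :: "'v::linorder \<Rightarrow> 'v set \<Rightarrow> 'k::field" where
  "face_sign v F = (-1) ^ card {u \<in> F. u < v}"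

definition boundary :: "'v::linorder set set \<Rightarrow> ('v set \<Rightarrow> 'k::field) \<Rightarrow> 'v set \<Rightarrow> 'k" where
  "boundary \<Delta> c G = (\<Sum>F\<in>\<Delta>. \<Sum>v | v \<in> F \<and> F - {v} = G. face_sign v F * c F)"

definition chains :: "'v set set \<Rightarrow> int \<Rightarrow> ('k::field, 'v set \<Rightarrow> 'k) module" where
  "chains \<Delta> i = fun_space (faces \<Delta> i)"

definition cycles :: "'v::linorder set set \<Rightarrow> int \<Rightarrow> ('v set \<Rightarrow> 'k::field) set" where
  "cycles \<Delta> i = {c \<in> carrier (chains \<Delta> i). boundary \<Delta> c = (\<lambda>_. 0)}"

definition boundaries :: "'v::linorder set set \<Rightarrow> int \<Rightarrow> ('v set \<Rightarrow> 'k::field) set" where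
  "boundaries \<Delta> i = boundary \<Delta> ` carrier (chains \<Delta> (i + 1))"

definition homology :: "'v::linorder set set \<Rightarrow> int \<Rightarrow> ('k::field, ('v set \<Rightarrow> 'k) set) module" where
  "homology \<Delta> i = quot_space ((chains \<Delta> i)\<lparr>carrier := cycles \<Delta> i\<rparr>) (boundaries \<Delta> i)"

definition betti :: "'k::field itself \<Rightarrow> 'v::linorder set set \<Rightarrow> int \<Rightarrow> nat" where
  "betti _ \<Delta> i = vs_dim (homology \<Delta> i :: ('k, ('v set \<Rightarrow> 'k) set) module)"

definition coboundary :: "'v::linorder set set \<Rightarrow> ('v set \<Rightarrow> 'k::field) \<Rightarrow> 'v set \<Rightarrow> 'k" where
  "coboundary \<Delta> f F = (if F \<in> \<Delta> then \<Sum>v\<in>F. face_sign v F * f (F - {v}) else 0)"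

text \<open>Relative cochains of a pair \<open>(\<Delta>, A)\<close> are the cochains of \<open>\<Delta>\<close> vanishing on \<open>A\<close>.  Reduced
  absolute cohomology is the case where \<open>A\<close> is the void complex \<open>{}\<close>.\<close>

definition cochains :: "'v set set \<Rightarrow> 'v set set \<Rightarrow> int \<Rightarrow> ('k::field, 'v set \<Rightarrow> 'k) module" where
  "cochains \<Delta> A i = fun_space (faces \<Delta> i - A)"

definition cocycles :: "'v::linorder set set \<Rightarrow> 'v set set \<Rightarrow> int \<Rightarrow> ('v set \<Rightarrow> 'k::field) set" where
  "cocycles \<Delta> A i = {f \<in> carrier (cochains \<Delta> A i). coboundary \<Delta> f = (\<lambda>_. 0)}"

definition coboundaries :: "'v::linorder set set \<Rightarrow> 'v set set \<Rightarrow> int \<Rightarrow> ('v set \<Rightarrow> 'k::field) set" where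
  "coboundaries \<Delta> A i = coboundary \<Delta> ` carrier (cochains \<Delta> A (i - 1))"

definition cohomology ::
    "'v::linorder set set \<Rightarrow> 'v set set \<Rightarrow> int \<Rightarrow> ('k::field, ('v set \<Rightarrow> 'k) set) module" where
  "cohomology \<Delta> A i =
    quot_space ((cochains \<Delta> A i)\<lparr>carrier := cocycles \<Delta> A i\<rparr>) (coboundaries \<Delta> A i)"

text \<open>The map from the cohomology of a pair \<open>(\<Delta>, A)\<close> to that of \<open>\<Delta>\<close> sends the class of a relative
  cocycle to the class of the same function; it is independent of \<open>A\<close> as a map on cosets.\<close>

definition incl_star ::
    "'v::linorder set set \<Rightarrow> int \<Rightarrow> ('v set \<Rightarrow> 'k::field) set \<Rightarrow> ('v set \<Rightarrow> 'k) set" where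
  "incl_star \<Delta> i X = (\<Union>f\<in>X. coboundaries \<Delta> {} i +>\<^bsub>cochains \<Delta> {} i\<^esub> f)"

text \<open>Without boundary: the link of a nonempty face \<open>F\<close> has the reduced homology of the sphere of
  dimension \<open>sdim \<Delta> - card F\<close>.\<close>

definition homology_manifold :: "'k::field itself \<Rightarrow> 'v::linorder set set \<Rightarrow> bool" where
  "homology_manifold k \<Delta> \<longleftrightarrow> simplicial_complex \<Delta> \<and>
    (\<forall>F\<in>\<Delta>. F \<noteq> {} \<longrightarrow>
      (\<forall>i. betti k (link \<Delta> F) i = (if i = sdim \<Delta> - int (card F) then 1 else 0)))"

definition homology_sphere :: "'k::field itself \<Rightarrow> 'v::linorder set set \<Rightarrow> bool" where
  "homology_sphere k \<Delta> \<longleftrightarrow> homology_manifold k \<Delta> \<and>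
    (\<forall>i. betti k \<Delta> i = (if i = sdim \<Delta> then 1 else 0))"

definition isolated_singularities :: "'k::field itself \<Rightarrow> 'v::linorder set set \<Rightarrow> bool" where
  "isolated_singularities k \<Delta> \<longleftrightarrow> simplicial_complex \<Delta> \<and> pure \<Delta> \<and>
    (\<forall>v\<in>vertices \<Delta>. homology_manifold k (link \<Delta> {v}))"

definition singular_vertices :: "'k::field itself \<Rightarrow> 'v::linorder set set \<Rightarrow> 'v set" where
  "singular_vertices k \<Delta> = {v \<in> vertices \<Delta>. \<not> homology_sphere k (link \<Delta> {v})}"

definition homologically_isolated_singularities ::
    "'k::field itself \<Rightarrow> 'v::linorder set set \<Rightarrow> bool" where
  "homologically_isolated_singularities k \<Delta> \<longleftrightarrow> isolated_singularities k \<Delta> \<and>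
    (\<forall>i. 0 \<le> i \<and> i \<le> sdim \<Delta> - 1 \<longrightarrow>
      independent_subspaces (cohomology \<Delta> {} i :: ('k, ('v set \<Rightarrow> 'k) set) module) (vertices \<Delta>)
        (\<lambda>v. incl_star \<Delta> i ` carrier (cohomology \<Delta> (costar \<Delta> v) i)))"

definition sum_incl_star :: "('v::linorder \<Rightarrow> 'k::field) \<Rightarrow> 'v set set \<Rightarrow> int \<Rightarrow>
    ('v \<Rightarrow> ('v set \<Rightarrow> 'k) set) \<Rightarrow> ('v set \<Rightarrow> 'k) set" where
  "sum_incl_star a \<Delta> i x =
    (\<Oplus>\<^bsub>cohomology \<Delta> {} i\<^esub> v\<in>vertices \<Delta>. a v \<odot>\<^bsub>cohomology \<Delta> {} i\<^esub> incl_star \<Delta> i (x v))"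

text \<open>The dimension does not depend on the coefficients \<open>a v\<close> as long as they are nonzero.\<close>

definition kernel_dim :: "('v::linorder \<Rightarrow> 'k::field) \<Rightarrow> 'v set set \<Rightarrow> int \<Rightarrow> nat" where
  "kernel_dim a \<Delta> i =
    (let M = direct_sum_space (vertices \<Delta>) (\<lambda>v. cohomology \<Delta> (costar \<Delta> v) i)
     in vs_dim (M\<lparr>carrier := {x \<in> carrier M. sum_incl_star a \<Delta> i x = \<zero>\<^bsub>cohomology \<Delta> {} i\<^esub>}\<rparr>))"

end

theory Submission
  imports Defs "HOL-Library.Function_Algebras"
begin

text \<open>Place the vertices generically in \<open>k\<^sup>n\<close>, \<open>n = d + 1\<close>, by \<open>v \<mapsto> p v\<close>.  Consider pairs of a
  \<open>(d-2)\<close>-cycle \<open>Z\<close> with values in alternating forms on \<open>k\<^sup>n\<close> and, for every vertex \<open>v\<close>, a chain \<open>b v\<close> on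
  the facets containing \<open>v\<close> with values in the functionals that vanish at \<open>p v\<close>, subject to
  \<open>\<partial> (b v) = Z (p v, -)\<close> on the ridges containing \<open>v\<close>.  For an edge \<open>{u, v}\<close> the number
  \<open>b u (p v) + b v (p u)\<close> is a relative cycle of the star of the edge, hence, the link being a homology
  sphere, determined by its value on one facet.  A solution all of whose edge numbers vanish
  comes from a chain of forms on the facets: such forms exist facet by facet, and their boundary
  equals \<open>Z\<close> because a cycle of forms on ridges, each form killed by the vertices of its ridge, is zero.
  So the dimension of the space of solutions is at most the number of edges plus \<open>n choose 2\<close> times
  the number of facets; bounding it from below by counting equations gives the inequality.  The
  linear independence hypothesis enters in the number of equations, where \<open>\<K>\<close> appears.

  The vanishing of such cycles is a statement about the links of the \<open>(d-4)\<close>-faces.  They are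
  homology 2-spheres, which are generically rigid in dimension 3 by Fogelsanger's contraction
  argument for minimal cycles and therefore, having \<open>3 f\<^sub>0 - 6\<close> edges, free of stresses; the Hodge
  star of \<open>k\<^sup>4\<close> turns a cycle of forms into a stress.  If \<open>d = 4\<close>, ridges whose vertices are all singular lie in
  a set of five vertices, which can be placed independently.\<close>

section \<open>Function spaces\<close>

text \<open>The bound is a count of unknowns against equations. Global unknowns less facet forms
  give \<open>binom(d+1,2) (dim Z - f_{d-1})\<close>, and
  \<open>dim Z - f_{d-1} = \<beta>_{d-2} - \<beta>_{d-1}\<close>. A vertex \<open>v\<close> adds
  \<open>d\<close> times the number of its facets, less \<open>d\<close> times the dimension of a
  space \<open>I v\<close> in which each coordinate of its equation takes values; the factor is
  \<open>d\<close> and not \<open>d + 1\<close> because functionals vanishing at \<open>p v\<close>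
  have \<open>d\<close> free coordinates. Both summands 1 of the bound come from
  \<open>g_2 = f_1 - d f_0 + binom(d+1,2)\<close>. \<open>I v\<close> is annihilated by the relative
  cocycles of the star of \<open>v\<close> that are coboundaries in \<open>\<Delta>\<close>. Modulo
  relative coboundaries these are the kernel of one inclusion map, and independence makes the kernel
  of the sum map the direct sum of such kernels: \<open>\<K>\<close> counts redundant equations. The
  obstacle is that links of singular vertices need not be spheres. A \<open>(d-4)\<close>-face has
  \<open>d - 3\<close> vertices, at least two when \<open>d \<ge> 5\<close>, and then its link is a
  sphere. For \<open>d = 4\<close> it is a vertex, and five is the size of a basis of
  \<open>k\<^sup>5\<close>. Since \<open>k\<close> is arbitrary apart from being infinite,
  velocities are functionals, forms are alternating, and nothing is divided by 2.\<close>

interpretation fs: vector_space "\<lambda>(c::'k::field) (f::'x \<Rightarrow> 'k) x. c * f x"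
  by unfold_locales (auto simp: fun_eq_iff algebra_simps)

interpretation fsp: vector_space_pair
  "\<lambda>(c::'k::field) (f::'x \<Rightarrow> 'k) x. c * f x" "\<lambda>(c::'k::field) (f::'y \<Rightarrow> 'k) x. c * f x"
  by unfold_locales

abbreviation lin :: "(('x \<Rightarrow> 'k::field) \<Rightarrow> 'y \<Rightarrow> 'k) \<Rightarrow> bool" where
  "lin \<equiv> Vector_Spaces.linear (\<lambda>c f x. c * f x) (\<lambda>c f x. c * f x)"

text \<open>Chain groups of all degrees are handled as subspaces of one type of total functions, so
  that boundary maps need no domain and compose freely. \<open>FS X\<close> carries the
  finite-dimensionality.\<close>

definition FS :: "'x set \<Rightarrow> ('x \<Rightarrow> 'k::field) set" where
  "FS X = {f. \<forall>x. x \<notin> X \<longrightarrow> f x = 0}"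

definition unitf :: "'x \<Rightarrow> 'x \<Rightarrow> 'k::field" where
  "unitf x = (\<lambda>y. if y = x then 1 else 0)"

lemma sum_fun_apply: "(\<Sum>i\<in>A. f i) x = (\<Sum>i\<in>A. f i x)"
  for f :: "'i \<Rightarrow> 'x \<Rightarrow> 'a::comm_monoid_add"
  by (induction A rule: infinite_finite_induct) auto

lemma linI:
  assumes "\<And>f g. T (f + g) = T f + T g" "\<And>c f. T (\<lambda>x. c * f x) = (\<lambda>x. c * T f x)"
  shows "lin T"
  by (unfold_locales) (use assms in auto)

lemma lin_add: "lin T \<Longrightarrow> T (f + g) = T f + T g"
  by (rule fsp.linear_add)

lemma lin_scale: "lin T \<Longrightarrow> T (\<lambda>x. c * f x) = (\<lambda>x. c * T f x)"
  by (rule fsp.linear_scale)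

lemma subspaceI:
  assumes "(\<lambda>_. 0) \<in> U" "\<And>f g. f \<in> U \<Longrightarrow> g \<in> U \<Longrightarrow> (\<lambda>x. f x + g x) \<in> U"
    "\<And>c f. f \<in> U \<Longrightarrow> (\<lambda>x. c * f x) \<in> U"
  shows "fs.subspace U"
  using assms by (auto simp: fs.subspace_def zero_fun_def plus_fun_def)

lemma subspace_FS: "fs.subspace (FS X)"
  by (auto intro!: subspaceI simp: FS_def)

lemma FS_sum_unitf: "finite X \<Longrightarrow> f \<in> FS X \<Longrightarrow> f = (\<Sum>x\<in>X. (\<lambda>y. f x * unitf x y))"
  by (auto simp: fun_eq_iff FS_def unitf_def sum_fun_apply if_distrib[of "\<lambda>z. _ * z"] sum.delta cong: if_cong)

lemma span_unitf:
  assumes "finite X" shows "fs.span (unitf ` X) = (FS X :: ('x \<Rightarrow> 'k::field) set)"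
proof
  show "fs.span (unitf ` X) \<subseteq> (FS X :: ('x \<Rightarrow> 'k::field) set)"
    by (rule fs.span_minimal[OF _ subspace_FS]) (auto simp: FS_def unitf_def)
  show "FS X \<subseteq> fs.span (unitf ` X :: ('x \<Rightarrow> 'k::field) set)"
  proof
    fix f :: "'x \<Rightarrow> 'k" assume "f \<in> FS X"
    then have "f = (\<Sum>x\<in>X. (\<lambda>y. f x * unitf x y))" by (rule FS_sum_unitf[OF assms])
    also have "\<dots> \<in> fs.span (unitf ` X)"
      by (intro fs.span_sum fs.span_scale fs.span_base) auto
    finally show "f \<in> fs.span (unitf ` X)" .
  qed
qed

lemma inj_unitf: "inj_on (unitf :: 'x \<Rightarrow> 'x \<Rightarrow> 'k::field) X"
  by (auto simp: inj_on_def unitf_def fun_eq_iff split: if_splits)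

lemma independent_unitf:
  assumes "finite X" shows "fs.independent (unitf ` X :: ('x \<Rightarrow> 'k::field) set)"
proof (rule fs.independent_if_scalars_zero)
  fix u :: "('x \<Rightarrow> 'k) \<Rightarrow> 'k" and v :: "'x \<Rightarrow> 'k"
  assume s: "(\<Sum>v\<in>unitf ` X. (\<lambda>x. u v * v x)) = 0" and v: "v \<in> unitf ` X"
  then obtain x where x: "x \<in> X" "v = unitf x" by auto
  have "0 = (\<Sum>y\<in>X. (\<lambda>z. u (unitf y) * unitf y z)) x"
    using s by (simp add: sum.reindex[OF inj_unitf] o_def)
  also have "\<dots> = (\<Sum>y\<in>X. u (unitf y) * unitf y x)" by (simp add: sum_fun_apply)
  also have "\<dots> = u v"
    using x assms by (simp add: unitf_def if_distrib[of "\<lambda>z. _ * z"] sum.delta cong: if_cong)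
  finally show "u v = 0" by simp
qed (use assms in auto)

lemma dim_FS: "finite X \<Longrightarrow> fs.dim (FS X :: ('x \<Rightarrow> 'k::field) set) = card X"
  using fs.dim_span_eq_card_independent[OF independent_unitf[of X, where ?'k='k]]
    card_image[OF inj_unitf[where ?'k='k], of X]
  by (simp add: span_unitf)

lemma independent_bound:
  assumes "finite X" "fs.independent B" "B \<subseteq> (FS X :: ('x \<Rightarrow> 'k::field) set)"
  shows "finite B" "card B \<le> card X"
  using fs.independent_span_bound[of "unitf ` X" B] assms span_unitf[OF assms(1), where ?'k='k]
    card_image[OF inj_unitf[where ?'k='k], of X] by auto

text \<open>A basis of \<open>K\<close> is extended to one of \<open>U\<close>, and the added
  vectors form \<open>C\<close>. Finiteness comes from \<open>U \<subseteq> FS X\<close>, as the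
  ambient function space may be infinite-dimensional. Rank-nullity and the dimension of quotients
  both rest on this.\<close>

lemma subspace_complement:
  fixes K U :: "('x \<Rightarrow> 'k::field) set"
  assumes X: "finite X" "U \<subseteq> FS X" and K: "fs.subspace K" "K \<subseteq> U" and U: "fs.subspace U"
  obtains C where "finite C" "fs.independent C" "C \<subseteq> U" "fs.span C \<inter> K = {0}"
    "U = {x + y |x y. x \<in> K \<and> y \<in> fs.span C}" "card C + fs.dim K = fs.dim U"
proof -
  obtain BK where BK: "BK \<subseteq> K" "fs.independent BK" "K \<subseteq> fs.span BK" "card BK = fs.dim K"
    using fs.basis_exists by metis
  obtain B where B: "BK \<subseteq> B" "B \<subseteq> U" "fs.independent B" "U \<subseteq> fs.span B"
    using fs.maximal_independent_subset_extend[of BK U] BK K by blast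
  have fB: "finite B" using independent_bound[OF X(1) B(3)] B(2) X(2) by auto
  have sK: "fs.span BK = K" using BK K fs.span_minimal by blast
  have sU: "fs.span B = U" using B U fs.span_minimal by blast
  let ?C = "B - BK"
  have ind: "fs.independent ?C" using B(3) fs.independent_mono by blast
  have *: "fs.span ?C \<inter> K = {0}"
  proof (intro equalityI subsetI)
    fix x assume x: "x \<in> fs.span ?C \<inter> K"
    then obtain u where u: "x = (\<Sum>v\<in>?C. (\<lambda>t. u v * v t))"
      using fB fs.span_finite[of ?C] by auto
    obtain w where w: "x = (\<Sum>v\<in>BK. (\<lambda>t. w v * v t))"
      using x sK fs.span_finite[of BK] fB B(1) finite_subset by blast
    \<comment> \<open>The difference of the two expansions of \<open>x\<close>, a relation among the
      vectors of \<open>B\<close>.\<close>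
    let ?h = "\<lambda>v. if v \<in> BK then w v else - u v"
    have "(\<Sum>v\<in>B. (\<lambda>t. ?h v * v t)) = (\<Sum>v\<in>BK. (\<lambda>t. ?h v * v t)) + (\<Sum>v\<in>?C. (\<lambda>t. ?h v * v t))"
      using sum.subset_diff[OF B(1) fB, of "\<lambda>v. (\<lambda>t. ?h v * v t)"] by (simp add: add.commute)
    also have "(\<Sum>v\<in>?C. (\<lambda>t. ?h v * v t)) = - x"
      unfolding u sum_negf[symmetric] by (intro sum.cong refl) (auto simp: fun_eq_iff)
    also have "(\<Sum>v\<in>BK. (\<lambda>t. ?h v * v t)) = x" unfolding w by (intro sum.cong refl) auto
    finally have "(\<Sum>v\<in>B. (\<lambda>t. ?h v * v t)) = 0" by (simp add: zero_fun_def)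
    then have "fs.dependent B" if "v \<in> B" "?h v \<noteq> 0" for v
      unfolding fs.dependent_finite[OF fB] using that by (intro exI[of _ ?h] conjI bexI[of _ v])
    then have "?h v = 0" if "v \<in> B" for v using B(3) that by blast
    then have "\<forall>v\<in>BK. w v = 0" using B(1) by fastforce
    then have "x = (\<Sum>v\<in>BK. (\<lambda>t. 0))" unfolding w by (intro sum.cong) auto
    then show "x \<in> {0}" by (simp add: zero_fun_def[symmetric])
  qed (use fs.span_zero fs.subspace_0 K in auto)
  have "U = fs.span (BK \<union> ?C)" using sU B(1) by (simp add: Un_absorb1)
  then have "U = {x + y |x y. x \<in> K \<and> y \<in> fs.span ?C}"
    using fs.span_Un[of BK ?C] sK by auto
  moreover have "card ?C + fs.dim K = fs.dim U"
    using fs.dim_span_eq_card_independent[OF B(3)] sU BK(4) card_Diff_subset[of BK B]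
      card_mono[OF fB B(1)] B(1) fB finite_subset by fastforce
  ultimately show ?thesis using that[of ?C] fB ind * B(2) by blast
qed

lemma rank_nullity:
  fixes U :: "('x \<Rightarrow> 'k::field) set" and T :: "('x \<Rightarrow> 'k) \<Rightarrow> 'y \<Rightarrow> 'k"
  assumes X: "finite X" "U \<subseteq> FS X" and U: "fs.subspace U" and T: "lin T"
  shows "fs.dim U = fs.dim {f \<in> U. T f = 0} + fs.dim (T ` U)"
proof -
  let ?K = "{f \<in> U. T f = 0}"
  have K: "fs.subspace ?K"
  proof (rule subspaceI)
    show "(\<lambda>_. 0) \<in> ?K"
      using fs.subspace_0[OF U] fsp.linear_0[OF T] by (simp add: zero_fun_def)
    show "(\<lambda>x. f x + g x) \<in> ?K" if "f \<in> ?K" "g \<in> ?K" for f g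
      using fs.subspace_add[OF U] lin_add[OF T, of f g] that by (auto simp: plus_fun_def)
    show "(\<lambda>x. c * f x) \<in> ?K" if "f \<in> ?K" for c f
      using fs.subspace_scale[OF U] lin_scale[OF T, of c f] that by (auto simp: zero_fun_def)
  qed
  obtain C where C: "finite C" "fs.independent C" "C \<subseteq> U" "fs.span C \<inter> ?K = {0}"
    "U = {x + y |x y. x \<in> ?K \<and> y \<in> fs.span C}" "card C + fs.dim ?K = fs.dim U"
    using subspace_complement[OF X K _ U] by blast
  have sC: "fs.span C \<subseteq> U" using C(3) U by (rule fs.span_minimal)
  have inj: "inj_on T (fs.span C)"
  proof (rule inj_onI)
    fix x y assume xy: "x \<in> fs.span C" "y \<in> fs.span C" "T x = T y"
    then have "x - y \<in> fs.span C" "T (x - y) = 0"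
      by (auto simp: fs.span_diff fsp.linear_diff[OF T])
    then have "x - y \<in> {0}" using C(4) sC by blast
    then show "x = y" by simp
  qed
  have "fs.independent (T ` C)" by (rule fsp.linear_independent_injective_image[OF T C(2) inj])
  moreover have "fs.span (T ` C) = T ` U"
  proof -
    have "T ` U = T ` fs.span C"
    proof
      show "T ` U \<subseteq> T ` fs.span C"
      proof
        fix z assume "z \<in> T ` U"
        then obtain u where u: "u \<in> U" "z = T u" by blast
        obtain x y where xy: "T x = 0" "y \<in> fs.span C" "u = x + y" using u(1) by (subst (asm) C(5)) blast
        have "z = T y" unfolding u(2) xy(3) lin_add[OF T] xy(1) by simp
        then show "z \<in> T ` fs.span C" using xy(2) by blast
      qed
    qed (use sC in auto)
    then show ?thesis by (simp add: fsp.linear_span_image[OF T])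
  qed
  moreover have "card (T ` C) = card C"
    using inj fs.span_superset card_image inj_on_subset by metis
  ultimately show ?thesis
    using fs.dim_span_eq_card_independent[of "T ` C"] C(6) by simp
qed

lemma dim_mono:
  fixes U V :: "('x \<Rightarrow> 'k::field) set"
  assumes "finite X" "V \<subseteq> FS X" "U \<subseteq> V"
  shows "fs.dim U \<le> fs.dim V"
proof -
  obtain B where B: "B \<subseteq> V" "fs.independent B" "V \<subseteq> fs.span B" "card B = fs.dim V"
    using fs.basis_exists by metis
  have "finite B" using independent_bound(1)[OF assms(1) B(2)] B(1) assms by blast
  then show ?thesis using fs.dim_le_card[of U B] B assms by auto
qed

lemma dim_inj_le:
  fixes U :: "('x \<Rightarrow> 'k::field) set" and T :: "('x \<Rightarrow> 'k) \<Rightarrow> 'y \<Rightarrow> 'k"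
  assumes "finite X" "U \<subseteq> FS X" "fs.subspace U" "lin T"
  shows "fs.dim (T ` U) \<le> fs.dim U"
  using rank_nullity[OF assms] by simp

lemma dim_inj:
  fixes U :: "('x \<Rightarrow> 'k::field) set" and T :: "('x \<Rightarrow> 'k) \<Rightarrow> 'y \<Rightarrow> 'k"
  assumes "finite X" "U \<subseteq> FS X" "fs.subspace U" "lin T" "\<And>f. f \<in> U \<Longrightarrow> T f = 0 \<Longrightarrow> f = 0"
  shows "fs.dim (T ` U) = fs.dim U"
proof -
  have "{f \<in> U. T f = 0} = {0}"
    using assms(5) fs.subspace_0[OF assms(3)] fsp.linear_0[OF assms(4)] by auto
  moreover have "fs.dim ({0} :: ('x \<Rightarrow> 'k) set) = 0"
    using fs.dim_le_card[of "{0}" "{}"] by simp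
  ultimately show ?thesis using rank_nullity[OF assms(1-4)] by simp
qed

lemma dim_zero_iff:
  fixes U :: "('x \<Rightarrow> 'k::field) set"
  assumes "finite X" "U \<subseteq> FS X" "fs.dim U = 0" "f \<in> U" shows "f = 0"
proof -
  obtain B where B: "B \<subseteq> U" "fs.independent B" "U \<subseteq> fs.span B" "card B = fs.dim U"
    using fs.basis_exists by metis
  have "finite B" using independent_bound(1)[OF assms(1) B(2)] B(1) assms by blast
  then have "B = {}" using B assms by simp
  then show ?thesis using B assms by auto
qed

text \<open>Pairing with a basis \<open>B\<close> of \<open>N\<close> maps onto \<open>FS B\<close>,
  and its kernel is the annihilator of \<open>N\<close>. All duality of the proof goes through this
  count: stresses against motions, relative cycles against coboundaries, \<open>I v\<close> against
  cocycles.\<close>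

lemma dim_perp:
  fixes N :: "('x \<Rightarrow> 'k::field) set"
  assumes X: "finite X" and N: "N \<subseteq> FS X"
  shows "fs.dim {f \<in> FS X. \<forall>n\<in>N. (\<Sum>x\<in>X. n x * f x) = 0} + fs.dim N = card X"
proof -
  obtain B where B: "B \<subseteq> N" "fs.independent B" "N \<subseteq> fs.span B" "card B = fs.dim N"
    using fs.basis_exists by metis
  have fB: "finite B" using independent_bound(1)[OF X B(2)] B(1) N by blast
  define T where "T = (\<lambda>(f::'x \<Rightarrow> 'k) b. if b \<in> B then (\<Sum>x\<in>X. b x * f x) else 0)"
  have T: "lin T"
    by (rule linI) (auto simp: T_def fun_eq_iff algebra_simps sum.distrib sum_distrib_left)
  have perp: "{f \<in> FS X. T f = 0} = {f \<in> FS X. \<forall>n\<in>N. (\<Sum>x\<in>X. n x * f x) = 0}" (is "?A = ?P")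
  proof (intro equalityI subsetI)
    fix f assume f: "f \<in> ?A"
    have "(\<Sum>x\<in>X. n x * f x) = 0" if n: "n \<in> N" for n
    proof -
      obtain u where "n = (\<Sum>v\<in>B. (\<lambda>t. u v * v t))"
        using n B(3) fs.span_finite[OF fB] by auto
      then have "(\<Sum>x\<in>X. n x * f x) = (\<Sum>x\<in>X. \<Sum>v\<in>B. u v * (v x * f x))"
        by (simp add: sum_fun_apply sum_distrib_right mult.assoc)
      also have "\<dots> = (\<Sum>v\<in>B. u v * T f v)"
        by (subst sum.swap) (simp add: T_def sum_distrib_left)
      finally show ?thesis using f by simp
    qed
    then show "f \<in> ?P" using f by auto
  qed (use B(1) in \<open>auto simp: T_def fun_eq_iff\<close>)
  have img: "T ` FS X = FS B"
  proof
    show "T ` FS X \<subseteq> FS B" by (auto simp: T_def FS_def)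
    have "unitf b \<in> T ` FS X" if b: "b \<in> B" for b
    proof -
      \<comment> \<open>The coordinate functional of \<open>b\<close> is encoded with values in the
        constant functions and read off at one point \<open>x0\<close>; \<open>h\<close> is the
        vector that represents it under the pairing.\<close>
      obtain g :: "('x \<Rightarrow> 'k) \<Rightarrow> 'x \<Rightarrow> 'k" where g: "lin g" "\<forall>y\<in>B. g y = (\<lambda>_. if y = b then 1 else 0)"
        using fsp.linear_independent_extend[OF B(2), of "\<lambda>y _. if y = b then 1 else 0"] by blast
      obtain x0 :: 'x where True by simp
      define h where "h = (\<lambda>x. if x \<in> X then g (unitf x) x0 else 0)"
      have "T h b' = unitf b b'" for b'
      proof (cases "b' \<in> B")
        case True
        then have "b' = (\<Sum>x\<in>X. (\<lambda>y. b' x * unitf x y))" using FS_sum_unitf[OF X] B(1) N by blast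
        then have "g b' = g (\<Sum>x\<in>X. (\<lambda>y. b' x * unitf x y))" by (rule arg_cong)
        also have "\<dots> = (\<Sum>x\<in>X. g (\<lambda>y. b' x * unitf x y))" by (rule fsp.linear_sum[OF g(1)])
        finally have "g b' = (\<Sum>x\<in>X. g (\<lambda>y. b' x * unitf x y))" .
        then have "g b' x0 = (\<Sum>x\<in>X. b' x * g (unitf x) x0)"
          by (simp add: fsp.linear_scale[OF g(1)] sum_fun_apply)
        then show ?thesis using True g(2) by (auto simp: T_def h_def unitf_def cong: sum.cong)
      qed (use b in \<open>auto simp: T_def unitf_def\<close>)
      moreover have "h \<in> FS X" by (auto simp: h_def FS_def)
      ultimately show ?thesis by (metis ext image_eqI)
    qed
    moreover have "fs.subspace (T ` FS X)" by (rule fsp.linear_subspace_image[OF T subspace_FS])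
    ultimately have "fs.span (unitf ` B) \<subseteq> T ` FS X" by (intro fs.span_minimal) auto
    then show "FS B \<subseteq> T ` FS X" by (simp add: span_unitf[OF fB])
  qed
  show ?thesis
    using rank_nullity[OF X order_refl subspace_FS T] dim_FS[OF X, where ?'k='k]
      dim_FS[OF fB, where ?'k='k] perp img B(4) by simp
qed

text \<open>A family of vectors indexed by a finite set of labels is one function of a label and a point.\<close>

definition lab :: "'l set \<Rightarrow> ('l \<Rightarrow> ('x \<Rightarrow> 'k::field) set) \<Rightarrow> ('l \<times> 'x \<Rightarrow> 'k) set" where
  "lab L U = {f. (\<forall>l\<in>L. (\<lambda>x. f (l, x)) \<in> U l) \<and> (\<forall>l x. l \<notin> L \<longrightarrow> f (l, x) = 0)}"

lemma subspace_lab: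
  assumes "\<And>l. l \<in> L \<Longrightarrow> fs.subspace (U l)" shows "fs.subspace (lab L U)"
proof (rule subspaceI)
  show "(\<lambda>_. 0) \<in> lab L U"
    using fs.subspace_0[OF assms] by (auto simp: lab_def zero_fun_def)
  show "(\<lambda>x. f x + g x) \<in> lab L U" if "f \<in> lab L U" "g \<in> lab L U" for f g
    using fs.subspace_add[OF assms] that by (auto simp: lab_def plus_fun_def)
  show "(\<lambda>x. c * f x) \<in> lab L U" if "f \<in> lab L U" for c f
    using fs.subspace_scale[OF assms] that by (auto simp: lab_def)
qed

lemma lab_FS:
  assumes "\<And>l. l \<in> L \<Longrightarrow> U l \<subseteq> FS (X l)" shows "lab L U \<subseteq> FS (Sigma L X)"
  using assms by (fastforce simp: lab_def FS_def)

text \<open>Evaluation at one label \<open>m\<close> has the families on the remaining labels as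
  kernel and all of \<open>U m\<close> as image.\<close>

lemma dim_lab:
  fixes U :: "'l \<Rightarrow> ('x \<Rightarrow> 'k::field) set"
  assumes "finite L" "\<And>l. l \<in> L \<Longrightarrow> fs.subspace (U l)" "\<And>l. l \<in> L \<Longrightarrow> U l \<subseteq> FS (X l)"
    "\<And>l. l \<in> L \<Longrightarrow> finite (X l)"
  shows "fs.dim (lab L U) = (\<Sum>l\<in>L. fs.dim (U l))"
  using assms
proof (induction L)
  case empty
  have "lab {} U = {0}" by (auto simp: lab_def zero_fun_def)
  then show ?case using fs.dim_le_card[of "{0 :: 'l \<times> 'x \<Rightarrow> 'k}" "{}"] by simp
next
  case (insert m L)
  define T where "T = (\<lambda>(f :: 'l \<times> 'x \<Rightarrow> 'k) x. f (m, x))"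
  have T: "lin T" by (rule linI) (auto simp: T_def fun_eq_iff)
  have fin: "finite (Sigma (insert m L) X)" using insert by (intro finite_SigmaI) auto
  have "{f \<in> lab (insert m L) U. T f = 0} = lab L U"
    using fs.subspace_0[OF insert.prems(1)[of m]] insert.hyps(2)
    by (auto simp: lab_def T_def fun_eq_iff zero_fun_def)
  moreover have "T ` lab (insert m L) U = U m"
  proof
    show "U m \<subseteq> T ` lab (insert m L) U"
    proof
      fix u assume u: "u \<in> U m"
      have "(\<lambda>(l, x). (if l = m then u else (\<lambda>_. 0)) x) \<in> lab (insert m L) U"
        using u fs.subspace_0[OF insert.prems(1)] by (auto simp: lab_def zero_fun_def)
      then show "u \<in> T ` lab (insert m L) U" by (rule rev_image_eqI) (simp add: T_def)
    qed
  qed (auto simp: lab_def T_def)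
  ultimately show ?case
    using rank_nullity[OF fin lab_FS[OF insert.prems(2)] subspace_lab[OF insert.prems(1)] T]
      insert by simp
qed

text \<open>The homology groups and direct sums of the statement are records whose elements are
  cosets or families of cosets. Each is the image of a subspace of functions under a map
  \<open>\<phi>\<close> that respects the operations, and the axioms are transported along
  \<open>\<phi>\<close>.\<close>

lemma vectorspace_image:
  fixes M :: "('k::field, 'm, 'b) module_scheme" and U :: "('x \<Rightarrow> 'k) set"
  assumes U: "fs.subspace U"
    and car: "carrier M = \<phi> ` U" and zero: "\<phi> 0 = \<zero>\<^bsub>M\<^esub>"
    and add: "\<And>f g. f \<in> U \<Longrightarrow> g \<in> U \<Longrightarrow> \<phi> (f + g) = \<phi> f \<oplus>\<^bsub>M\<^esub> \<phi> g"
    and smult: "\<And>c f. f \<in> U \<Longrightarrow> \<phi> (\<lambda>x. c * f x) = c \<odot>\<^bsub>M\<^esub> \<phi> f"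
  shows "vectorspace class_ring M"
proof -
  note clo = fs.subspace_0[OF U] fs.subspace_add[OF U] fs.subspace_scale[OF U] fs.subspace_neg[OF U]
  have ab: "abelian_group M"
  proof (rule abelian_groupI)
    show "\<zero>\<^bsub>M\<^esub> \<in> carrier M" using clo zero car by (metis imageI)
    show "x \<oplus>\<^bsub>M\<^esub> y \<in> carrier M" if "x \<in> carrier M" "y \<in> carrier M" for x y
      using that clo unfolding car by (auto simp: add[symmetric])
    show "x \<oplus>\<^bsub>M\<^esub> y \<oplus>\<^bsub>M\<^esub> z = x \<oplus>\<^bsub>M\<^esub> (y \<oplus>\<^bsub>M\<^esub> z)"
      if "x \<in> carrier M" "y \<in> carrier M" "z \<in> carrier M" for x y z
      using that clo unfolding car by (auto simp: add[symmetric] add.assoc)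
    show "x \<oplus>\<^bsub>M\<^esub> y = y \<oplus>\<^bsub>M\<^esub> x" if "x \<in> carrier M" "y \<in> carrier M" for x y
      using that unfolding car by (auto simp: add[symmetric] add.commute)
    show "\<zero>\<^bsub>M\<^esub> \<oplus>\<^bsub>M\<^esub> x = x" if "x \<in> carrier M" for x
      using that clo unfolding car by (auto simp: zero[symmetric] add[symmetric])
    show "\<exists>y\<in>carrier M. y \<oplus>\<^bsub>M\<^esub> x = \<zero>\<^bsub>M\<^esub>" if x: "x \<in> carrier M" for x
    proof -
      obtain f where f: "f \<in> U" "x = \<phi> f" using x car by auto
      have "\<phi> (- f) \<oplus>\<^bsub>M\<^esub> x = \<phi> (- f + f)" using f clo by (simp only: add)
      also have "- f + f = 0" by (rule left_minus)
      finally show ?thesis using f clo car zero by (metis imageI)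
    qed
  qed
  have "Module.module class_ring M"
  proof (rule Module.module.intro[OF class_cring.is_cring ab], unfold_locales)
    fix a x assume x: "x \<in> carrier M"
    then show "a \<odot>\<^bsub>M\<^esub> x \<in> carrier M" unfolding car using clo by (auto simp: smult[symmetric])
  next
    fix a b :: 'k and x assume x: "x \<in> carrier M"
    then obtain f where f: "f \<in> U" "x = \<phi> f" using car by auto
    have "(a + b) \<odot>\<^bsub>M\<^esub> x = \<phi> ((\<lambda>t. a * f t) + (\<lambda>t. b * f t))"
      unfolding f(2) smult[OF f(1), symmetric] by (simp add: plus_fun_def distrib_right)
    also have "\<dots> = a \<odot>\<^bsub>M\<^esub> x \<oplus>\<^bsub>M\<^esub> b \<odot>\<^bsub>M\<^esub> x"
      unfolding f(2) smult[OF f(1), symmetric] by (intro add clo(3) f(1))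
    finally show "(a \<oplus>\<^bsub>class_ring\<^esub> b) \<odot>\<^bsub>M\<^esub> x = a \<odot>\<^bsub>M\<^esub> x \<oplus>\<^bsub>M\<^esub> b \<odot>\<^bsub>M\<^esub> x" by simp
    have "(a * b) \<odot>\<^bsub>M\<^esub> x = \<phi> (\<lambda>t. a * b * f t)" unfolding f(2) by (rule smult[OF f(1), symmetric])
    also have "\<dots> = \<phi> (\<lambda>t. a * (b * f t))" by (simp only: mult.assoc)
    also have "\<dots> = a \<odot>\<^bsub>M\<^esub> \<phi> (\<lambda>t. b * f t)" by (rule smult[OF clo(3)[OF f(1)]])
    also have "\<phi> (\<lambda>t. b * f t) = b \<odot>\<^bsub>M\<^esub> x" unfolding f(2) by (rule smult[OF f(1)])
    finally show "(a \<otimes>\<^bsub>class_ring\<^esub> b) \<odot>\<^bsub>M\<^esub> x = a \<odot>\<^bsub>M\<^esub> (b \<odot>\<^bsub>M\<^esub> x)" by simp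
  next
    fix a :: 'k and x y assume "x \<in> carrier M" "y \<in> carrier M"
    then obtain f g where f: "f \<in> U" "x = \<phi> f" "g \<in> U" "y = \<phi> g" using car by auto
    have "a \<odot>\<^bsub>M\<^esub> (x \<oplus>\<^bsub>M\<^esub> y) = \<phi> (\<lambda>t. a * (f + g) t)"
      unfolding f(2,4) add[OF f(1,3), symmetric] by (rule smult[OF clo(2)[OF f(1,3)], symmetric])
    also have "(\<lambda>t. a * (f + g) t) = (\<lambda>t. a * f t) + (\<lambda>t. a * g t)"
      by (simp add: fun_eq_iff distrib_left)
    also have "\<phi> \<dots> = a \<odot>\<^bsub>M\<^esub> x \<oplus>\<^bsub>M\<^esub> a \<odot>\<^bsub>M\<^esub> y"
      unfolding f(2,4) smult[OF f(1), symmetric] smult[OF f(3), symmetric]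
      by (intro add clo(3) f(1,3))
    finally show "a \<odot>\<^bsub>M\<^esub> (x \<oplus>\<^bsub>M\<^esub> y) = a \<odot>\<^bsub>M\<^esub> x \<oplus>\<^bsub>M\<^esub> a \<odot>\<^bsub>M\<^esub> y" .
  next
    fix x assume "x \<in> carrier M"
    then obtain f where f: "f \<in> U" "x = \<phi> f" using car by auto
    have "1 \<odot>\<^bsub>M\<^esub> \<phi> f = \<phi> f" using smult[OF f(1), of 1, symmetric] by (simp only: mult_1_left)
    then show "\<one>\<^bsub>class_ring\<^esub> \<odot>\<^bsub>M\<^esub> x = x" unfolding f(2) by simp
  qed
  then show ?thesis
    by (intro vectorspace.intro class_field.field_axioms)
qed

lemma finsum_image:
  fixes M :: "('k::field, 'm, 'b) module_scheme" and U :: "('x \<Rightarrow> 'k) set"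
  assumes U: "fs.subspace U"
    and car: "carrier M = \<phi> ` U" and zero: "\<phi> 0 = \<zero>\<^bsub>M\<^esub>"
    and add: "\<And>f g. f \<in> U \<Longrightarrow> g \<in> U \<Longrightarrow> \<phi> (f + g) = \<phi> f \<oplus>\<^bsub>M\<^esub> \<phi> g"
    and smult: "\<And>c f. f \<in> U \<Longrightarrow> \<phi> (\<lambda>x. c * f x) = c \<odot>\<^bsub>M\<^esub> \<phi> f"
    and A: "finite A" "\<And>i. i \<in> A \<Longrightarrow> g i \<in> U"
  shows "finsum M (\<lambda>i. \<phi> (g i)) A = \<phi> (\<Sum>i\<in>A. g i)"
proof -
  interpret vectorspace class_ring M by (rule vectorspace_image[OF U car zero add smult])
  show ?thesis
    using A
  proof (induction A)
    case empty
    show ?case by (simp add: zero zero_fun_def[symmetric])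
  next
    case (insert i A)
    have "(\<Sum>j\<in>A. g j) \<in> U" using insert by (intro fs.subspace_sum[OF U]) auto
    then have "\<phi> (g i + (\<Sum>j\<in>A. g j)) = \<phi> (g i) \<oplus>\<^bsub>M\<^esub> \<phi> (\<Sum>j\<in>A. g j)"
      using insert by (intro add) auto
    then show ?case using insert car by (subst finsum_insert) auto
  qed
qed

text \<open>\<open>\<phi>\<close> is injective on a complement of its kernel, so it carries a basis
  of the complement to a basis of \<open>M\<close>.\<close>

lemma vs_dim_image:
  fixes M :: "('k::field, 'm, 'b) module_scheme" and U :: "('x \<Rightarrow> 'k) set"
  assumes X: "finite X" "U \<subseteq> FS X" and U: "fs.subspace U"
    and car: "carrier M = \<phi> ` U" and zero: "\<phi> 0 = \<zero>\<^bsub>M\<^esub>"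
    and add: "\<And>f g. f \<in> U \<Longrightarrow> g \<in> U \<Longrightarrow> \<phi> (f + g) = \<phi> f \<oplus>\<^bsub>M\<^esub> \<phi> g"
    and smult: "\<And>c f. f \<in> U \<Longrightarrow> \<phi> (\<lambda>x. c * f x) = c \<odot>\<^bsub>M\<^esub> \<phi> f"
  shows "vs_dim M + fs.dim {f \<in> U. \<phi> f = \<zero>\<^bsub>M\<^esub>} = fs.dim U"
proof -
  interpret M: vectorspace class_ring M by (rule vectorspace_image[OF U car zero add smult])
  let ?K = "{f \<in> U. \<phi> f = \<zero>\<^bsub>M\<^esub>}"
  have K: "fs.subspace ?K"
  proof (rule subspaceI)
    show "(\<lambda>_. 0) \<in> ?K"
      using fs.subspace_0[OF U] zero by (simp add: zero_fun_def)
    show "(\<lambda>x. f x + g x) \<in> ?K" if "f \<in> ?K" "g \<in> ?K" for f g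
      using fs.subspace_add[OF U] add[of f g] that by (auto simp: plus_fun_def)
    show "(\<lambda>x. c * f x) \<in> ?K" if "f \<in> ?K" for c f
      using fs.subspace_scale[OF U] smult[of f c] that by auto
  qed
  obtain C where C: "finite C" "fs.independent C" "C \<subseteq> U" "fs.span C \<inter> ?K = {0}"
    "U = {x + y |x y. x \<in> ?K \<and> y \<in> fs.span C}" "card C + fs.dim ?K = fs.dim U"
    using subspace_complement[OF X K _ U] by blast
  have sC: "fs.span C \<subseteq> U" using C(3) U by (rule fs.span_minimal)
  have inj: "x = y" if xy: "x \<in> fs.span C" "y \<in> fs.span C" "\<phi> x = \<phi> y" for x y
  proof -
    have mem: "x - y \<in> fs.span C" using xy by (simp add: fs.span_diff)
    have xU: "x \<in> U" "y \<in> U" using xy sC by auto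
    have "\<phi> x = \<phi> (x - y + y)" by simp
    also have "\<dots> = \<phi> (x - y) \<oplus>\<^bsub>M\<^esub> \<phi> y" using xU fs.subspace_diff[OF U] by (intro add) auto
    finally have "\<phi> (x - y) = \<zero>\<^bsub>M\<^esub>"
      using xy(3) xU car fs.subspace_diff[OF U xU]
      by (metis M.add.l_cancel_one M.add.m_comm image_eqI)
    then have "x - y \<in> {0}" using mem C(4) sC by blast
    then show "x = y" by simp
  qed
  have injC: "inj_on \<phi> C" by (rule inj_onI) (auto intro: inj fs.span_base)
  have lc: "M.lincomb a (\<phi> ` C) = \<phi> (\<Sum>v\<in>C. (\<lambda>t. a (\<phi> v) * v t))" for a
  proof -
    have "M.lincomb a (\<phi> ` C) = finsum M (\<lambda>v. a (\<phi> v) \<odot>\<^bsub>M\<^esub> \<phi> v) C"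
      unfolding M.lincomb_def
      by (subst M.finsum_reindex[OF _ injC]) (use car C(3) M.smult_closed in \<open>auto simp del: M.smult_closed\<close>)
    also have "\<dots> = finsum M (\<lambda>v. \<phi> (\<lambda>t. a (\<phi> v) * v t)) C"
      by (rule M.finsum_cong) (use C(3) car fs.subspace_scale[OF U] smult M.smult_closed in \<open>auto simp: simp_implies_def\<close>)
    also have "\<dots> = \<phi> (\<Sum>v\<in>C. (\<lambda>t. a (\<phi> v) * v t))"
      using C(3) fs.subspace_scale[OF U] by (intro finsum_image[OF U car zero add smult C(1)]) auto
    finally show ?thesis .
  qed
  have sub: "\<phi> ` C \<subseteq> carrier M" using C(3) car by auto
  have "M.lin_indpt (\<phi> ` C)"
  proof (rule M.finite_lin_indpt2)
    fix a assume "M.lincomb a (\<phi> ` C) = \<zero>\<^bsub>M\<^esub>"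
    then have "\<phi> (\<Sum>v\<in>C. (\<lambda>t. a (\<phi> v) * v t)) = \<phi> 0" by (simp add: lc zero)
    then have z: "(\<Sum>v\<in>C. (\<lambda>t. a (\<phi> v) * v t)) = 0"
      by (intro inj fs.span_sum fs.span_scale fs.span_base fs.span_zero) auto
    show "\<forall>w\<in>\<phi> ` C. a w = \<zero>\<^bsub>class_ring\<^esub>"
    proof (rule ccontr)
      assume "\<not> ?thesis"
      then obtain v where "v \<in> C" "a (\<phi> v) \<noteq> 0" by auto
      then have "fs.dependent C"
        unfolding fs.dependent_finite[OF C(1)] using z by (intro exI[of _ "\<lambda>v. a (\<phi> v)"]) auto
      then show False using C(2) by simp
    qed
  qed (use C(1) sub in auto)
  moreover have "M.gen_set (\<phi> ` C)"
  proof
    show "M.span (\<phi> ` C) \<subseteq> carrier M" using sub by (rule M.span_is_subset2)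
    show "carrier M \<subseteq> M.span (\<phi> ` C)"
    proof
      fix x assume "x \<in> carrier M"
      then obtain u where u: "u \<in> U" "x = \<phi> u" using car by auto
      obtain k c where kc: "k \<in> ?K" "c \<in> fs.span C" "u = k + c"
        using u(1) equalityD1[OF C(5)] by blast
      obtain w where w: "c = (\<Sum>v\<in>C. (\<lambda>t. w v * v t))"
        using kc(2) fs.span_finite[OF C(1)] by auto
      have "x = \<phi> k \<oplus>\<^bsub>M\<^esub> \<phi> c" unfolding u(2) kc(3) using kc sC by (intro add) auto
      then have "x = \<phi> c" using kc sC car by auto
      also have "\<dots> = \<phi> (\<Sum>v\<in>C. (\<lambda>t. w (the_inv_into C \<phi> (\<phi> v)) * v t))"
        unfolding w by (intro arg_cong[of _ _ \<phi>] sum.cong) (auto simp: the_inv_into_f_f[OF injC])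
      also have "\<dots> = M.lincomb (\<lambda>y. w (the_inv_into C \<phi> y)) (\<phi> ` C)" by (simp add: lc)
      finally show "x \<in> M.span (\<phi> ` C)" unfolding M.span_def using C(1) by auto
    qed
  qed
  ultimately have "M.basis (\<phi> ` C)" using sub by (simp add: M.basis_def)
  then have "vs_dim M = card C"
    using M.dim_basis[of "\<phi> ` C"] C(1) card_image[OF injC] by simp
  then show ?thesis using C(6) by simp
qed

text \<open>Eigenvectors for distinct eigenvalues are independent: applying \<open>N\<close> to a
  relation and subtracting \<open>\<mu> s\<close> times the relation eliminates
  \<open>w s\<close>.\<close>

lemma eigenvectors_bound:
  fixes N :: "('x \<Rightarrow> 'k::field) \<Rightarrow> 'x \<Rightarrow> 'k"
  assumes X: "finite X" and N: "lin N"
    and S: "finite S" "inj_on \<mu> S"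
    and w: "\<And>t. t \<in> S \<Longrightarrow> w t \<in> FS X \<and> w t \<noteq> 0 \<and> N (w t) = (\<lambda>x. \<mu> t * w t x)"
  shows "card S \<le> card X"
proof -
  have key: "(\<forall>t\<in>S. c t = 0)" if "(\<Sum>t\<in>S. (\<lambda>x. c t * w t x)) = 0" for c
    using S w that
  proof (induction S arbitrary: c)
    case (insert s S)
    have Nsum: "N (\<Sum>t\<in>insert s S. (\<lambda>x. c t * w t x)) = (\<Sum>t\<in>insert s S. (\<lambda>x. c t * (\<mu> t * w t x)))"
      unfolding fsp.linear_sum[OF N]
      by (intro sum.cong refl) (use insert.prems(2) in \<open>simp add: lin_scale[OF N]\<close>)
    then have N0: "(\<Sum>t\<in>insert s S. (\<lambda>x. c t * (\<mu> t * w t x))) = 0"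
      unfolding insert.prems(3) fsp.linear_0[OF N] by simp
    have "(\<Sum>t\<in>S. (\<lambda>x. (c t * (\<mu> t - \<mu> s)) * w t x)) x = 0" for x
    proof -
      have 1: "c s * w s x + (\<Sum>t\<in>S. c t * w t x) = 0"
        using fun_cong[OF insert.prems(3), of x]
        by (simp only: sum_fun_apply sum.insert[OF insert.hyps] zero_fun_apply plus_fun_apply)
      have 2: "c s * (\<mu> s * w s x) + (\<Sum>t\<in>S. c t * (\<mu> t * w t x)) = 0"
        using fun_cong[OF N0, of x]
        by (simp only: sum_fun_apply sum.insert[OF insert.hyps] zero_fun_apply plus_fun_apply)
      have "(\<Sum>t\<in>S. (c t * (\<mu> t - \<mu> s)) * w t x)
          = (\<Sum>t\<in>S. c t * (\<mu> t * w t x)) - \<mu> s * (\<Sum>t\<in>S. c t * w t x)"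
        by (simp add: sum_subtractf sum_distrib_left algebra_simps)
      also have "(\<Sum>t\<in>S. c t * (\<mu> t * w t x)) = - (c s * (\<mu> s * w s x))"
        using 2 by (simp only: add_eq_0_iff)
      also have "(\<Sum>t\<in>S. c t * w t x) = - (c s * w s x)" using 1 by (simp only: add_eq_0_iff)
      also have "- (c s * (\<mu> s * w s x)) - \<mu> s * - (c s * w s x) = 0" by (simp add: mult.left_commute)
      finally show ?thesis by (simp only: sum_fun_apply)
    qed
    then have sum0: "(\<Sum>t\<in>S. (\<lambda>x. (c t * (\<mu> t - \<mu> s)) * w t x)) = 0"
      by (intro ext) (simp only: zero_fun_apply)
    have "inj_on \<mu> S" using insert.prems(1) by (rule inj_on_subset) auto
    then have "\<forall>t\<in>S. c t * (\<mu> t - \<mu> s) = 0"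
      by (rule insert.IH[OF _ insert.prems(2) sum0]) (rule insertI2)
    then have c: "\<forall>t\<in>S. c t = 0" using insert.prems(1) insert.hyps by (auto simp: inj_on_def)
    have "c s * w s x = 0" for x
      using fun_cong[OF insert.prems(3), of x] c
      by (simp add: sum_fun_apply sum.insert[OF insert.hyps])
    then have "c s = 0" using insert.prems(2)[of s] by (auto simp: fun_eq_iff)
    then show ?case using c by auto
  qed simp
  have injw: "inj_on w S"
  proof (rule inj_onI)
    fix s t assume st: "s \<in> S" "t \<in> S" "w s = w t"
    obtain x where x: "w s x \<noteq> 0" using w[OF st(1)] by (auto simp: fun_eq_iff)
    have "\<mu> s * w s x = \<mu> t * w s x"
      using fun_cong[OF conjunct2[OF conjunct2[OF w[OF st(1)]]], of x]
        fun_cong[OF conjunct2[OF conjunct2[OF w[OF st(2)]]], of x] st(3) by auto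
    then show "s = t" using x S(2) st by (auto simp: inj_on_def)
  qed
  have "fs.independent (w ` S)"
  proof (rule fs.independent_if_scalars_zero)
    fix u v assume "(\<Sum>v\<in>w ` S. (\<lambda>x. u v * v x)) = 0" and v: "v \<in> w ` S"
    then have "(\<Sum>t\<in>S. (\<lambda>x. u (w t) * w t x)) = 0"
      by (simp add: sum.reindex[OF injw] o_def)
    from key[OF this] show "u v = 0" using v by auto
  qed (use S in auto)
  moreover have "w ` S \<subseteq> FS X" using w by auto
  ultimately have "card (w ` S) \<le> card X" by (intro independent_bound[OF X])
  then show ?thesis by (simp add: card_image[OF injw])
qed

text \<open>Takes the place of the nonvanishing of a determinant polynomial. With a left inverse
  \<open>L\<close> of \<open>M0\<close>, a kernel vector of \<open>M0 + t M1\<close> is an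
  eigenvector of \<open>L \<circ> M1\<close> for the eigenvalue \<open>-1/t\<close>. Distinct
  \<open>t\<close> give distinct eigenvalues, of which there are at most
  \<open>card X\<close>.\<close>

lemma injective_cofinite_on_line:
  fixes M0 M1 :: "('x \<Rightarrow> 'k::field) \<Rightarrow> 'y \<Rightarrow> 'k"
  assumes X: "finite X" and M: "lin M0" "lin M1"
    and inj: "\<And>w. w \<in> FS X \<Longrightarrow> M0 w = 0 \<Longrightarrow> w = 0"
  shows "finite {t. \<exists>w\<in>FS X. w \<noteq> 0 \<and> (\<forall>y. M0 w y + t * M1 w y = 0)}" (is "finite ?T")
proof (rule ccontr)
  assume "infinite ?T"
  then obtain S where S: "S \<subseteq> ?T" "finite S" "card S = Suc (card X)"
    using infinite_arbitrarily_large by blast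
  have "inj_on M0 (FS X)"
  proof (rule inj_onI)
    fix f g assume fg: "f \<in> FS X" "g \<in> FS X" "M0 f = M0 g"
    then have "M0 (f - g) = 0" by (simp add: fsp.linear_diff[OF M(1)])
    moreover have "f - g \<in> FS X" using fg fs.subspace_diff[OF subspace_FS] by blast
    ultimately show "f = g" using inj[of "f - g"] by simp
  qed
  then obtain L where L: "lin L" "\<forall>v\<in>FS X. L (M0 v) = v"
    using fsp.linear_exists_left_inverse_on[OF M(1) subspace_FS[of X]] by blast
  define N where "N = L \<circ> M1"
  have N: "lin N" unfolding N_def using M(2) L(1) by (rule Vector_Spaces.linear_compose)
  have "\<exists>w\<in>FS X. w \<noteq> 0 \<and> t \<noteq> 0 \<and> N w = (\<lambda>x. - inverse t * w x)" if t: "t \<in> S" for t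
  proof -
    obtain w where w: "w \<in> FS X" "w \<noteq> 0" "\<forall>y. M0 w y + t * M1 w y = 0" using S(1) t by auto
    have "t \<noteq> 0"
    proof
      assume "t = 0"
      then have "M0 w = 0" using w(3) by (auto simp: fun_eq_iff)
      then show False using inj w by blast
    qed
    have "M1 w = (\<lambda>y. - inverse t * M0 w y)"
    proof
      fix y
      have "t * M1 w y = - M0 w y" using w(3) by (metis add.commute add.inverse_unique)
      then have "inverse t * (t * M1 w y) = inverse t * (- M0 w y)" by simp
      then show "M1 w y = - inverse t * M0 w y" using \<open>t \<noteq> 0\<close> by (simp add: mult.assoc[symmetric])
    qed
    then have "N w = (\<lambda>x. - inverse t * w x)"
      unfolding N_def o_def using lin_scale[OF L(1), of "- inverse t" "M0 w"] L(2) w(1) by simp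
    then show ?thesis using w \<open>t \<noteq> 0\<close> by blast
  qed
  then obtain w where w: "\<And>t. t \<in> S \<Longrightarrow> w t \<in> FS X \<and> w t \<noteq> 0 \<and> t \<noteq> 0 \<and> N (w t) = (\<lambda>x. - inverse t * w t x)"
    by metis
  have "inj_on (\<lambda>t. - inverse t) S" by (auto simp: inj_on_def)
  then have "card S \<le> card X"
    using eigenvectors_bound[OF X N S(2), of "\<lambda>t. - inverse t" w] w by auto
  then show False using S(3) by simp
qed

section \<open>Generic configurations\<close>

text \<open>Zariski-type genericity without multivariate polynomials: a property holds somewhere, and on
  every line meeting it it holds outside a finite set.\<close>

definition generic :: "(('v \<Rightarrow> nat \<Rightarrow> 'k::field) \<Rightarrow> bool) \<Rightarrow> bool" where
  "generic P \<longleftrightarrow> (\<exists>p. P p) \<and> (\<forall>p q. P p \<longrightarrow> finite {t. \<not> P (\<lambda>v i. p v i + t * q v i)})"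

text \<open>A witness of \<open>P\<close> and a witness of \<open>Q\<close> are joined by a line.
  Each property fails at finitely many points of it, and an infinite field leaves another
  one.\<close>

lemma generic_conj:
  fixes P Q :: "('v \<Rightarrow> nat \<Rightarrow> 'k::field) \<Rightarrow> bool"
  assumes "infinite (UNIV :: 'k set)" "generic P" "generic Q"
  shows "generic (\<lambda>p. P p \<and> Q p)"
proof -
  have "\<exists>p. P p \<and> Q p"
  proof -
    obtain p q where pq: "P p" "Q q" using assms by (auto simp: generic_def)
    define A where "A = {t. \<not> P (\<lambda>v i. p v i + t * (q v i - p v i))}"
    define B where "B = {t. \<not> Q (\<lambda>v i. q v i + t * (p v i - q v i))}"
    have "finite A"
      using assms(2) pq unfolding generic_def A_def by (elim conjE allE[of _ p] allE[of _ "\<lambda>v i. q v i - p v i"]) simp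
    moreover have "finite B"
      using assms(3) pq unfolding generic_def B_def by (elim conjE allE[of _ q] allE[of _ "\<lambda>v i. p v i - q v i"]) simp
    \<comment> \<open>The point with parameter \<open>t\<close>, counted from \<open>p\<close>, has
      parameter \<open>1 - t\<close> when the line is run through from \<open>q\<close>.\<close>
    ultimately have "finite (A \<union> (\<lambda>t. 1 - t) ` B)" by simp
    from ex_new_if_finite[OF assms(1) this]
    obtain t where t: "t \<notin> A" "t \<notin> (\<lambda>t. 1 - t) ` B" by blast
    have "1 - t \<notin> B"
    proof
      assume "1 - t \<in> B"
      then have "1 - (1 - t) \<in> (\<lambda>t. 1 - t) ` B" by (rule imageI)
      then show False using t(2) by simp
    qed
    then have "Q (\<lambda>v i. q v i + (1 - t) * (p v i - q v i))" by (simp add: B_def)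
    moreover have "(\<lambda>v i. q v i + (1 - t) * (p v i - q v i)) = (\<lambda>v i. p v i + t * (q v i - p v i))"
      by (simp add: fun_eq_iff algebra_simps)
    ultimately show ?thesis using t(1) by (auto simp: A_def)
  qed
  moreover have "finite {t. \<not> (P (\<lambda>v i. p v i + t * q v i) \<and> Q (\<lambda>v i. p v i + t * q v i))}"
    if "P p" "Q p" for p q
  proof -
    have "finite ({t. \<not> P (\<lambda>v i. p v i + t * q v i)} \<union> {t. \<not> Q (\<lambda>v i. p v i + t * q v i)})"
      using assms that by (auto simp: generic_def)
    then show ?thesis by (rule rev_finite_subset) auto
  qed
  ultimately show ?thesis by (auto simp: generic_def)
qed

lemma generic_True: "generic (\<lambda>_. True)"
  by (auto simp: generic_def)

lemma generic_ball:
  fixes P :: "'i \<Rightarrow> ('v \<Rightarrow> nat \<Rightarrow> 'k::field) \<Rightarrow> bool"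
  assumes inf: "infinite (UNIV :: 'k set)" and "finite I" "\<And>i. i \<in> I \<Longrightarrow> generic (P i)"
  shows "generic (\<lambda>p. \<forall>i\<in>I. P i p)"
  using assms(2,3)
proof (induction I)
  case (insert i I)
  then show ?case using generic_conj[OF inf, of "P i" "\<lambda>p. \<forall>i\<in>I. P i p"] by simp
qed (simp add: generic_True)

text \<open>\<open>M\<close> depends affinely on the configuration and \<open>M'\<close> is its
  linear part. The two differ when some rows of the system do not involve the points.\<close>

lemma generic_injective:
  fixes M :: "('v \<Rightarrow> nat \<Rightarrow> 'k::field) \<Rightarrow> ('x \<Rightarrow> 'k) \<Rightarrow> 'y \<Rightarrow> 'k"
  assumes "finite X" "\<And>p. lin (M p)" "\<And>p. lin (M' p)"
    and "\<And>p q t w y. M (\<lambda>v i. p v i + t * q v i) w y = M p w y + t * M' q w y"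
    and "\<exists>p. \<forall>w\<in>FS X. M p w = 0 \<longrightarrow> w = 0"
  shows "generic (\<lambda>p. \<forall>w\<in>FS X. M p w = 0 \<longrightarrow> w = 0)"
  unfolding generic_def
proof (intro conjI allI impI assms(5))
  fix p q assume inj: "\<forall>w\<in>FS X. M p w = 0 \<longrightarrow> w = 0"
  have "finite {t. \<exists>w\<in>FS X. w \<noteq> 0 \<and> (\<forall>y. M p w y + t * M' q w y = 0)}"
    using inj by (intro injective_cofinite_on_line[OF assms(1,2,3)]) auto
  then show "finite {t. \<not> (\<forall>w\<in>FS X. M (\<lambda>v i. p v i + t * q v i) w = 0 \<longrightarrow> w = 0)}"
    by (rule rev_finite_subset) (auto simp: fun_eq_iff assms(4))
qed

text \<open>Off-diagonal terms cancel in pairs. The diagonal is a separate hypothesis because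
  antisymmetry does not make it vanish in characteristic 2.\<close>

lemma alternating_sum_zero:
  fixes f :: "'a \<Rightarrow> 'a \<Rightarrow> 'k::ab_group_add"
  assumes "finite T" "\<And>u v. u \<in> T \<Longrightarrow> v \<in> T \<Longrightarrow> f v u = - f u v" "\<And>u. u \<in> T \<Longrightarrow> f u u = 0"
  shows "(\<Sum>u\<in>T. \<Sum>v\<in>T. f u v) = 0"
  using assms
proof (induction T)
  case (insert x T)
  have "(\<Sum>u\<in>insert x T. \<Sum>v\<in>insert x T. f u v)
      = f x x + (\<Sum>v\<in>T. f x v) + ((\<Sum>u\<in>T. f u x) + (\<Sum>u\<in>T. \<Sum>v\<in>T. f u v))"
    using insert.hyps by (simp add: sum.distrib)
  also have "(\<Sum>u\<in>T. f u x) = (\<Sum>v\<in>T. - f x v)" by (intro sum.cong refl insert.prems(1)) auto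
  also have "(\<Sum>u\<in>T. \<Sum>v\<in>T. f u v) = 0" by (intro insert.IH insert.prems insertI2)
  also have "f x x = 0" by (intro insert.prems insertI1)
  finally show ?case by (simp add: sum_negf)
qed simp

section \<open>Alternating forms\<close>

definition dot :: "nat \<Rightarrow> (nat \<Rightarrow> 'k::field) \<Rightarrow> (nat \<Rightarrow> 'k) \<Rightarrow> 'k" where
  "dot n f p = (\<Sum>i<n. f i * p i)"

text \<open>An alternating bilinear form on \<open>k\<^sup>n\<close> is stored by its entries above the diagonal.\<close>

definition pairs :: "nat \<Rightarrow> (nat \<times> nat) set" where
  "pairs n = {(i, j). i < j \<and> j < n}"

definition alt :: "(nat \<times> nat \<Rightarrow> 'k::field) \<Rightarrow> nat \<Rightarrow> nat \<Rightarrow> 'k" where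
  "alt f i j = (if i < j then f (i, j) else if j < i then - f (j, i) else 0)"

text \<open>The functional \<open>f(p, -)\<close> in coordinates.\<close>

definition ctr :: "nat \<Rightarrow> (nat \<Rightarrow> 'k::field) \<Rightarrow> (nat \<times> nat \<Rightarrow> 'k) \<Rightarrow> nat \<Rightarrow> 'k" where
  "ctr n p f j = (\<Sum>i<n. p i * alt f i j)"

lemma finite_pairs: "finite (pairs n)"
  by (rule finite_subset[of _ "{..<n} \<times> {..<n}"]) (auto simp: pairs_def)

lemma card_pairs: "card (pairs n) = n choose 2"
proof (induction n)
  case 0
  have "pairs 0 = {}" by (auto simp: pairs_def)
  then show ?case by simp
next
  case (Suc n)
  have "pairs (Suc n) = pairs n \<union> (\<lambda>i. (i, n)) ` {..<n}" by (auto simp: pairs_def)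
  moreover have "pairs n \<inter> (\<lambda>i. (i, n)) ` {..<n} = {}" by (auto simp: pairs_def)
  ultimately have "card (pairs (Suc n)) = card (pairs n) + n"
    using finite_pairs by (simp add: card_Un_disjoint card_image inj_on_def)
  then show ?case using Suc by (simp add: numeral_2_eq_2)
qed

lemma alt_simps [simp]: "alt f i i = 0" "alt (\<lambda>_. 0) i j = 0" "alt 0 i j = 0"
  by (auto simp: alt_def)

lemma alt_swap: "alt f j i = - alt f i j"
  by (auto simp: alt_def)

lemma alt_add: "alt (\<lambda>x. f x + g x) i j = alt f i j + alt g i j"
  and alt_scale: "alt (\<lambda>x. c * f x) i j = c * alt f i j"
  by (auto simp: alt_def)

lemma alt_sum: "alt (\<lambda>x. \<Sum>a\<in>S. g a x) i j = (\<Sum>a\<in>S. alt (g a) i j)"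
  by (auto simp: alt_def sum_negf)

lemma ctr_add: "ctr n p (\<lambda>x. f x + g x) j = ctr n p f j + ctr n p g j"
  and ctr_scale: "ctr n p (\<lambda>x. c * f x) j = c * ctr n p f j"
  and ctr_zero [simp]: "ctr n p (\<lambda>_. 0) j = 0"
  by (auto simp: ctr_def alt_add alt_scale sum.distrib sum_distrib_left algebra_simps)

lemma ctr_sum: "ctr n p (\<lambda>x. \<Sum>a\<in>S. g a x) j = (\<Sum>a\<in>S. ctr n p (g a) j)"
  by (simp add: ctr_def alt_sum sum_distrib_left) (rule sum.swap)

lemma ctr_line: "ctr n (\<lambda>i. p i + t * q i) f j = ctr n p f j + t * ctr n q f j"
  by (simp add: ctr_def sum.distrib sum_distrib_left algebra_simps)

lemma dot_ctr_swap: "dot n (ctr n p f) q = - dot n (ctr n q f) p"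
proof -
  have "dot n (ctr n p f) q = (\<Sum>j<n. \<Sum>i<n. p i * alt f i j * q j)"
    by (simp add: dot_def ctr_def sum_distrib_right)
  also have "\<dots> = (\<Sum>i<n. \<Sum>j<n. p i * alt f i j * q j)" by (rule sum.swap)
  also have "\<dots> = (\<Sum>i<n. \<Sum>j<n. - (q j * alt f j i * p i))"
    by (intro sum.cong refl) (subst alt_swap, simp)
  also have "\<dots> = - dot n (ctr n q f) p"
    by (simp add: dot_def ctr_def sum_distrib_right sum_negf)
  finally show ?thesis .
qed

lemma dot_ctr_self: "dot n (ctr n p f) p = 0"
proof -
  have "dot n (ctr n p f) p = (\<Sum>j<n. \<Sum>i<n. p i * alt f i j * p j)"
    by (simp add: dot_def ctr_def sum_distrib_right)
  also have "\<dots> = 0"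
  proof (rule alternating_sum_zero)
    show "p v * alt f v u * p u = - (p u * alt f u v * p v)" for u v
      by (subst alt_swap) simp
  qed auto
  finally show ?thesis .
qed

lemma form_eq_0:
  assumes "f \<in> FS (pairs n)" "\<And>i j. i < n \<Longrightarrow> j < n \<Longrightarrow> alt f i j = 0" shows "f = (\<lambda>_. 0)"
proof
  fix x :: "nat \<times> nat"
  obtain i j where x: "x = (i, j)" by (cases x)
  show "f x = 0"
  proof (cases "x \<in> pairs n")
    case True
    then show ?thesis using assms(2)[of i j] by (auto simp: x pairs_def alt_def)
  qed (use assms(1) in \<open>simp add: FS_def x\<close>)
qed

text \<open>Independence of a family in its first \<open>n\<close> coordinates: it is stated for
  indices, not for the set of vectors, so that coinciding points count as dependent.\<close>

definition indep :: "nat \<Rightarrow> ('v \<Rightarrow> nat \<Rightarrow> 'k::field) \<Rightarrow> 'v set \<Rightarrow> bool" where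
  "indep n p T \<longleftrightarrow> (\<forall>c. (\<forall>i<n. (\<Sum>v\<in>T. c v * p v i) = 0) \<longrightarrow> (\<forall>v\<in>T. c v = 0))"

lemma indep_subset:
  assumes "indep n p T" "finite T" "S \<subseteq> T" shows "indep n p S"
  unfolding indep_def
proof (intro allI impI)
  fix c assume c: "\<forall>i<n. (\<Sum>v\<in>S. c v * p v i) = 0"
  let ?c = "\<lambda>v. if v \<in> S then c v else 0"
  have eq: "(\<Sum>v\<in>T. ?c v * p v i) = (\<Sum>v\<in>S. c v * p v i)" for i
    using assms(2,3) by (intro sum.mono_neutral_cong_right) auto
  have "(\<forall>i<n. (\<Sum>v\<in>T. ?c v * p v i) = 0) \<longrightarrow> (\<forall>v\<in>T. ?c v = 0)"
    by (rule spec[OF assms(1)[unfolded indep_def]])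
  moreover have "\<forall>i<n. (\<Sum>v\<in>T. ?c v * p v i) = 0" unfolding eq by (rule c)
  ultimately have "\<forall>v\<in>T. ?c v = 0" by (rule mp)
  then show "\<forall>v\<in>S. c v = 0" using assms(3) by (auto split: if_splits)
qed

section \<open>Independent vectors, dual functionals and interpolation of alternating forms\<close>

context
  fixes n :: nat and p :: "'v \<Rightarrow> nat \<Rightarrow> 'k::field" and T :: "'v set" and C :: "('v \<Rightarrow> 'k) \<Rightarrow> nat \<Rightarrow> 'k"
  assumes T: "finite T" and ind: "indep n p T"
  defines "C \<equiv> \<lambda>c i. if i < n then (\<Sum>v\<in>T. c v * p v i) else 0"
begin

private lemma C: "lin C"
  by (rule linI) (auto simp: C_def fun_eq_iff algebra_simps sum.distrib sum_distrib_left)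

private lemma C_inj: "c \<in> FS T \<Longrightarrow> C c = 0 \<Longrightarrow> c = 0"
proof -
  assume c: "c \<in> FS T" "C c = 0"
  have "(\<Sum>v\<in>T. c v * p v i) = 0" if "i < n" for i
    using fun_cong[OF c(2), of i] that by (simp add: C_def)
  then have "\<forall>v\<in>T. c v = 0" using ind[unfolded indep_def, rule_format, of c] by blast
  then show "c = 0" using c(1) by (auto simp: FS_def fun_eq_iff)
qed

private lemma C_img: "C ` FS T \<subseteq> FS {..<n}" "fs.dim (C ` FS T) = card T"
  using dim_inj[OF T order_refl subspace_FS C C_inj] dim_FS[OF T]
  by (auto simp: C_def FS_def)

lemma indep_card: "card T \<le> n"
  using dim_mono[OF finite_lessThan order_refl C_img(1)] C_img(2) dim_FS[of "{..<n}", where ?'k='k]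
  by simp

text \<open>Independence makes the map \<open>C\<close> from coefficients to vectors injective; the
  coordinates of a left inverse are the dual functionals.\<close>

lemma indep_dual: "\<exists>\<alpha>. \<forall>u\<in>T. \<forall>v\<in>T. dot n (\<alpha> u) (p v) = (if u = v then 1 else 0)"
proof -
  have "inj_on C (FS T)"
  proof (rule inj_onI)
    fix f g assume fg: "f \<in> FS T" "g \<in> FS T" "C f = C g"
    then have "C (f - g) = 0" by (simp add: fsp.linear_diff[OF C])
    moreover have "f - g \<in> FS T" using fg fs.subspace_diff[OF subspace_FS] by blast
    ultimately show "f = g" using C_inj[of "f - g"] by simp
  qed
  then obtain L where L: "lin L" "\<forall>c\<in>FS T. L (C c) = c"
    using fsp.linear_exists_left_inverse_on[OF C subspace_FS[of T]] by blast
  have "dot n (\<lambda>i. L (unitf i) u) (p v) = (if u = v then 1 else 0)" if "u \<in> T" "v \<in> T" for u v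
  proof -
    have uv: "unitf v \<in> FS T" using that by (auto simp: FS_def unitf_def)
    have "C (unitf v) = (\<lambda>i. if i < n then p v i else 0)"
      using that T by (auto simp: C_def unitf_def fun_eq_iff if_distrib[of "\<lambda>z. z * _"] cong: if_cong)
    also have "\<dots> = (\<Sum>i<n. (\<lambda>y. p v i * unitf i y))"
      by (auto simp: fun_eq_iff sum_fun_apply unitf_def if_distrib[of "\<lambda>z. _ * z"] cong: if_cong)
    finally have "L (C (unitf v)) = (\<Sum>i<n. L (\<lambda>y. p v i * unitf i y))"
      by (simp only: fsp.linear_sum[OF L(1)])
    also have "\<dots> = (\<Sum>i<n. (\<lambda>y. p v i * L (unitf i) y))" by (simp only: lin_scale[OF L(1)])
    finally have "unitf v = (\<Sum>i<n. (\<lambda>y. p v i * L (unitf i) y))"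
      unfolding L(2)[rule_format, OF uv] .
    then have "unitf v u = (\<Sum>i<n. (\<lambda>y. p v i * L (unitf i) y)) u" by (rule fun_cong)
    also have "\<dots> = dot n (\<lambda>i. L (unitf i) u) (p v)" by (simp add: sum_fun_apply dot_def mult.commute)
    finally show ?thesis by (simp add: unitf_def)
  qed
  then show ?thesis by (intro exI[of _ "\<lambda>u i. L (unitf i) u"] ballI)
qed

lemma indep_span:
  assumes "card T = n" "\<And>v. v \<in> T \<Longrightarrow> dot n f (p v) = 0" "i < n" shows "f i = 0"
proof -
  obtain Cc where Cc: "finite Cc" "fs.independent Cc" "Cc \<subseteq> FS {..<n}" "fs.span Cc \<inter> C ` FS T = {0}"
    "FS {..<n} = {x + y |x y. x \<in> C ` FS T \<and> y \<in> fs.span Cc}"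
    "card Cc + fs.dim (C ` FS T) = fs.dim (FS {..<n} :: (nat \<Rightarrow> 'k) set)"
    by (rule subspace_complement[OF finite_lessThan order_refl
        fsp.linear_subspace_image[OF C subspace_FS] C_img(1) subspace_FS])
  have "Cc = {}" using Cc(1,6) C_img(2) assms(1) dim_FS[of "{..<n}", where ?'k='k] by simp
  then have "FS {..<n} \<subseteq> C ` FS T" using Cc(5) by auto
  moreover have "unitf i \<in> FS {..<n}" using assms(3) by (auto simp: FS_def unitf_def)
  ultimately obtain c where c: "unitf i = C c" by auto
  have "f i = (\<Sum>j<n. f j * unitf i j)"
    using assms(3) by (simp add: unitf_def if_distrib[of "\<lambda>z. _ * z"] cong: if_cong)
  also have "\<dots> = (\<Sum>j<n. \<Sum>v\<in>T. c v * (f j * p v j))"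
    unfolding c by (simp add: C_def sum_distrib_left algebra_simps)
  also have "\<dots> = (\<Sum>v\<in>T. c v * dot n f (p v))"
    by (subst sum.swap) (simp add: dot_def sum_distrib_left)
  finally show ?thesis using assms(2) by simp
qed

lemma indep_extend1:
  assumes "Suc (card T) = n"
  obtains e where "\<And>f i. \<lbrakk>\<And>v. v \<in> T \<Longrightarrow> dot n f (p v) = 0; dot n f e = 0; i < n\<rbrakk> \<Longrightarrow> f i = 0"
proof -
  obtain Cc where Cc: "finite Cc" "fs.independent Cc" "Cc \<subseteq> FS {..<n}" "fs.span Cc \<inter> C ` FS T = {0}"
    "FS {..<n} = {x + y |x y. x \<in> C ` FS T \<and> y \<in> fs.span Cc}"
    "card Cc + fs.dim (C ` FS T) = fs.dim (FS {..<n} :: (nat \<Rightarrow> 'k) set)"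
    by (rule subspace_complement[OF finite_lessThan order_refl
        fsp.linear_subspace_image[OF C subspace_FS] C_img(1) subspace_FS])
  have "card Cc = 1" using Cc(1,6) C_img(2) assms(1) dim_FS[of "{..<n}", where ?'k='k] by simp
  then obtain e where e: "Cc = {e}" by (auto simp: card_1_singleton_iff)
  have "f i = 0" if f: "\<And>v. v \<in> T \<Longrightarrow> dot n f (p v) = 0" "dot n f e = 0" "i < n" for f i
  proof -
    have "unitf i \<in> FS {..<n}" using f(3) by (auto simp: FS_def unitf_def)
    then obtain c y where cy: "unitf i = C c + y" "y \<in> fs.span {e}" using equalityD1[OF Cc(5)] unfolding e by blast
    obtain k where k: "y = (\<lambda>j. k * e j)" using cy(2) by (auto simp: fs.span_singleton)
    have "f i = (\<Sum>j<n. f j * unitf i j)"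
      using f(3) by (simp add: unitf_def if_distrib[of "\<lambda>z. _ * z"] cong: if_cong)
    also have "\<dots> = (\<Sum>j<n. \<Sum>v\<in>T. c v * (f j * p v j)) + k * dot n f e"
      unfolding cy(1) k by (simp add: C_def dot_def sum_distrib_left algebra_simps sum.distrib)
    also have "(\<Sum>j<n. \<Sum>v\<in>T. c v * (f j * p v j)) = (\<Sum>v\<in>T. c v * dot n f (p v))"
      by (subst sum.swap) (simp add: dot_def sum_distrib_left)
    finally show ?thesis using f by simp
  qed
  then show ?thesis using that by blast
qed

text \<open>Let \<open>e\<close> complete the hyperplane spanned by \<open>T\<close>. The functional
  \<open>A(e, -)\<close> vanishes on \<open>T\<close> by antisymmetry and at \<open>e\<close>
  because \<open>A\<close> is alternating, so \<open>e\<close> lies in the radical as well.\<close>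

lemma form_zero_of_hyperplane:
  assumes "Suc (card T) = n" "A \<in> FS (pairs n)" "\<And>v j. v \<in> T \<Longrightarrow> j < n \<Longrightarrow> ctr n (p v) A j = 0"
  shows "A = (\<lambda>_. 0)"
proof (rule form_eq_0[OF assms(2)])
  obtain e where e: "\<And>f i. \<lbrakk>\<And>v. v \<in> T \<Longrightarrow> dot n f (p v) = 0; dot n f e = 0; i < n\<rbrakk> \<Longrightarrow> f i = 0"
    using indep_extend1[OF assms(1)] by blast
  have Ae: "ctr n e A j = 0" if "j < n" for j
  proof (rule e[OF _ dot_ctr_self that])
    fix v assume "v \<in> T"
    then show "dot n (ctr n e A) (p v) = 0"
      using assms(3) by (subst dot_ctr_swap) (simp add: dot_def)
  qed
  fix i j assume ij: "i < n" "j < n"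
  show "alt A i j = 0"
  proof (rule e[OF _ _ ij(1), where f="\<lambda>i. alt A i j"])
    show "dot n (\<lambda>i. alt A i j) (p v) = 0" if "v \<in> T" for v
      using assms(3)[OF that ij(2)] by (simp add: dot_def ctr_def mult.commute)
    show "dot n (\<lambda>i. alt A i j) e = 0" using Ae[OF ij(2)] by (simp add: dot_def ctr_def mult.commute)
  qed
qed

text \<open>With dual functionals \<open>\<alpha> u\<close>, the form is the sum of all wedges of
  \<open>\<alpha> u\<close> with \<open>m u\<close>, minus \<open>m u (p v)\<close> times the tensor
  product of \<open>\<alpha> u\<close> and \<open>\<alpha> v\<close> over all pairs. The second sum
  removes the values at pairs of points of \<open>T\<close>, which the first one counts twice; it is
  alternating by the hypotheses on \<open>m\<close>, and no division by 2 occurs.\<close>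

lemma form_exists:
  assumes m: "\<And>u v. u \<in> T \<Longrightarrow> v \<in> T \<Longrightarrow> dot n (m u) (p v) + dot n (m v) (p u) = 0"
    "\<And>u. u \<in> T \<Longrightarrow> dot n (m u) (p u) = 0"
  shows "\<exists>A\<in>FS (pairs n). \<forall>u\<in>T. \<forall>j<n. ctr n (p u) A j = m u j"
proof -
  obtain \<alpha> where \<alpha>: "\<And>u v. u \<in> T \<Longrightarrow> v \<in> T \<Longrightarrow> dot n (\<alpha> u) (p v) = (if u = v then 1 else 0)"
    using indep_dual by metis
  define a where "a i j = (\<Sum>u\<in>T. \<alpha> u i * m u j) - (\<Sum>u\<in>T. \<alpha> u j * m u i)
      - (\<Sum>u\<in>T. \<Sum>v\<in>T. \<alpha> u i * \<alpha> v j * dot n (m u) (p v))" for i j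
  define A where "A = (\<lambda>(i, j). if (i, j) \<in> pairs n then a i j else 0)"
  have m': "dot n (m v) (p u) = - dot n (m u) (p v)" if "u \<in> T" "v \<in> T" for u v
    using m(1)[OF that] by (simp add: eq_neg_iff_add_eq_0 add.commute)
  have swap: "a j i = - a i j" for i j
  proof -
    have "(\<Sum>u\<in>T. \<Sum>v\<in>T. \<alpha> u j * \<alpha> v i * dot n (m u) (p v))
        = (\<Sum>u\<in>T. \<Sum>v\<in>T. \<alpha> v j * \<alpha> u i * dot n (m v) (p u))" by (rule sum.swap)
    also have "\<dots> = - (\<Sum>u\<in>T. \<Sum>v\<in>T. \<alpha> u i * \<alpha> v j * dot n (m u) (p v))"
      unfolding sum_negf[symmetric] by (intro sum.cong refl) (subst m', simp_all add: mult.commute)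
    finally show ?thesis by (simp add: a_def)
  qed
  have diag: "a i i = 0" for i
  proof -
    have "(\<Sum>u\<in>T. \<Sum>v\<in>T. \<alpha> u i * \<alpha> v i * dot n (m u) (p v)) = 0"
    proof (rule alternating_sum_zero[OF T])
      fix u v assume "u \<in> T" "v \<in> T"
      then show "\<alpha> v i * \<alpha> u i * dot n (m v) (p u) = - (\<alpha> u i * \<alpha> v i * dot n (m u) (p v))"
        by (subst m') (simp_all add: mult.commute)
    qed (simp add: m(2))
    then show ?thesis by (simp add: a_def)
  qed
  have alt: "alt A i j = a i j" if "i < n" "j < n" for i j
  proof (cases i j rule: linorder_cases)
    case greater
    then show ?thesis using that swap[of i j] by (auto simp: alt_def A_def pairs_def)
  qed (use that diag in \<open>auto simp: alt_def A_def pairs_def\<close>)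
  have "ctr n (p k) A j = m k j" if k: "k \<in> T" and j: "j < n" for k j
  proof -
    have pull: "(\<Sum>i<n. p k i * (\<Sum>u\<in>T. \<alpha> u i * g u)) = g k" for g
    proof -
      have "(\<Sum>i<n. p k i * (\<Sum>u\<in>T. \<alpha> u i * g u)) = (\<Sum>u\<in>T. dot n (\<alpha> u) (p k) * g u)"
        unfolding sum_distrib_left dot_def sum_distrib_right
        by (subst sum.swap) (simp add: algebra_simps)
      also have "\<dots> = (\<Sum>u\<in>T. if u = k then g u else 0)"
        by (intro sum.cong) (use \<alpha> k in auto)
      finally show ?thesis using k T by simp
    qed
    have "ctr n (p k) A j = (\<Sum>i<n. p k i * a i j)"
      unfolding ctr_def by (intro sum.cong) (use alt j in auto)
    also have "\<dots> = (\<Sum>i<n. p k i * (\<Sum>u\<in>T. \<alpha> u i * m u j))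
        - (\<Sum>i<n. p k i * (\<Sum>u\<in>T. \<alpha> u j * m u i))
        - (\<Sum>i<n. p k i * (\<Sum>u\<in>T. \<alpha> u i * (\<Sum>v\<in>T. \<alpha> v j * dot n (m u) (p v))))"
      by (simp add: a_def right_diff_distrib sum_distrib_left sum_subtractf mult.assoc)
    also have "(\<Sum>i<n. p k i * (\<Sum>u\<in>T. \<alpha> u j * m u i)) = (\<Sum>u\<in>T. \<alpha> u j * dot n (m u) (p k))"
      unfolding sum_distrib_left dot_def by (subst sum.swap) (simp add: algebra_simps)
    also have "\<dots> = - (\<Sum>v\<in>T. \<alpha> v j * dot n (m k) (p v))"
      unfolding sum_negf[symmetric] by (intro sum.cong refl) (subst m'[OF k], simp_all)
    finally show ?thesis by (simp add: pull)
  qed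
  moreover have "A \<in> FS (pairs n)" by (auto simp: A_def FS_def)
  ultimately show ?thesis by blast
qed

end

section \<open>Chains and links\<close>

lemma simplicial_complexD:
  assumes "simplicial_complex \<Delta>"
  shows "finite \<Delta>" "{} \<in> \<Delta>" "\<And>F. F \<in> \<Delta> \<Longrightarrow> finite F" "\<And>F G. F \<in> \<Delta> \<Longrightarrow> G \<subseteq> F \<Longrightarrow> G \<in> \<Delta>"
  using assms by (auto simp: simplicial_complex_def)

lemma finite_cofaces: "finite \<Delta> \<Longrightarrow> finite {v. v \<notin> G \<and> insert v G \<in> \<Delta>}"
  by (rule inj_on_finite[of "\<lambda>v. insert v G" _ \<Delta>]) (auto simp: inj_on_def)

lemma boundary_eq:
  assumes "finite \<Delta>"
  shows "boundary \<Delta> c G = (\<Sum>v | v \<notin> G \<and> insert v G \<in> \<Delta>. face_sign v (insert v G) * c (insert v G))"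
proof -
  have fin: "finite {v. v \<in> F \<and> F - {v} = G}" for F
  proof (cases "\<exists>v. v \<in> F \<and> F - {v} = G")
    case True
    then obtain v where "v \<in> F" "F - {v} = G" by blast
    then have "{v. v \<in> F \<and> F - {v} = G} \<subseteq> {v}" by blast
    then show ?thesis by (rule finite_subset) simp
  next
    case False
    then have "{v. v \<in> F \<and> F - {v} = G} = {}" by blast
    then show ?thesis by (simp only: finite.emptyI)
  qed
  have "boundary \<Delta> c G = (\<Sum>(F, v)\<in>(SIGMA F:\<Delta>. {v. v \<in> F \<and> F - {v} = G}). face_sign v F * c F)"
    unfolding boundary_def using assms fin by (subst sum.Sigma) auto
  also have "\<dots> = (\<Sum>v | v \<notin> G \<and> insert v G \<in> \<Delta>. face_sign v (insert v G) * c (insert v G))"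
    by (rule sum.reindex_bij_witness[of _ "\<lambda>v. (insert v G, v)" snd]) (auto simp: insert_absorb)
  finally show ?thesis .
qed

text \<open>Inserting the larger vertex does not change the position of the smaller one, whereas
  inserting the smaller one moves the larger one up by one place.\<close>

lemma face_sign_swap:
  fixes u v :: "'v::linorder"
  assumes "finite G" "u \<notin> G" "v \<notin> G" "u \<noteq> v"
  shows "face_sign v (insert v G) * face_sign u (insert u (insert v G))
    = - (face_sign u (insert u G) * face_sign v (insert u (insert v G)) :: 'k::field)"
proof -
  have *: "face_sign b (insert b G) * face_sign a (insert a (insert b G))
    = - (face_sign a (insert a G) * face_sign b (insert a (insert b G)) :: 'k)"
    if "a < b" "a \<notin> G" "b \<notin> G" for a b
  proof -
    have 1: "{w \<in> insert a (insert b G). w < a} = {w \<in> insert a G. w < a}" using that by auto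
    have 2: "{w \<in> insert a (insert b G). w < b} = insert a {w \<in> insert b G. w < b}" using that by auto
    have 3: "card (insert a {w \<in> insert b G. w < b}) = Suc (card {w \<in> insert b G. w < b})"
      using that assms(1) by (subst card_insert_disjoint) auto
    show ?thesis unfolding face_sign_def 1 2 3 by simp
  qed
  show ?thesis
  proof (cases "u < v")
    case True
    then show ?thesis using * assms by blast
  next
    case False
    then have "v < u" using assms by simp
    from *[OF this assms(3,2)] show ?thesis by (simp add: insert_commute)
  qed
qed

lemma lin_boundary: "finite \<Delta> \<Longrightarrow> lin (boundary \<Delta>)"
  by (rule linI) (auto simp: boundary_eq fun_eq_iff algebra_simps sum.distrib sum_distrib_left)

lemma lin_coboundary: "lin (coboundary \<Delta>)"
  by (rule linI) (auto simp: coboundary_def fun_eq_iff algebra_simps sum.distrib sum_distrib_left)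

text \<open>The double sum runs over ordered pairs of inserted vertices, and its terms are
  antisymmetric in the pair.\<close>

lemma boundary_boundary:
  assumes "simplicial_complex \<Delta>" shows "boundary \<Delta> (boundary \<Delta> c) G = (0::'k::field)"
proof -
  note S = simplicial_complexD[OF assms]
  let ?N = "\<lambda>G. {v. v \<notin> G \<and> insert v G \<in> \<Delta>}"
  define f where "f u v = (if u \<noteq> v \<and> insert u (insert v G) \<in> \<Delta>
    then face_sign u (insert u G) * face_sign v (insert u (insert v G)) * c (insert u (insert v G)) else 0)" for u v
  have "boundary \<Delta> (boundary \<Delta> c) G
      = (\<Sum>u\<in>?N G. \<Sum>v\<in>?N (insert u G). face_sign u (insert u G) *
          (face_sign v (insert v (insert u G)) * c (insert v (insert u G))))"
    by (simp add: boundary_eq[OF S(1)] sum_distrib_left)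
  also have "\<dots> = (\<Sum>u\<in>?N G. \<Sum>v\<in>?N G. f u v)"
  proof (rule sum.cong[OF refl], rule sum.mono_neutral_cong_left)
    fix u assume u: "u \<in> ?N G"
    show "finite (?N G)" by (rule finite_cofaces[OF S(1)])
    show "?N (insert u G) \<subseteq> ?N G" using S(4) by blast
    show "\<forall>v\<in>?N G - ?N (insert u G). f u v = 0" by (auto simp: f_def insert_commute)
    show "face_sign u (insert u G) * (face_sign v (insert v (insert u G)) * c (insert v (insert u G))) = f u v"
      if "v \<in> ?N (insert u G)" for v
      using that by (auto simp: f_def insert_commute mult.assoc)
  qed
  also have "\<dots> = 0"
  proof (rule alternating_sum_zero[OF finite_cofaces[OF S(1)]])
    fix u v assume uv: "u \<in> ?N G" "v \<in> ?N G"
    then have "finite G" using S(3)[of "insert u G"] by auto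
    show "f v u = - f u v"
    proof (cases "u \<noteq> v \<and> insert u (insert v G) \<in> \<Delta>")
      case True
      have "f v u = (face_sign v (insert v G) * face_sign u (insert u (insert v G))) * c (insert u (insert v G))"
      proof -
        have T: "v \<noteq> u \<and> insert v (insert u G) \<in> \<Delta>" using True by (auto simp: insert_commute)
        then show ?thesis using True unfolding f_def insert_commute[of v u] by auto
      qed
      also have "\<dots> = - (face_sign u (insert u G) * face_sign v (insert u (insert v G))) * c (insert u (insert v G))"
        using True uv by (subst face_sign_swap[OF \<open>finite G\<close>]) auto
      also have "\<dots> = - f u v" unfolding f_def if_P[OF True] by simp
      finally show ?thesis .
    next
      case False
      then have "\<not> (v \<noteq> u \<and> insert v (insert u G) \<in> \<Delta>)" by (auto simp: insert_commute)
      then show ?thesis using False unfolding f_def by (simp only: if_False minus_zero)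
    qed
  qed (auto simp: f_def)
  finally show ?thesis .
qed

lemma boundary_coboundary_adjoint:
  assumes "simplicial_complex \<Delta>"
  shows "(\<Sum>F\<in>\<Delta>. coboundary \<Delta> f F * c F) = (\<Sum>G\<in>\<Delta>. f G * boundary \<Delta> c G)"
proof -
  note S = simplicial_complexD[OF assms]
  have "(\<Sum>F\<in>\<Delta>. coboundary \<Delta> f F * c F)
      = (\<Sum>(F, v)\<in>(SIGMA F:\<Delta>. F). face_sign v F * f (F - {v}) * c F)"
    using S by (subst sum.Sigma[symmetric]) (auto simp: coboundary_def sum_distrib_right)
  also have "\<dots> = (\<Sum>(G, v)\<in>(SIGMA G:\<Delta>. {v. v \<notin> G \<and> insert v G \<in> \<Delta>}).
      f G * (face_sign v (insert v G) * c (insert v G)))"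
    by (rule sum.reindex_bij_witness[of _ "\<lambda>(G, v). (insert v G, v)" "\<lambda>(F, v). (F - {v}, v)"])
      (use S(4) in \<open>auto simp: insert_absorb\<close>)
  also have "\<dots> = (\<Sum>G\<in>\<Delta>. f G * boundary \<Delta> c G)"
    using S(1) finite_cofaces[OF S(1)]
    by (subst sum.Sigma[symmetric]) (auto simp: boundary_eq sum_distrib_left)
  finally show ?thesis .
qed

lemma sum_unitf: "finite X \<Longrightarrow> x \<in> X \<Longrightarrow> (\<Sum>y\<in>X. g y * unitf x y) = g x"
  by (simp add: unitf_def if_distrib[of "\<lambda>z. _ * z"] cong: if_cong)

lemma coboundary_coboundary:
  assumes "simplicial_complex \<Delta>" shows "coboundary \<Delta> (coboundary \<Delta> f) F = (0::'k::field)"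
proof (cases "F \<in> \<Delta>")
  case True
  have "coboundary \<Delta> (coboundary \<Delta> f) F = (\<Sum>F'\<in>\<Delta>. coboundary \<Delta> (coboundary \<Delta> f) F' * unitf F F')"
    by (rule sum_unitf[OF simplicial_complexD(1)[OF assms] True, symmetric])
  also have "\<dots> = 0"
    unfolding boundary_coboundary_adjoint[OF assms] boundary_boundary[OF assms] by simp
  finally show ?thesis .
qed (simp add: coboundary_def)

lemma boundary_FS:
  assumes "simplicial_complex \<Delta>" "c \<in> FS (faces \<Delta> i)" shows "boundary \<Delta> c \<in> FS (faces \<Delta> (i - 1))"
proof -
  note S = simplicial_complexD[OF assms(1)]
  have "boundary \<Delta> c G = 0" if G: "G \<notin> faces \<Delta> (i - 1)" for G
  proof -
    have "c (insert v G) = 0" if v: "v \<notin> G" "insert v G \<in> \<Delta>" for v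
    proof -
      have "finite G" "G \<in> \<Delta>" using S(3,4)[OF v(2)] by auto
      then have "insert v G \<notin> faces \<Delta> i" using G v by (auto simp: faces_def)
      then show ?thesis using assms(2) by (auto simp: FS_def)
    qed
    then show ?thesis by (simp add: boundary_eq[OF S(1)])
  qed
  then show ?thesis by (simp add: FS_def)
qed

lemma finite_faces: "finite \<Delta> \<Longrightarrow> finite (faces \<Delta> i)"
  by (simp add: faces_def)

text \<open>The cosets of \<open>fun_space\<close> do not depend on the chosen carrier, so one
  notion serves cycles, absolute cocycles and relative cocycles.\<close>

definition coset :: "('x \<Rightarrow> 'k::field) set \<Rightarrow> ('x \<Rightarrow> 'k) \<Rightarrow> ('x \<Rightarrow> 'k) set" where
  "coset B f = (\<lambda>b x. b x + f x) ` B"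

lemma a_r_coset_fun_space:
  "B +>\<^bsub>(fun_space S)\<lparr>carrier := Z\<rparr>\<^esub> f = coset B f" "B +>\<^bsub>fun_space S\<^esub> f = coset B f"
  by (auto simp: a_r_coset_def r_coset_def fun_space_def coset_def)

lemma coset_eq_iff:
  assumes "fs.subspace B" shows "coset B f = B \<longleftrightarrow> f \<in> B"
proof
  assume "coset B f = B"
  moreover have "(\<lambda>x. 0 x + f x) \<in> coset B f"
    unfolding coset_def by (rule imageI[OF fs.subspace_0[OF assms]])
  ultimately show "f \<in> B" by simp
next
  assume f: "f \<in> B"
  have "b \<in> coset B f" if "b \<in> B" for b
  proof -
    have "b - f \<in> B" using fs.subspace_diff[OF assms that f] .
    then show ?thesis unfolding coset_def by (rule rev_image_eqI) (simp add: fun_eq_iff)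
  qed
  moreover have "(\<lambda>x. b x + f x) \<in> B" if "b \<in> B" for b
    using fs.subspace_add[OF assms that f] by (simp add: plus_fun_def)
  ultimately show "coset B f = B" by (auto simp: coset_def)
qed

section \<open>Quotients of spaces of functions and Betti numbers\<close>

context
  fixes Z B :: "('x \<Rightarrow> 'k::field) set" and S :: "'x set" and M
  assumes Z: "fs.subspace Z" and B: "fs.subspace B"
  defines "M \<equiv> quot_space ((fun_space S)\<lparr>carrier := Z\<rparr>) B"
begin

lemma quot_space_carrier: "carrier M = coset B ` Z"
proof -
  have "carrier M = (\<Union>f\<in>Z. {B +>\<^bsub>(fun_space S)\<lparr>carrier := Z\<rparr>\<^esub> f})"
    by (simp add: M_def quot_space_def A_RCOSETS_def RCOSETS_def a_r_coset_def)
  then show ?thesis unfolding a_r_coset_fun_space by auto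
qed

lemma quot_space_zero: "coset B 0 = \<zero>\<^bsub>M\<^esub>" "\<zero>\<^bsub>M\<^esub> = B"
  using coset_eq_iff[OF B, of 0] fs.subspace_0[OF B] by (auto simp: M_def quot_space_def)

lemma quot_space_add: "coset B (f + g) = coset B f \<oplus>\<^bsub>M\<^esub> coset B g"
proof -
  have "coset B f \<oplus>\<^bsub>M\<^esub> coset B g = (\<Union>h\<in>coset B f. \<Union>k\<in>coset B g. {\<lambda>x. h x + k x})"
    by (simp add: M_def quot_space_def set_add_def set_mult_def fun_space_def)
  also have "\<dots> = coset B (f + g)"
  proof (intro equalityI subsetI)
    fix y assume "y \<in> (\<Union>h\<in>coset B f. \<Union>k\<in>coset B g. {\<lambda>x. h x + k x})"
    then obtain b c where bc: "b \<in> B" "c \<in> B" "y = (\<lambda>x. (b x + f x) + (c x + g x))" by (auto simp: coset_def)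
    then have "y = (\<lambda>x. (b + c) x + (f + g) x)" by (auto simp: fun_eq_iff)
    then show "y \<in> coset B (f + g)" unfolding coset_def by (rule image_eqI[OF _ fs.subspace_add[OF B bc(1,2)]])
  next
    fix y assume "y \<in> coset B (f + g)"
    then obtain b where b: "b \<in> B" "y = (\<lambda>x. b x + (f + g) x)" by (auto simp: coset_def)
    have "(\<lambda>x. b x + f x) \<in> coset B f" "(\<lambda>x. 0 x + g x) \<in> coset B g"
      using b fs.subspace_0[OF B] unfolding coset_def by blast+
    moreover have "y = (\<lambda>x. (b x + f x) + (0 x + g x))" using b by (simp add: fun_eq_iff add.assoc)
    ultimately show "y \<in> (\<Union>h\<in>coset B f. \<Union>k\<in>coset B g. {\<lambda>x. h x + k x})" by blast
  qed
  finally show ?thesis by simp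
qed

lemma quot_space_smult: "coset B (\<lambda>x. c * f x) = c \<odot>\<^bsub>M\<^esub> coset B f"
proof -
  have "c \<odot>\<^bsub>M\<^esub> coset B f = (\<Union>y\<in>coset B f. coset B (\<lambda>x. c * y x))"
    unfolding M_def quot_space_def module.simps a_r_coset_fun_space by (simp add: fun_space_def)
  also have "\<dots> = coset B (\<lambda>x. c * f x)"
  proof (intro equalityI subsetI)
    fix y assume "y \<in> (\<Union>y\<in>coset B f. coset B (\<lambda>x. c * y x))"
    then obtain b b' where b: "b \<in> B" "b' \<in> B" "y = (\<lambda>x. b' x + c * (b x + f x))" by (auto simp: coset_def)
    then have "y = (\<lambda>x. (b' + (\<lambda>x. c * b x)) x + c * f x)" by (auto simp: fun_eq_iff algebra_simps)
    moreover have "b' + (\<lambda>x. c * b x) \<in> B" using b by (intro fs.subspace_add[OF B] fs.subspace_scale[OF B])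
    ultimately show "y \<in> coset B (\<lambda>x. c * f x)" unfolding coset_def by (rule image_eqI)
  next
    fix y assume y: "y \<in> coset B (\<lambda>x. c * f x)"
    have "(\<lambda>x. 0 x + f x) \<in> coset B f" using fs.subspace_0[OF B] unfolding coset_def by blast
    then have "f \<in> coset B f" by simp
    then show "y \<in> (\<Union>y\<in>coset B f. coset B (\<lambda>x. c * y x))" using y by blast
  qed
  finally show ?thesis by simp
qed

lemmas quot_space_facts = quot_space_carrier quot_space_zero(1) quot_space_add quot_space_smult

lemma quot_space_dim:
  assumes "finite X" "Z \<subseteq> FS X" "B \<subseteq> Z"
  shows "vs_dim M + fs.dim B = fs.dim Z"
proof -
  have "{f \<in> Z. coset B f = \<zero>\<^bsub>M\<^esub>} = B"
    using assms(3) coset_eq_iff[OF B] by (auto simp: quot_space_zero(2))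
  then show ?thesis
    using vs_dim_image[OF assms(1,2) Z quot_space_facts] by simp
qed

end

lemma cycles_eq: "cycles \<Delta> i = {c \<in> FS (faces \<Delta> i). boundary \<Delta> c = 0}"
  by (auto simp: cycles_def chains_def fun_space_def FS_def zero_fun_def)

lemma boundaries_eq: "boundaries \<Delta> i = boundary \<Delta> ` FS (faces \<Delta> (i + 1))"
  by (auto simp: boundaries_def chains_def fun_space_def FS_def)

lemma subspace_kernel:
  assumes T: "lin T" and U: "fs.subspace U" shows "fs.subspace {f \<in> U. T f = 0}" (is "fs.subspace ?K")
proof (rule subspaceI)
  show "(\<lambda>_. 0) \<in> ?K"
    using fs.subspace_0[OF U] fsp.linear_0[OF T] by (simp add: zero_fun_def)
  show "(\<lambda>x. f x + g x) \<in> ?K" if "f \<in> ?K" "g \<in> ?K" for f g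
    using fs.subspace_add[OF U] lin_add[OF T, of f g] that by (auto simp: plus_fun_def)
  show "(\<lambda>x. c * f x) \<in> ?K" if "f \<in> ?K" for c f
    using fs.subspace_scale[OF U] lin_scale[OF T, of c f] that by (auto simp: zero_fun_def)
qed

lemma subspace_cycles: "finite \<Delta> \<Longrightarrow> fs.subspace (cycles \<Delta> i)"
  unfolding cycles_eq by (intro subspace_kernel lin_boundary subspace_FS)

lemma subspace_boundaries: "finite \<Delta> \<Longrightarrow> fs.subspace (boundaries \<Delta> i)"
  unfolding boundaries_eq by (intro fsp.linear_subspace_image lin_boundary subspace_FS)

lemma betti_eq:
  assumes "simplicial_complex (\<Delta> :: 'v::linorder set set)"
  shows "betti TYPE('k::field) \<Delta> i + fs.dim (boundaries \<Delta> i :: ('v set \<Rightarrow> 'k) set)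
    = fs.dim (cycles \<Delta> i :: ('v set \<Rightarrow> 'k) set)"
proof -
  note S = simplicial_complexD[OF assms]
  have "boundaries \<Delta> i \<subseteq> (cycles \<Delta> i :: ('v set \<Rightarrow> 'k) set)"
    unfolding boundaries_eq cycles_eq
    using boundary_FS[OF assms, of _ "i + 1"] boundary_boundary[OF assms] by (auto simp: fun_eq_iff)
  moreover have "cycles \<Delta> i \<subseteq> (FS (faces \<Delta> i) :: ('v set \<Rightarrow> 'k) set)" by (auto simp: cycles_eq)
  ultimately show ?thesis
    unfolding betti_def homology_def chains_def
    using quot_space_dim[OF subspace_cycles[OF S(1)] subspace_boundaries[OF S(1)] finite_faces[OF S(1)]]
    by blast
qed

lemma dim_cycles_boundaries:
  assumes "simplicial_complex (\<Delta> :: 'v::linorder set set)"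
  shows "fs.dim (cycles \<Delta> i :: ('v set \<Rightarrow> 'k::field) set) + fs.dim (boundaries \<Delta> (i - 1) :: ('v set \<Rightarrow> 'k) set)
    = card (faces \<Delta> i)"
  using rank_nullity[OF finite_faces order_refl subspace_FS lin_boundary, of \<Delta> \<Delta> i, where ?'k='k]
    simplicial_complexD(1)[OF assms] dim_FS[OF finite_faces, of \<Delta> i, where ?'k='k]
  by (simp add: cycles_eq boundaries_eq)

lemma simplicial_complex_link:
  assumes "simplicial_complex \<Delta>" "G \<in> \<Delta>" shows "simplicial_complex (link \<Delta> G)"
proof -
  note S = simplicial_complexD[OF assms(1)]
  have "finite (link \<Delta> G)"
    by (rule inj_on_finite[of "\<lambda>F. F \<union> G" _ \<Delta>]) (use S in \<open>auto simp: link_def inj_on_def\<close>)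
  moreover have "finite F \<and> (\<forall>H. H \<subseteq> F \<longrightarrow> H \<in> link \<Delta> G)" if F: "F \<in> link \<Delta> G" for F
  proof -
    have *: "F \<union> G \<in> \<Delta>" "F \<inter> G = {}" using F by (auto simp: link_def)
    have "H \<in> link \<Delta> G" if "H \<subseteq> F" for H
      using S(4)[OF *(1), of "H \<union> G"] *(2) that by (auto simp: link_def)
    then show ?thesis using S(3)[OF *(1)] by auto
  qed
  moreover have "{} \<in> link \<Delta> G" using assms(2) by (simp add: link_def)
  ultimately show ?thesis unfolding simplicial_complex_def by blast
qed

lemma link_link:
  assumes "F \<in> link \<Delta> G" shows "link (link \<Delta> G) F = link \<Delta> (G \<union> F)"
  using assms by (auto simp: link_def Un_ac)

lemma link_empty: "link \<Delta> {} = \<Delta>"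
  by (auto simp: link_def)

text \<open>Joining \<open>G\<close> to a face changes the sign of a vertex \<open>x\<close> of that
  face by the number of elements of \<open>G\<close> below \<open>x\<close>. The product of these
  signs turns the passage from cofaces of \<open>G\<close> to faces of the link into a chain
  map.\<close>

definition lsign :: "'v::linorder set \<Rightarrow> 'v set \<Rightarrow> 'k::field" where
  "lsign G F = (\<Prod>x\<in>F. (-1) ^ card {g \<in> G. g < x})"

lemma lsign_sq: "lsign G F * lsign G F = (1::'k::field)"
  unfolding lsign_def prod.distrib[symmetric]
  by (intro prod.neutral ballI) (simp add: power_mult_distrib[symmetric])

lemma lsign_nonzero: "lsign G F \<noteq> (0::'k::field)"
  using lsign_sq[of G F, where ?'k='k] by auto

definition to_link :: "'v::linorder set set \<Rightarrow> 'v set \<Rightarrow> ('v set \<Rightarrow> 'k::field) \<Rightarrow> 'v set \<Rightarrow> 'k" where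
  "to_link \<Delta> G c F = (if F \<in> link \<Delta> G then lsign G F * c (F \<union> G) else 0)"

lemma lin_to_link: "lin (to_link \<Delta> G)"
  by (rule linI) (auto simp: to_link_def fun_eq_iff algebra_simps)

lemma boundary_to_link:
  assumes "simplicial_complex \<Delta>" "G \<in> \<Delta>" "H \<in> link \<Delta> G"
  shows "boundary (link \<Delta> G) (to_link \<Delta> G c) H = lsign G H * boundary \<Delta> c (H \<union> G)"
proof -
  note S = simplicial_complexD[OF assms(1)] and L = simplicial_complexD[OF simplicial_complex_link[OF assms(1,2)]]
  have HG: "H \<inter> G = {}" "H \<union> G \<in> \<Delta>" using assms(3) by (auto simp: link_def)
  have fin: "finite H" "finite G" using S(3)[OF HG(2)] by auto
  have set: "{v. v \<notin> H \<and> insert v H \<in> link \<Delta> G} = {v. v \<notin> H \<union> G \<and> insert v (H \<union> G) \<in> \<Delta>}"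
    using HG by (auto simp: link_def)
  show ?thesis
    unfolding boundary_eq[OF L(1)] boundary_eq[OF S(1)] sum_distrib_left set
  proof (rule sum.cong[OF refl])
    fix v assume v: "v \<in> {v. v \<notin> H \<union> G \<and> insert v (H \<union> G) \<in> \<Delta>}"
    then have mem: "insert v H \<in> link \<Delta> G" using set by blast
    have "{u \<in> insert v (H \<union> G). u < v} = {u \<in> insert v H. u < v} \<union> {g \<in> G. g < v}" by auto
    moreover have "card ({u \<in> insert v H. u < v} \<union> {g \<in> G. g < v})
        = card {u \<in> insert v H. u < v} + card {g \<in> G. g < v}"
      using fin HG(1) v by (intro card_Un_disjoint) auto
    ultimately have 1: "face_sign v (insert v (H \<union> G))
        = face_sign v (insert v H) * (-1) ^ card {g \<in> G. g < v}"
      by (simp add: face_sign_def power_add)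
    have 2: "lsign G (insert v H) = (-1) ^ card {g \<in> G. g < v} * lsign G H"
      unfolding lsign_def using v fin by (subst prod.insert) auto
    have "to_link \<Delta> G c (insert v H) = (-1) ^ card {g \<in> G. g < v} * lsign G H * c (insert v (H \<union> G))"
      using mem by (simp add: to_link_def 2)
    then show "face_sign v (insert v H) * to_link \<Delta> G c (insert v H)
        = lsign G H * (face_sign v (insert v (H \<union> G)) * c (insert v (H \<union> G)))"
      by (simp add: 1)
  qed
qed

definition star_faces :: "'v set set \<Rightarrow> 'v set \<Rightarrow> int \<Rightarrow> 'v set set" where
  "star_faces \<Delta> G i = {F \<in> faces \<Delta> i. G \<subseteq> F}"

text \<open>Cycles relative to the faces that do not contain \<open>G\<close>: the boundary is
  tested only on faces containing \<open>G\<close>.\<close>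

definition rel_cycles :: "'v::linorder set set \<Rightarrow> 'v set \<Rightarrow> int \<Rightarrow> ('v set \<Rightarrow> 'k::field) set" where
  "rel_cycles \<Delta> G i = {c \<in> FS (star_faces \<Delta> G i). \<forall>H. G \<subseteq> H \<longrightarrow> boundary \<Delta> c H = 0}"

lemma finite_star_faces: "finite \<Delta> \<Longrightarrow> finite (star_faces \<Delta> G i)"
  by (simp add: star_faces_def finite_faces)

lemma subspace_rel_cycles:
  assumes "finite \<Delta>" shows "fs.subspace (rel_cycles \<Delta> G i)"
proof (rule subspaceI)
  note L = lin_boundary[OF assms]
  show "(\<lambda>_. 0) \<in> rel_cycles \<Delta> G i"
    using fun_cong[OF fsp.linear_0[OF L]] by (auto simp: rel_cycles_def FS_def zero_fun_def)
  show "(\<lambda>x. f x + g x) \<in> rel_cycles \<Delta> G i" if "f \<in> rel_cycles \<Delta> G i" "g \<in> rel_cycles \<Delta> G i" for f g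
    using lin_add[OF L, of f g] that by (auto simp: rel_cycles_def FS_def plus_fun_def)
  show "(\<lambda>x. c * f x) \<in> rel_cycles \<Delta> G i" if "f \<in> rel_cycles \<Delta> G i" for c f
    using lin_scale[OF L, of c f] that by (auto simp: rel_cycles_def FS_def)
qed

text \<open>On faces containing \<open>G\<close>, the map \<open>to_link\<close> strips
  \<open>G\<close> and changes signs. It is therefore bijective there, compatible with boundaries,
  and lowers the degree by \<open>card G\<close>.\<close>

lemma rel_cycles_to_link:
  fixes \<Delta> :: "'v::linorder set set" and c :: "'v set \<Rightarrow> 'k::field"
  assumes \<Delta>: "simplicial_complex \<Delta>" and G: "G \<in> \<Delta>"
  shows "to_link \<Delta> G ` rel_cycles \<Delta> G i = (cycles (link \<Delta> G) (i - int (card G)) :: ('v set \<Rightarrow> 'k) set)"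
    and "c \<in> FS (star_faces \<Delta> G i) \<Longrightarrow> to_link \<Delta> G c = 0 \<Longrightarrow> c = 0"
proof -
  note S = simplicial_complexD[OF \<Delta>] and L = simplicial_complexD[OF simplicial_complex_link[OF \<Delta> G]]
  have finG: "finite G" using S(3)[OF G] .
  have face: "F \<in> faces (link \<Delta> G) (i - int (card G))"
    if "F \<in> link \<Delta> G" "F \<union> G \<in> faces \<Delta> i" for F
  proof -
    have "card (F \<union> G) = card F + card G"
      using that L(3) finG by (intro card_Un_disjoint) (auto simp: link_def)
    then show ?thesis using that by (auto simp: faces_def)
  qed
  have bd0: "boundary (link \<Delta> G) c H = 0" if "H \<notin> link \<Delta> G" for c :: "'v set \<Rightarrow> 'k" and H
  proof -
    have "{v. v \<notin> H \<and> insert v H \<in> link \<Delta> G} = {}" using that L(4) by blast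
    then show ?thesis by (simp only: boundary_eq[OF L(1)] sum.empty)
  qed
  show "c = 0" if c: "c \<in> FS (star_faces \<Delta> G i)" "to_link \<Delta> G c = 0" for c :: "'v set \<Rightarrow> 'k"
  proof
    fix F
    show "c F = 0 F"
    proof (cases "F \<in> star_faces \<Delta> G i")
      case True
      then have F: "F - G \<in> link \<Delta> G" "F - G \<union> G = F" by (auto simp: star_faces_def faces_def link_def Un_absorb1 Un_absorb2)
      have "lsign G (F - G) * c F = 0"
        using fun_cong[OF c(2), of "F - G"] F by (simp add: to_link_def)
      then show ?thesis using lsign_nonzero[of G "F - G", where ?'k='k] by simp
    qed (use c(1) in \<open>simp add: FS_def\<close>)
  qed
  show "to_link \<Delta> G ` rel_cycles \<Delta> G i = (cycles (link \<Delta> G) (i - int (card G)) :: ('v set \<Rightarrow> 'k) set)"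
  proof (intro equalityI subsetI)
    fix c' :: "'v set \<Rightarrow> 'k" assume "c' \<in> to_link \<Delta> G ` rel_cycles \<Delta> G i"
    then obtain c where c: "c \<in> rel_cycles \<Delta> G i" "c' = to_link \<Delta> G c" by blast
    have "boundary (link \<Delta> G) c' H = 0" for H
    proof (cases "H \<in> link \<Delta> G")
      case True
      then show ?thesis using c by (simp add: boundary_to_link[OF \<Delta> G] rel_cycles_def)
    qed (rule bd0)
    moreover have "c' \<in> FS (faces (link \<Delta> G) (i - int (card G)))"
    proof -
      have "c' F = 0" if F: "F \<notin> faces (link \<Delta> G) (i - int (card G))" for F
      proof (cases "F \<in> link \<Delta> G")
        case True
        then have "F \<union> G \<notin> faces \<Delta> i" using face F by blast
        then show ?thesis using c by (auto simp: to_link_def rel_cycles_def FS_def star_faces_def)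
      qed (simp add: c(2) to_link_def)
      then show ?thesis by (simp add: FS_def)
    qed
    ultimately show "c' \<in> cycles (link \<Delta> G) (i - int (card G))" by (auto simp: cycles_eq)
  next
    fix c' :: "'v set \<Rightarrow> 'k" assume c': "c' \<in> cycles (link \<Delta> G) (i - int (card G))"
    \<comment> \<open>The signs square to one, so multiplication by \<open>lsign\<close> also gives
      the inverse.\<close>
    define c where "c F = (if G \<subseteq> F \<and> F \<in> \<Delta> then lsign G (F - G) * c' (F - G) else 0)" for F
    have c'_out: "c' F = 0" if "F \<notin> faces (link \<Delta> G) (i - int (card G))" for F
      using c' that by (auto simp: cycles_eq FS_def)
    have T: "to_link \<Delta> G c = c'"
    proof
      fix F
      show "to_link \<Delta> G c F = c' F"
      proof (cases "F \<in> link \<Delta> G")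
        case True
        then have "F \<union> G \<in> \<Delta>" "F \<union> G - G = F" by (auto simp: link_def)
        then show ?thesis using True by (simp add: to_link_def c_def mult.assoc[symmetric] lsign_sq)
      next
        case False
        then show ?thesis using c'_out[of F] by (simp add: to_link_def faces_def)
      qed
    qed
    have "c F = 0" if F: "F \<notin> star_faces \<Delta> G i" for F
    proof (cases "G \<subseteq> F \<and> F \<in> \<Delta>")
      case True
      then have "card F = card (F - G) + card G"
        using S(3) finG by (metis card_Diff_subset card_mono le_add_diff_inverse2)
      then have "F - G \<notin> faces (link \<Delta> G) (i - int (card G))"
        using F True by (auto simp: faces_def star_faces_def)
      then show ?thesis by (simp add: c_def c'_out)
    next
      case False
      then show ?thesis unfolding c_def by (rule if_not_P)
    qed
    then have "c \<in> FS (star_faces \<Delta> G i)" by (simp add: FS_def)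
    moreover have "boundary \<Delta> c H = 0" if H: "G \<subseteq> H" for H
    proof (cases "H \<in> \<Delta>")
      case True
      then have m: "H - G \<in> link \<Delta> G" "H - G \<union> G = H" using H by (auto simp: link_def Un_absorb1 Un_absorb2)
      have "lsign G (H - G) * boundary \<Delta> c H = boundary (link \<Delta> G) c' (H - G)"
        using boundary_to_link[OF \<Delta> G m(1), of c] m(2) T by simp
      also have "\<dots> = 0" using c' by (simp add: cycles_eq)
      finally show ?thesis using lsign_nonzero[of G "H - G", where ?'k='k] by simp
    next
      case False
      then have "{v. v \<notin> H \<and> insert v H \<in> \<Delta>} = {}" using S(4) by blast
      then show ?thesis by (simp only: boundary_eq[OF S(1)] sum.empty)
    qed
    ultimately have "c \<in> rel_cycles \<Delta> G i" by (simp add: rel_cycles_def)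
    then show "c' \<in> to_link \<Delta> G ` rel_cycles \<Delta> G i" using T by blast
  qed
qed

lemma dim_rel_cycles:
  assumes \<Delta>: "simplicial_complex \<Delta>" and G: "G \<in> \<Delta>"
  shows "fs.dim (rel_cycles \<Delta> G i :: ('v::linorder set \<Rightarrow> 'k::field) set)
    = fs.dim (cycles (link \<Delta> G) (i - int (card G)) :: ('v set \<Rightarrow> 'k) set)"
proof -
  note fin = simplicial_complexD(1)[OF \<Delta>]
  have sub: "rel_cycles \<Delta> G i \<subseteq> (FS (star_faces \<Delta> G i) :: ('v set \<Rightarrow> 'k) set)"
    by (auto simp: rel_cycles_def)
  have "fs.dim (to_link \<Delta> G ` rel_cycles \<Delta> G i :: ('v set \<Rightarrow> 'k) set) = fs.dim (rel_cycles \<Delta> G i :: ('v set \<Rightarrow> 'k) set)"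
    using rel_cycles_to_link(2)[OF \<Delta> G] sub
    by (intro dim_inj[OF finite_star_faces[OF fin] sub subspace_rel_cycles[OF fin] lin_to_link]) blast
  then show ?thesis by (simp only: rel_cycles_to_link(1)[OF \<Delta> G])
qed

text \<open>Here \<open>d\<close> is the number of vertices of a facet, so
  \<open>d - 1 - card G\<close> is the dimension of the link. The condition is stated for one face
  at a time because singular vertices violate it while faces with two or more vertices satisfy
  it.\<close>

definition spherical :: "'k::field itself \<Rightarrow> 'v::linorder set set \<Rightarrow> nat \<Rightarrow> 'v set \<Rightarrow> bool" where
  "spherical k \<Delta> d G \<longleftrightarrow> (\<forall>i. betti k (link \<Delta> G) i = (if i = int d - 1 - int (card G) then 1 else 0))"

lemma boundaries_top:
  assumes "faces \<Delta> (i + 1) = {}" "finite \<Delta>" shows "fs.dim (boundaries \<Delta> i :: ('v::linorder set \<Rightarrow> 'k::field) set) = 0"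
proof -
  have "FS (faces \<Delta> (i + 1)) = {0 :: 'v set \<Rightarrow> 'k}" using assms by (auto simp: FS_def fun_eq_iff)
  then have "boundaries \<Delta> i = {0 :: 'v set \<Rightarrow> 'k}"
    using fsp.linear_0[OF lin_boundary[OF assms(2)]] by (simp add: boundaries_eq)
  then show ?thesis using fs.dim_le_card[of "{0 :: 'v set \<Rightarrow> 'k}" "{}"] by simp
qed

text \<open>The top cycles of a link with the homology of a sphere form a line, and any coordinate
  at which a generator does not vanish determines them. For an edge this is what reduces its edge
  number to a single scalar.\<close>

lemma spherical_top_coordinate:
  assumes \<Delta>: "simplicial_complex \<Delta>" and G: "G \<in> \<Delta>" and sph: "spherical TYPE('k::field) \<Delta> d G"
    and card: "\<And>F. F \<in> \<Delta> \<Longrightarrow> card F \<le> d"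
  shows "\<exists>F. \<forall>c \<in> (rel_cycles \<Delta> G (int d - 1) :: ('v::linorder set \<Rightarrow> 'k) set). c F = 0 \<longrightarrow> c = 0"
proof -
  note S = simplicial_complexD[OF \<Delta>] and L = simplicial_complexD[OF simplicial_complex_link[OF \<Delta> G]]
  have "faces (link \<Delta> G) (int d - 1 - int (card G) + 1) = {}"
  proof -
    have False if F: "F \<in> link \<Delta> G" "int (card F) = int d - int (card G) + 1" for F
    proof -
      have "card (F \<union> G) = card F + card G"
        using F L(3) S(3)[OF G] by (intro card_Un_disjoint) (auto simp: link_def)
      then show False using card[of "F \<union> G"] F by (auto simp: link_def)
    qed
    then show ?thesis unfolding faces_def by (auto simp: algebra_simps)
  qed
  from boundaries_top[OF this L(1), where ?'k='k]
  have "fs.dim (cycles (link \<Delta> G) (int d - 1 - int (card G)) :: ('v set \<Rightarrow> 'k) set) = 1"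
    using betti_eq[OF simplicial_complex_link[OF \<Delta> G], of "int d - 1 - int (card G)", where ?'k='k] sph
    by (simp add: spherical_def)
  then have d1: "fs.dim (rel_cycles \<Delta> G (int d - 1) :: ('v set \<Rightarrow> 'k) set) = 1"
    by (simp add: dim_rel_cycles[OF \<Delta> G])
  obtain B where B: "B \<subseteq> (rel_cycles \<Delta> G (int d - 1) :: ('v set \<Rightarrow> 'k) set)" "fs.independent B"
    "rel_cycles \<Delta> G (int d - 1) \<subseteq> fs.span B" "card B = 1"
    using fs.basis_exists[of "rel_cycles \<Delta> G (int d - 1) :: ('v set \<Rightarrow> 'k) set"] d1 by metis
  then obtain b where b: "B = {b}" by (auto simp: card_1_singleton_iff)
  then have "b \<noteq> 0" using B(2) by (metis fs.dependent_single)
  then obtain F where F: "b F \<noteq> 0" by (auto simp: fun_eq_iff)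
  have "c = 0" if c: "c \<in> rel_cycles \<Delta> G (int d - 1)" "c F = 0" for c :: "'v set \<Rightarrow> 'k"
  proof -
    obtain k where "c = (\<lambda>x. k * b x)" using B(3) c(1) b by (auto simp: fs.span_singleton)
    then show ?thesis using c(2) F by (auto simp: fun_eq_iff)
  qed
  then show ?thesis by blast
qed

context
  fixes \<Delta> :: "'v::linorder set set" and d :: nat
  assumes \<Delta>: "simplicial_complex \<Delta>" and pure: "pure \<Delta>" and sdim: "sdim \<Delta> = int d - 1"
begin

lemma card_face_le: "F \<in> \<Delta> \<Longrightarrow> card F \<le> d"
  using sdim simplicial_complexD(1)[OF \<Delta>] by (auto simp: sdim_def)

lemma face_in_facet: assumes "F \<in> \<Delta>" shows "\<exists>H\<in>\<Delta>. F \<subseteq> H \<and> card H = d"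
proof -
  obtain H where H: "H \<in> \<Delta>" "F \<subseteq> H" "\<forall>K\<in>\<Delta>. H \<subseteq> K \<longrightarrow> H = K"
    using finite_has_maximal2[OF simplicial_complexD(1)[OF \<Delta>] assms] by metis
  then have "H \<in> facets \<Delta>" by (auto simp: facets_def)
  then have "int (card H) - 1 = int d - 1" using pure sdim by (auto simp: pure_def)
  then show ?thesis using H by auto
qed

lemma sdim_link_vertex: assumes "{v} \<in> \<Delta>" shows "sdim (link \<Delta> {v}) = int d - 2"
proof -
  note S = simplicial_complexD[OF \<Delta>] and L = simplicial_complexD[OF simplicial_complex_link[OF \<Delta> assms]]
  obtain H where H: "H \<in> \<Delta>" "{v} \<subseteq> H" "card H = d" using face_in_facet[OF assms] by blast
  have fH: "finite H" using S(3)[OF H(1)] .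
  have d: "d > 0" using H fH by (metis card_gt_0_iff insert_not_empty subset_empty)
  have "H - {v} \<in> link \<Delta> {v}" using H by (auto simp: link_def insert_absorb)
  moreover have "card (H - {v}) = d - 1" using H by simp
  moreover have "card F \<le> d - 1" if F: "F \<in> link \<Delta> {v}" for F
  proof -
    have "card (insert v F) = Suc (card F)" using F L(3) by (subst card_insert_disjoint) (auto simp: link_def)
    moreover have "insert v F \<in> \<Delta>" using F by (auto simp: link_def)
    ultimately show ?thesis using card_face_le[of "insert v F"] by simp
  qed
  ultimately have "Max (card ` link \<Delta> {v}) = d - 1" using L(1) by (intro Max_eqI) (auto intro: rev_image_eqI)
  then show ?thesis using d by (simp add: sdim_def)
qed

text \<open>The link of \<open>G\<close> is the link of \<open>G - {v}\<close> inside the link of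
  \<open>v\<close>, and \<open>G - {v}\<close> is a nonempty face of that homology manifold.\<close>

lemma spherical_of_card_ge_2:
  assumes iso: "\<forall>v\<in>vertices \<Delta>. homology_manifold TYPE('k::field) (link \<Delta> {v})"
    and G: "G \<in> \<Delta>" "card G \<ge> 2"
  shows "spherical TYPE('k) \<Delta> d G"
proof -
  note S = simplicial_complexD[OF \<Delta>]
  obtain v where v: "v \<in> G" using G(2) by fastforce
  have vD: "{v} \<in> \<Delta>" using S(4)[OF G(1)] v by auto
  have F: "G - {v} \<in> link \<Delta> {v}" using G(1) v by (auto simp: link_def insert_absorb)
  have c: "card (G - {v}) = card G - 1" using v by simp
  have "G - {v} \<noteq> {}" 
  proof
    assume "G - {v} = {}"
    then have "card (G - {v}) = 0" by (simp only: card.empty)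
    then show False using c G(2) by simp
  qed
  moreover have "homology_manifold TYPE('k) (link \<Delta> {v})" using iso vD by (auto simp: vertices_def)
  ultimately have "betti TYPE('k) (link (link \<Delta> {v}) (G - {v})) i
      = (if i = sdim (link \<Delta> {v}) - int (card (G - {v})) then 1 else 0)" for i
    using F by (simp add: homology_manifold_def)
  moreover have "link (link \<Delta> {v}) (G - {v}) = link \<Delta> G"
    unfolding link_link[OF F] using v by (simp add: insert_absorb)
  ultimately show ?thesis
    using sdim_link_vertex[OF vD] c G(2) by (auto simp: spherical_def of_nat_diff)
qed

lemma spherical_of_sphere:
  assumes "homology_sphere TYPE('k::field) (link \<Delta> {v})" "{v} \<in> \<Delta>"
  shows "spherical TYPE('k) \<Delta> d {v}"
  using assms sdim_link_vertex[OF assms(2)] by (auto simp: spherical_def homology_sphere_def)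

end

section \<open>Genericity of independence\<close>

lemma indep_iff_FS:
  assumes "finite T"
  shows "indep n p T \<longleftrightarrow> (\<forall>w\<in>FS T. (\<lambda>i. if i < n then (\<Sum>v\<in>T. w v * p v i) else 0) = 0 \<longrightarrow> w = 0)"
proof
  assume *: "indep n p T"
  show "\<forall>w\<in>FS T. (\<lambda>i. if i < n then (\<Sum>v\<in>T. w v * p v i) else 0) = 0 \<longrightarrow> w = 0"
  proof (intro ballI impI)
    fix w assume w: "w \<in> FS T" "(\<lambda>i. if i < n then (\<Sum>v\<in>T. w v * p v i) else 0) = 0"
    have "(\<Sum>v\<in>T. w v * p v i) = 0" if "i < n" for i using fun_cong[OF w(2), of i] that by simp
    then have "\<forall>v\<in>T. w v = 0" using *[unfolded indep_def, rule_format, of w] by blast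
    then show "w = 0" using w(1) by (auto simp: FS_def fun_eq_iff)
  qed
next
  assume *: "\<forall>w\<in>FS T. (\<lambda>i. if i < n then (\<Sum>v\<in>T. w v * p v i) else 0) = 0 \<longrightarrow> w = 0"
  show "indep n p T"
    unfolding indep_def
  proof (intro allI impI)
    fix c assume c: "\<forall>i<n. (\<Sum>v\<in>T. c v * p v i) = 0"
    let ?w = "\<lambda>v. if v \<in> T then c v else 0"
    have "(\<Sum>v\<in>T. ?w v * p v i) = (\<Sum>v\<in>T. c v * p v i)" for i by (rule sum.cong) auto
    then have 0: "(\<lambda>i. if i < n then (\<Sum>v\<in>T. ?w v * p v i) else 0) = 0" using c by (auto simp: fun_eq_iff)
    have "?w \<in> FS T" by (auto simp: FS_def)
    then have "?w = 0" by (rule *[rule_format, OF _ 0])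
    then show "\<forall>v\<in>T. c v = 0" by (auto simp: fun_eq_iff split: if_splits)
  qed
qed

lemma indep_unit_vectors:
  assumes "finite T" "inj_on f T" "f ` T \<subseteq> {..<n}"
  shows "indep n (\<lambda>v i. if i = f v then 1 else 0 :: 'k::field) T"
  unfolding indep_def
proof (intro allI impI ballI)
  fix c :: "'a \<Rightarrow> 'k" and v
  assume c: "\<forall>i<n. (\<Sum>v\<in>T. c v * (if i = f v then 1 else 0)) = 0" and v: "v \<in> T"
  have "(\<Sum>u\<in>T. c u * (if f v = f u then 1 else 0)) = (\<Sum>u\<in>T. if u = v then c u else 0)"
    using assms(2) v by (intro sum.cong) (auto simp: inj_on_def)
  moreover have "f v < n" using assms(3) v by auto
  ultimately show "c v = 0" using c v assms(1) by auto
qed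

lemma generic_indep:
  fixes T :: "'v set"
  assumes "finite T" "card T \<le> n"
  shows "generic (\<lambda>p :: 'v \<Rightarrow> nat \<Rightarrow> 'k::field. indep n p T)"
proof -
  let ?M = "\<lambda>p :: 'v \<Rightarrow> nat \<Rightarrow> 'k. \<lambda>w i. if i < n then (\<Sum>v\<in>T. w v * p v i) else 0"
  obtain f where f: "bij_betw f T {0..<card T}" using ex_bij_betw_finite_nat[OF assms(1)] by blast
  have "indep n (\<lambda>v i. if i = f v then 1 else 0 :: 'k) T"
    using f assms(2) by (intro indep_unit_vectors assms(1)) (auto simp: bij_betw_def)
  then have "\<exists>p. \<forall>w\<in>FS T. ?M p w = 0 \<longrightarrow> w = 0" 
    unfolding indep_iff_FS[OF assms(1)] by (rule exI[of _ "\<lambda>v i. if i = f v then 1 else 0"])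
  moreover have L: "lin (?M p)" for p
    by (rule linI) (auto simp: fun_eq_iff algebra_simps sum.distrib sum_distrib_left)
  ultimately have "generic (\<lambda>p. \<forall>w\<in>FS T. ?M p w = 0 \<longrightarrow> w = 0)"
    by (intro generic_injective[OF assms(1) L L])
      (auto simp: algebra_simps sum.distrib sum_distrib_left)
  then show ?thesis by (simp only: indep_iff_FS[OF assms(1)])
qed

lemma dot_add: "dot n (\<lambda>j. f j + g j) q = dot n f q + dot n g q"
  and dot_diff: "dot n (\<lambda>j. f j - g j) q = dot n f q - dot n g q"
  and dot_scale: "dot n (\<lambda>j. c * f j) q = c * dot n f q"
  and dot_line: "dot n f (\<lambda>i. p i + t * q i) = dot n f p + t * dot n f q"
  by (auto simp: dot_def algebra_simps sum.distrib sum_subtractf sum_distrib_left)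

lemma dot_zero: "(\<And>j. j < n \<Longrightarrow> f j = 0) \<Longrightarrow> dot n f q = 0"
  by (simp add: dot_def)

section \<open>Rigidity of circuits of triangles\<close>

text \<open>Infinitesimal motions of a graph in projective 3-space: the velocity of the point
  \<open>p u \<in> k\<^sup>4\<close> is a linear functional \<open>m u\<close>, and rigidity means that it comes from one alternating form.\<close>

definition motion :: "'v set \<Rightarrow> ('v \<Rightarrow> 'v \<Rightarrow> bool) \<Rightarrow> ('v \<Rightarrow> nat \<Rightarrow> 'k::field) \<Rightarrow> ('v \<Rightarrow> nat \<Rightarrow> 'k) \<Rightarrow> bool" where
  "motion V E p m \<longleftrightarrow> (\<forall>u\<in>V. dot 4 (m u) (p u) = 0) \<and>
    (\<forall>u\<in>V. \<forall>v\<in>V. E u v \<longrightarrow> dot 4 (m u) (p v) + dot 4 (m v) (p u) = 0)"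

definition rigid :: "'v set \<Rightarrow> ('v \<Rightarrow> 'v \<Rightarrow> bool) \<Rightarrow> ('v \<Rightarrow> nat \<Rightarrow> 'k::field) \<Rightarrow> bool" where
  "rigid V E p \<longleftrightarrow> (\<forall>m. motion V E p m \<longrightarrow> (\<exists>A\<in>FS (pairs 4). \<forall>u\<in>V. \<forall>j<4. m u j = ctr 4 (p u) A j))"

text \<open>Rigidity normalised by fixing the points of \<open>T\<close>. In this form it is the
  injectivity of a linear system that depends linearly on \<open>p\<close>, which is the shape that
  genericity requires.\<close>

definition pinned :: "'v set \<Rightarrow> ('v \<Rightarrow> 'v \<Rightarrow> bool) \<Rightarrow> 'v set \<Rightarrow> ('v \<Rightarrow> nat \<Rightarrow> 'k::field) \<Rightarrow> bool" where
  "pinned V E T p \<longleftrightarrow> (\<forall>m. motion V E p m \<and> (\<forall>v\<in>T. \<forall>j<4. m v j = 0) \<longrightarrow> (\<forall>v\<in>V. \<forall>j<4. m v j = 0))"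

text \<open>On the triangle \<open>T\<close> any motion is induced by a form, by
  \<open>form_exists\<close>; subtracting it leaves a motion that vanishes on \<open>T\<close>.
  Conversely, a form killed by three independent points of \<open>k\<^sup>4\<close> is zero.\<close>

lemma rigid_iff_pinned:
  assumes T: "T \<subseteq> V" "card T = 3" "indep 4 p T" and cl: "\<And>u v. u \<in> T \<Longrightarrow> v \<in> T \<Longrightarrow> u \<noteq> v \<Longrightarrow> E u v"
  shows "rigid V E p \<longleftrightarrow> pinned V E T p"
proof
  have fT: "finite T" using T(2) by (simp add: card_ge_0_finite)
  assume r: "rigid V E p"
  show "pinned V E T p"
    unfolding pinned_def
  proof (intro allI impI)
    fix m assume m: "motion V E p m \<and> (\<forall>v\<in>T. \<forall>j<4. m v j = 0)"
    then obtain A where A: "A \<in> FS (pairs 4)" "\<forall>u\<in>V. \<forall>j<4. m u j = ctr 4 (p u) A j"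
      using r unfolding rigid_def by blast
    have "ctr 4 (p v) A j = 0" if "v \<in> T" "j < 4" for v j
    proof -
      have "m v j = ctr 4 (p v) A j" using A(2) that T(1) by blast
      then show ?thesis using m that by auto
    qed
    then have "A = (\<lambda>_. 0)"
      using A(1) T(2) by (intro form_zero_of_hyperplane[OF fT T(3)]) auto
    then show "\<forall>v\<in>V. \<forall>j<4. m v j = 0" using A(2) by simp
  qed
next
  have fT: "finite T" using T(2) by (simp add: card_ge_0_finite)
  assume r: "pinned V E T p"
  show "rigid V E p"
    unfolding rigid_def
  proof (intro allI impI)
    fix m assume m: "motion V E p m"
    have "\<exists>A\<in>FS (pairs 4). \<forall>u\<in>T. \<forall>j<4. ctr 4 (p u) A j = m u j"
    proof (rule form_exists[OF fT T(3)])
      show self: "dot 4 (m u) (p u) = 0" if "u \<in> T" for u using m that T(1) unfolding motion_def by blast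
      show "dot 4 (m u) (p v) + dot 4 (m v) (p u) = 0" if uv: "u \<in> T" "v \<in> T" for u v
      proof (cases "u = v")
        case True
        then show ?thesis using self[OF uv(1)] by simp
      next
        case False
        then have "E u v" "u \<in> V" "v \<in> V" using cl uv T(1) by auto
        then show ?thesis using m unfolding motion_def by blast
      qed
    qed
    then obtain A where A: "A \<in> FS (pairs 4)" "\<forall>u\<in>T. \<forall>j<4. ctr 4 (p u) A j = m u j" by blast
    define m' where "m' u j = m u j - ctr 4 (p u) A j" for u j
    have d: "dot 4 (m' u) q = dot 4 (m u) q - dot 4 (ctr 4 (p u) A) q" for u q
      unfolding m'_def[abs_def] by (rule dot_diff)
    have "motion V E p m'"
      unfolding motion_def d
    proof (intro conjI ballI impI)
      show "dot 4 (m u) (p u) - dot 4 (ctr 4 (p u) A) (p u) = 0" if "u \<in> V" for u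
        using m that unfolding motion_def dot_ctr_self by simp
      fix u v assume "u \<in> V" "v \<in> V" "E u v"
      then have "dot 4 (m u) (p v) + dot 4 (m v) (p u) = 0" using m unfolding motion_def by blast
      then show "dot 4 (m u) (p v) - dot 4 (ctr 4 (p u) A) (p v)
          + (dot 4 (m v) (p u) - dot 4 (ctr 4 (p v) A) (p u)) = 0"
        unfolding dot_ctr_swap[of 4 "p v" A "p u"] by simp
    qed
    moreover have "\<forall>v\<in>T. \<forall>j<4. m' v j = 0" using A(2) by (simp add: m'_def)
    ultimately have "\<forall>v\<in>V. \<forall>j<4. m' v j = 0" using r unfolding pinned_def by blast
    then show "\<exists>A\<in>FS (pairs 4). \<forall>u\<in>V. \<forall>j<4. m u j = ctr 4 (p u) A j"
      using A(1) by (intro bexI[of _ A]) (auto simp: m'_def)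
  qed
qed

lemma generic_pinned:
  fixes V :: "'v set"
  assumes "finite V" "\<exists>p :: 'v \<Rightarrow> nat \<Rightarrow> 'k::field. pinned V E T p"
  shows "generic (\<lambda>p :: 'v \<Rightarrow> nat \<Rightarrow> 'k. pinned V E T p)"
proof -
  define X where "X = (V - T) \<times> {..<4::nat}"
  define M where "M p w y = (case y of
      Inl u \<Rightarrow> if u \<in> V then dot 4 (\<lambda>j. w (u, j)) (p u) else 0
    | Inr (u, v) \<Rightarrow> if u \<in> V \<and> v \<in> V \<and> E u v
        then dot 4 (\<lambda>j. w (u, j)) (p v) + dot 4 (\<lambda>j. w (v, j)) (p u) else 0)"
    for p :: "'v \<Rightarrow> nat \<Rightarrow> 'k" and w :: "'v \<times> nat \<Rightarrow> 'k" and y :: "'v + 'v \<times> 'v"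
  have eq: "pinned V E T p \<longleftrightarrow> (\<forall>w\<in>FS X. M p w = 0 \<longrightarrow> w = 0)" for p
  proof
    assume pin: "pinned V E T p"
    show "\<forall>w\<in>FS X. M p w = 0 \<longrightarrow> w = 0"
    proof (intro ballI impI)
      fix w assume w: "w \<in> FS X" "M p w = 0"
      have "motion V E p (\<lambda>u j. w (u, j))"
        unfolding motion_def
      proof (intro conjI ballI impI)
        show "dot 4 (\<lambda>j. w (u, j)) (p u) = 0" if "u \<in> V" for u
          using fun_cong[OF w(2), of "Inl u"] that by (simp add: M_def)
        show "dot 4 (\<lambda>j. w (u, j)) (p v) + dot 4 (\<lambda>j. w (v, j)) (p u) = 0"
          if "u \<in> V" "v \<in> V" "E u v" for u v
          using fun_cong[OF w(2), of "Inr (u, v)"] that by (simp add: M_def)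
      qed
      moreover have "\<forall>v\<in>T. \<forall>j<4. w (v, j) = 0" using w(1) by (auto simp: FS_def X_def)
      ultimately have "\<forall>v\<in>V. \<forall>j<4. w (v, j) = 0" using pin unfolding pinned_def by blast
      then show "w = 0" using w(1) by (auto simp: FS_def X_def fun_eq_iff)
    qed
  next
    assume inj: "\<forall>w\<in>FS X. M p w = 0 \<longrightarrow> w = 0"
    show "pinned V E T p"
      unfolding pinned_def
    proof (intro allI impI)
      fix m assume m: "motion V E p m \<and> (\<forall>v\<in>T. \<forall>j<4. m v j = 0)"
      let ?w = "\<lambda>x. if x \<in> X then m (fst x) (snd x) else 0"
      have d: "dot 4 (\<lambda>j. ?w (u, j)) q = dot 4 (m u) q" if "u \<in> V" for u q
        unfolding dot_def using m that by (intro sum.cong) (auto simp: X_def)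
      have 0: "M p ?w = 0"
      proof
        fix y show "M p ?w y = 0 y"
          using m by (cases y) (auto simp: M_def d motion_def)
      qed
      have "?w \<in> FS X" by (auto simp: FS_def)
      then have "?w = 0" by (rule inj[rule_format, OF _ 0])
      then have "m v j = 0" if "v \<in> V" "j < 4" for v j
        using fun_cong[OF \<open>?w = 0\<close>, of "(v, j)"] that m by (auto simp: X_def split: if_splits)
      then show "\<forall>v\<in>V. \<forall>j<4. m v j = 0" by blast
    qed
  qed
  have L: "lin (M p)" for p
    by (rule linI) (auto simp: M_def fun_eq_iff dot_add dot_scale algebra_simps split: sum.split)
  have "generic (\<lambda>p. \<forall>w\<in>FS X. M p w = 0 \<longrightarrow> w = 0)"
  proof (rule generic_injective[OF _ L L])
    show "finite X" using assms(1) by (simp add: X_def)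
    show "M (\<lambda>v i. p v i + t * q v i) w y = M p w y + t * M q w y" for p q t w y
      by (auto simp: M_def dot_line algebra_simps split: sum.split)
    show "\<exists>p. \<forall>w\<in>FS X. M p w = 0 \<longrightarrow> w = 0" using assms(2) unfolding eq .
  qed
  then show ?thesis by (simp only: eq)
qed

section \<open>Cycles of triangles modulo 2 and contraction of an edge\<close>

definition deg :: "'v set set \<Rightarrow> 'v set \<Rightarrow> nat" where
  "deg S e = card {T \<in> S. e \<subseteq> T}"

text \<open>Coefficients modulo 2 are used whatever the field is: such a cycle is a mere set of
  triangles, and contraction acts on it without signs.\<close>

definition z2cycle :: "'v set set \<Rightarrow> bool" where
  "z2cycle S \<longleftrightarrow> finite S \<and> (\<forall>T\<in>S. card T = 3) \<and> (\<forall>e. card e = 2 \<longrightarrow> even (deg S e))"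

definition circuit :: "'v set set \<Rightarrow> bool" where
  "circuit S \<longleftrightarrow> z2cycle S \<and> S \<noteq> {} \<and> (\<forall>Q\<subseteq>S. z2cycle Q \<longrightarrow> Q = {} \<or> Q = S)"

definition adj :: "'v set set \<Rightarrow> 'v \<Rightarrow> 'v \<Rightarrow> bool" where
  "adj S u v \<longleftrightarrow> u \<noteq> v \<and> (\<exists>T\<in>S. u \<in> T \<and> v \<in> T)"

lemma deg_Un_disjoint:
  "finite P \<Longrightarrow> finite Q \<Longrightarrow> P \<inter> Q = {} \<Longrightarrow> deg (P \<union> Q) e = deg P e + deg Q e"
proof -
  assume "finite P" "finite Q" "P \<inter> Q = {}"
  then have "card ({T \<in> P. e \<subseteq> T} \<union> {T \<in> Q. e \<subseteq> T}) = card {T \<in> P. e \<subseteq> T} + card {T \<in> Q. e \<subseteq> T}"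
    by (intro card_Un_disjoint) auto
  moreover have "{T \<in> P \<union> Q. e \<subseteq> T} = {T \<in> P. e \<subseteq> T} \<union> {T \<in> Q. e \<subseteq> T}" by auto
  ultimately show ?thesis by (simp add: deg_def)
qed

lemma deg_Union:
  assumes "finite \<P>" "\<And>P. P \<in> \<P> \<Longrightarrow> finite P" "disjoint \<P>"
  shows "deg (\<Union>\<P>) e = (\<Sum>P\<in>\<P>. deg P e)"
  using assms
proof (induction \<P>)
  case (insert P \<P>)
  have "disjoint \<P>" using insert.prems(2) by (simp add: pairwise_insert)
  moreover have "P \<inter> \<Union>\<P> = {}"
    using insert.prems(2) insert.hyps(2) by (auto simp: pairwise_insert disjnt_def) 
  ultimately show ?case
    using insert by (simp add: deg_Un_disjoint)
qed (simp add: deg_def)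

lemma deg_pos: "finite S \<Longrightarrow> odd (deg S e) \<Longrightarrow> \<exists>T\<in>S. e \<subseteq> T"
  unfolding deg_def using card.empty odd_card_imp_not_empty by blast

lemma z2cycleD:
  "z2cycle S \<Longrightarrow> finite S" "z2cycle S \<Longrightarrow> T \<in> S \<Longrightarrow> card T = 3" "z2cycle S \<Longrightarrow> T \<in> S \<Longrightarrow> finite T"
  "z2cycle S \<Longrightarrow> card e = 2 \<Longrightarrow> even (deg S e)"
  by (auto simp: z2cycle_def intro: card_ge_0_finite)

lemma finite_Union_z2cycle: "z2cycle S \<Longrightarrow> finite (\<Union>S)"
  using z2cycleD by (metis finite_Union)

locale contraction =
  fixes S :: "'v set set" and x y :: 'v
  assumes circ: "circuit S" and xy: "adj S x y"
begin

lemma z: "z2cycle S" using circ by (simp add: circuit_def)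

lemma neq: "x \<noteq> y" using xy by (simp add: adj_def)

definition S0 where "S0 = {T \<in> S. \<not> {x, y} \<subseteq> T}"

text \<open>\<open>st Q\<close> says that the image of \<open>Q\<close> under the contraction of \<open>x\<close> to \<open>y\<close> is a cycle modulo 2,
  triangles of the image being counted with multiplicity.\<close>

definition st :: "'v set set \<Rightarrow> bool" where
  "st Q \<longleftrightarrow> (\<forall>e. card e = 2 \<and> x \<notin> e \<and> y \<notin> e \<longrightarrow> even (deg Q e)) \<and>
    (\<forall>w. w \<noteq> x \<and> w \<noteq> y \<longrightarrow> (even (deg Q {x, w}) \<longleftrightarrow> even (deg Q {y, w})))"

lemma finS: "finite S" "finite S0" "finite (\<Union>S)" "S0 \<subseteq> S"
  using z2cycleD(1)[OF z] finite_Union_z2cycle[OF z] by (auto simp: S0_def)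

lemma fin_sub: "Q \<subseteq> S0 \<Longrightarrow> finite Q"
  using finS(2) finite_subset by blast

lemma tri: "T \<in> S \<Longrightarrow> card T = 3" "T \<in> S \<Longrightarrow> finite T"
  using z2cycleD[OF z] by auto

lemma xy_triangle: "{T \<in> S. {x, y} \<subseteq> T \<and> w \<in> T} = (if {x, y, w} \<in> S then {{x, y, w}} else {})"
  if "w \<noteq> x" "w \<noteq> y"
proof -
  have "T = {x, y, w}" if T: "T \<in> S" "{x, y} \<subseteq> T" "w \<in> T" for T
  proof (rule sym, rule card_subset_eq)
    show "finite T" using tri T by auto
    show "{x, y, w} \<subseteq> T" using T by auto
    show "card {x, y, w} = card T" using tri(1)[OF T(1)] neq \<open>w \<noteq> x\<close> \<open>w \<noteq> y\<close> by auto
  qed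
  then have sub: "{T \<in> S. {x, y} \<subseteq> T \<and> w \<in> T} \<subseteq> {{x, y, w}} \<inter> S" by blast
  show ?thesis
  proof (cases "{x, y, w} \<in> S")
    case True
    then have "{x, y, w} \<in> {T \<in> S. {x, y} \<subseteq> T \<and> w \<in> T}" by simp
    then show ?thesis using sub True by (subst if_P) blast+
  next
    case False
    then show ?thesis using sub by (subst if_not_P) blast+
  qed
qed

text \<open>The triangles lost in passing to \<open>S0\<close> contain both \<open>x\<close> and
  \<open>y\<close>. At most one of them contains \<open>w\<close>, and it counts once at
  \<open>{x, w}\<close> and once at \<open>{y, w}\<close>; so both degrees drop by the same amount,
  and the image of \<open>S0\<close> is a cycle.\<close>

lemma deg_S0_x:
  assumes "w \<noteq> x" "w \<noteq> y" "a = x \<or> a = y"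
  shows "deg S {a, w} = deg S0 {a, w} + (if {x, y, w} \<in> S then 1 else 0)"
proof -
  have "{T \<in> S. {a, w} \<subseteq> T} = {T \<in> S0. {a, w} \<subseteq> T} \<union> {T \<in> S. {x, y} \<subseteq> T \<and> w \<in> T}"
    using assms(3) by (auto simp: S0_def)
  moreover have "card ({T \<in> S0. {a, w} \<subseteq> T} \<union> {T \<in> S. {x, y} \<subseteq> T \<and> w \<in> T})
      = card {T \<in> S0. {a, w} \<subseteq> T} + card {T \<in> S. {x, y} \<subseteq> T \<and> w \<in> T}"
    using finS by (intro card_Un_disjoint) (auto simp: S0_def)
  ultimately show ?thesis unfolding deg_def xy_triangle[OF assms(1,2)] by simp
qed

lemma deg_S0_other:
  assumes "card e = 2" "x \<notin> e" "y \<notin> e" shows "deg S0 e = deg S e"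
proof -
  have "\<not> {x, y} \<subseteq> T" if "T \<in> S" "e \<subseteq> T" for T
  proof
    assume "{x, y} \<subseteq> T"
    then have "{x, y} \<union> e \<subseteq> T" using that by auto
    then have "card ({x, y} \<union> e) \<le> 3" using tri[OF that(1)] card_mono by metis
    moreover have "card ({x, y} \<union> e) = 4"
      using assms neq by (subst card_Un_disjoint) (auto intro: card_ge_0_finite)
    ultimately show False by simp
  qed
  then have "{T \<in> S0. e \<subseteq> T} = {T \<in> S. e \<subseteq> T}" by (auto simp: S0_def)
  then show ?thesis by (simp add: deg_def)
qed

lemma st_S0: "st S0"
  unfolding st_def
proof (intro conjI allI impI; elim conjE)
  show "even (deg S0 e)" if "card e = 2" "x \<notin> e" "y \<notin> e" for e
    using z2cycleD(4)[OF z that(1)] deg_S0_other[OF that] by simp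
  fix w assume w: "w \<noteq> x" "w \<noteq> y"
  have "even (deg S {x, w})" "even (deg S {y, w})" using w by (auto intro!: z2cycleD(4)[OF z])
  then show "even (deg S0 {x, w}) \<longleftrightarrow> even (deg S0 {y, w})"
    using deg_S0_x[OF w, of x] deg_S0_x[OF w, of y] by auto
qed

lemma deg_diff:
  assumes "Q \<subseteq> R" "R \<subseteq> S0" shows "deg R e = deg Q e + deg (R - Q) e"
  using deg_Un_disjoint[of Q "R - Q" e] assms fin_sub[of R] fin_sub[of Q]
  by (simp add: Un_absorb1)

lemma st_diff: assumes "st Q" "st R" "Q \<subseteq> R" "R \<subseteq> S0" shows "st (R - Q)"
  using assms(1,2) unfolding st_def deg_diff[OF assms(3,4)] by auto

lemma st_Union:
  assumes "finite \<P>" "\<And>P. P \<in> \<P> \<Longrightarrow> finite P \<and> st P" "disjoint \<P>" shows "st (\<Union>\<P>)"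
proof -
  have *: "even (deg (\<Union>\<P>) e) \<longleftrightarrow> even (card {P \<in> \<P>. odd (deg P e)})" for e
  proof -
    have "deg (\<Union>\<P>) e = (\<Sum>P\<in>\<P>. deg P e)" using assms by (intro deg_Union) auto
    then show ?thesis by (simp only: even_sum_iff[OF assms(1)])
  qed
  have 1: "even (card {P \<in> \<P>. odd (deg P e)})" if "card e = 2" "x \<notin> e" "y \<notin> e" for e
  proof -
    have "{P \<in> \<P>. odd (deg P e)} = {}" using assms(2) that by (auto simp: st_def)
    then show ?thesis by (simp only: card.empty dvd_0_right)
  qed
  have 2: "{P \<in> \<P>. odd (deg P {x, w})} = {P \<in> \<P>. odd (deg P {y, w})}" if "w \<noteq> x" "w \<noteq> y" for w
    using assms(2) that by (auto simp: st_def)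
  show ?thesis unfolding st_def * using 1 2 by (intro conjI allI impI) simp_all
qed

definition piece :: "'v set set \<Rightarrow> bool" where
  "piece Q \<longleftrightarrow> Q \<subseteq> S0 \<and> Q \<noteq> {} \<and> st Q \<and> (\<forall>R\<subseteq>Q. R \<noteq> {} \<longrightarrow> st R \<longrightarrow> R = Q)"

text \<open>Splitting off a minimal nonempty set with cyclic image leaves a set with cyclic image,
  by \<open>st_diff\<close>. The decomposition is needed because the image of a circuit under
  contraction need not be a circuit.\<close>

lemma pieces:
  assumes "R \<subseteq> S0" "st R"
  shows "\<exists>\<P>. finite \<P> \<and> \<Union>\<P> = R \<and> disjoint \<P> \<and> (\<forall>P\<in>\<P>. piece P)"
  using assms
proof (induction "card R" arbitrary: R rule: less_induct)
  case less
  show ?case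
  proof (cases "R = {}")
    case True
    then show ?thesis by (intro exI[of _ "{}"]) auto
  next
    case False
    have finR: "finite R" using fin_sub[OF less.prems(1)] .
    define A where "A = {Q. Q \<subseteq> R \<and> Q \<noteq> {} \<and> st Q}"
    have fA: "finite A" using finR by (simp add: A_def)
    have RA: "R \<in> A" using less.prems False by (simp add: A_def)
    obtain Q where QA: "Q \<in> A" "\<forall>P\<in>A. P \<subseteq> Q \<longrightarrow> Q = P"
      using finite_has_minimal2[OF fA RA] by blast
    have Q: "Q \<subseteq> R" "Q \<noteq> {}" "st Q" using QA(1) by (auto simp: A_def)
    have pQ: "piece Q"
      unfolding piece_def
    proof (intro conjI allI impI)
      show "Q \<subseteq> S0" using Q(1) less.prems(1) by (rule order_trans)
      show "P = Q" if "P \<subseteq> Q" "P \<noteq> {}" "st P" for P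
        using QA(2) that Q(1) by (auto simp: A_def)
    qed (use Q in auto)
    have "card (R - Q) < card R" using Q finR by (intro psubset_card_mono) auto
    moreover have "R - Q \<subseteq> S0" "st (R - Q)"
      using less.prems(1) st_diff[OF Q(3) less.prems(2) Q(1) less.prems(1)] by auto
    ultimately obtain \<P> where P: "finite \<P>" "\<Union>\<P> = R - Q" "disjoint \<P>" "\<forall>P\<in>\<P>. piece P"
      using less.hyps[of "R - Q"] by blast
    have "disjoint (insert Q \<P>)" using P(2,3) by (auto simp: pairwise_insert disjnt_def)
    then show ?thesis using P pQ Q by (intro exI[of _ "insert Q \<P>"]) auto
  qed
qed

text \<open>A triangle of \<open>S0\<close> through \<open>x\<close> avoids \<open>y\<close>, so it
  contributes exactly two edges \<open>{x, w}\<close> with \<open>w\<close> different from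
  \<open>y\<close>. The sum of the degrees is even, hence an even number of them is odd.\<close>

lemma handshake:
  assumes "Q \<subseteq> S0" shows "even (card {w \<in> \<Union>S - {x, y}. odd (deg Q {x, w})})"
proof -
  let ?W = "\<Union>S - {x, y}"
  have fW: "finite ?W" using finS by simp
  have fQ: "finite Q" using fin_sub[OF assms] .
  have "(\<Sum>w\<in>?W. deg Q {x, w}) = (\<Sum>w\<in>?W. \<Sum>T\<in>Q. if {x, w} \<subseteq> T then 1 else 0)"
    unfolding deg_def using fQ by (simp add: sum.If_cases Int_def)
  also have "\<dots> = (\<Sum>T\<in>Q. \<Sum>w\<in>?W. if {x, w} \<subseteq> T then 1 else 0)" by (rule sum.swap)
  also have "even \<dots>"
  proof (rule dvd_sum)
    fix T assume T: "T \<in> Q"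
    then have TS: "T \<in> S" "\<not> {x, y} \<subseteq> T" using assms by (auto simp: S0_def)
    have "(\<Sum>w\<in>?W. if {x, w} \<subseteq> T then 1 else 0) = card {w \<in> ?W. {x, w} \<subseteq> T}"
      using fW by (simp add: sum.If_cases Int_def)
    also have "\<dots> = (if x \<in> T then 2 else 0)"
    proof (cases "x \<in> T")
      case True
      then have "{w \<in> ?W. {x, w} \<subseteq> T} = T - {x}" using TS by auto
      then show ?thesis using True tri[OF TS(1)] by simp
    next
      case False
      then have "{w \<in> ?W. {x, w} \<subseteq> T} = {}" by auto
      then show ?thesis using False by (simp only: card.empty if_False)
    qed
    finally show "2 dvd (\<Sum>w\<in>?W. if {x, w} \<subseteq> T then 1 else 0 :: nat)" by (simp only: dvd_refl dvd_0_right split: if_split) simp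
  qed
  finally show ?thesis unfolding even_sum_iff[OF fW] .
qed

text \<open>The triangles \<open>{x, y, w}\<close> with \<open>deg Q {x, w}\<close> odd undo the
  contraction. Each repairs the parity at \<open>{x, w}\<close> and, since the image of
  \<open>Q\<close> is a cycle, also at \<open>{y, w}\<close>; the edge \<open>{x, y}\<close> is
  settled by \<open>handshake\<close>. The added triangles need not belong to
  \<open>S\<close>.\<close>

lemma completion_cycle:
  assumes Q: "Q \<subseteq> S0" "st Q" and W: "W = {w \<in> \<Union>S - {x, y}. odd (deg Q {x, w})}"
  shows "z2cycle (Q \<union> (\<lambda>w. {x, y, w}) ` W)"
proof -
  let ?D = "(\<lambda>w. {x, y, w}) ` W"
  have fW: "finite W" by (rule finite_subset[OF _ finS(3)]) (auto simp: W)
  have fQ: "finite Q" using fin_sub[OF Q(1)] .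
  have Wn: "w \<noteq> x" "w \<noteq> y" if "w \<in> W" for w using that by (auto simp: W)
  have disj: "Q \<inter> ?D = {}" using Q(1) by (auto simp: S0_def)
  have "inj_on (\<lambda>w. {x, y, w}) W" by (rule inj_onI) (use Wn in blast)
  then have cD: "card ?D = card W" by (rule card_image)
  have "even (deg (Q \<union> ?D) e)" if e: "card e = 2" for e
  proof -
    have deg: "deg (Q \<union> ?D) e = deg Q e + deg ?D e" using disj fQ fW by (intro deg_Un_disjoint) auto
    obtain a b where ab: "e = {a, b}" "a \<noteq> b" using e by (auto simp: card_2_iff)
    have main: "even (deg (Q \<union> ?D) {c, w})" if c: "c = x \<or> c = y" "w \<noteq> x" "w \<noteq> y" "e = {c, w}" for c w
    proof -
      have "{T \<in> ?D. {c, w} \<subseteq> T} = (if w \<in> W then {{x, y, w}} else {})" using c by auto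
      then have "deg ?D {c, w} = (if w \<in> W then 1 else 0)" by (simp add: deg_def)
      moreover have "w \<in> W \<longleftrightarrow> odd (deg Q {x, w})"
      proof
        assume "odd (deg Q {x, w})"
        then have "w \<in> \<Union>S" using deg_pos[OF fQ] Q(1) finS(4) by blast
        then show "w \<in> W" using c \<open>odd (deg Q {x, w})\<close> by (simp add: W)
      qed (simp add: W)
      moreover have "even (deg Q {x, w}) \<longleftrightarrow> even (deg Q {c, w})" using Q(2) c by (auto simp: st_def)
      ultimately show ?thesis using deg c(4) by auto
    qed
    consider "e = {x, y}" | "x \<notin> e" "y \<notin> e" | c w where "c = x \<or> c = y" "w \<noteq> x" "w \<noteq> y" "e = {c, w}"
      using ab by (metis doubleton_eq_iff insertE singletonD)
    then show ?thesis
    proof cases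
      case 1
      have "{T \<in> Q. e \<subseteq> T} = {}" using 1 Q(1) by (auto simp: S0_def)
      then have "deg Q e = 0" by (simp only: deg_def card.empty)
      moreover have "{T \<in> ?D. e \<subseteq> T} = ?D" using 1 by auto
      then have "deg ?D e = card W" by (simp only: deg_def cD)
      moreover have "even (card W)" unfolding W by (rule handshake[OF Q(1)])
      ultimately show ?thesis unfolding deg by simp
    next
      case 2
      have "{T \<in> ?D. e \<subseteq> T} = {}" using 2 ab by auto
      then have "deg ?D e = 0" by (simp only: deg_def card.empty)
      moreover have "even (deg Q e)" using Q(2) 2 e by (auto simp: st_def)
      ultimately show ?thesis unfolding deg by simp
    next
      case 3
      then show ?thesis using main by blast
    qed
  qed
  moreover have "card {x, y, w} = 3" if "w \<in> W" for w
    using Wn[OF that] neq by auto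
  then have "card T = 3" if "T \<in> Q \<union> ?D" for T
    using that Q(1) finS(4) tri(1) by blast
  ultimately show ?thesis using fQ fW by (simp add: z2cycle_def)
qed

lemma S0_neq_S: "S0 \<noteq> S"
  using xy by (auto simp: adj_def S0_def)

text \<open>By minimality of \<open>S\<close>, completing a proper nonempty part of the
  decomposition must use a triangle \<open>{x, y, w}\<close> outside \<open>S\<close>. Then no
  triangle at \<open>{x, w}\<close> was lost in \<open>S0\<close>, so the even degree of that edge
  in \<open>S\<close> is a sum of two odd degrees, one from each part.\<close>

lemma exchange:
  assumes P: "finite \<P>" "\<Union>\<P> = S0" "disjoint \<P>" "\<forall>P\<in>\<P>. piece P"
    and J: "J \<subseteq> \<P>" "J \<noteq> {}" "J \<noteq> \<P>"
  shows "\<exists>w P P'. P \<in> J \<and> P' \<in> \<P> - J \<and> w \<noteq> x \<and> w \<noteq> y \<and> odd (deg P {x, w}) \<and> odd (deg P' {x, w})"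
proof -
  have fP: "finite P \<and> st P" if "P \<in> \<P>" for P using P(4) that fin_sub by (auto simp: piece_def)
  let ?R = "\<Union>J" and ?R' = "\<Union>(\<P> - J)"
  have finJ: "finite J" "finite (\<P> - J)" using J(1) P(1) finite_subset by auto
  have dJ: "disjoint J" "disjoint (\<P> - J)" 
    using pairwise_subset[OF P(3) J(1)] pairwise_subset[OF P(3) Diff_subset] by auto
  have R: "?R \<subseteq> S0" "st ?R" using J(1) P(2) st_Union[OF finJ(1) _ dJ(1)] fP by auto
  have SR: "deg S0 e = deg ?R e + deg ?R' e" for e
  proof -
    have "?R \<inter> ?R' = {}" using P(3) J(1) by (fastforce simp: pairwise_def disjnt_def)
    moreover have "J \<union> (\<P> - J) = \<P>" using J(1) by blast
    then have "?R \<union> ?R' = S0" using P(2) by (metis Union_Un_distrib)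
    ultimately show ?thesis using deg_Un_disjoint[of ?R ?R' e] finS(2) by (metis finite_Un)
  qed
  define W where "W = {w \<in> \<Union>S - {x, y}. odd (deg ?R {x, w})}"
  have "\<exists>w\<in>W. {x, y, w} \<notin> S"
  proof (rule ccontr)
    assume "\<not> ?thesis"
    then have sub: "?R \<union> (\<lambda>w. {x, y, w}) ` W \<subseteq> S" using R(1) finS(4) by auto
    obtain P where PJ: "P \<in> J" using J(2) by blast
    then have "P \<in> \<P>" using J(1) by blast
    then have "P \<noteq> {}" using P(4) by (simp add: piece_def)
    then have "?R \<noteq> {}" using PJ by blast
    then have eq: "?R \<union> (\<lambda>w. {x, y, w}) ` W = S"
      using completion_cycle[OF R W_def] sub circ unfolding circuit_def by blast
    have "S0 \<subseteq> ?R" using eq by (auto simp: S0_def)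
    moreover obtain P' where P': "P' \<in> \<P>" "P' \<notin> J" using J by blast
    moreover have "P' \<noteq> {}" using P(4) P'(1) by (simp add: piece_def)
    then obtain T where T: "T \<in> P'" by blast
    ultimately obtain P'' where P'': "P'' \<in> J" "T \<in> P''" using P(2) by blast
    then have "P'' \<in> \<P>" "P'' \<noteq> P'" using J(1) P'(2) by auto
    then have "disjnt P'' P'" using P(3) P'(1) by (auto simp: pairwise_def)
    then show False using T P''(2) by (auto simp: disjnt_def)
  qed
  then obtain w where w: "w \<in> W" "{x, y, w} \<notin> S" by blast
  then have wn: "w \<noteq> x" "w \<noteq> y" by (auto simp: W_def)
  have "even (deg S {x, w})" using wn by (intro z2cycleD(4)[OF z]) auto
  then have "even (deg S0 {x, w})" using deg_S0_x[OF wn, of x] w by simp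
  then have odd': "odd (deg ?R {x, w})" "odd (deg ?R' {x, w})" using w SR[of "{x, w}"] by (auto simp: W_def)
  have ex: "\<exists>P\<in>K. odd (deg P {x, w})" if "K \<subseteq> \<P>" "finite K" "disjoint K" "odd (deg (\<Union>K) {x, w})" for K
  proof (rule ccontr)
    assume "\<not> ?thesis"
    then have "even (\<Sum>P\<in>K. deg P {x, w})" by (intro dvd_sum) auto
    moreover have "deg (\<Union>K) {x, w} = (\<Sum>P\<in>K. deg P {x, w})" using that fP by (intro deg_Union) auto
    ultimately show False using that(4) by simp
  qed
  show ?thesis using ex[OF J(1) finJ(1) dJ(1) odd'(1)] ex[OF _ finJ(2) dJ(2) odd'(2)] wn by blast
qed

end

section \<open>Splitting a vertex\<close>

lemma indep_reindex:
  assumes "inj_on g T" "indep n p (g ` T)" shows "indep n (\<lambda>v. p (g v)) T"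
  unfolding indep_def
proof (intro allI impI ballI)
  fix c v assume c: "\<forall>i<n. (\<Sum>v\<in>T. c v * p (g v) i) = 0" and v: "v \<in> T"
  let ?c = "\<lambda>u. c (the_inv_into T g u)"
  have "(\<Sum>u\<in>g ` T. ?c u * p u i) = (\<Sum>v\<in>T. c v * p (g v) i)" for i
    unfolding sum.reindex[OF assms(1)] o_def by (intro sum.cong refl) (simp add: the_inv_into_f_f[OF assms(1)])
  then have "\<forall>i<n. (\<Sum>u\<in>g ` T. ?c u * p u i) = 0" using c by simp
  moreover have "(\<forall>i<n. (\<Sum>u\<in>g ` T. ?c u * p u i) = 0) \<longrightarrow> (\<forall>u\<in>g ` T. ?c u = 0)"
    by (rule spec[OF assms(2)[unfolded indep_def]])
  ultimately have "\<forall>u\<in>g ` T. ?c u = 0" by blast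
  then show "c v = 0" using v by (auto simp: the_inv_into_f_f[OF assms(1)])
qed

text \<open>Vertex splitting in the sense of Whiteley. The point of \<open>x\<close> starts at that
  of \<open>y\<close> and moves along a direction \<open>q\<close>. At \<open>t = 0\<close> the
  equation of the edge \<open>xy\<close> carries no new information, so it is replaced by its
  quotient by \<open>t\<close>, which equates the values of the two velocities at \<open>q\<close>.
  With the two common neighbours this forces the velocities of \<open>x\<close> and \<open>y\<close>
  to agree at \<open>t = 0\<close>, and the contracted graph finishes the argument there.
  Injectivity then persists for almost all \<open>t\<close>.\<close>

lemma vertex_split:
  fixes p' :: "'v \<Rightarrow> nat \<Rightarrow> 'k::field" and x y :: 'v
  defines "g \<equiv> \<lambda>v. if v = x then y else v"
  assumes inf: "infinite (UNIV :: 'k set)"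
    and V: "finite V'" "x \<notin> V'" "y \<in> V'" "V = insert x V'"
    and T: "T \<subseteq> V" "x \<in> T \<Longrightarrow> y \<notin> T"
    and pin: "pinned V' E' (g ` T) p'" and ind: "indep 4 p' (g ` T)"
    and Exy: "E x y"
    and zz: "z1 \<in> V'" "z2 \<in> V'" "E x z1" "E y z1" "E x z2" "E y z2"
      "card {y, z1, z2} = 3" "indep 4 p' {y, z1, z2}"
    and E': "\<And>u v. u \<in> V' \<Longrightarrow> v \<in> V' \<Longrightarrow> E' u v \<Longrightarrow> E u v \<or> (u = y \<and> E x v) \<or> (v = y \<and> E u x)"
  shows "\<exists>p. indep 4 p T \<and> pinned V E T (p :: 'v \<Rightarrow> nat \<Rightarrow> 'k)"
proof -
  have neq: "x \<noteq> y" "z1 \<noteq> x" "z2 \<noteq> x" using V zz by auto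
  have zy: "z1 \<noteq> y" "z2 \<noteq> y" using zz(7) by (auto simp: card_insert_if split: if_splits)
  have finT: "finite T" using T(1) V finite_subset by auto
  have injg: "inj_on g T" using T(2) by (auto simp: inj_on_def g_def)
  \<comment> \<open>Any vector that completes the points of \<open>y\<close>, \<open>z1\<close> and
    \<open>z2\<close> to a basis will do.\<close>
  obtain q where q: "\<And>f i. \<lbrakk>\<And>v. v \<in> {y, z1, z2} \<Longrightarrow> dot 4 f (p' v) = 0; dot 4 f q = 0; i < 4\<rbrakk> \<Longrightarrow> f i = 0"
    using indep_extend1[of "{y, z1, z2}" 4 p'] zz(7,8) by (metis finite.emptyI finite.insertI numeral_3_eq_3 eval_nat_numeral(2) semiring_norm(26) semiring_norm(27))
  define p0 where "p0 v = p' (g v)" for v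
  define qq where "qq v i = (if v = x then q i else 0)" for v i
  define X where "X = (V - T) \<times> {..<4::nat}"
  define ok where "ok u v \<longleftrightarrow> u \<in> V \<and> v \<in> V \<and> E u v \<and> \<not> (u = x \<and> v = y) \<and> \<not> (u = y \<and> v = x)" for u v
  \<comment> \<open>The limit system. Its row \<open>(x, y)\<close> is the edge equation after
    division by \<open>t\<close>; that quotient is constant in \<open>t\<close>, so
    \<open>M1\<close> has no such row, and \<open>ok\<close> leaves out the edge in both
    directions.\<close>
  define M0 where "M0 w s = (case s of
      Inl u \<Rightarrow> if u \<in> V then dot 4 (\<lambda>j. w (u, j)) (p0 u) else 0
    | Inr (u, v) \<Rightarrow> if ok u v then dot 4 (\<lambda>j. w (u, j)) (p0 v) + dot 4 (\<lambda>j. w (v, j)) (p0 u)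
        else if u = x \<and> v = y then dot 4 (\<lambda>j. w (x, j)) q - dot 4 (\<lambda>j. w (y, j)) q else 0)"
    for w :: "'v \<times> nat \<Rightarrow> 'k" and s :: "'v + 'v \<times> 'v"
  define M1 where "M1 w s = (case s of
      Inl u \<Rightarrow> if u \<in> V then dot 4 (\<lambda>j. w (u, j)) (qq u) else 0
    | Inr (u, v) \<Rightarrow> if ok u v then dot 4 (\<lambda>j. w (u, j)) (qq v) + dot 4 (\<lambda>j. w (v, j)) (qq u) else 0)"
    for w :: "'v \<times> nat \<Rightarrow> 'k" and s :: "'v + 'v \<times> 'v"
  have lin: "lin M0" "lin M1"
    by (rule linI; auto simp: M0_def M1_def fun_eq_iff dot_add dot_scale algebra_simps split: sum.split)+
  have inj: "w = 0" if w: "w \<in> FS X" "M0 w = 0" for w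
  proof -
    define m where "m u j = w (u, j)" for u j
    have self: "dot 4 (m u) (p0 u) = 0" if "u \<in> V" for u
      using fun_cong[OF w(2), of "Inl u"] that by (simp add: M0_def m_def[abs_def])
    have edge: "dot 4 (m u) (p0 v) + dot 4 (m v) (p0 u) = 0" if "ok u v" for u v
      using fun_cong[OF w(2), of "Inr (u, v)"] that by (simp add: M0_def m_def[abs_def])
    have "\<not> ok x y" by (simp add: ok_def)
    then have xq: "dot 4 (m x) q - dot 4 (m y) q = 0"
      using fun_cong[OF w(2), of "Inr (x, y)"] by (simp add: M0_def m_def[abs_def])
    have p0: "p0 x = p' y" "\<And>v. v \<in> V' \<Longrightarrow> p0 v = p' v" using V by (auto simp: p0_def g_def)
    have zok: "dot 4 (m x) (p' z) - dot 4 (m y) (p' z) = 0" if "z \<in> V'" "E x z" "E y z" "z \<noteq> x" "z \<noteq> y" for z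
    proof -
      have "dot 4 (m x) (p' z) + dot 4 (m z) (p' y) = 0"
        using edge[of x z] that V p0 by (simp add: ok_def)
      moreover have "dot 4 (m y) (p' z) + dot 4 (m z) (p' y) = 0"
        using edge[of y z] that V p0 neq by (simp add: ok_def)
      ultimately show ?thesis by (simp add: eq_neg_iff_add_eq_0[symmetric])
    qed
    have mxy: "m x j = m y j" if "j < 4" for j
    proof -
      have "m x j - m y j = 0"
      proof (rule q[OF _ _ that, where f="\<lambda>j. m x j - m y j"])
        show "dot 4 (\<lambda>j. m x j - m y j) q = 0" unfolding dot_diff by (rule xq)
        have "dot 4 (m x) (p' y) - dot 4 (m y) (p' y) = 0" using self[of x] self[of y] p0 V by simp
        then show "dot 4 (\<lambda>j. m x j - m y j) (p' v) = 0" if "v \<in> {y, z1, z2}" for v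
          unfolding dot_diff using that zok[of z1] zok[of z2] zz neq zy by auto
      qed
      then show ?thesis by simp
    qed
    have dxy: "dot 4 (m x) f = dot 4 (m y) f" for f
      unfolding dot_def by (intro sum.cong refl) (simp add: mxy)
    have "motion V' E' p' m"
      unfolding motion_def
    proof (intro conjI ballI impI)
      show s': "dot 4 (m u) (p' u) = 0" if "u \<in> V'" for u using self[of u] that V p0 by simp
      fix u v assume uv: "u \<in> V'" "v \<in> V'" "E' u v"
      show "dot 4 (m u) (p' v) + dot 4 (m v) (p' u) = 0"
      proof (cases "u = v")
        case True
        then show ?thesis using s' uv by simp
      next
        case False
        consider "E u v" | "u = y" "E x v" | "v = y" "E u x" using E'[OF uv] by blast
        then show ?thesis
        proof cases
          case 1
          then have "ok u v" using uv V by (auto simp: ok_def)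
          then show ?thesis using edge[of u v] uv p0 by simp
        next
          case 2
          then have "ok x v" using uv V False by (auto simp: ok_def)
          then show ?thesis using edge[of x v] uv p0 dxy 2 by simp
        next
          case 3
          then have "ok u x" using uv V False by (auto simp: ok_def)
          then show ?thesis using edge[of u x] uv p0 dxy 3 by simp
        qed
      qed
    qed
    moreover have "\<forall>v\<in>g ` T. \<forall>j<4. m v j = 0"
    proof (intro ballI allI impI)
      fix v j assume v: "v \<in> g ` T" and j: "j < (4::nat)"
      then obtain t where t: "t \<in> T" "v = g t" by blast
      have "m t j = 0" using w(1) t by (simp add: m_def FS_def X_def)
      then show "m v j = 0" using t mxy[OF j] by (cases "t = x") (auto simp: g_def)
    qed
    ultimately have z0: "\<forall>v\<in>V'. \<forall>j<4. m v j = 0" using pin unfolding pinned_def by blast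
    show "w = 0"
    proof
      fix s :: "'v \<times> nat" obtain u j where s: "s = (u, j)" by (cases s)
      show "w s = 0 s"
      proof (cases "s \<in> X")
        case True
        then have "u \<in> V" "j < 4" by (auto simp: X_def s)
        then have "m u j = 0" using z0 mxy V by auto
        then show ?thesis by (simp add: m_def s)
      qed (use w(1) in \<open>simp add: FS_def s\<close>)
    qed
  qed
  have finX: "finite X" using V by (simp add: X_def)
  define B1 where "B1 = {t. \<exists>w\<in>FS X. w \<noteq> 0 \<and> (\<forall>s. M0 w s + t * M1 w s = 0)}"
  define B2 where "B2 = {t. \<not> indep 4 (\<lambda>v i. p0 v i + t * qq v i) T}"
  have "finite B1" unfolding B1_def by (rule injective_cofinite_on_line[OF finX lin inj])
  moreover have "finite B2"
  proof -
    have "indep 4 p0 T" unfolding p0_def[abs_def] by (rule indep_reindex[OF injg ind])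
    moreover have "card T \<le> 4"
      using indep_card[OF _ ind] finT card_image[OF injg] by simp
    then have "generic (\<lambda>p :: 'v \<Rightarrow> nat \<Rightarrow> 'k. indep 4 p T)" by (rule generic_indep[OF finT])
    ultimately show ?thesis unfolding generic_def B2_def by blast
  qed
  ultimately have "finite (insert 0 (B1 \<union> B2))" by simp
  from ex_new_if_finite[OF inf this] obtain t where t: "t \<noteq> 0" "t \<notin> B1" "t \<notin> B2" by blast
  define p where "p v i = p0 v i + t * qq v i" for v i
  have px: "dot 4 f (p v) = dot 4 f (p0 v) + t * dot 4 f (qq v)" for f v
    unfolding p_def[abs_def] by (rule dot_line)
  have dqq: "dot 4 f (qq v) = (if v = x then dot 4 f q else 0)" for f v
    by (simp add: dot_def qq_def[abs_def])
  have "pinned V E T p"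
    unfolding pinned_def
  proof (intro allI impI)
    fix m assume m: "motion V E p m \<and> (\<forall>v\<in>T. \<forall>j<4. m v j = 0)"
    let ?w = "\<lambda>s. if s \<in> X then m (fst s) (snd s) else 0"
    have d: "dot 4 (\<lambda>j. ?w (u, j)) f = dot 4 (m u) f" if "u \<in> V" for u f
      unfolding dot_def using m that by (intro sum.cong) (auto simp: X_def)
    have self: "dot 4 (m u) (p u) = 0" if "u \<in> V" for u using m that unfolding motion_def by blast
    have edge: "dot 4 (m u) (p v) + dot 4 (m v) (p u) = 0" if "u \<in> V" "v \<in> V" "E u v" for u v
      using m that unfolding motion_def by blast
    have "M0 ?w s + t * M1 ?w s = 0" for s
    proof (cases s)
      case (Inl u)
      then show ?thesis using self[of u] by (simp add: M0_def M1_def d px)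
    next
      case (Inr uv)
      obtain u v where uv: "uv = (u, v)" by (cases uv)
      show ?thesis
      proof (cases "ok u v")
        case True
        then have "u \<in> V" "v \<in> V" "E u v" by (auto simp: ok_def)
        then show ?thesis using edge[of u v] True
          by (simp add: Inr uv M0_def M1_def d px algebra_simps)
      next
        case False
        show ?thesis
        proof (cases "u = x \<and> v = y")
          case True
          have V2: "x \<in> V" "y \<in> V" using V by auto
          \<comment> \<open>The conditions at \<open>x\<close> and at \<open>y\<close> are
            subtracted from the edge equation. As \<open>p0 x = p0 y\<close>, what remains is a
            multiple of \<open>t\<close>.\<close>
          have 1: "dot 4 (m x) (p0 x) + t * dot 4 (m x) q = 0" using self[OF V2(1)] by (simp add: px dqq)
          have 2: "dot 4 (m y) (p0 y) = 0" using self[OF V2(2)] neq by (simp add: px dqq)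
          have "dot 4 (m x) (p0 y) + (dot 4 (m y) (p0 x) + t * dot 4 (m y) q) = 0"
            using edge[OF V2 Exy] neq by (simp add: px dqq)
          moreover have "p0 x = p0 y" using neq by (simp add: p0_def g_def)
          ultimately have "dot 4 (m x) (p0 x) + t * dot 4 (m y) q = 0" using 2 by simp
          then have "t * (dot 4 (m x) q - dot 4 (m y) q) = 0" using 1
            by (simp add: right_diff_distrib eq_neg_iff_add_eq_0[symmetric])
          then have "dot 4 (m x) q - dot 4 (m y) q = 0" using t by simp
          then show ?thesis using True False V2 by (simp add: Inr uv M0_def M1_def d)
        qed (use False in \<open>auto simp: Inr uv M0_def M1_def\<close>)
      qed
    qed
    moreover have "?w \<in> FS X" by (simp add: FS_def)
    ultimately have "?w = 0" using t(2) unfolding B1_def by blast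
    then have "m v j = 0" if "v \<in> V" "j < 4" for v j
      using fun_cong[OF \<open>?w = 0\<close>, of "(v, j)"] that m by (auto simp: X_def split: if_splits)
    then show "\<forall>v\<in>V. \<forall>j<4. m v j = 0" by blast
  qed
  moreover have "indep 4 p T" using t(3) unfolding B2_def p_def[abs_def] by blast
  ultimately show ?thesis by blast
qed

section \<open>Pieces after the contraction\<close>

context contraction
begin

lemma in_piece:
  assumes "piece Q"
  shows "Q \<subseteq> S0" "Q \<subseteq> S" "finite Q" "st Q" "Q \<noteq> {}"
    and "\<And>R. R \<subseteq> Q \<Longrightarrow> R \<noteq> {} \<Longrightarrow> st R \<Longrightarrow> R = Q"
    and "\<And>T. T \<in> Q \<Longrightarrow> card T = 3" and "\<And>T. T \<in> Q \<Longrightarrow> finite T"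
    and "\<And>T. T \<in> Q \<Longrightarrow> x \<in> T \<Longrightarrow> y \<notin> T"
proof -
  have *: "Q \<subseteq> S0" using assms by (simp add: piece_def)
  then have "Q \<subseteq> S" using finS(4) by (rule order_trans)
  then show "Q \<subseteq> S0" "Q \<subseteq> S" "finite Q" "st Q" "Q \<noteq> {}"
    "\<And>R. R \<subseteq> Q \<Longrightarrow> R \<noteq> {} \<Longrightarrow> st R \<Longrightarrow> R = Q"
    "\<And>T. T \<in> Q \<Longrightarrow> card T = 3" "\<And>T. T \<in> Q \<Longrightarrow> finite T"
    using assms * fin_sub[OF *] tri by (auto simp: piece_def)
  show "\<And>T. T \<in> Q \<Longrightarrow> x \<in> T \<Longrightarrow> y \<notin> T" using * by (auto simp: S0_def)
qed

text \<open>Two triangles that the contraction identifies cancel modulo 2, so they already have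
  cyclic image together; minimality leaves nothing else in the piece.\<close>

lemma pair_piece:
  assumes Q: "piece Q" and e: "insert x e \<in> Q" "insert y e \<in> Q" "x \<notin> e" "y \<notin> e"
  shows "Q = {insert x e, insert y e}" "card e = 2"
proof -
  have fe: "finite e" using in_piece(8)[OF Q e(1)] by simp
  show ce: "card e = 2" using in_piece(7)[OF Q e(1)] fe e(3) by simp
  let ?R = "{insert x e, insert y e}"
  have ne: "insert x e \<noteq> insert y e" using e neq by auto
  have "st ?R"
    unfolding st_def
  proof (intro conjI allI impI; elim conjE)
    fix f assume f: "card f = 2" "x \<notin> f" "y \<notin> f"
    have "{T \<in> ?R. f \<subseteq> T} = (if f \<subseteq> e then ?R else {})" using f by auto
    then show "even (deg ?R f)" using ne by (simp add: deg_def)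
  next
    fix w assume w: "w \<noteq> x" "w \<noteq> y"
    have "{T \<in> ?R. {x, w} \<subseteq> T} = (if w \<in> e then {insert x e} else {})" using w e neq by auto
    moreover have "{T \<in> ?R. {y, w} \<subseteq> T} = (if w \<in> e then {insert y e} else {})" using w e neq by auto
    ultimately show "even (deg ?R {x, w}) \<longleftrightarrow> even (deg ?R {y, w})" unfolding deg_def by simp
  qed
  then show "Q = ?R" using in_piece(6)[OF Q, of ?R] e by simp
qed

definition g where "g v = (if v = x then y else v)"

lemma g_image: "g ` T = (if x \<in> T then insert y (T - {x}) else T)"
  by (auto simp: g_def)

lemma g_subset: "x \<notin> e \<Longrightarrow> y \<notin> e \<Longrightarrow> e \<subseteq> g ` T \<longleftrightarrow> e \<subseteq> T"
  by (auto simp: g_def image_iff subset_iff)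

context
  fixes Q assumes Q: "piece Q" and np: "\<And>e. insert x e \<in> Q \<Longrightarrow> insert y e \<in> Q \<Longrightarrow> x \<notin> e \<Longrightarrow> y \<notin> e \<Longrightarrow> False"
begin

text \<open>Distinct triangles with the same image are of the form \<open>insert x e\<close> and
  \<open>insert y e\<close>, which is the excluded case. So the image of the piece is an honest set
  of triangles, without multiplicities.\<close>

lemma inj_g: "inj_on (image g) Q"
proof (rule inj_onI)
  fix T T' assume T: "T \<in> Q" "T' \<in> Q" "g ` T = g ` T'"
  have *: False if AB: "A \<in> Q" "B \<in> Q" "x \<in> A" "x \<notin> B" "g ` A = g ` B" for A B
  proof -
    have "B = insert y (A - {x})" using AB by (simp add: g_image)
    moreover have "A = insert x (A - {x})" using AB by auto
    ultimately show False using np[of "A - {x}"] in_piece(9)[OF Q AB(1,3)] AB by auto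
  qed
  show "T = T'"
  proof (cases "x \<in> T \<longleftrightarrow> x \<in> T'")
    case True
    show ?thesis
    proof (cases "x \<in> T")
      case xT: True
      then have "insert y (T - {x}) = insert y (T' - {x})" using T(3) True by (simp add: g_image)
      moreover have "y \<notin> T" "y \<notin> T'" using in_piece(9)[OF Q] T xT True by auto
      ultimately have "T - {x} = T' - {x}" by (metis Diff_iff insert_ident)
      then show ?thesis using xT True by (metis insert_Diff)
    qed (use True T(3) in \<open>simp add: g_image\<close>)
  qed (use *[of T T'] *[of T' T] T in auto)
qed

lemma deg_g:
  assumes "R \<subseteq> Q"
  shows "x \<notin> e \<Longrightarrow> y \<notin> e \<Longrightarrow> deg (image g ` R) e = deg R e"
    and "w \<noteq> x \<Longrightarrow> w \<noteq> y \<Longrightarrow> deg (image g ` R) {y, w} = deg R {x, w} + deg R {y, w}"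
    and "x \<in> e \<Longrightarrow> deg (image g ` R) e = 0"
proof -
  have injR: "inj_on (image g) R" using inj_g assms by (rule inj_on_subset)
  have fR: "finite R" using in_piece(3)[OF Q] assms finite_subset by blast
  have deg: "deg (image g ` R) e = card {T \<in> R. e \<subseteq> g ` T}" for e
  proof -
    have "{T \<in> image g ` R. e \<subseteq> T} = image g ` {T \<in> R. e \<subseteq> g ` T}" by auto
    moreover have "inj_on (image g) {T \<in> R. e \<subseteq> g ` T}" using injR by (rule inj_on_subset) auto
    ultimately show ?thesis by (simp add: deg_def card_image)
  qed
  show "deg (image g ` R) e = deg R e" if "x \<notin> e" "y \<notin> e" for e
    unfolding deg g_subset[OF that] by (simp add: deg_def)
  show "deg (image g ` R) e = 0" if "x \<in> e" for e
  proof -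
    have "{T \<in> R. e \<subseteq> g ` T} = {}" using that neq by (auto simp: g_def split: if_splits)
    then show ?thesis unfolding deg by (simp only: card.empty)
  qed
  show "deg (image g ` R) {y, w} = deg R {x, w} + deg R {y, w}" if w: "w \<noteq> x" "w \<noteq> y" for w
  proof -
    have "{T \<in> R. {y, w} \<subseteq> g ` T} = {T \<in> R. {x, w} \<subseteq> T} \<union> {T \<in> R. {y, w} \<subseteq> T}"
      using w neq by (auto simp: g_image split: if_splits)
    moreover have "card ({T \<in> R. {x, w} \<subseteq> T} \<union> {T \<in> R. {y, w} \<subseteq> T})
        = card {T \<in> R. {x, w} \<subseteq> T} + card {T \<in> R. {y, w} \<subseteq> T}"
      using fR in_piece(9)[OF Q] assms by (intro card_Un_disjoint) auto
    ultimately show ?thesis unfolding deg by (simp add: deg_def)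
  qed
qed

lemma z2cycle_g:
  assumes "R \<subseteq> Q" shows "z2cycle (image g ` R) \<longleftrightarrow> st R"
proof -
  have card3: "card (g ` T) = 3" if "T \<in> Q" for T
  proof -
    have "inj_on g T" using in_piece(9)[OF Q that] by (auto simp: inj_on_def g_def)
    then show ?thesis using in_piece(7)[OF Q that] by (simp add: card_image)
  qed
  have fR: "finite R" using in_piece(3)[OF Q] assms finite_subset by blast
  have "z2cycle (image g ` R) \<longleftrightarrow> (\<forall>e. card e = 2 \<longrightarrow> even (deg (image g ` R) e))"
    using card3 assms fR by (auto simp: z2cycle_def)
  also have "\<dots> \<longleftrightarrow> st R"
  proof
    assume *: "\<forall>e. card e = 2 \<longrightarrow> even (deg (image g ` R) e)"
    show "st R"
      unfolding st_def
    proof (intro conjI allI impI; elim conjE)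
      show "even (deg R e)" if "card e = 2" "x \<notin> e" "y \<notin> e" for e
        using *[rule_format, OF that(1)] deg_g(1)[OF assms that(2,3)] by simp
      fix w assume w: "w \<noteq> x" "w \<noteq> y"
      have "even (deg (image g ` R) {y, w})" using * w by simp
      then show "even (deg R {x, w}) \<longleftrightarrow> even (deg R {y, w})" using deg_g(2)[OF assms w] by simp
    qed
  next
    assume stR: "st R"
    show "\<forall>e. card e = 2 \<longrightarrow> even (deg (image g ` R) e)"
    proof (intro allI impI)
      fix e :: "'v set" assume e: "card e = 2"
      consider "x \<in> e" | "x \<notin> e" "y \<notin> e" | "x \<notin> e" "y \<in> e" by blast
      then show "even (deg (image g ` R) e)"
      proof cases
        case 1
        then show ?thesis using deg_g(3)[OF assms] by simp
      next
        case 2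
        then show ?thesis using deg_g(1)[OF assms 2] stR e by (simp add: st_def)
      next
        case 3
        obtain w where w: "e = {y, w}" "w \<noteq> y" using e 3 by (auto simp: card_2_iff)
        then have "w \<noteq> x" using 3 by auto
        then show ?thesis using deg_g(2)[OF assms, of w] stR w by (simp add: st_def)
      qed
    qed
  qed
  finally show ?thesis .
qed

text \<open>Cycles inside the image correspond to subsets of \<open>Q\<close> with cyclic image, so
  minimality of the piece is minimality of its image.\<close>

lemma circuit_g: "circuit (image g ` Q)"
  unfolding circuit_def
proof (intro conjI allI impI)
  show "z2cycle (image g ` Q)" using z2cycle_g[OF order_refl] in_piece(4)[OF Q] by simp
  show "image g ` Q \<noteq> {}" using in_piece(5)[OF Q] by simp
  fix P assume P: "P \<subseteq> image g ` Q" "z2cycle P"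
  define R where "R = {T \<in> Q. g ` T \<in> P}"
  have "P = image g ` R" using P(1) by (auto simp: R_def)
  moreover have "R \<subseteq> Q" by (auto simp: R_def)
  ultimately show "P = {} \<or> P = image g ` Q"
    using in_piece(6)[OF Q, of R] z2cycle_g[of R] P(2) by auto
qed

text \<open>Without a vertex of odd degree the completion would add nothing, and \<open>Q\<close>
  would be a cycle inside \<open>S\<close>, hence all of \<open>S\<close>, although \<open>S\<close>
  has a triangle through \<open>x\<close> and \<open>y\<close> and \<open>Q\<close> has none. The
  number of such vertices is even, so there are two; they are the common neighbours needed for
  splitting.\<close>

lemma common_neighbours:
  obtains z1 z2 where "z1 \<noteq> z2" "z1 \<noteq> x" "z1 \<noteq> y" "z2 \<noteq> x" "z2 \<noteq> y"
    "odd (deg Q {x, z1})" "odd (deg Q {x, z2})"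
proof -
  define W where "W = {w \<in> \<Union>S - {x, y}. odd (deg Q {x, w})}"
  have fW: "finite W" by (rule finite_subset[OF _ finS(3)]) (auto simp: W_def)
  have "W \<noteq> {}"
  proof
    assume "W = {}"
    then have "z2cycle Q" using completion_cycle[OF in_piece(1)[OF Q] in_piece(4)[OF Q] W_def] by simp
    then have "Q = S" using in_piece(2,5)[OF Q] circ unfolding circuit_def by blast
    then show False using in_piece(1)[OF Q] S0_neq_S finS(4) by blast
  qed
  moreover have "even (card W)" unfolding W_def by (rule handshake[OF in_piece(1)[OF Q]])
  ultimately have "card W \<ge> 2" using fW by (metis card_gt_0_iff even_zero less_2_cases_iff linorder_not_less odd_one not_gr_zero One_nat_def)
  then obtain z1 z2 where "z1 \<in> W" "z2 \<in> W" "z1 \<noteq> z2"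
    by (metis card_le_Suc0_iff_eq fW not_less_eq_eq numeral_2_eq_2)
  then show ?thesis using that by (auto simp: W_def)
qed

end

text \<open>The edge \<open>xy\<close> and its ends are added to every piece, so that any two pieces
  overlap in them and one further common vertex suffices to compare their motions.\<close>

definition VQ where "VQ Q = \<Union>Q \<union> {x, y}"

definition EQ where "EQ Q u v \<longleftrightarrow> adj Q u v \<or> (u = x \<and> v = y) \<or> (u = y \<and> v = x)"

text \<open>Either the piece is a pair of triangles identified by the contraction; with the edge
  \<open>xy\<close> its graph is that of a tetrahedron, and four independent points pin it. Or its
  image is a circuit with fewer vertices, and the contracted vertex is split again.\<close>

lemma piece_rigid:
  assumes inf: "infinite (UNIV :: 'k::field set)" and Q: "piece Q"
    and IH: "\<And>S'. circuit S' \<Longrightarrow> card (\<Union>S') < card (\<Union>S) \<Longrightarrow>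
      \<exists>p T. T \<in> S' \<and> indep 4 p T \<and> pinned (\<Union>S') (adj S') T (p :: 'v \<Rightarrow> nat \<Rightarrow> 'k)"
  shows "\<exists>p T. T \<subseteq> VQ Q \<and> card T = 3 \<and> (\<forall>u\<in>T. \<forall>v\<in>T. u \<noteq> v \<longrightarrow> EQ Q u v)
    \<and> indep 4 p T \<and> pinned (VQ Q) (EQ Q) T (p :: 'v \<Rightarrow> nat \<Rightarrow> 'k)"
proof (cases "\<exists>e. insert x e \<in> Q \<and> insert y e \<in> Q \<and> x \<notin> e \<and> y \<notin> e")
  case True
  then obtain e where e: "insert x e \<in> Q" "insert y e \<in> Q" "x \<notin> e" "y \<notin> e" by blast
  have Qe: "Q = {insert x e, insert y e}" and ce: "card e = 2" using pair_piece[OF Q e] by auto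
  have fe: "finite e" using ce by (simp add: card_ge_0_finite)
  have V: "VQ Q = insert y (insert x e)" by (auto simp: VQ_def Qe)
  have c4: "card (VQ Q) = 4" "finite (VQ Q)" unfolding V using fe ce e neq by auto
  obtain p :: "'v \<Rightarrow> nat \<Rightarrow> 'k" where p: "indep 4 p (VQ Q)"
    using generic_indep[OF c4(2), of 4] c4(1) unfolding generic_def by auto
  have adjQ: "EQ Q u v" if "u \<in> VQ Q" "v \<in> VQ Q" "u \<noteq> v" for u v
  proof -
    have "u = x \<or> u = y \<or> u \<in> e" "v = x \<or> v = y \<or> v \<in> e" using that V by auto
    then show ?thesis using that(3) unfolding EQ_def adj_def Qe by auto
  qed
  have "pinned (VQ Q) (EQ Q) (insert x e) p"
    unfolding pinned_def
  proof (intro allI impI ballI)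
    fix m v j assume m: "motion (VQ Q) (EQ Q) p m \<and> (\<forall>v\<in>insert x e. \<forall>j<4. m v j = 0)"
      and v: "v \<in> VQ Q" and j: "j < (4::nat)"
    show "m v j = 0"
    proof (cases "v \<in> insert x e")
      case False
      then have vy: "v = y" using v V by auto
      show ?thesis unfolding vy
      proof (rule indep_span[OF c4(2) p c4(1) _ j])
        fix u assume u: "u \<in> VQ Q"
        show "dot 4 (m y) (p u) = 0"
        proof (cases "u = y")
          case True
          then show ?thesis using m u unfolding motion_def by auto
        next
          case ne: False
          then have "dot 4 (m y) (p u) + dot 4 (m u) (p y) = 0"
            using m u adjQ[of y u] V unfolding motion_def by auto
          moreover have "dot 4 (m u) (p y) = 0" using m u ne V by (intro dot_zero) auto
          ultimately show ?thesis by simp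
        qed
      qed
    qed (use m j in blast)
  qed
  moreover have "indep 4 p (insert x e)" using p c4(2) V by (intro indep_subset[OF p]) auto
  moreover have "card (insert x e) = 3" using ce fe e by simp
  moreover have "insert x e \<subseteq> VQ Q" using V by auto
  ultimately show ?thesis using adjQ by (intro exI[of _ p] exI[of _ "insert x e"]) blast
next
  case False
  then have np: "\<And>e. insert x e \<in> Q \<Longrightarrow> insert y e \<in> Q \<Longrightarrow> x \<notin> e \<Longrightarrow> y \<notin> e \<Longrightarrow> False" by blast
  obtain z1 z2 where zz: "z1 \<noteq> z2" "z1 \<noteq> x" "z1 \<noteq> y" "z2 \<noteq> x" "z2 \<noteq> y"
    "odd (deg Q {x, z1})" "odd (deg Q {x, z2})" by (rule common_neighbours[OF Q np])
  let ?V' = "\<Union>(image g ` Q)"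
  have fQ: "finite Q" by (rule in_piece(3)[OF Q])
  have fV': "finite ?V'" using fQ in_piece(8)[OF Q] by auto
  have xV': "x \<notin> ?V'" using neq by (auto simp: g_def split: if_splits)
  have nb: "adj Q x w \<and> adj Q y w \<and> w \<in> ?V'" if w: "w \<noteq> x" "w \<noteq> y" "odd (deg Q {x, w})" for w
  proof -
    have "odd (deg Q {y, w})" using in_piece(4)[OF Q] w by (simp add: st_def)
    then obtain T' where T': "T' \<in> Q" "{y, w} \<subseteq> T'" using deg_pos[OF fQ] by blast
    obtain T where T: "T \<in> Q" "{x, w} \<subseteq> T" using deg_pos[OF fQ w(3)] by blast
    have "w \<in> g ` T" using T w by (intro image_eqI[of w g w]) (auto simp: g_def)
    then have "w \<in> ?V'" using T(1) by blast
    then show ?thesis using w T T' unfolding adj_def by blast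
  qed
  obtain T1 where T1: "T1 \<in> Q" "x \<in> T1" using deg_pos[OF fQ zz(6)] by blast
  have yV': "y \<in> ?V'" using T1 by (auto simp: g_def)
  have V: "VQ Q = insert x ?V'"
  proof (intro equalityI subsetI)
    fix v assume v: "v \<in> VQ Q"
    show "v \<in> insert x ?V'"
    proof (cases "v = x \<or> v = y")
      case False
      then obtain T where T: "T \<in> Q" "v \<in> T" using v by (auto simp: VQ_def)
      have "v \<in> g ` T" using T False by (intro image_eqI[of v g v]) (auto simp: g_def)
      then show ?thesis using T(1) by blast
    qed (use yV' in auto)
  qed (auto simp: VQ_def g_def split: if_splits)
  have sub: "?V' \<subseteq> \<Union>S - {x}"
  proof -
    have "x \<in> \<Union>S" "y \<in> \<Union>S" using xy by (auto simp: adj_def)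
    moreover have "VQ Q \<subseteq> \<Union>S" using calculation in_piece(2)[OF Q] by (auto simp: VQ_def)
    ultimately show ?thesis using V xV' by blast
  qed
  have "card ?V' < card (\<Union>S)"
  proof -
    have "x \<in> \<Union>S" using xy by (auto simp: adj_def)
    then have "?V' \<subset> \<Union>S" using sub by blast
    then show ?thesis by (rule psubset_card_mono[OF finS(3)])
  qed
  moreover have "circuit (image g ` Q)" by (rule circuit_g[OF Q]) (rule np)
  ultimately have "\<exists>p T. T \<in> image g ` Q \<and> indep 4 p T \<and> pinned ?V' (adj (image g ` Q)) T (p :: 'v \<Rightarrow> nat \<Rightarrow> 'k)"
    by (intro IH)
  then
  obtain p1 :: "'v \<Rightarrow> nat \<Rightarrow> 'k" and T' where p1: "T' \<in> image g ` Q" "indep 4 p1 T'" "pinned ?V' (adj (image g ` Q)) T' p1"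
    by (elim exE conjE) (rule that)
  then obtain T where T: "T \<in> Q" "T' = g ` T" by blast
  have cT: "card T = 3" "finite T" using in_piece(7,8)[OF Q T(1)] by auto
  have c3: "card {y, z1, z2} = 3" using zz by auto
  \<comment> \<open>The induction hypothesis yields some pinned configuration; a generic one has in
    addition the independent points \<open>y\<close>, \<open>z1\<close>, \<open>z2\<close> that the
    split requires.\<close>
  have "generic (\<lambda>p :: 'v \<Rightarrow> nat \<Rightarrow> 'k. indep 4 p T' \<and> pinned ?V' (adj (image g ` Q)) T' p \<and> indep 4 p {y, z1, z2})"
  proof (intro generic_conj[OF inf] generic_indep generic_pinned fV')
    show "card T' \<le> 4" using card_image_le[OF cT(2), of g] cT(1) T(2) by simp
    show "card {y, z1, z2} \<le> 4" using c3 by simp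
  qed (use p1 T cT in auto)
  then obtain p' :: "'v \<Rightarrow> nat \<Rightarrow> 'k" where p': "indep 4 p' T'" "pinned ?V' (adj (image g ` Q)) T' p'" "indep 4 p' {y, z1, z2}"
    unfolding generic_def by blast
  have "\<exists>p. indep 4 p T \<and> pinned (VQ Q) (EQ Q) T (p :: 'v \<Rightarrow> nat \<Rightarrow> 'k)"
  proof (rule vertex_split[OF inf fV' xV' yV' V])
    show "T \<subseteq> VQ Q" using T(1) by (auto simp: VQ_def)
    show "y \<notin> T" if "x \<in> T" using in_piece(9)[OF Q T(1) that] .
    show "pinned ?V' (adj (image g ` Q)) ((\<lambda>v. if v = x then y else v) ` T) p'"
      "indep 4 p' ((\<lambda>v. if v = x then y else v) ` T)"
      using p' T(2) by (simp_all add: g_def[abs_def])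
    show "EQ Q x y" by (simp add: EQ_def)
    show "z1 \<in> ?V'" "z2 \<in> ?V'" "EQ Q x z1" "EQ Q y z1" "EQ Q x z2" "EQ Q y z2"
      using nb[of z1] nb[of z2] zz by (auto simp: EQ_def)
    show "card {y, z1, z2} = 3" "indep 4 p' {y, z1, z2}" by fact+
    fix u v assume uv: "u \<in> ?V'" "v \<in> ?V'" "adj (image g ` Q) u v"
    then obtain R where R: "R \<in> Q" "u \<in> g ` R" "v \<in> g ` R" "u \<noteq> v" by (auto simp: adj_def)
    show "EQ Q u v \<or> (u = y \<and> EQ Q x v) \<or> (v = y \<and> EQ Q u x)"
    proof (cases "x \<in> R")
      case True
      then have "u \<in> insert y (R - {x})" "v \<in> insert y (R - {x})" using R by (auto simp: g_image)
      then show ?thesis using R True neq by (auto simp: EQ_def adj_def)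
    next
      case False
      then show ?thesis using R by (auto simp: g_image EQ_def adj_def)
    qed
  qed
  then obtain p :: "'v \<Rightarrow> nat \<Rightarrow> 'k" where "indep 4 p T" "pinned (VQ Q) (EQ Q) T p" by blast
  moreover have "T \<subseteq> VQ Q" using T(1) by (auto simp: VQ_def)
  moreover have "\<forall>u\<in>T. \<forall>v\<in>T. u \<noteq> v \<longrightarrow> EQ Q u v" using T(1) by (auto simp: EQ_def adj_def)
  ultimately show ?thesis using cT(1) by blast
qed

text \<open>Losing a triangle \<open>{x, y, w}\<close> makes the degree of \<open>{x, w}\<close> odd
  in \<open>S0\<close>, so \<open>w\<close> still lies in some triangle of
  \<open>S0\<close>.\<close>

lemma VQ_cover: "\<Union>S \<subseteq> \<Union>S0 \<union> {x, y}" "S0 \<noteq> {}"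
proof -
  have ex: "\<exists>T\<in>S0. w \<in> T" if w: "{x, y, w} \<in> S" "w \<noteq> x" "w \<noteq> y" for w
  proof -
    have "even (deg S {x, w})" using w by (intro z2cycleD(4)[OF z]) auto
    then have "odd (deg S0 {x, w})" using deg_S0_x[OF w(2,3), of x] w(1) by simp
    then show ?thesis using deg_pos[OF finS(2)] by blast
  qed
  have third: "\<exists>w. T = {x, y, w} \<and> w \<noteq> x \<and> w \<noteq> y" if T: "T \<in> S" "{x, y} \<subseteq> T" for T
  proof -
    have "card (T - {x, y}) = 1" using tri[OF T(1)] T(2) neq by (simp add: card_Diff_subset)
    then obtain w where w: "T - {x, y} = {w}" by (auto simp: card_1_singleton_iff)
    then have "T = {x, y, w}" using T(2) by blast
    then show ?thesis using w by blast
  qed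
  show "\<Union>S \<subseteq> \<Union>S0 \<union> {x, y}"
  proof
    fix v assume "v \<in> \<Union>S"
    then obtain T where T: "T \<in> S" "v \<in> T" by blast
    show "v \<in> \<Union>S0 \<union> {x, y}"
    proof (cases "{x, y} \<subseteq> T")
      case True
      then obtain w where "T = {x, y, w}" "w \<noteq> x" "w \<noteq> y" using third T by blast
      then show ?thesis using T ex[of w] by auto
    qed (use T in \<open>auto simp: S0_def\<close>)
  qed
  obtain T where "T \<in> S" "{x, y} \<subseteq> T" using xy by (auto simp: adj_def)
  then show "S0 \<noteq> {}" using third ex by blast
qed

end

text \<open>Contract an edge and induct on the number of vertices. A motion is induced on every
  piece by one form. The forms of two pieces with a common vertex \<open>w\<close> agree at
  \<open>x\<close>, \<open>y\<close> and \<open>w\<close>, three independent points, so they are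
  equal; by \<open>exchange\<close> all pieces are linked in this way.\<close>

theorem circuit_rigid:
  fixes S :: "'v set set"
  assumes inf: "infinite (UNIV :: 'k::field set)" and "circuit S"
  shows "\<exists>p T. T \<in> S \<and> indep 4 p T \<and> pinned (\<Union>S) (adj S) T (p :: 'v \<Rightarrow> nat \<Rightarrow> 'k)"
  using assms(2)
proof (induction "card (\<Union>S)" arbitrary: S rule: less_induct)
  case less
  have z: "z2cycle S" "S \<noteq> {}" using less.prems by (auto simp: circuit_def)
  then obtain T0 where T0: "T0 \<in> S" by blast
  have cT0: "card T0 = 3" "finite T0" using z2cycleD[OF z(1)] T0 by auto
  then obtain x y where xyT: "x \<in> T0" "y \<in> T0" "x \<noteq> y"
    by (metis card_le_Suc0_iff_eq numeral_3_eq_3 Suc_le_mono le_zero_eq nat.distinct(1) order_refl)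
  interpret contraction S x y
    by unfold_locales (use less.prems T0 xyT in \<open>auto simp: adj_def\<close>)
  obtain \<P> where P: "finite \<P>" "\<Union>\<P> = S0" "disjoint \<P>" "\<forall>P\<in>\<P>. piece P"
    using pieces[OF order_refl st_S0] by blast
  have "\<forall>Q\<in>\<P>. \<exists>T. (\<exists>p. indep 4 p T \<and> pinned (VQ Q) (EQ Q) T (p :: 'v \<Rightarrow> nat \<Rightarrow> 'k)) \<and>
      T \<subseteq> VQ Q \<and> card T = 3 \<and> (\<forall>u\<in>T. \<forall>v\<in>T. u \<noteq> v \<longrightarrow> EQ Q u v)"
    using piece_rigid[OF inf _ less.hyps] P(4) less.prems by meson
  then obtain t where t: "\<And>Q. Q \<in> \<P> \<Longrightarrow> \<exists>p. indep 4 p (t Q) \<and> pinned (VQ Q) (EQ Q) (t Q) (p :: 'v \<Rightarrow> nat \<Rightarrow> 'k)"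
    "\<And>Q. Q \<in> \<P> \<Longrightarrow> t Q \<subseteq> VQ Q \<and> card (t Q) = 3"
    "\<And>Q u v. Q \<in> \<P> \<Longrightarrow> u \<in> t Q \<Longrightarrow> v \<in> t Q \<Longrightarrow> u \<noteq> v \<Longrightarrow> EQ Q u v"
    by (metis (no_types, lifting))
  have inS: "x \<in> \<Union>S" "y \<in> \<Union>S" using T0 xyT by auto
  have VS: "VQ Q \<subseteq> \<Union>S" if "Q \<in> \<P>" for Q
    using in_piece(2)[of Q] P(4) that inS unfolding VQ_def by blast
  have finV: "finite (VQ Q)" if "Q \<in> \<P>" for Q using VS[OF that] finS(3) finite_subset by blast
  have "generic (\<lambda>p :: 'v \<Rightarrow> nat \<Rightarrow> 'k. (\<forall>Q\<in>\<P>. indep 4 p (t Q) \<and> pinned (VQ Q) (EQ Q) (t Q) p)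
      \<and> indep 4 p T0 \<and> (\<forall>w\<in>\<Union>S. indep 4 p {x, y, w}))"
  proof (intro generic_conj[OF inf] generic_ball[OF inf] generic_indep generic_pinned)
    show "finite (t Q)" "card (t Q) \<le> 4" if "Q \<in> \<P>" for Q
      using t(2)[OF that] by (auto intro: card_ge_0_finite)
    show "card {x, y, w} \<le> 4" for w by (simp add: card_insert_if)
  qed (use t(1) P(1) finV cT0 finS(3) in auto)
  then obtain p :: "'v \<Rightarrow> nat \<Rightarrow> 'k" where p: "\<forall>Q\<in>\<P>. indep 4 p (t Q) \<and> pinned (VQ Q) (EQ Q) (t Q) p"
    "indep 4 p T0" "\<forall>w\<in>\<Union>S. indep 4 p {x, y, w}"
    unfolding generic_def by blast
  have rigidQ: "rigid (VQ Q) (EQ Q) p" if "Q \<in> \<P>" for Q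
    using rigid_iff_pinned[of "t Q" "VQ Q" p "EQ Q"] t(2,3)[OF that] p(1) that by blast
  have "rigid (\<Union>S) (adj S) p"
    unfolding rigid_def
  proof (intro allI impI)
    fix m assume m: "motion (\<Union>S) (adj S) p m"
    have EQ: "adj S u v" if "Q \<in> \<P>" "EQ Q u v" for Q u v
      using that in_piece(2)[of Q] P(4) T0 xyT unfolding EQ_def adj_def by blast
    have mQ: "motion (VQ Q) (EQ Q) p m" if "Q \<in> \<P>" for Q
      using m VS[OF that] EQ[OF that] unfolding motion_def by blast
    then have "\<forall>Q\<in>\<P>. \<exists>A\<in>FS (pairs 4). \<forall>u\<in>VQ Q. \<forall>j<4. m u j = ctr 4 (p u) A j"
      using rigidQ unfolding rigid_def by blast
    then obtain A where A: "\<And>Q. Q \<in> \<P> \<Longrightarrow> A Q \<in> FS (pairs 4)"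
      "\<And>Q u j. Q \<in> \<P> \<Longrightarrow> u \<in> VQ Q \<Longrightarrow> j < 4 \<Longrightarrow> m u j = ctr 4 (p u) (A Q) j" by metis
    have same: "A Q = A Q'" if QQ: "Q \<in> \<P>" "Q' \<in> \<P>" and w: "w \<noteq> x" "w \<noteq> y" "w \<in> VQ Q" "w \<in> VQ Q'" for Q Q' w
    proof -
      have c: "ctr 4 (p v) (\<lambda>s. A Q s + (-1) * A Q' s) j = 0" if "v \<in> {x, y, w}" "j < 4" for v j
      proof -
        have "v \<in> VQ Q" "v \<in> VQ Q'" using that w by (auto simp: VQ_def)
        then show ?thesis unfolding ctr_add ctr_scale using A(2)[OF QQ(1) _ that(2), of v] A(2)[OF QQ(2) _ that(2), of v] by simp
      qed
      have "(\<lambda>s. A Q s + (-1) * A Q' s) = (\<lambda>_. 0)"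
      proof (rule form_zero_of_hyperplane[of "{x, y, w}" 4 p])
        show "indep 4 p {x, y, w}" using p(3) VS[OF QQ(1)] w(3) by blast
        show "Suc (card {x, y, w}) = 4" using w xyT by auto
        show "(\<lambda>s. A Q s + (-1) * A Q' s) \<in> FS (pairs 4)" using A(1)[OF QQ(1)] A(1)[OF QQ(2)] by (auto simp: FS_def)
      qed (use c in auto)
      then show ?thesis by (auto simp: fun_eq_iff)
    qed
    obtain Q0 where Q0: "Q0 \<in> \<P>" using VQ_cover(2) P(2) by blast
    \<comment> \<open>The pieces whose form is that of \<open>Q0\<close>. If some piece were
      missing, \<open>exchange\<close> would give a piece inside and one outside with a common
      vertex, hence with the same form.\<close>
    define J where "J = {Q \<in> \<P>. A Q = A Q0}"
    have "J = \<P>"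
    proof (rule ccontr)
      assume "J \<noteq> \<P>"
      moreover have "J \<subseteq> \<P>" "J \<noteq> {}" using Q0 by (auto simp: J_def)
      ultimately obtain w Q Q' where w: "Q \<in> J" "Q' \<in> \<P> - J" "w \<noteq> x" "w \<noteq> y" "odd (deg Q {x, w})" "odd (deg Q' {x, w})"
        using exchange[OF P] by blast
      have QP: "Q \<in> \<P>" "Q' \<in> \<P>" using w by (auto simp: J_def)
      have "w \<in> VQ R" if "R \<in> \<P>" "odd (deg R {x, w})" for R
        using deg_pos[OF in_piece(3) that(2)] P(4) that(1) by (auto simp: VQ_def)
      then have "A Q = A Q'" using same[OF QP w(3,4)] QP w(5,6) by blast
      then show False using w(1,2) QP by (auto simp: J_def)
    qed
    then have all: "A Q = A Q0" if "Q \<in> \<P>" for Q using that by (auto simp: J_def)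
    have "m u j = ctr 4 (p u) (A Q0) j" if "u \<in> \<Union>S" "j < 4" for u j
    proof -
      have "\<exists>Q\<in>\<P>. u \<in> VQ Q"
      proof (cases "u = x \<or> u = y")
        case True
        then show ?thesis using Q0 by (auto simp: VQ_def)
      next
        case False
        then have "u \<in> \<Union>S0" using VQ_cover(1) that(1) by blast
        then show ?thesis unfolding P(2)[symmetric] VQ_def by blast
      qed
      then show ?thesis using A(2) all that(2) by metis
    qed
    then show "\<exists>A\<in>FS (pairs 4). \<forall>u\<in>\<Union>S. \<forall>j<4. m u j = ctr 4 (p u) A j" using A(1)[OF Q0] by blast
  qed
  moreover have "T0 \<subseteq> \<Union>S" using T0 by blast
  moreover have "adj S u v" if "u \<in> T0" "v \<in> T0" "u \<noteq> v" for u v using that T0 by (auto simp: adj_def)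
  ultimately have "pinned (\<Union>S) (adj S) T0 p" using rigid_iff_pinned[of T0 "\<Union>S" p "adj S"] cT0(1) p(2) by blast
  then show ?case using T0 p(2) by blast
qed

section \<open>Homology 2-spheres\<close>

text \<open>The Hodge star of two-forms on \<open>k\<^sup>4\<close> for the standard volume form:
  complementary pairs of indices are swapped, with the sign of the permutation.\<close>

definition hodge :: "(nat \<times> nat \<Rightarrow> 'k::field) \<Rightarrow> nat \<times> nat \<Rightarrow> 'k" where
  "hodge f s = (if s = (0, 1) then f (2, 3) else if s = (0, 2) then - f (1, 3) else if s = (0, 3) then f (1, 2)
    else if s = (1, 2) then f (0, 3) else if s = (1, 3) then - f (0, 2) else f (0, 1))"

text \<open>Pluecker coordinates of the line through \<open>p\<close> and \<open>q\<close>.\<close>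

definition wedge :: "(nat \<Rightarrow> 'k::field) \<Rightarrow> (nat \<Rightarrow> 'k) \<Rightarrow> nat \<times> nat \<Rightarrow> 'k" where
  "wedge p q s = p (fst s) * q (snd s) - p (snd s) * q (fst s)"

lemma pairs_4: "pairs 4 = {(0,1), (0,2), (0,3), (1,2), (1,3), (2,3)}"
proof -
  have *: "(i, j) \<in> pairs 4 \<longleftrightarrow> (i, j) \<in> {(0,1), (0,2), (0,3), (1,2), (1,3), (2,3)}" for i j
  proof -
    have "i < j \<and> j < 4 \<longleftrightarrow> j < 4 \<and> i < j" by auto
    also have "\<dots> \<longleftrightarrow> (j = 0 \<or> j = 1 \<or> j = 2 \<or> j = 3) \<and> i < j" by auto
    also have "\<dots> \<longleftrightarrow> (i, j) \<in> {(0,1), (0,2), (0,3), (1,2), (1,3), (2,3)}" by auto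
    finally show ?thesis by (simp add: pairs_def)
  qed
  show ?thesis
  proof (rule Set.set_eqI)
    show "s \<in> pairs 4 \<longleftrightarrow> s \<in> {(0,1), (0,2), (0,3), (1,2), (1,3), (2,3)}" for s
      using *[of "fst s" "snd s"] by (simp only: prod.collapse)
  qed
qed

lemma lessThan_4: "{..<4} = {0, 1, 2, 3 :: nat}"
  by auto

lemma ctr_4: "ctr 4 p f j = p 0 * alt f 0 j + p 1 * alt f 1 j + p 2 * alt f 2 j + p 3 * alt f 3 j"
  unfolding ctr_def lessThan_4 by (simp add: add.assoc)

text \<open>The letters \<open>a\<close> to \<open>f\<close> are the six entries of a form in the
  order of \<open>pairs_4\<close>, and the hypotheses say that it is killed by two vectors. The
  fifteen conclusions are the 2 by 2 minors, one for each pair of coordinates, comparing its Hodge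
  dual with the wedge of the vectors.\<close>

lemma hodge_wedge_proportional:
  fixes a b c d e f :: "'k::field"
  assumes p: "- (p1 * a) - p2 * b - p3 * c = 0" "p0 * a - p2 * d - p3 * e = 0"
      "p0 * b + p1 * d - p3 * f = 0" "p0 * c + p1 * e + p2 * f = 0"
    and q: "- (q1 * a) - q2 * b - q3 * c = 0" "q0 * a - q2 * d - q3 * e = 0"
      "q0 * b + q1 * d - q3 * f = 0" "q0 * c + q1 * e + q2 * f = 0"
  shows "f * (p0 * q2 - p2 * q0) = - e * (p0 * q1 - p1 * q0)"
    and "f * (p0 * q3 - p3 * q0) = d * (p0 * q1 - p1 * q0)"
    and "f * (p1 * q2 - p2 * q1) = c * (p0 * q1 - p1 * q0)"
    and "f * (p1 * q3 - p3 * q1) = - b * (p0 * q1 - p1 * q0)"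
    and "f * (p2 * q3 - p3 * q2) = a * (p0 * q1 - p1 * q0)"
    and "- e * (p0 * q3 - p3 * q0) = d * (p0 * q2 - p2 * q0)"
    and "- e * (p1 * q2 - p2 * q1) = c * (p0 * q2 - p2 * q0)"
    and "- e * (p1 * q3 - p3 * q1) = - b * (p0 * q2 - p2 * q0)"
    and "- e * (p2 * q3 - p3 * q2) = a * (p0 * q2 - p2 * q0)"
    and "d * (p1 * q2 - p2 * q1) = c * (p0 * q3 - p3 * q0)"
    and "d * (p1 * q3 - p3 * q1) = - b * (p0 * q3 - p3 * q0)"
    and "d * (p2 * q3 - p3 * q2) = a * (p0 * q3 - p3 * q0)"
    and "c * (p1 * q3 - p3 * q1) = - b * (p1 * q2 - p2 * q1)"
    and "c * (p2 * q3 - p3 * q2) = a * (p1 * q2 - p2 * q1)"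
    and "- b * (p2 * q3 - p3 * q2) = a * (p1 * q3 - p3 * q1)"
  using p q by Groebner_Basis.algebra+

text \<open>The dual of a form killed by two independent vectors of \<open>k\<^sup>4\<close> is a
  multiple of their wedge; the nonzero coordinate \<open>s0\<close> serves to compute the
  factor.\<close>

lemma hodge_eq_wedge:
  fixes p q :: "nat \<Rightarrow> 'k::field"
  assumes f: "f \<in> FS (pairs 4)" and p: "\<And>j. j < 4 \<Longrightarrow> ctr 4 p f j = 0" and q: "\<And>j. j < 4 \<Longrightarrow> ctr 4 q f j = 0"
    and s0: "s0 \<in> pairs 4" "wedge p q s0 \<noteq> 0"
  shows "\<exists>w. \<forall>s\<in>pairs 4. hodge f s = w * wedge p q s"
proof -
  have eqs: "- (r 1 * f (0,1)) - r 2 * f (0,2) - r 3 * f (0,3) = 0" "r 0 * f (0,1) - r 2 * f (1,2) - r 3 * f (1,3) = 0"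
      "r 0 * f (0,2) + r 1 * f (1,2) - r 3 * f (2,3) = 0" "r 0 * f (0,3) + r 1 * f (1,3) + r 2 * f (2,3) = 0"
    if "\<And>j. j < 4 \<Longrightarrow> ctr 4 r f j = 0" for r :: "nat \<Rightarrow> 'k"
    using that[of 0] that[of 1] that[of 2] that[of 3] by (simp_all add: ctr_4 alt_def)
  note X = hodge_wedge_proportional[OF eqs[OF p] eqs[OF q]]
  have h: "hodge f (0,1) = f (2,3)" "hodge f (0,2) = - f (1,3)" "hodge f (0,3) = f (1,2)"
    "hodge f (1,2) = f (0,3)" "hodge f (1,3) = - f (0,2)" "hodge f (2,3) = f (0,1)"
    by (simp_all add: hodge_def)
  have "\<forall>s\<in>pairs 4. \<forall>t\<in>pairs 4. hodge f s * wedge p q t = hodge f t * wedge p q s"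
    unfolding pairs_4 Set.ball_simps h wedge_def fst_conv snd_conv
    by (intro conjI TrueI; (rule X | rule X[symmetric] | rule refl))
  then have cross: "hodge f s * wedge p q t = hodge f t * wedge p q s" if "s \<in> pairs 4" "t \<in> pairs 4" for s t
    using that by blast
  have "hodge f s = hodge f s0 / wedge p q s0 * wedge p q s" if "s \<in> pairs 4" for s
    using cross[OF that s0(1)] s0(2) by (simp add: field_simps)
  then show ?thesis by blast
qed

lemma hodge_zero:
  assumes "f \<in> FS (pairs 4)" "\<And>s. s \<in> pairs 4 \<Longrightarrow> hodge f s = 0" shows "f = (\<lambda>_. 0)"
proof
  fix s
  show "f s = 0"
  proof (cases "s \<in> pairs 4")
    case True
    moreover have "hodge f (0,1) = 0" "hodge f (0,2) = 0" "hodge f (0,3) = 0" "hodge f (1,2) = 0"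
      "hodge f (1,3) = 0" "hodge f (2,3) = 0" using assms(2) by (auto simp: pairs_4)
    ultimately show ?thesis unfolding pairs_4 by (auto simp: hodge_def)
  next
    case False
    then show ?thesis using assms(1) unfolding FS_def by blast
  qed
qed

lemma wedge_nonzero:
  fixes p :: "'v \<Rightarrow> nat \<Rightarrow> 'k::field"
  assumes "indep 4 p {a, b}" "a \<noteq> b" shows "\<exists>s\<in>pairs 4. wedge (p a) (p b) s \<noteq> 0"
proof (rule ccontr)
  assume "\<not> ?thesis"
  then have W: "\<forall>s\<in>pairs 4. wedge (p a) (p b) s = 0" by blast
  have sym: "p a k * p b l = p a l * p b k" if kl: "k < 4" "l < 4" for k l
  proof (cases k l rule: linorder_cases)
    case less
    then show ?thesis using W[rule_format, of "(k, l)"] kl by (simp add: pairs_def wedge_def)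
  next
    case greater
    then show ?thesis using W[rule_format, of "(l, k)"] kl by (simp add: pairs_def wedge_def)
  qed simp
  have dep: "\<forall>v\<in>{a, b}. c v = 0" if "\<forall>i<4. c a * p a i + c b * p b i = 0" for c
    using assms(1)[unfolded indep_def, rule_format, of c] that assms(2) by auto
  have zero: "p a k = 0" if k: "k < 4" for k
  proof -
    have "\<forall>v\<in>{a, b}. (if v = a then p b k else - p a k) = 0"
      by (rule dep) (use assms(2) sym[OF k] in \<open>auto simp: mult.commute\<close>)
    then show ?thesis using assms(2) by auto
  qed
  have "\<forall>v\<in>{a, b}. (if v = a then 1 else 0 :: 'k) = 0"
    by (rule dep) (use assms(2) zero in auto)
  then show False by simp
qed

lemma subspace_eq_of_dim:
  fixes U V :: "('x \<Rightarrow> 'k::field) set"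
  assumes "finite X" "V \<subseteq> FS X" "fs.subspace U" "U \<subseteq> V" "fs.subspace V" "fs.dim U = fs.dim V"
  shows "U = V"
proof -
  obtain C where C: "finite C" "fs.independent C" "C \<subseteq> V" "fs.span C \<inter> U = {0}"
    "V = {x + y |x y. x \<in> U \<and> y \<in> fs.span C}" "card C + fs.dim U = fs.dim V"
    by (rule subspace_complement[OF assms(1,2,3,4,5)])
  have "C = {}" using C(1,6) assms(6) by simp
  then have "V \<subseteq> U" using equalityD1[OF C(5)] by auto
  then show ?thesis using assms(4) by blast
qed

section \<open>Connectedness and Euler relations\<close>

lemma face_sign_singleton: "face_sign w {w} = 1"
proof -
  have "{x \<in> {w}. x < w} = {}" by auto
  then show ?thesis unfolding face_sign_def by (simp only: card.empty power_0)
qed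

lemma face_sign_pair: "u \<noteq> x \<Longrightarrow> face_sign x {x, u} = (if u < x then -1 else 1)"
proof -
  assume "u \<noteq> x"
  have "{y \<in> {x, u}. y < x} = (if u < x then {u} else {})" by auto
  then show ?thesis by (simp add: face_sign_def)
qed

text \<open>Vanishing reduced homology in degree 0 makes the difference of two vertices the boundary
  of a 1-chain. Pairing with \<open>f\<close>, read as a 0-cochain, moves the boundary over to
  \<open>f\<close>, whose coboundary vanishes on every edge.\<close>

lemma betti0_connected:
  fixes f :: "'v::linorder \<Rightarrow> 'k::field"
  assumes K: "simplicial_complex K" and b: "betti TYPE('k) K 0 = 0"
    and f: "\<And>a b. a \<noteq> b \<Longrightarrow> {a, b} \<in> K \<Longrightarrow> f a = f b" and uv: "{u} \<in> K" "{v} \<in> K"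
  shows "f u = f v"
proof (cases "u = v")
  case False
  note S = simplicial_complexD[OF K]
  define c :: "'v set \<Rightarrow> 'k" where "c F = (if F = {u} then 1 else if F = {v} then -1 else 0)" for F
  define h :: "'v set \<Rightarrow> 'k" where "h F = (if card F = 1 then f (the_elem F) else 0)" for F
  have cF: "c \<in> FS (faces K 0)" using uv by (auto simp: c_def FS_def faces_def)
  have "boundary K c H = 0" for H
  proof (cases "H = {}")
    case True
    let ?N = "{w. w \<notin> H \<and> insert w H \<in> K}"
    have "boundary K c H = (\<Sum>w\<in>?N. c {w})"
      unfolding boundary_eq[OF S(1)] True by (simp add: face_sign_singleton)
    also have "\<dots> = (\<Sum>w\<in>{u, v}. c {w})"
      by (rule sum.mono_neutral_right) (use finite_cofaces[OF S(1), of H] uv True in \<open>auto simp: c_def\<close>)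
    also have "\<dots> = 0" using False by (simp add: c_def)
    finally show ?thesis .
  next
    case False
    have "H \<notin> faces K (0 - 1)" using False S(3) by (auto simp: faces_def)
    then show ?thesis using boundary_FS[OF K cF] unfolding FS_def by blast
  qed
  then have "c \<in> cycles K 0" using cF by (auto simp: cycles_eq)
  moreover have "boundaries K 0 = (cycles K 0 :: ('v set \<Rightarrow> 'k) set)"
  proof (rule subspace_eq_of_dim[OF finite_faces[OF S(1)] _ subspace_boundaries[OF S(1)] _ subspace_cycles[OF S(1)]])
    show "cycles K 0 \<subseteq> (FS (faces K 0) :: ('v set \<Rightarrow> 'k) set)" by (auto simp: cycles_eq)
    show "boundaries K 0 \<subseteq> (cycles K 0 :: ('v set \<Rightarrow> 'k) set)"
      unfolding boundaries_eq cycles_eq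
      using boundary_FS[OF K, of _ "0 + 1"] boundary_boundary[OF K] by (auto simp: fun_eq_iff)
    show "fs.dim (boundaries K 0 :: ('v set \<Rightarrow> 'k) set) = fs.dim (cycles K 0 :: ('v set \<Rightarrow> 'k) set)"
      using betti_eq[OF K, of 0, where ?'k='k] b by simp
  qed
  ultimately obtain w where w: "w \<in> FS (faces K 1)" "c = boundary K w" by (auto simp: boundaries_eq)
  have "(\<Sum>F\<in>K. h F * c F) = (\<Sum>F\<in>K. coboundary K h F * w F)"
    unfolding w(2) by (rule boundary_coboundary_adjoint[OF K, symmetric])
  also have "\<dots> = 0"
  proof (rule sum.neutral, rule ballI)
    fix F assume F: "F \<in> K"
    show "coboundary K h F * w F = 0"
    proof (cases "card F = 2")
      case True
      then obtain a b where ab: "F = {a, b}" "a < b" by (metis card_2_iff insert_commute linorder_neqE)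
      have "coboundary K h F = face_sign a {a, b} * h {b} + face_sign b {a, b} * h {a}"
        using F ab(1) less_imp_neq[OF ab(2)] by (simp add: coboundary_def insert_Diff_if)
      also have "face_sign a {a, b} = (1 :: 'k)" using ab(2) by (subst face_sign_pair) auto
      also have "face_sign b {a, b} = (- 1 :: 'k)" using ab(2) by (subst insert_commute, subst face_sign_pair) auto
      also have "h {b} = h {a}" using f[of a b] F ab by (simp add: h_def)
      finally show ?thesis by simp
    next
      case False
      then have "F \<notin> faces K 1" by (auto simp: faces_def)
      then show ?thesis using w(1) by (simp add: FS_def)
    qed
  qed
  also have "(\<Sum>F\<in>K. h F * c F) = (\<Sum>F\<in>{{u}, {v}}. h F * c F)"
    by (rule sum.mono_neutral_right) (use S(1) uv in \<open>auto simp: c_def\<close>)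
  also have "\<dots> = f u - f v" using False by (simp add: h_def c_def)
  finally show ?thesis by simp
qed simp

lemma dim_boundaries_bottom:
  assumes K: "simplicial_complex K"
  shows "fs.dim (boundaries K (-2) :: ('v::linorder set \<Rightarrow> 'k::field) set) = 0" "card (faces K (-1)) = 1"
proof -
  have "faces K (- 1 - 1) = {}" by (auto simp: faces_def)
  then have "boundary K c = 0" if "c \<in> FS (faces K (-1))" for c :: "'v set \<Rightarrow> 'k"
    using boundary_FS[OF K that] by (auto simp: FS_def fun_eq_iff)
  then have "boundaries K (-2) \<subseteq> fs.span ({} :: ('v set \<Rightarrow> 'k) set)" by (auto simp: boundaries_eq)
  then show "fs.dim (boundaries K (-2) :: ('v set \<Rightarrow> 'k) set) = 0"
    using fs.dim_le_card[of "boundaries K (-2) :: ('v set \<Rightarrow> 'k) set" "{}"] by simp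
  have "faces K (-1) = {{}}" using simplicial_complexD[OF K] by (auto simp: faces_def)
  then show "card (faces K (-1)) = 1" by simp
qed

text \<open>Alternating sums of the dimensions of cycles and boundaries: a homology 0-sphere has two
  points, and a homology 2-sphere has Euler characteristic 2.\<close>

lemma euler_relations:
  assumes K: "simplicial_complex (K :: 'v::linorder set set)"
  shows "faces K 1 = {} \<Longrightarrow> betti TYPE('k::field) K (-1) = 0 \<Longrightarrow> betti TYPE('k) K 0 = 1 \<Longrightarrow> card (faces K 0) = 2"
    and "faces K 3 = {} \<Longrightarrow> betti TYPE('k) K (-1) = 0 \<Longrightarrow> betti TYPE('k) K 0 = 0 \<Longrightarrow> betti TYPE('k) K 1 = 0 \<Longrightarrow>
      betti TYPE('k) K 2 = 1 \<Longrightarrow> card (faces K 0) + card (faces K 2) = card (faces K 1) + 2"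
proof -
  let ?z = "\<lambda>i. fs.dim (cycles K i :: ('v set \<Rightarrow> 'k) set)" and ?b = "\<lambda>i. fs.dim (boundaries K i :: ('v set \<Rightarrow> 'k) set)"
  have z: "?z (-1) + ?b (-2) = card (faces K (-1))" "?z 0 + ?b (-1) = card (faces K 0)"
    "?z 1 + ?b 0 = card (faces K 1)" "?z 2 + ?b 1 = card (faces K 2)"
    using dim_cycles_boundaries[OF K, of "-1", where ?'k='k] dim_cycles_boundaries[OF K, of 0, where ?'k='k]
      dim_cycles_boundaries[OF K, of 1, where ?'k='k] dim_cycles_boundaries[OF K, of 2, where ?'k='k] by auto
  note b = betti_eq[OF K, where ?'k='k]
  note bot = dim_boundaries_bottom(1)[OF K, where ?'k='k] dim_boundaries_bottom(2)[OF K]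
  have top: "?b 0 = 0" if "faces K 1 = {}"
    using boundaries_top[of K 0, where ?'k='k] that simplicial_complexD(1)[OF K] by simp
  have top2: "?b 2 = 0" if "faces K 3 = {}"
    using boundaries_top[of K 2, where ?'k='k] that simplicial_complexD(1)[OF K] by simp
  show "card (faces K 0) = 2" if "faces K 1 = {}" "betti TYPE('k) K (-1) = 0" "betti TYPE('k) K 0 = 1"
    using z(1,2) b[of "-1"] b[of 0] bot top that by simp
  show "card (faces K 0) + card (faces K 2) = card (faces K 1) + 2"
    if "faces K 3 = {}" "betti TYPE('k) K (-1) = 0" "betti TYPE('k) K 0 = 0" "betti TYPE('k) K 1 = 0" "betti TYPE('k) K 2 = 1"
    using z b[of "-1"] b[of 0] b[of 1] b[of 2] bot top2 that by simp
qed

text \<open>The empty face is among the faces in \<open>sph\<close>, so \<open>K\<close> itself has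
  the homology of a 2-sphere.\<close>

locale sphere2 =
  fixes K :: "'v::linorder set set" and k :: "'k::field itself"
  assumes K: "simplicial_complex K" and sph: "\<And>F. F \<in> K \<Longrightarrow> spherical TYPE('k) K 3 F"
    and card3: "\<And>F. F \<in> K \<Longrightarrow> card F \<le> 3"
begin

lemmas S = simplicial_complexD[OF K]

lemma betti_link: "F \<in> K \<Longrightarrow> betti TYPE('k) (link K F) i = (if i = 2 - int (card F) then 1 else 0)"
  using sph[of F] by (simp add: spherical_def)

abbreviation Tr where "Tr \<equiv> faces K 2"
abbreviation Ed where "Ed \<equiv> faces K 1"
definition N where "N e = {w. w \<notin> e \<and> insert w e \<in> K}"

lemma Tr: "T \<in> Tr \<longleftrightarrow> T \<in> K \<and> card T = 3" and Ed: "e \<in> Ed \<longleftrightarrow> e \<in> K \<and> card e = 2"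
  by (auto simp: faces_def)

lemma edge_two: assumes "e \<in> Ed" shows "card (N e) = 2"
proof -
  have e: "e \<in> K" "card e = 2" using assms by (auto simp: Ed)
  let ?L = "link K e"
  note L = simplicial_complex_link[OF K e(1)]
  have fe: "finite e" using S(3)[OF e(1)] .
  have "faces ?L 1 = {}"
  proof -
    have False if F: "F \<in> ?L" "card F = 2" for F
    proof -
      have "card (F \<union> e) = 4"
        using F e fe simplicial_complexD(3)[OF L F(1)] by (subst card_Un_disjoint) (auto simp: link_def)
      then show False using card3[of "F \<union> e"] F by (simp add: link_def)
    qed
    then show ?thesis by (auto simp: faces_def)
  qed
  then have "card (faces ?L 0) = 2"
    using euler_relations(1)[OF L, where ?'k='k] betti_link[OF e(1)] e(2) by simp
  moreover have "faces ?L 0 = (\<lambda>w. {w}) ` N e"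
  proof (intro equalityI subsetI)
    fix F assume "F \<in> faces ?L 0"
    then have F: "F \<in> ?L" "card F = 1" by (auto simp: faces_def)
    then obtain w where "F = {w}" by (auto simp: card_1_singleton_iff)
    then show "F \<in> (\<lambda>w. {w}) ` N e" using F(1) by (auto simp: N_def link_def)
  qed (auto simp: N_def faces_def link_def)
  ultimately show ?thesis by (simp add: card_image inj_on_def)
qed

lemma tri_edge: assumes "card e = 2" shows "{T \<in> Tr. e \<subseteq> T} = (\<lambda>w. insert w e) ` N e"
proof (intro equalityI subsetI)
  fix T assume T: "T \<in> {T \<in> Tr. e \<subseteq> T}"
  have fT: "finite T" using T S(3) by (auto simp: Tr)
  have "card (T - e) = 1" using T assms by (simp add: card_Diff_subset finite_subset[OF _ fT] Tr)
  then obtain w where "T - e = {w}" by (auto simp: card_1_singleton_iff)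
  then have "T = insert w e" "w \<notin> e" using T by auto
  then show "T \<in> (\<lambda>w. insert w e) ` N e" using T by (auto simp: N_def Tr)
next
  fix T assume "T \<in> (\<lambda>w. insert w e) ` N e"
  then obtain w where w: "w \<notin> e" "insert w e \<in> K" "T = insert w e" by (auto simp: N_def)
  have "finite e" using assms by (simp add: card_ge_0_finite)
  then show "T \<in> {T \<in> Tr. e \<subseteq> T}" using w assms by (auto simp: Tr)
qed

lemma inj_insert: "inj_on (\<lambda>w. insert w e) (N e)"
  by (auto simp: inj_on_def N_def)

lemma deg_Tr: assumes "R \<subseteq> Tr" "card e = 2" shows "deg R e = card {w \<in> N e. insert w e \<in> R}"
proof -
  have "{T \<in> R. e \<subseteq> T} = {T \<in> Tr. e \<subseteq> T} \<inter> R" using assms(1) by blast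
  also have "\<dots> = (\<lambda>w. insert w e) ` {w \<in> N e. insert w e \<in> R}"
    unfolding tri_edge[OF assms(2)] by blast
  finally have "deg R e = card ((\<lambda>w. insert w e) ` {w \<in> N e. insert w e \<in> R})" by (simp only: deg_def)
  also have "\<dots> = card {w \<in> N e. insert w e \<in> R}"
    by (rule card_image, rule inj_on_subset[OF inj_insert]) auto
  finally show ?thesis .
qed

lemma N_empty: assumes "card e = 2" "e \<notin> Ed" shows "N e = {}"
  using assms S(4) by (auto simp: N_def Ed)

lemma fund: obtains b where "b \<noteq> 0" "b \<in> cycles K 2" "\<forall>c\<in>cycles K 2. \<exists>l::'k. c = (\<lambda>x. l * b x)"
proof -
  have "faces K (2 + 1) = {}" using card3 by (force simp: faces_def)
  then have "fs.dim (cycles K 2 :: ('v set \<Rightarrow> 'k) set) = 1"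
    using boundaries_top[of K 2, where ?'k='k] S(1) betti_eq[OF K, of 2, where ?'k='k] betti_link[OF S(2)]
    by (simp add: link_empty)
  then obtain B where B: "B \<subseteq> (cycles K 2 :: ('v set \<Rightarrow> 'k) set)" "fs.independent B"
    "cycles K 2 \<subseteq> fs.span B" "card B = 1"
    using fs.basis_exists[of "cycles K 2 :: ('v set \<Rightarrow> 'k) set"] by metis
  then obtain b where b: "B = {b}" by (auto simp: card_1_singleton_iff)
  have "b \<noteq> 0" using B(2) b by (metis fs.dependent_single)
  moreover have "\<exists>l::'k. c = (\<lambda>x. l * b x)" if "c \<in> cycles K 2" for c
    using B(3) that b by (auto simp: fs.span_singleton)
  ultimately show ?thesis using that[of b] B(1) b by blast
qed

lemma boundary_edge:
  assumes e: "e \<in> Ed" obtains w1 w2 where "w1 \<noteq> w2" "N e = {w1, w2}"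
    "\<And>c :: 'v set \<Rightarrow> 'k. boundary K c e = face_sign w1 (insert w1 e) * c (insert w1 e) + face_sign w2 (insert w2 e) * c (insert w2 e)"
proof -
  obtain w1 w2 where w: "w1 \<noteq> w2" "N e = {w1, w2}" using edge_two[OF e] by (auto simp: card_2_iff)
  moreover have "boundary K c e = face_sign w1 (insert w1 e) * c (insert w1 e) + face_sign w2 (insert w2 e) * c (insert w2 e)" for c :: "'v set \<Rightarrow> 'k"
    unfolding boundary_eq[OF S(1)] w(2)[unfolded N_def] using w(1) by simp
  ultimately show ?thesis using that by blast
qed

lemma face_sign_nonzero: "face_sign v F \<noteq> (0::'k)"
  by (simp add: face_sign_def)

lemma cycle2I:
  fixes c :: "'v set \<Rightarrow> 'k"
  assumes "c \<in> FS Tr" "\<And>e. e \<in> Ed \<Longrightarrow> boundary K c e = 0" shows "c \<in> cycles K 2"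
proof -
  have "boundary K c e = 0" for e
  proof (cases "e \<in> Ed")
    case False
    have "boundary K c \<in> FS (faces K (2 - 1))" by (rule boundary_FS[OF K assms(1)])
    then show ?thesis using False by (simp add: FS_def)
  qed (rule assms(2))
  then show ?thesis using assms(1) by (auto simp: cycles_eq)
qed

text \<open>Let \<open>Q\<close> be the support of a generator \<open>b\<close> of the top cycles.
  An edge lies in two triangles, so the coefficients of \<open>b\<close> on them vanish together;
  connectedness of the vertex links and of \<open>K\<close> then makes \<open>Q\<close> all of
  \<open>Tr\<close>. A subset that is a cycle modulo 2 contains both or none of the triangles at
  each edge, so the restriction of \<open>b\<close> to it is a cycle over \<open>k\<close>, hence a
  multiple of \<open>b\<close>. This passes from coefficients in \<open>k\<close> to parity in any
  characteristic.\<close>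

lemma circuit_Tr: "circuit Tr" "\<Union>Tr = vertices K"
proof -
  obtain b :: "'v set \<Rightarrow> 'k" where b: "b \<noteq> 0" "b \<in> cycles K 2" "\<forall>c\<in>cycles K 2. \<exists>l. c = (\<lambda>x. l * b x)"
    by (rule fund)
  have bF: "b \<in> FS Tr" "\<And>e. boundary K b e = 0" using b(2) by (auto simp: cycles_eq)
  define Q where "Q = {T \<in> Tr. b T \<noteq> 0}"
  have both: "T' \<in> Q" if T: "T \<in> Q" "T' \<in> Tr" "e \<subseteq> T" "e \<subseteq> T'" "card e = 2" for T T' e
  proof -
    have TT: "T \<in> Tr" using T by (auto simp: Q_def)
    have eE: "e \<in> Ed" using T S(4) by (auto simp: Tr Ed)
    obtain w1 w2 where w: "w1 \<noteq> w2" "N e = {w1, w2}"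
      "\<And>c :: 'v set \<Rightarrow> 'k. boundary K c e = face_sign w1 (insert w1 e) * c (insert w1 e) + face_sign w2 (insert w2 e) * c (insert w2 e)"
      using boundary_edge[OF eE] by blast
    have "T \<in> {insert w1 e, insert w2 e}" "T' \<in> {insert w1 e, insert w2 e}"
      using tri_edge[OF T(5)] w(2) T TT by auto
    moreover have "b (insert w1 e) = 0 \<longleftrightarrow> b (insert w2 e) = 0"
      using bF(2)[of e] w(3)[of b] face_sign_nonzero[of w1 "insert w1 e"] face_sign_nonzero[of w2 "insert w2 e"]
      by (auto simp: add_eq_0_iff)
    ultimately show ?thesis using T by (auto simp: Q_def)
  qed
  have QT: "Q \<subseteq> Tr" by (auto simp: Q_def)
  have Qne: "Q \<noteq> {}"
  proof -
    obtain T where "b T \<noteq> 0" using b(1) by (auto simp: fun_eq_iff)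
    then have "T \<in> Q" using bF(1) unfolding Q_def FS_def by blast
    then show ?thesis by blast
  qed
  have finTr: "finite Tr" by (rule finite_faces[OF S(1)])
  have zTr: "z2cycle Tr"
    unfolding z2cycle_def
  proof (intro conjI ballI allI impI)
    fix e :: "'v set" assume e: "card e = 2"
    have "deg Tr e = card (N e)"
      unfolding deg_def tri_edge[OF e] by (rule card_image[OF inj_insert])
    then show "even (deg Tr e)" using edge_two[of e] N_empty[OF e] by (cases "e \<in> Ed") auto
  qed (use finTr in \<open>auto simp: Tr\<close>)
  \<comment> \<open>The link of \<open>v\<close> is connected, and membership in \<open>Q\<close>
    spreads along its edges from one triangle at \<open>v\<close> to the next.\<close>
  have star: "T \<in> Q" if v: "v \<in> \<Union>Q" and T: "T \<in> Tr" "v \<in> T" for v T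
  proof -
    have vK: "{v} \<in> K" using T S(4) by (auto simp: Tr)
    let ?L = "link K {v}"
    note L = simplicial_complex_link[OF K vK]
    define f :: "'v \<Rightarrow> 'k" where "f a = (if \<exists>T\<in>Q. v \<in> T \<and> a \<in> T then 1 else 0)" for a
    have step: "\<exists>T\<in>Q. v \<in> T \<and> b \<in> T" if ab: "{a, b} \<in> ?L" "a \<noteq> b" "\<exists>T\<in>Q. v \<in> T \<and> a \<in> T" for a b
    proof -
      obtain T where T: "T \<in> Q" "v \<in> T" "a \<in> T" using ab(3) by blast
      have "{v, a, b} \<in> K" "v \<noteq> a" "v \<noteq> b" using ab(1) by (auto simp: link_def insert_commute)
      then have "{v, a, b} \<in> Tr" "card {v, a} = 2" using ab(2) by (auto simp: Tr)
      then have "{v, a, b} \<in> Q" using both[OF T(1), of "{v, a, b}" "{v, a}"] T by simp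
      then show ?thesis by blast
    qed
    have const: "f a = f b" if "{a} \<in> ?L" "{b} \<in> ?L" for a b
    proof (rule betti0_connected[OF L _ _ that])
      show "betti TYPE('k) ?L 0 = 0" using betti_link[OF vK] by simp
      show "f a = f b" if "a \<noteq> b" "{a, b} \<in> ?L" for a b
        using step[of a b] step[of b a] that by (auto simp: f_def insert_commute)
    qed
    obtain T0 where T0: "T0 \<in> Q" "v \<in> T0" using v by blast
    have other: "\<exists>a. a \<in> R \<and> a \<noteq> v \<and> {a} \<in> ?L" if R: "R \<in> Tr" "v \<in> R" for R
    proof -
      have "card (R - {v}) = 2" using R by (simp add: Tr)
      then obtain a where a: "a \<in> R - {v}" unfolding card_2_iff by blast
      then have "{a, v} \<in> K" using R S(4)[of R "{a, v}"] by (auto simp: Tr)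
      then have "{a} \<in> ?L" using a by (auto simp: link_def insert_commute)
      then show ?thesis using a by blast
    qed
    obtain a0 where a0: "a0 \<in> T0" "a0 \<noteq> v" "{a0} \<in> ?L" using other[of T0] T0 QT by blast
    obtain a where a: "a \<in> T" "a \<noteq> v" "{a} \<in> ?L" using other[OF T] by blast
    have "f a0 = 1" using T0 a0 by (auto simp: f_def)
    then have "f a = 1" using const[OF a0(3) a(3)] by simp
    then obtain R where R: "R \<in> Q" "v \<in> R" "a \<in> R" by (auto simp: f_def split: if_splits)
    show ?thesis using both[OF R(1) T(1), of "{v, a}"] R T a by simp
  qed
  have edge_tri: "\<exists>T\<in>Tr. e \<subseteq> T" if eE: "e \<in> Ed" for e
  proof -
    obtain w where "w \<in> N e" using edge_two[OF eE] unfolding card_2_iff by blast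
    moreover have "card e = 2" using eE by (simp add: Ed)
    ultimately have "insert w e \<in> {T \<in> Tr. e \<subseteq> T}" unfolding tri_edge[OF \<open>card e = 2\<close>] by (intro imageI)
    then show ?thesis by blast
  qed
  have allv: "v \<in> \<Union>Q" if v: "v \<in> vertices K" for v
  proof -
    define f :: "'v \<Rightarrow> 'k" where "f a = (if a \<in> \<Union>Q then 1 else 0)" for a
    have step: "b \<in> \<Union>Q" if ab: "a \<noteq> b" "{a, b} \<in> K" "a \<in> \<Union>Q" for a b
    proof -
      have "{a, b} \<in> Ed" using ab by (simp add: Ed)
      then obtain T where "T \<in> Tr" "{a, b} \<subseteq> T" using edge_tri by blast
      then show ?thesis using star[OF ab(3), of T] by blast
    qed
    obtain T u where T: "T \<in> Q" "u \<in> T"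
    proof -
      obtain T where "T \<in> Q" using Qne by blast
      then have "T \<noteq> {}" using QT by (auto simp: Tr)
      then show ?thesis using that \<open>T \<in> Q\<close> by blast
    qed
    have "T \<in> K" using T(1) QT by (auto simp: Tr)
    then have uK: "{u} \<in> K" using S(4)[of T "{u}"] T(2) by simp
    have "f u = f v"
    proof (rule betti0_connected[OF K _ _ uK])
      show "betti TYPE('k) K 0 = 0" using betti_link[OF S(2)] by (simp add: link_empty)
      show "f a = f b" if "a \<noteq> b" "{a, b} \<in> K" for a b
        using step[of a b] step[of b a] that by (auto simp: f_def insert_commute)
      show "{v} \<in> K" using v by (simp add: vertices_def)
    qed
    then show ?thesis using T by (auto simp: f_def split: if_splits)
  qed
  have QTr: "Q = Tr"
  proof
    show "Tr \<subseteq> Q"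
    proof
      fix T assume T: "T \<in> Tr"
      then have "T \<noteq> {}" by (auto simp: Tr)
      then obtain v where v: "v \<in> T" by blast
      then have "v \<in> vertices K" using T S(4) by (auto simp: Tr vertices_def)
      then show "T \<in> Q" using star[OF allv T v] by blast
    qed
  qed (rule QT)
  show "\<Union>Tr = vertices K"
    using allv QTr S(4) by (auto simp: vertices_def Tr)
  show "circuit Tr"
    unfolding circuit_def
  proof (intro conjI allI impI zTr)
    show "Tr \<noteq> {}" using Qne QTr by simp
    fix R assume R: "R \<subseteq> Tr" "z2cycle R"
    define c where "c T = (if T \<in> R then b T else 0)" for T
    have "c \<in> cycles K 2"
    proof (rule cycle2I)
      show "c \<in> FS Tr" using R(1) by (auto simp: c_def FS_def)
      fix e assume e: "e \<in> Ed"
      obtain w1 w2 where w: "w1 \<noteq> w2" "N e = {w1, w2}"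
        "\<And>c :: 'v set \<Rightarrow> 'k. boundary K c e = face_sign w1 (insert w1 e) * c (insert w1 e) + face_sign w2 (insert w2 e) * c (insert w2 e)"
        using boundary_edge[OF e] by blast
      have "even (card {w \<in> {w1, w2}. insert w e \<in> R})"
      proof -
        have ce: "card e = 2" using e by (simp add: Ed)
        show ?thesis using z2cycleD(4)[OF R(2) ce] unfolding deg_Tr[OF R(1) ce] w(2) .
      qed
      moreover have "{w \<in> {w1, w2}. insert w e \<in> R} = (if insert w1 e \<in> R then {w1} else {}) \<union> (if insert w2 e \<in> R then {w2} else {})"
        by auto
      ultimately have "insert w1 e \<in> R \<longleftrightarrow> insert w2 e \<in> R" using w(1) by (auto split: if_splits)
      then show "boundary K c e = 0" using w(3)[of c] w(3)[of b] bF(2)[of e] by (auto simp: c_def)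
    qed
    then obtain l where l: "c = (\<lambda>x. l * b x)" using b(3) by blast
    have bT: "b T \<noteq> 0" if "T \<in> Tr" for T using QTr that by (auto simp: Q_def)
    have "T \<in> R \<longleftrightarrow> l \<noteq> 0" if "T \<in> Tr" for T
      using fun_cong[OF l, of T] bT[OF that] by (auto simp: c_def split: if_splits)
    then show "R = {} \<or> R = Tr" using R(1) by blast
  qed
qed

lemma adj_Tr: "adj Tr u v \<longleftrightarrow> u \<noteq> v \<and> {u, v} \<in> K"
proof
  assume uv: "u \<noteq> v \<and> {u, v} \<in> K"
  then have e: "{u, v} \<in> Ed" "card {u, v} = 2" by (simp_all add: Ed)
  then obtain w where "w \<in> N {u, v}" using edge_two[OF e(1)] unfolding card_2_iff by blast
  then have "insert w {u, v} \<in> {T \<in> Tr. {u, v} \<subseteq> T}" unfolding tri_edge[OF e(2)] by (rule imageI)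
  then have "insert w {u, v} \<in> Tr" by simp
  then show "adj Tr u v" using uv unfolding adj_def by (intro conjI bexI[of _ "insert w {u, v}"]) auto
qed (use S(4) in \<open>auto simp: adj_def Tr\<close>)

text \<open>Each edge lies in two triangles and each triangle has three edges, so
  \<open>2 f_1 = 3 f_2\<close>; Euler's formula turns this into
  \<open>f_1 = 3 f_0 - 6\<close>.\<close>

lemma edge_count: "card Ed + 6 = 3 * card (vertices K)"
proof -
  have fin: "finite Tr" "finite Ed" using finite_faces[OF S(1)] by auto
  have "(\<Sum>e\<in>Ed. \<Sum>T\<in>Tr. if e \<subseteq> T then 1 else 0) = (\<Sum>e\<in>Ed. 2 :: nat)"
  proof (rule sum.cong[OF refl])
    fix e assume e: "e \<in> Ed"
    have "(\<Sum>T\<in>Tr. if e \<subseteq> T then 1 else 0) = card {T \<in> Tr. e \<subseteq> T}" using fin by (simp add: sum.If_cases Int_def)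
    also have "\<dots> = 2" using tri_edge[of e] edge_two[OF e] e card_image[OF inj_insert, of e] by (simp add: Ed)
    finally show "(\<Sum>T\<in>Tr. if e \<subseteq> T then 1 else 0) = (2::nat)" .
  qed
  moreover have "(\<Sum>T\<in>Tr. \<Sum>e\<in>Ed. if e \<subseteq> T then 1 else 0) = (\<Sum>T\<in>Tr. 3 :: nat)"
  proof (rule sum.cong[OF refl])
    fix T assume T: "T \<in> Tr"
    have "(\<Sum>e\<in>Ed. if e \<subseteq> T then 1 else 0) = card {e \<in> Ed. e \<subseteq> T}" using fin by (simp add: sum.If_cases Int_def)
    also have "{e \<in> Ed. e \<subseteq> T} = {e. e \<subseteq> T \<and> card e = 2}" using T S(4) by (auto simp: Ed Tr)
    also have "card \<dots> = 3" using n_subsets[of T 2] T S(3) by (simp add: Tr numeral_3_eq_3 numeral_2_eq_2)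
    finally show "(\<Sum>e\<in>Ed. if e \<subseteq> T then 1 else 0) = (3::nat)" .
  qed
  moreover have "(\<Sum>e\<in>Ed. \<Sum>T\<in>Tr. if e \<subseteq> T then 1 else 0 :: nat) = (\<Sum>T\<in>Tr. \<Sum>e\<in>Ed. if e \<subseteq> T then 1 else 0)"
    by (rule sum.swap)
  ultimately have 23: "2 * card Ed = 3 * card Tr" by simp
  have "faces K 3 = {}" using card3 by (force simp: faces_def)
  then have "card (faces K 0) + card Tr = card Ed + 2"
    using betti_link[OF S(2)] by (intro euler_relations(2)[OF K, where ?'k='k]) (simp_all add: link_empty)
  moreover have "faces K 0 = (\<lambda>v. {v}) ` vertices K"
    by (auto simp: faces_def vertices_def card_1_singleton_iff)
  then have "card (faces K 0) = card (vertices K)" by (simp add: card_image inj_on_def)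
  ultimately show ?thesis using 23 by simp
qed

end

section \<open>Stresses of a homology 2-sphere\<close>

context sphere2
begin

text \<open>Motions are the kernel of \<open>R\<close> on \<open>4 f_0\<close> unknowns, and
  rigidity bounds its dimension by 6, that of the space of forms. The rank is thus at least
  \<open>4 f_0 - 6\<close>, which equals the number \<open>f_0 + f_1\<close> of equations. So the
  equations are independent, and a stress is a relation among them.\<close>

lemma stress_free:
  fixes p :: "'v \<Rightarrow> nat \<Rightarrow> 'k" and s :: "'v + 'v set \<Rightarrow> 'k"
  assumes rig: "rigid (vertices K) (adj Tr) p"
    and sF: "s \<in> FS (Inl ` vertices K \<union> Inr ` Ed)"
    and s: "\<And>u j. u \<in> vertices K \<Longrightarrow> j < 4 \<Longrightarrow>
      s (Inl u) * p u j + (\<Sum>e | e \<in> Ed \<and> u \<in> e. s (Inr e) * (\<Sum>v\<in>e - {u}. p v j)) = 0"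
  shows "s = 0"
proof -
  let ?V = "vertices K"
  have finV: "finite ?V"
    by (rule inj_on_finite[of "\<lambda>v. {v}" _ K]) (use S(1) in \<open>auto simp: vertices_def inj_on_def\<close>)
  have finE: "finite Ed" by (rule finite_faces[OF S(1)])
  let ?Y = "Inl ` ?V \<union> Inr ` Ed" and ?X = "?V \<times> {..<4::nat}"
  have finY: "finite ?Y" "finite ?X" using finV finE by auto
  have cardY: "card ?Y = card ?V + card Ed"
    using finV finE by (subst card_Un_disjoint) (auto simp: card_image)
  define R where "R m y = (case y of Inl u \<Rightarrow> if u \<in> ?V then dot 4 (\<lambda>j. m (u, j)) (p u) else 0
      | Inr e \<Rightarrow> if e \<in> Ed then (\<Sum>u\<in>e. \<Sum>v\<in>e - {u}. dot 4 (\<lambda>j. m (u, j)) (p v)) else 0)"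
    for m :: "'v \<times> nat \<Rightarrow> 'k" and y :: "'v + 'v set"
  have R: "lin R"
    by (rule linI) (auto simp: R_def fun_eq_iff dot_add dot_scale sum.distrib sum_distrib_left split: sum.split)
  define \<Phi> where "\<Phi> A x = (if x \<in> ?X then ctr 4 (p (fst x)) A (snd x) else 0)"
    for A :: "nat \<times> nat \<Rightarrow> 'k" and x :: "'v \<times> nat"
  have \<Phi>: "lin \<Phi>"
    by (rule linI) (auto simp: \<Phi>_def fun_eq_iff ctr_add ctr_scale plus_fun_def)
  have "{m \<in> FS ?X. R m = 0} \<subseteq> \<Phi> ` FS (pairs 4)"
  proof
    fix m assume m: "m \<in> {m \<in> FS ?X. R m = 0}"
    have "motion ?V (adj Tr) p (\<lambda>u j. m (u, j))"
      unfolding motion_def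
    proof (intro conjI ballI impI)
      show "dot 4 (\<lambda>j. m (u, j)) (p u) = 0" if "u \<in> ?V" for u
      proof -
        have "R m (Inl u) = 0" using m by simp
        then show ?thesis using that by (simp add: R_def)
      qed
      show "dot 4 (\<lambda>j. m (u, j)) (p v) + dot 4 (\<lambda>j. m (v, j)) (p u) = 0"
        if "u \<in> ?V" "v \<in> ?V" "adj Tr u v" for u v
      proof -
        have uv: "u \<noteq> v" "{u, v} \<in> Ed" using that(3) by (auto simp: adj_Tr Ed)
        have "R m (Inr {u, v}) = 0" using m by simp
        then show ?thesis using uv by (simp add: R_def insert_Diff_if)
      qed
    qed
    then obtain A where A: "A \<in> FS (pairs 4)" "\<forall>u\<in>?V. \<forall>j<4. m (u, j) = ctr 4 (p u) A j"
      using rig unfolding rigid_def by blast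
    have "m = \<Phi> A"
    proof
      fix x :: "'v \<times> nat"
      show "m x = \<Phi> A x"
      proof (cases "x \<in> ?X")
        case True
        then show ?thesis using A(2) by (auto simp: \<Phi>_def)
      next
        case False
        then have "m x = 0" using m unfolding FS_def by blast
        then show ?thesis using False by (simp add: \<Phi>_def)
      qed
    qed
    then show "m \<in> \<Phi> ` FS (pairs 4)" using A(1) by blast
  qed
  then have "fs.dim {m \<in> FS ?X. R m = 0} \<le> fs.dim (\<Phi> ` FS (pairs 4))"
    by (rule dim_mono[OF finY(2), rotated]) (auto simp: \<Phi>_def FS_def)
  also have "\<dots> \<le> fs.dim (FS (pairs 4) :: (nat \<times> nat \<Rightarrow> 'k) set)"
    by (rule dim_inj_le[OF finite_pairs order_refl subspace_FS \<Phi>])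
  also have "\<dots> = 6" 
    using dim_FS[OF finite_pairs[of 4], where ?'k='k] by (simp add: card_pairs choose_two)
  finally have ker: "fs.dim {m \<in> FS ?X. R m = 0} \<le> 6" .
  have img: "4 * card ?V = fs.dim {m \<in> FS ?X. R m = 0} + fs.dim (R ` FS ?X)"
    using rank_nullity[OF finY(2) order_refl subspace_FS R] dim_FS[OF finY(2), where ?'k='k]
    by (simp add: card_cartesian_product)
  have sub: "R ` FS ?X \<subseteq> FS ?Y" by (auto simp: R_def FS_def split: sum.split)
  let ?P = "{f \<in> FS ?Y. \<forall>n\<in>R ` FS ?X. (\<Sum>y\<in>?Y. n y * f y) = 0}"
  have "fs.dim ?P + fs.dim (R ` FS ?X) = card ?V + card Ed"
    using dim_perp[OF finY(1) sub] cardY by simp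
  then have P0: "fs.dim ?P = 0" using img ker edge_count by simp
  \<comment> \<open>The left-hand sides of the stress equations are the coefficients of the entries
    of \<open>m\<close> in this sum, so \<open>s\<close> annihilates the image of
    \<open>R\<close>.\<close>
  have "(\<Sum>y\<in>?Y. R m y * s y) = 0" for m
  proof -
    have "(\<Sum>y\<in>?Y. R m y * s y) = (\<Sum>y\<in>Inl ` ?V. R m y * s y) + (\<Sum>y\<in>Inr ` Ed. R m y * s y)"
      by (rule sum.union_disjoint) (use finV finE in auto)
    also have "(\<Sum>y\<in>Inl ` ?V. R m y * s y) = (\<Sum>u\<in>?V. dot 4 (\<lambda>j. m (u, j)) (p u) * s (Inl u))"
      by (subst sum.reindex) (auto simp: R_def)
    also have "(\<Sum>y\<in>Inr ` Ed. R m y * s y)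
        = (\<Sum>e\<in>Ed. \<Sum>u\<in>e. (\<Sum>v\<in>e - {u}. dot 4 (\<lambda>j. m (u, j)) (p v)) * s (Inr e))"
      by (subst sum.reindex) (auto simp: R_def sum_distrib_right)
    also have "\<dots> = (\<Sum>e\<in>Ed. \<Sum>u | u \<in> ?V \<and> u \<in> e. (\<Sum>v\<in>e - {u}. dot 4 (\<lambda>j. m (u, j)) (p v)) * s (Inr e))"
    proof (rule sum.cong[OF refl])
      fix e assume "e \<in> Ed"
      then have "{u. u \<in> ?V \<and> u \<in> e} = e" using S(4) by (auto simp: Ed vertices_def)
      then show "(\<Sum>u\<in>e. (\<Sum>v\<in>e - {u}. dot 4 (\<lambda>j. m (u, j)) (p v)) * s (Inr e))
          = (\<Sum>u | u \<in> ?V \<and> u \<in> e. (\<Sum>v\<in>e - {u}. dot 4 (\<lambda>j. m (u, j)) (p v)) * s (Inr e))" by simp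
    qed
    also have "\<dots> = (\<Sum>u\<in>?V. \<Sum>e | e \<in> Ed \<and> u \<in> e. (\<Sum>v\<in>e - {u}. dot 4 (\<lambda>j. m (u, j)) (p v)) * s (Inr e))"
      by (rule sum.swap_restrict[OF finE finV])
    also have "(\<Sum>u\<in>?V. dot 4 (\<lambda>j. m (u, j)) (p u) * s (Inl u)) + \<dots>
        = (\<Sum>u\<in>?V. \<Sum>j<4. m (u, j) * (s (Inl u) * p u j + (\<Sum>e | e \<in> Ed \<and> u \<in> e. s (Inr e) * (\<Sum>v\<in>e - {u}. p v j))))"
      unfolding sum.distrib[symmetric]
    proof (rule sum.cong[OF refl])
      fix u
      have 1: "(\<Sum>v\<in>e - {u}. dot 4 (\<lambda>j. m (u, j)) (p v)) * s (Inr e)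
          = (\<Sum>j<4. m (u, j) * (s (Inr e) * (\<Sum>v\<in>e - {u}. p v j)))" for e
      proof -
        have "(\<Sum>v\<in>e - {u}. dot 4 (\<lambda>j. m (u, j)) (p v)) = (\<Sum>j<4. m (u, j) * (\<Sum>v\<in>e - {u}. p v j))"
          unfolding dot_def sum_distrib_left by (rule sum.swap)
        then show ?thesis by (simp add: sum_distrib_right sum_distrib_left algebra_simps)
      qed
      have "(\<Sum>e | e \<in> Ed \<and> u \<in> e. (\<Sum>v\<in>e - {u}. dot 4 (\<lambda>j. m (u, j)) (p v)) * s (Inr e))
          = (\<Sum>j<4. m (u, j) * (\<Sum>e | e \<in> Ed \<and> u \<in> e. s (Inr e) * (\<Sum>v\<in>e - {u}. p v j)))"
        unfolding 1 by (subst sum.swap) (simp only: sum_distrib_left)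
      moreover have "dot 4 (\<lambda>j. m (u, j)) (p u) * s (Inl u) = (\<Sum>j<4. m (u, j) * (s (Inl u) * p u j))"
        unfolding dot_def sum_distrib_right by (intro sum.cong refl) (simp add: ac_simps)
      ultimately show "dot 4 (\<lambda>j. m (u, j)) (p u) * s (Inl u)
          + (\<Sum>e | e \<in> Ed \<and> u \<in> e. (\<Sum>v\<in>e - {u}. dot 4 (\<lambda>j. m (u, j)) (p v)) * s (Inr e))
          = (\<Sum>j<4. m (u, j) * (s (Inl u) * p u j + (\<Sum>e | e \<in> Ed \<and> u \<in> e. s (Inr e) * (\<Sum>v\<in>e - {u}. p v j))))"
        by (simp only: distrib_left sum.distrib)
    qed
    also have "\<dots> = 0" by (intro sum.neutral ballI) (simp add: s)
    finally show ?thesis .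
  qed
  then have "s \<in> ?P" using sF by auto
  then show "s = 0" by (intro dim_zero_iff[OF finY(1) _ P0]) auto
qed

lemma hodge_lin: "hodge (\<lambda>t. \<Sum>x\<in>A. c x * f x t) r = (\<Sum>x\<in>A. c x * hodge (f x) r)"
  by (auto simp: hodge_def sum_negf)

lemma wedge_sum_right: "(\<Sum>x\<in>A. c x * wedge q (f x) t) = wedge q (\<lambda>j. \<Sum>x\<in>A. c x * f x j) t"
  unfolding wedge_def sum_distrib_left sum_subtractf[symmetric] right_diff_distrib
  by (intro sum.cong refl) (simp add: mult.left_commute)

text \<open>The Hodge dual of a form killed by both ends of an edge is a multiple \<open>w\<close>
  of the wedge of the ends. The cycle condition at \<open>u\<close> then says that the sum of the
  neighbours of \<open>u\<close>, weighted by \<open>w\<close>, is parallel to \<open>p u\<close>;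
  the factor of proportionality is the vertex component of a stress with edge components
  \<open>w\<close>.\<close>

lemma form_stress_free:
  assumes inf: "infinite (UNIV :: 'k set)"
  shows "\<exists>p :: 'v \<Rightarrow> nat \<Rightarrow> 'k. \<forall>C\<in>FS (pairs 4 \<times> Ed).
    (\<forall>e\<in>Ed. \<forall>v\<in>e. \<forall>j<4. ctr 4 (p v) (\<lambda>t. C (t, e)) j = 0) \<longrightarrow>
    (\<forall>t\<in>pairs 4. \<forall>u\<in>vertices K. boundary K (\<lambda>e. C (t, e)) {u} = 0) \<longrightarrow> C = 0"
proof -
  obtain p0 :: "'v \<Rightarrow> nat \<Rightarrow> 'k" and T where T: "T \<in> Tr" "indep 4 p0 T" "pinned (\<Union>Tr) (adj Tr) T p0"
    using circuit_rigid[OF inf circuit_Tr(1)] by (elim exE conjE) (rule that)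
  have cT: "card T = 3" "finite T" using T(1) S(3) by (auto simp: Tr)
  have finV: "finite (\<Union>Tr)" using finite_faces[OF S(1)] S(3) by (auto simp: Tr)
  have finE: "finite Ed" by (rule finite_faces[OF S(1)])
  have "generic (\<lambda>p :: 'v \<Rightarrow> nat \<Rightarrow> 'k. indep 4 p T \<and> pinned (\<Union>Tr) (adj Tr) T p \<and> (\<forall>e\<in>Ed. indep 4 p e))"
  proof (intro generic_conj[OF inf] generic_ball[OF inf] generic_indep generic_pinned finV finE)
    show "\<exists>p :: 'v \<Rightarrow> nat \<Rightarrow> 'k. pinned (\<Union>Tr) (adj Tr) T p" by (rule exI[of _ p0], rule T(3))
    show "finite e" "card e \<le> 4" if "e \<in> Ed" for e using that S(3) by (auto simp: Ed)
  qed (use cT in auto)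
  then obtain p :: "'v \<Rightarrow> nat \<Rightarrow> 'k" where p: "indep 4 p T" "pinned (\<Union>Tr) (adj Tr) T p" "\<forall>e\<in>Ed. indep 4 p e"
    unfolding generic_def by (elim conjE exE) (rule that)
  have "rigid (\<Union>Tr) (adj Tr) p"
    using rigid_iff_pinned[of T "\<Union>Tr" p "adj Tr"] T(1) cT(1) p(1,2) by (auto simp: adj_def)
  then have rig: "rigid (vertices K) (adj Tr) p" by (simp only: circuit_Tr(2))
  show ?thesis
  proof (rule exI[of _ p], intro ballI impI)
    fix C :: "(nat \<times> nat) \<times> 'v set \<Rightarrow> 'k"
    assume CF: "C \<in> FS (pairs 4 \<times> Ed)"
      and C: "\<forall>e\<in>Ed. \<forall>v\<in>e. \<forall>j<4. ctr 4 (p v) (\<lambda>t. C (t, e)) j = 0"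
      and bd: "\<forall>t\<in>pairs 4. \<forall>u\<in>vertices K. boundary K (\<lambda>e. C (t, e)) {u} = 0"
    define F where "F e t = C (t, e)" for e t
    have FF: "F e \<in> FS (pairs 4)" for e using CF by (auto simp: F_def FS_def)
    have "\<exists>w. \<forall>a b. a < b \<longrightarrow> e = {a, b} \<longrightarrow> (\<forall>t\<in>pairs 4. hodge (F e) t = w * wedge (p a) (p b) t)" if e: "e \<in> Ed" for e
    proof -
      obtain a b where ab: "e = {a, b}" "a < b" using e by (metis Ed card_2_iff insert_commute linorder_neqE)
      have "indep 4 p {a, b}" using p(3) e ab by simp
      from wedge_nonzero[OF this less_imp_neq[OF ab(2)]]
      obtain s0 where s0: "s0 \<in> pairs 4" "wedge (p a) (p b) s0 \<noteq> 0" by (elim bexE) (rule that)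
      have "ctr 4 (p v) (F e) j = 0" if "v \<in> e" "j < 4" for v j using C[rule_format, OF e that] by (simp only: F_def[abs_def])
      then have "\<exists>w. \<forall>t\<in>pairs 4. hodge (F e) t = w * wedge (p a) (p b) t"
        using ab by (intro hodge_eq_wedge[OF FF _ _ s0]) auto
      then obtain w where w: "\<forall>t\<in>pairs 4. hodge (F e) t = w * wedge (p a) (p b) t" by (elim exE) (rule that)
      show ?thesis
      proof (rule exI[of _ w], intro allI impI)
        fix a' b' assume "a' < b'" "e = {a', b'}"
        then have eq: "a' = a" "b' = b" using ab by (auto simp: doubleton_eq_iff)
        show "\<forall>t\<in>pairs 4. hodge (F e) t = w * wedge (p a') (p b') t" unfolding eq by (rule w)
      qed
    qed
    then have "\<forall>e\<in>Ed. \<exists>w. \<forall>a b. a < b \<longrightarrow> e = {a, b} \<longrightarrow> (\<forall>t\<in>pairs 4. hodge (F e) t = w * wedge (p a) (p b) t)" by (rule ballI)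
    from bchoice[OF this] obtain w where
      w': "\<forall>e\<in>Ed. \<forall>a b. a < b \<longrightarrow> e = {a, b} \<longrightarrow> (\<forall>t\<in>pairs 4. hodge (F e) t = w e * wedge (p a) (p b) t)"
      by (elim exE) (rule that)
    note w = w'[rule_format]
    \<comment> \<open>The orientation sign and the order of the factors of the wedge both depend on
      which vertex is smaller, and the two effects compensate.\<close>
    have signed: "face_sign x {x, u} * hodge (F {x, u}) t = - (w {x, u} * wedge (p u) (p x) t)"
      if "{x, u} \<in> Ed" "x \<noteq> u" "t \<in> pairs 4" for x u t
    proof (cases "u < x")
      case True
      have "hodge (F {x, u}) t = w {x, u} * wedge (p u) (p x) t" using True that by (intro w) auto
      then show ?thesis using True by (subst face_sign_pair) auto
    next
      case False
      then have "x < u" using that(2) by simp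
      have "hodge (F {x, u}) t = w {x, u} * wedge (p x) (p u) t" using \<open>x < u\<close> that by (intro w) auto
      moreover have "wedge (p x) (p u) t = - wedge (p u) (p x) t" by (simp add: wedge_def)
      ultimately show ?thesis using \<open>x < u\<close> by (subst face_sign_pair) auto
    qed
    let ?N = "\<lambda>u. {x. x \<notin> {u} \<and> insert x {u} \<in> K}"
    define Su where "Su u = (\<lambda>j. \<Sum>x\<in>?N u. w {x, u} * p x j)" for u
    have NE: "{x, u} \<in> Ed" "x \<noteq> u" if "x \<in> ?N u" for x u using that by (auto simp: Ed)
    have par: "wedge (p u) (Su u) t = 0" if u: "u \<in> vertices K" and t: "t \<in> pairs 4" for u t
    proof -
      have "0 = hodge (\<lambda>t. \<Sum>x\<in>?N u. face_sign x (insert x {u}) * F (insert x {u}) t) t"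
      proof -
        have "(\<Sum>x\<in>?N u. face_sign x (insert x {u}) * F (insert x {u}) r) = 0" if "r \<in> pairs 4" for r
          using bd[rule_format, OF that u] by (simp only: boundary_eq[OF S(1)] F_def)
        then show ?thesis by (auto simp: hodge_def pairs_4)
      qed
      also have "\<dots> = (\<Sum>x\<in>?N u. face_sign x {x, u} * hodge (F {x, u}) t)" by (rule hodge_lin)
      also have "\<dots> = (\<Sum>x\<in>?N u. - (w {x, u} * wedge (p u) (p x) t))"
      proof (rule sum.cong[OF refl])
        fix x assume x: "x \<in> ?N u"
        show "face_sign x {x, u} * hodge (F {x, u}) t = - (w {x, u} * wedge (p u) (p x) t)"
          by (rule signed[OF NE[OF x] t])
      qed
      also have "\<dots> = - wedge (p u) (Su u) t"
        by (simp only: sum_negf wedge_sum_right Su_def)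
      finally show ?thesis by simp
    qed
    have par2: "p u k * Su u l = p u l * Su u k" if "u \<in> vertices K" "k < 4" "l < 4" for u k l
    proof (cases k l rule: linorder_cases)
      case less
      then show ?thesis using par[of u "(k, l)"] that by (simp add: pairs_def wedge_def)
    next
      case greater
      then show ?thesis using par[of u "(l, k)"] that by (simp add: pairs_def wedge_def)
    qed simp
    have nz: "\<exists>k<4. p u k \<noteq> 0" if u: "u \<in> vertices K" for u
    proof -
      have "u \<in> \<Union>Tr" using u circuit_Tr(2) by simp
      then obtain R where R: "R \<in> Tr" "u \<in> R" by blast
      then have "card (R - {u}) = 2" by (simp add: Tr)
      then obtain x where x: "x \<in> R - {u}" unfolding card_2_iff by blast
      then have "{u, x} \<in> Ed" using R S(4)[of R "{u, x}"] by (auto simp: Ed Tr)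
      then have "indep 4 p {u, x}" using p(3) by blast
      moreover have "u \<noteq> x" using x by blast
      ultimately have "\<exists>t\<in>pairs 4. wedge (p u) (p x) t \<noteq> 0" by (rule wedge_nonzero)
      then obtain t where "t \<in> pairs 4" "wedge (p u) (p x) t \<noteq> 0" by (elim bexE) (rule that)
      then have "fst t < 4" "snd t < 4" "p u (fst t) \<noteq> 0 \<or> p u (snd t) \<noteq> 0" by (auto simp: wedge_def pairs_def)
      then show ?thesis by blast
    qed
    have "\<exists>l. \<forall>j<4. l * p u j + Su u j = 0" if u: "u \<in> vertices K" for u
    proof -
      obtain k where k: "k < 4" "p u k \<noteq> 0" using nz[OF u] by blast
      have "(- Su u k / p u k) * p u j + Su u j = 0" if "j < 4" for j
        using par2[OF u k(1) that] k(2) by (simp add: field_simps)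
      then show ?thesis by (intro exI[of _ "- Su u k / p u k"]) simp
    qed
    then have "\<forall>u\<in>vertices K. \<exists>l. \<forall>j<4. l * p u j + Su u j = 0" by (rule ballI)
    from bchoice[OF this] obtain l where l': "\<forall>u\<in>vertices K. \<forall>j<4. l u * p u j + Su u j = 0"
      by (elim exE) (rule that)
    note l = l'[rule_format]
    define s where "s y = (case y of Inl u \<Rightarrow> if u \<in> vertices K then l u else 0 | Inr e \<Rightarrow> if e \<in> Ed then w e else 0)" for y
    have "s = 0"
    proof (rule stress_free[OF rig])
      show "s \<in> FS (Inl ` vertices K \<union> Inr ` Ed)" by (auto simp: s_def FS_def split: sum.split)
      fix u j assume u: "u \<in> vertices K" and j: "j < (4::nat)"
      have "{e. e \<in> Ed \<and> u \<in> e} = (\<lambda>x. insert x {u}) ` ?N u"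
      proof (intro equalityI subsetI)
        fix e assume e: "e \<in> {e. e \<in> Ed \<and> u \<in> e}"
        then obtain a b where "e = {a, b}" "a \<noteq> b" "e \<in> K" by (auto simp: Ed card_2_iff)
        then show "e \<in> (\<lambda>x. insert x {u}) ` ?N u" using e by (auto simp: insert_commute image_iff)
      next
        fix e assume "e \<in> (\<lambda>x. insert x {u}) ` ?N u"
        then obtain x where x: "e = insert x {u}" "x \<in> ?N u" by (rule imageE)
        show "e \<in> {e. e \<in> Ed \<and> u \<in> e}" using NE(1)[OF x(2)] by (simp add: x(1))
      qed
      note nbr = this
      have "(\<Sum>e | e \<in> Ed \<and> u \<in> e. s (Inr e) * (\<Sum>v\<in>e - {u}. p v j))
          = (\<Sum>x\<in>?N u. s (Inr (insert x {u})) * (\<Sum>v\<in>insert x {u} - {u}. p v j))"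
        by (rule sum.reindex_cong[OF _ nbr refl]) (auto simp: inj_on_def doubleton_eq_iff)
      also have "\<dots> = Su u j"
        unfolding Su_def
      proof (rule sum.cong[OF refl])
        fix x assume x: "x \<in> ?N u"
        have "insert x {u} - {u} = {x}" using NE(2)[OF x] by auto
        then show "s (Inr (insert x {u})) * (\<Sum>v\<in>insert x {u} - {u}. p v j) = w {x, u} * p x j"
          using NE(1)[OF x] by (simp add: s_def)
      qed
      finally show "s (Inl u) * p u j + (\<Sum>e | e \<in> Ed \<and> u \<in> e. s (Inr e) * (\<Sum>v\<in>e - {u}. p v j)) = 0"
        using l[OF u j] u by (simp add: s_def)
    qed
    then have s0: "s y = 0" for y by (rule fun_cong[THEN trans]) simp
    have w0: "w e = 0" if "e \<in> Ed" for e using s0[of "Inr e"] that by (simp add: s_def)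
    show "C = 0"
    proof
      fix te :: "(nat \<times> nat) \<times> 'v set"
      obtain t e where te: "te = (t, e)" by (cases te)
      show "C te = 0 te"
      proof (cases "e \<in> Ed")
        case True
        obtain a b where ab: "e = {a, b}" "a < b" using True by (metis Ed card_2_iff insert_commute linorder_neqE)
        have "F e = (\<lambda>_. 0)" using w[OF True ab(2,1)] w0[OF True] by (intro hodge_zero[OF FF]) simp
        then have "F e t = 0" by (rule fun_cong)
        then show ?thesis by (simp add: te F_def)
      next
        case False
        then have "te \<notin> pairs 4 \<times> Ed" by (simp add: te)
        then have "C te = 0" using CF unfolding FS_def by blast
        then show ?thesis by simp
      qed
    qed
  qed
qed

end

section \<open>Vanishing of cycles of forms\<close>

lemma generic_coordinate_nonzero: "generic (\<lambda>p :: 'v \<Rightarrow> nat \<Rightarrow> 'k::field. p v i \<noteq> 0)"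
  unfolding generic_def
proof (intro conjI allI impI)
  show "\<exists>p :: 'v \<Rightarrow> nat \<Rightarrow> 'k. p v i \<noteq> 0" by (rule exI[of _ "\<lambda>_ _. 1"]) simp
  fix p q :: "'v \<Rightarrow> nat \<Rightarrow> 'k" assume p: "p v i \<noteq> 0"
  have "t = - p v i / q v i" if t: "p v i + t * q v i = 0" for t
  proof -
    have "q v i \<noteq> 0" using t p by auto
    then show ?thesis using t by (simp add: field_simps add_eq_0_iff)
  qed
  then have "{t. \<not> p v i + t * q v i \<noteq> 0} \<subseteq> {- p v i / q v i}" by blast
  then show "finite {t. \<not> p v i + t * q v i \<noteq> 0}" by (rule finite_subset) simp
qed

text \<open>The vanishing statement for the link of \<open>G\<close>, with forms that the points of
  \<open>G\<close> kill as well. For \<open>n = card G + 4\<close> and independent points of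
  \<open>G\<close>, dividing by their span leaves \<open>k\<^sup>4\<close>.\<close>

definition link_stress_free :: "nat \<Rightarrow> 'v::linorder set set \<Rightarrow> 'v set \<Rightarrow> ('v \<Rightarrow> nat \<Rightarrow> 'k::field) \<Rightarrow> bool" where
  "link_stress_free n \<Delta> G p \<longleftrightarrow> (\<forall>C\<in>FS (pairs n \<times> faces (link \<Delta> G) 1).
    (\<forall>e\<in>faces (link \<Delta> G) 1. \<forall>v\<in>G \<union> e. \<forall>j<n. ctr n (p v) (\<lambda>t. C (t, e)) j = 0) \<longrightarrow>
    (\<forall>t\<in>pairs n. \<forall>u\<in>vertices (link \<Delta> G). boundary (link \<Delta> G) (\<lambda>e. C (t, e)) {u} = 0) \<longrightarrow> C = 0)"

text \<open>The vertices of \<open>G\<close> are placed at the last \<open>card G\<close> unit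
  vectors and all others in the first four coordinates. A form killed by \<open>G\<close> involves
  the first four coordinates only, so a configuration for the 2-sphere
  \<open>link \<Delta> G\<close> in \<open>k\<^sup>4\<close> serves as a witness.\<close>

lemma link_stress_free_exists:
  assumes inf: "infinite (UNIV :: 'k::field set)" and \<Delta>: "simplicial_complex \<Delta>" and G: "G \<in> \<Delta>"
    and card_le: "\<And>F. F \<in> \<Delta> \<Longrightarrow> card F \<le> card G + 3"
    and sph: "\<And>H. H \<in> \<Delta> \<Longrightarrow> G \<subseteq> H \<Longrightarrow> spherical TYPE('k) \<Delta> (card G + 3) H"
  shows "\<exists>p :: 'v::linorder \<Rightarrow> nat \<Rightarrow> 'k. link_stress_free (card G + 4) \<Delta> G p"
proof -
  let ?L = "link \<Delta> G" and ?n = "card G + 4"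
  note S = simplicial_complexD[OF \<Delta>] and SL = simplicial_complex_link[OF \<Delta> G]
  have finG: "finite G" using S(3)[OF G] .
  have cardU: "card (G \<union> F) = card G + card F" if "F \<in> ?L" for F
    using that finG simplicial_complexD(3)[OF SL that] by (intro card_Un_disjoint) (auto simp: link_def)
  have UD: "G \<union> F \<in> \<Delta>" if "F \<in> ?L" for F using that by (simp add: link_def Un_commute)
  interpret sphere2 ?L "TYPE('k)"
  proof
    show "simplicial_complex ?L" by (rule SL)
    show "spherical TYPE('k) ?L 3 F" if F: "F \<in> ?L" for F
      using sph[OF UD[OF F]] cardU[OF F] unfolding spherical_def link_link[OF F] by auto
    show "card F \<le> 3" if F: "F \<in> ?L" for F using card_le[OF UD[OF F]] cardU[OF F] by simp
  qed
  obtain p4 :: "'v \<Rightarrow> nat \<Rightarrow> 'k" where p4: "\<forall>C\<in>FS (pairs 4 \<times> Ed).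
    (\<forall>e\<in>Ed. \<forall>v\<in>e. \<forall>j<4. ctr 4 (p4 v) (\<lambda>t. C (t, e)) j = 0) \<longrightarrow>
    (\<forall>t\<in>pairs 4. \<forall>u\<in>vertices ?L. boundary ?L (\<lambda>e. C (t, e)) {u} = 0) \<longrightarrow> C = 0"
    using form_stress_free[OF inf] by (elim exE) (rule that)
  obtain f where f: "bij_betw f G {0..<card G}" using ex_bij_betw_finite_nat[OF finG] by blast
  define p where "p v i = (if v \<in> G then (if i = f v + 4 then 1 else 0) else if i < 4 then p4 v i else 0)" for v i
  have "link_stress_free ?n \<Delta> G p"
    unfolding link_stress_free_def
  proof (intro ballI impI)
    fix C :: "(nat \<times> nat) \<times> 'v set \<Rightarrow> 'k"
    assume CF: "C \<in> FS (pairs ?n \<times> Ed)"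
      and C: "\<forall>e\<in>Ed. \<forall>v\<in>G \<union> e. \<forall>j<?n. ctr ?n (p v) (\<lambda>t. C (t, e)) j = 0"
      and bd: "\<forall>t\<in>pairs ?n. \<forall>u\<in>vertices ?L. boundary ?L (\<lambda>e. C (t, e)) {u} = 0"
    have high: "alt (\<lambda>t. C (t, e)) i j = 0" if e: "e \<in> Ed" and i: "4 \<le> i" "i < ?n" and j: "j < ?n" for e i j
    proof -
      have "i - 4 \<in> f ` G" using f i by (auto simp: bij_betw_def)
      then obtain v where v: "v \<in> G" "f v = i - 4" by auto
      have "0 = ctr ?n (p v) (\<lambda>t. C (t, e)) j" using C e v(1) j by simp
      also have "\<dots> = (\<Sum>k<?n. if k = i then alt (\<lambda>t. C (t, e)) k j else 0)"
        unfolding ctr_def by (intro sum.cong refl) (use v i in \<open>auto simp: p_def\<close>)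
      also have "\<dots> = alt (\<lambda>t. C (t, e)) i j" using i by simp
      finally show ?thesis by simp
    qed
    have CF4: "C \<in> FS (pairs 4 \<times> Ed)"
    proof -
      have "C ((i, j), e) = 0" if not: "((i, j), e) \<notin> pairs 4 \<times> Ed" for i j e
      proof (cases "((i, j), e) \<in> pairs ?n \<times> Ed")
        case True
        then have ij: "i < j" "j < ?n" "e \<in> Ed" "4 \<le> j" using not by (auto simp: pairs_def)
        have "alt (\<lambda>t. C (t, e)) j i = 0" using high[of e j i] ij by simp
        then show ?thesis using ij by (simp add: alt_def)
      next
        case False
        then show ?thesis using CF unfolding FS_def by blast
      qed
      then show ?thesis by (auto simp: FS_def)
    qed
    show "C = 0"
    proof (rule p4[rule_format, OF CF4])
      fix e v j assume e: "e \<in> Ed" and v: "v \<in> e" and j: "j < (4::nat)"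
      have "e \<in> ?L" using e by (simp add: Ed)
      then have "v \<notin> G" using v by (auto simp: link_def)
      have "0 = ctr ?n (p v) (\<lambda>t. C (t, e)) j" using C e v j by simp
      also have "\<dots> = (\<Sum>k\<in>{..<4}. p4 v k * alt (\<lambda>t. C (t, e)) k j)"
        unfolding ctr_def by (rule sum.mono_neutral_cong_right) (use \<open>v \<notin> G\<close> in \<open>auto simp: p_def\<close>)
      finally show "ctr 4 (p4 v) (\<lambda>t. C (t, e)) j = 0" by (simp add: ctr_def)
    next
      fix t u assume "t \<in> pairs 4" "u \<in> vertices ?L"
      moreover have "pairs 4 \<subseteq> pairs ?n" by (auto simp: pairs_def)
      ultimately show "boundary ?L (\<lambda>e. C (t, e)) {u} = 0" using bd by blast
    qed
  qed
  then show ?thesis by blast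
qed

lemma generic_link_stress_free:
  fixes \<Delta> :: "'v::linorder set set"
  assumes \<Delta>: "simplicial_complex \<Delta>" and G: "G \<in> \<Delta>"
    and ex: "\<exists>p :: 'v \<Rightarrow> nat \<Rightarrow> 'k::field. link_stress_free n \<Delta> G p"
  shows "generic (\<lambda>p :: 'v \<Rightarrow> nat \<Rightarrow> 'k. link_stress_free n \<Delta> G p)"
proof -
  let ?L = "link \<Delta> G"
  note SL = simplicial_complexD[OF simplicial_complex_link[OF \<Delta> G]]
  define X where "X = pairs n \<times> faces ?L 1"
  define M where "M p w y = (case y of
      Inl (e, v, j) \<Rightarrow> if e \<in> faces ?L 1 \<and> v \<in> G \<union> e \<and> j < n then ctr n (p v) (\<lambda>t. w (t, e)) j else 0
    | Inr (t, u) \<Rightarrow> if t \<in> pairs n \<and> u \<in> vertices ?L then boundary ?L (\<lambda>e. w (t, e)) {u} else 0)"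
    for p :: "'v \<Rightarrow> nat \<Rightarrow> 'k" and w :: "(nat \<times> nat) \<times> 'v set \<Rightarrow> 'k" and y :: "('v set \<times> 'v \<times> nat) + ((nat \<times> nat) \<times> 'v)"
  \<comment> \<open>The boundary rows do not involve the points and so are zero in the linear
    part.\<close>
  define M' where "M' p w y = (case y of
      Inl (e, v, j) \<Rightarrow> if e \<in> faces ?L 1 \<and> v \<in> G \<union> e \<and> j < n then ctr n (p v) (\<lambda>t. w (t, e)) j else 0
    | Inr (t, u) \<Rightarrow> 0)"
    for p :: "'v \<Rightarrow> nat \<Rightarrow> 'k" and w :: "(nat \<times> nat) \<times> 'v set \<Rightarrow> 'k" and y :: "('v set \<times> 'v \<times> nat) + ((nat \<times> nat) \<times> 'v)"
  have eq: "link_stress_free n \<Delta> G p \<longleftrightarrow> (\<forall>w\<in>FS X. M p w = 0 \<longrightarrow> w = 0)" for p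
  proof -
    have "M p w = 0 \<longleftrightarrow> (\<forall>e\<in>faces ?L 1. \<forall>v\<in>G \<union> e. \<forall>j<n. ctr n (p v) (\<lambda>t. w (t, e)) j = 0) \<and>
      (\<forall>t\<in>pairs n. \<forall>u\<in>vertices ?L. boundary ?L (\<lambda>e. w (t, e)) {u} = 0)" (is "_ \<longleftrightarrow> ?A \<and> ?B") for w
    proof
      assume 0: "M p w = 0"
      have ?A
      proof (intro ballI allI impI)
        fix e v j assume "e \<in> faces ?L 1" "v \<in> G \<union> e" "j < n"
        then show "ctr n (p v) (\<lambda>t. w (t, e)) j = 0" using fun_cong[OF 0, of "Inl (e, v, j)"] by (simp add: M_def)
      qed
      moreover have ?B
      proof (intro ballI)
        fix t u assume "t \<in> pairs n" "u \<in> vertices ?L"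
        then show "boundary ?L (\<lambda>e. w (t, e)) {u} = 0" using fun_cong[OF 0, of "Inr (t, u)"] by (simp add: M_def)
      qed
      ultimately show "?A \<and> ?B" ..
    next
      assume AB: "?A \<and> ?B"
      show "M p w = 0"
      proof
        fix y show "M p w y = 0 y"
        proof (cases y)
          case (Inl evj)
          obtain e v j where "evj = (e, v, j)" by (cases evj)
          then show ?thesis using AB Inl by (auto simp: M_def)
        next
          case (Inr tu)
          obtain t u where "tu = (t, u)" by (cases tu)
          then show ?thesis using AB Inr by (auto simp: M_def)
        qed
      qed
    qed
    then show ?thesis unfolding link_stress_free_def X_def by (simp only: imp_conjL)
  qed
  have lin: "lin (M p)" "lin (M' p)" for p
    by (rule linI; auto simp: M_def M'_def fun_eq_iff ctr_add ctr_scale boundary_eq[OF SL(1)] distrib_left sum.distrib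
        sum_distrib_left mult.left_commute split: sum.split)+
  have "generic (\<lambda>p. \<forall>w\<in>FS X. M p w = 0 \<longrightarrow> w = 0)"
  proof (rule generic_injective[where M'=M', OF _ lin])
    show "finite X" using finite_pairs finite_faces[OF SL(1)] by (simp add: X_def)
    show "M (\<lambda>v i. p v i + t * q v i) w y = M p w y + t * M' q w y" for p q t w y
      by (auto simp: M_def M'_def ctr_line split: sum.split)
    show "\<exists>p. \<forall>w\<in>FS X. M p w = 0 \<longrightarrow> w = 0" using ex unfolding eq .
  qed
  then show ?thesis by (simp only: eq)
qed

text \<open>Ridges containing \<open>G\<close> correspond to the edges of its link, and
  \<open>to_link\<close> carries the form-valued cycle to one on the link.\<close>

lemma ridge_vanishes:
  fixes p :: "'v::linorder \<Rightarrow> nat \<Rightarrow> 'k::field"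
  assumes \<Delta>: "simplicial_complex \<Delta>" and G: "G \<in> \<Delta>" "card G + 3 = d" and lsf: "link_stress_free n \<Delta> G p"
    and cF: "c \<in> FS (pairs n \<times> faces \<Delta> (int d - 2))"
    and kill: "\<And>F v j. F \<in> faces \<Delta> (int d - 2) \<Longrightarrow> v \<in> F \<Longrightarrow> j < n \<Longrightarrow> ctr n (p v) (\<lambda>t. c (t, F)) j = 0"
    and cyc: "\<And>t. t \<in> pairs n \<Longrightarrow> boundary \<Delta> (\<lambda>F. c (t, F)) = 0"
    and R: "R \<in> faces \<Delta> (int d - 2)" "G \<subseteq> R"
  shows "c (t, R) = 0"
proof -
  let ?L = "link \<Delta> G"
  note S = simplicial_complexD[OF \<Delta>] and SL = simplicial_complexD[OF simplicial_complex_link[OF \<Delta> G(1)]]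
  have finG: "finite G" using S(3)[OF G(1)] .
  have cardU: "card (e \<union> G) = card e + card G" if "e \<in> ?L" for e
    using that finG SL(3)[OF that] by (intro card_Un_disjoint) (auto simp: link_def)
  have faceU: "e \<union> G \<in> faces \<Delta> (int d - 2) \<longleftrightarrow> e \<in> faces ?L 1" if "e \<in> ?L" for e
    using that cardU[OF that] G(2) by (auto simp: faces_def link_def)
  define C where "C y = to_link \<Delta> G (\<lambda>F. c (fst y, F)) (snd y)" for y
  have "C = 0"
  proof (rule lsf[unfolded link_stress_free_def, rule_format])
    have "C (t, e) = 0" if "(t, e) \<notin> pairs n \<times> faces ?L 1" for t e
    proof (cases "e \<in> ?L")
      case True
      have "(t, e \<union> G) \<notin> pairs n \<times> faces \<Delta> (int d - 2)" using that faceU[OF True] by simp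
      then have "c (t, e \<union> G) = 0" using cF unfolding FS_def by blast
      then show ?thesis by (simp add: C_def to_link_def)
    qed (simp add: C_def to_link_def)
    then show "C \<in> FS (pairs n \<times> faces ?L 1)" by (auto simp: FS_def)
  next
    fix e v j assume e: "e \<in> faces ?L 1" and v: "v \<in> G \<union> e" and j: "j < n"
    have eL: "e \<in> ?L" using e by (simp add: faces_def)
    have "(\<lambda>t. C (t, e)) = (\<lambda>t. lsign G e * c (t, e \<union> G))" using eL by (simp add: C_def to_link_def)
    then show "ctr n (p v) (\<lambda>t. C (t, e)) j = 0"
      using kill[of "e \<union> G" v j] faceU[OF eL] e v j by (simp add: ctr_scale Un_commute)
  next
    fix t u assume t: "t \<in> pairs n" and u: "u \<in> vertices ?L"
    have uL: "{u} \<in> ?L" using u by (simp add: vertices_def)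
    have "boundary ?L (\<lambda>e. C (t, e)) {u} = lsign G {u} * boundary \<Delta> (\<lambda>F. c (t, F)) ({u} \<union> G)"
      unfolding C_def fst_conv snd_conv by (rule boundary_to_link[OF \<Delta> G(1) uL])
    then show "boundary ?L (\<lambda>e. C (t, e)) {u} = 0" using cyc[OF t] by simp
  qed
  then have "C (t, R - G) = 0" by simp
  moreover have "R - G \<in> ?L" "R - G \<union> G = R" using R by (auto simp: link_def faces_def Un_absorb1 Un_absorb2)
  ultimately show ?thesis using lsign_nonzero[of G "R - G", where ?'k='k] by (simp add: C_def to_link_def)
qed

text \<open>The points of \<open>T\<close> form a basis of \<open>k\<^sup>5\<close>. At an edge
  \<open>H\<close> of \<open>R\<close>, only \<open>R\<close> and the triangles completed by
  \<open>y\<close> or \<open>y'\<close> can carry a form. The latter forms are killed by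
  \<open>p y\<close> or by \<open>p y'\<close>, so evaluating the boundary at \<open>H\<close> on
  this pair of points isolates the form of \<open>R\<close>. That form is then killed by
  \<open>p y\<close> besides the vertices of \<open>R\<close>, that is, by a hyperplane.\<close>

lemma ridge_vanishes_small:
  fixes p :: "'v::linorder \<Rightarrow> nat \<Rightarrow> 'k::field"
  assumes \<Delta>: "simplicial_complex \<Delta>" and T: "card T = 5" "indep 5 p T" "R \<subseteq> T"
    and kill: "\<And>F v j. F \<in> faces \<Delta> 2 \<Longrightarrow> v \<in> F \<Longrightarrow> j < 5 \<Longrightarrow> ctr 5 (p v) (\<lambda>t. c (t, F)) j = 0"
    and cF: "c \<in> FS (pairs 5 \<times> faces \<Delta> 2)"
    and cyc: "\<And>t. t \<in> pairs 5 \<Longrightarrow> boundary \<Delta> (\<lambda>F. c (t, F)) = 0"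
    and out: "\<And>t F. F \<in> faces \<Delta> 2 \<Longrightarrow> \<not> F \<subseteq> T \<Longrightarrow> c (t, F) = 0"
    and R: "R \<in> faces \<Delta> 2"
  shows "c (t, R) = 0"
proof -
  note S = simplicial_complexD[OF \<Delta>]
  have fT: "finite T" using T(1) by (simp add: card_ge_0_finite)
  have cR: "card R = 3" "R \<in> \<Delta>" using R by (auto simp: faces_def)
  have fR: "finite R" using S(3)[OF cR(2)] .
  obtain x where x: "x \<in> R" using cR(1) by fastforce
  define H where "H = R - {x}"
  have RH: "R = insert x H" "x \<notin> H" using x by (auto simp: H_def)
  have "card (T - R) = 2" using T(1,3) cR(1) fR by (simp add: card_Diff_subset)
  then obtain y y' where yy: "T - R = {y, y'}" "y \<noteq> y'" by (auto simp: card_2_iff)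
  define g where "g w t = c (t, insert w H)" for w t
  let ?N = "{w. w \<notin> H \<and> insert w H \<in> \<Delta>}"
  define \<phi> where "\<phi> f = dot 5 (ctr 5 (p y) f) (p y')" for f :: "nat \<times> nat \<Rightarrow> 'k"
  have cH: "card H = 2" "finite H" using cR fR x by (auto simp: H_def)
  have face: "insert w H \<in> faces \<Delta> 2" if "w \<in> ?N" for w using that cH by (auto simp: faces_def)
  have gw: "\<phi> (g w) = 0" if w: "w \<in> ?N" "w \<noteq> x" for w
  proof (cases "insert w H \<subseteq> T")
    case False
    then have "g w = (\<lambda>_. 0)" using out[OF face[OF w(1)]] by (simp add: g_def fun_eq_iff)
    then show ?thesis by (simp add: \<phi>_def dot_def)
  next
    case True
    then have "w \<in> T - R" using w RH by auto
    then have "w = y \<or> w = y'" using yy by auto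
    then show ?thesis
    proof
      assume "w = y"
      then have "ctr 5 (p y) (g w) j = 0" if "j < 5" for j
        using kill[OF face[OF w(1)], of y j] that unfolding g_def[abs_def] by simp
      then show ?thesis unfolding \<phi>_def by (rule dot_zero)
    next
      assume "w = y'"
      then have "ctr 5 (p y') (g w) j = 0" if "j < 5" for j
        using kill[OF face[OF w(1)], of y' j] that unfolding g_def[abs_def] by simp
      then have "dot 5 (ctr 5 (p y') (g w)) (p y) = 0" by (rule dot_zero)
      then show ?thesis unfolding \<phi>_def by (subst dot_ctr_swap) simp
    qed
  qed
  have "(\<Sum>w\<in>?N. face_sign w (insert w H) * g w t) = 0" for t
  proof (cases "t \<in> pairs 5")
    case True
    then show ?thesis using fun_cong[OF cyc[OF True], of H] unfolding boundary_eq[OF S(1)] g_def by simp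
  next
    case False
    have "g w t = 0" for w
    proof -
      have "(t, insert w H) \<notin> pairs 5 \<times> faces \<Delta> 2" using False by simp
      then show ?thesis using cF unfolding g_def FS_def by blast
    qed
    then show ?thesis by simp
  qed
  then have "(\<lambda>t. \<Sum>w\<in>?N. face_sign w (insert w H) * g w t) = (\<lambda>_. 0)" by (rule ext)
  then have "0 = \<phi> (\<lambda>t. \<Sum>w\<in>?N. face_sign w (insert w H) * g w t)" by (simp add: \<phi>_def dot_def)
  also have "\<dots> = (\<Sum>w\<in>?N. face_sign w (insert w H) * \<phi> (g w))"
    unfolding \<phi>_def dot_def ctr_sum ctr_scale sum_distrib_right sum_distrib_left
    by (subst sum.swap) (simp only: mult.assoc)
  also have "\<dots> = (\<Sum>w\<in>{x}. face_sign w (insert w H) * \<phi> (g w))"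
    by (rule sum.mono_neutral_right) (use finite_cofaces[OF S(1), of H] RH cR(2) gw in auto)
  finally have "face_sign x R * \<phi> (g x) = 0" by (simp add: RH(1))
  then have \<phi>0: "\<phi> (g x) = 0" by (simp add: face_sign_def)
  have gx: "g x = (\<lambda>t. c (t, R))" by (simp add: g_def fun_eq_iff RH(1)[symmetric])
  have gF: "g x \<in> FS (pairs 5)" using cF unfolding gx by (simp add: FS_def)
  have gk: "ctr 5 (p v) (g x) j = 0" if "v \<in> R" "j < 5" for v j unfolding gx using kill[OF R that] .
  have yk: "ctr 5 (p y) (g x) j = 0" if j: "j < 5" for j
  proof (rule indep_span[OF fT T(2) T(1) _ j])
    fix v assume v: "v \<in> T"
    consider "v \<in> R" | "v = y" | "v = y'" using v yy by blast
    then show "dot 5 (ctr 5 (p y) (g x)) (p v) = 0"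
    proof cases
      case 1
      then have "dot 5 (ctr 5 (p v) (g x)) (p y) = 0" using gk by (intro dot_zero)
      then show ?thesis by (subst dot_ctr_swap) simp
    next
      case 2
      then show ?thesis by (simp add: dot_ctr_self)
    next
      case 3
      then show ?thesis using \<phi>0 by (simp add: \<phi>_def)
    qed
  qed
  have yR: "y \<notin> R" "insert y R \<subseteq> T" using yy T(3) by auto
  have "g x = (\<lambda>_. 0)"
  proof (rule form_zero_of_hyperplane[of "insert y R" 5 p])
    show "indep 5 p (insert y R)" by (rule indep_subset[OF T(2) fT yR(2)])
    show "Suc (card (insert y R)) = 5" using yR(1) fR cR(1) by simp
  qed (use gF gk yk fR in auto)
  then have "g x t = 0" by (rule fun_cong)
  then show ?thesis by (simp add: gx)
qed

text \<open>\<open>good\<close> collects the faces with \<open>d - 3\<close> vertices all of whose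
  cofaces have spherical links. For \<open>d \<ge> 5\<close> such a face has at least two vertices,
  so every ridge contains a good one. For \<open>d = 4\<close> it is a single vertex, good when it
  is nonsingular, and the ridges without such a vertex are treated inside \<open>T\<close>.\<close>

theorem rigid_configuration:
  fixes \<Delta> :: "'v::linorder set set"
  assumes inf: "infinite (UNIV :: 'k::field set)" and iso: "isolated_singularities TYPE('k) \<Delta>"
    and sdim: "sdim \<Delta> = int d - 1"
    and d: "d \<ge> 5 \<or> d = 4 \<and> card (singular_vertices TYPE('k) \<Delta>) \<le> 5"
  shows "\<exists>p :: 'v \<Rightarrow> nat \<Rightarrow> 'k. (\<forall>v\<in>vertices \<Delta>. p v 0 \<noteq> 0) \<and> (\<forall>F\<in>faces \<Delta> (int d - 1). indep (Suc d) p F) \<and>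
    (\<forall>c\<in>FS (pairs (Suc d) \<times> faces \<Delta> (int d - 2)).
      (\<forall>F\<in>faces \<Delta> (int d - 2). \<forall>v\<in>F. \<forall>j<Suc d. ctr (Suc d) (p v) (\<lambda>t. c (t, F)) j = 0) \<longrightarrow>
      (\<forall>t\<in>pairs (Suc d). boundary \<Delta> (\<lambda>F. c (t, F)) = 0) \<longrightarrow> c = 0)"
proof -
  have \<Delta>: "simplicial_complex \<Delta>" and pure: "pure \<Delta>"
    and man: "\<forall>v\<in>vertices \<Delta>. homology_manifold TYPE('k) (link \<Delta> {v})"
    using iso by (auto simp: isolated_singularities_def)
  note S = simplicial_complexD[OF \<Delta>]
  note card_le = card_face_le[OF \<Delta> pure sdim]
  note sph2 = spherical_of_card_ge_2[OF \<Delta> pure sdim man]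
  let ?V = "vertices \<Delta>" and ?Sg = "singular_vertices TYPE('k) \<Delta>"
  have finV: "finite ?V"
    by (rule inj_on_finite[of "\<lambda>v. {v}" _ \<Delta>]) (use S(1) in \<open>auto simp: vertices_def inj_on_def\<close>)
  have SgV: "?Sg \<subseteq> ?V" by (auto simp: singular_vertices_def)
  define good where "good = {G \<in> \<Delta>. card G + 3 = d \<and> (\<forall>H\<in>\<Delta>. G \<subseteq> H \<longrightarrow> spherical TYPE('k) \<Delta> d H)}"
  \<comment> \<open>For \<open>d = 4\<close> the singular vertices are enlarged to exactly five
    whenever there are five vertices, because \<open>T\<close> has to span
    \<open>k\<^sup>5\<close>.\<close>
  have "\<exists>T. ?Sg \<subseteq> T \<and> finite T \<and> (d = 4 \<longrightarrow> card T \<le> 5) \<and> (d = 4 \<longrightarrow> 5 \<le> card ?V \<longrightarrow> card T = 5)"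
  proof (cases "d = 4 \<and> 5 \<le> card ?V")
    case True
    then have "card ?Sg \<le> 5" using d by auto
    then obtain T where T: "?Sg \<subseteq> T" "T \<subseteq> ?V" "card T = 5"
      using exists_subset_between[of ?Sg 5 ?V] True SgV finV by blast
    have "finite T" using T(2) finV by (rule finite_subset)
    then show ?thesis using T(1,3) by (intro exI[of _ T]) simp
  next
    case False
    have "finite ?Sg" using SgV finV by (rule finite_subset)
    then show ?thesis using False d by (intro exI[of _ ?Sg]) auto
  qed
  then obtain T where T: "?Sg \<subseteq> T" "finite T" "d = 4 \<Longrightarrow> card T \<le> 5" "d = 4 \<Longrightarrow> 5 \<le> card ?V \<Longrightarrow> card T = 5" by blast
  \<comment> \<open>The quantifier over \<open>{4} \<inter> {d}\<close> demands independence of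
    \<open>T\<close> only when \<open>d = 4\<close>, in a shape covered by
    \<open>generic_ball\<close>.\<close>
  have "generic (\<lambda>p :: 'v \<Rightarrow> nat \<Rightarrow> 'k. (\<forall>v\<in>?V. p v 0 \<noteq> 0) \<and> (\<forall>F\<in>faces \<Delta> (int d - 1). indep (Suc d) p F) \<and>
      (\<forall>G\<in>good. link_stress_free (Suc d) \<Delta> G p) \<and> (\<forall>_\<in>{4} \<inter> {d}. indep 5 p T))"
  proof (intro generic_conj[OF inf] generic_ball[OF inf] generic_coordinate_nonzero generic_indep generic_link_stress_free[OF \<Delta>])
    show "finite good" using S(1) by (simp add: good_def)
    fix G assume G: "G \<in> good"
    then show "G \<in> \<Delta>" by (simp add: good_def)
    have cG: "card G + 3 = d" "card G + 4 = Suc d" using G by (auto simp: good_def)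
    have "\<exists>p :: 'v \<Rightarrow> nat \<Rightarrow> 'k. link_stress_free (card G + 4) \<Delta> G p"
    proof (rule link_stress_free_exists[OF inf \<Delta>])
      show "G \<in> \<Delta>" using G by (simp add: good_def)
      show "card F \<le> card G + 3" if "F \<in> \<Delta>" for F using card_le[OF that] cG by simp
      show "spherical TYPE('k) \<Delta> (card G + 3) H" if "H \<in> \<Delta>" "G \<subseteq> H" for H
        using G that unfolding cG(1) by (simp add: good_def)
    qed
    then show "\<exists>p :: 'v \<Rightarrow> nat \<Rightarrow> 'k. link_stress_free (Suc d) \<Delta> G p" unfolding cG(2) .
  next
    show "finite (faces \<Delta> (int d - 1))" by (rule finite_faces[OF S(1)])
    show "finite F" "card F \<le> Suc d" if "F \<in> faces \<Delta> (int d - 1)" for F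
      using that S(3) card_le[of F] by (auto simp: faces_def)
  qed (use finV T in auto)
  then obtain p :: "'v \<Rightarrow> nat \<Rightarrow> 'k" where p: "\<forall>v\<in>?V. p v 0 \<noteq> 0" "\<forall>F\<in>faces \<Delta> (int d - 1). indep (Suc d) p F"
    "\<forall>G\<in>good. link_stress_free (Suc d) \<Delta> G p" "d = 4 \<Longrightarrow> indep 5 p T"
    unfolding generic_def by auto
  show ?thesis
  proof (rule exI[of _ p], intro conjI p(1,2) ballI impI)
    fix c :: "(nat \<times> nat) \<times> 'v set \<Rightarrow> 'k"
    assume cF: "c \<in> FS (pairs (Suc d) \<times> faces \<Delta> (int d - 2))"
      and kill: "\<forall>F\<in>faces \<Delta> (int d - 2). \<forall>v\<in>F. \<forall>j<Suc d. ctr (Suc d) (p v) (\<lambda>t. c (t, F)) j = 0"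
      and cyc: "\<forall>t\<in>pairs (Suc d). boundary \<Delta> (\<lambda>F. c (t, F)) = 0"
    have van: "c (t, R) = 0" if "G \<in> good" "R \<in> faces \<Delta> (int d - 2)" "G \<subseteq> R" for G R t
      by (rule ridge_vanishes[OF \<Delta> _ _ _ cF _ _ that(2,3), where p=p])
        (use that p(3) kill cyc in \<open>auto simp: good_def\<close>)
    have all: "c (t, R) = 0" if R: "R \<in> faces \<Delta> (int d - 2)" for R t
    proof -
      have RD: "R \<in> \<Delta>" and cR: "card R + 1 = d" using R d by (auto simp: faces_def)
      have fR: "finite R" using S(3)[OF RD] .
      show ?thesis
      proof (cases "d \<ge> 5")
        case True
        have "d - 3 \<le> card R" using cR by simp
        then obtain G where G: "G \<subseteq> R" "card G = d - 3" using obtain_subset_with_card_n by metis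
        have "spherical TYPE('k) \<Delta> d H" if H: "H \<in> \<Delta>" "G \<subseteq> H" for H
        proof (rule sph2[OF H(1)])
          have "card G \<le> card H" using H S(3) card_mono by blast
          then show "2 \<le> card H" using G(2) True by simp
        qed
        then have "G \<in> good" using G True S(4)[OF RD] by (auto simp: good_def)
        then show ?thesis using van R G(1) by blast
      next
        case False
        then have d4: "d = 4" and cS: "card ?Sg \<le> 5" using d by auto
        have c3: "card R = 3" using cR d4 by simp
        have Ri: "R \<in> faces \<Delta> 2" and i2: "int d - 2 = 2" using R d4 by auto
        have nons: "c (t, F) = 0" if F: "F \<in> faces \<Delta> 2" "v \<in> F" "v \<notin> ?Sg" for F v t
        proof -
          have FD: "F \<in> \<Delta>" using F by (simp add: faces_def)
          have vD: "{v} \<in> \<Delta>" using S(4)[OF FD, of "{v}"] F(2) by simp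
          then have "homology_sphere TYPE('k) (link \<Delta> {v})" using F(3) by (auto simp: singular_vertices_def vertices_def)
          then have s1: "spherical TYPE('k) \<Delta> d {v}" by (rule spherical_of_sphere[OF \<Delta> pure sdim _ vD])
          have "spherical TYPE('k) \<Delta> d H" if H: "H \<in> \<Delta>" "{v} \<subseteq> H" for H
          proof (cases "H = {v}")
            case False
            have "card {v} < card H" using H False S(3)[OF H(1)] by (intro psubset_card_mono) auto
            then show ?thesis by (intro sph2[OF H(1)]) simp
          qed (simp add: s1)
          then have "{v} \<in> good" using vD d4 by (simp add: good_def)
          then show ?thesis using van[of "{v}" F t] F i2 by simp
        qed
        show ?thesis
        proof (cases "R \<subseteq> ?Sg")
          case False
          then show ?thesis using nons[OF Ri] by blast
        next
          case True
          \<comment> \<open>Three vertices of \<open>R\<close>, and two more from its link, which is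
            a homology 0-sphere.\<close>
          have "card ?V \<ge> 5"
          proof -
            have sR: "spherical TYPE('k) \<Delta> d R" using sph2[OF RD] c3 by simp
            note L = simplicial_complex_link[OF \<Delta> RD]
            have "faces (link \<Delta> R) 1 = {}"
            proof -
              have False if F: "F \<in> link \<Delta> R" "card F = 2" for F
              proof -
                have "card (F \<union> R) = card F + card R"
                  using F fR simplicial_complexD(3)[OF L F(1)] by (intro card_Un_disjoint) (auto simp: link_def)
                then show False using card_le[of "F \<union> R"] F c3 d4 by (simp add: link_def)
              qed
              then show ?thesis by (auto simp: faces_def)
            qed
            then have "card (faces (link \<Delta> R) 0) = 2"
              using euler_relations(1)[OF L, where ?'k='k] sR c3 d4 by (simp add: spherical_def)
            moreover have "faces (link \<Delta> R) 0 \<subseteq> (\<lambda>v. {v}) ` (?V - R)"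
            proof
              fix F assume "F \<in> faces (link \<Delta> R) 0"
              then have F: "F \<in> link \<Delta> R" "card F = 1" by (auto simp: faces_def)
              then obtain w where w: "F = {w}" by (auto simp: card_1_singleton_iff)
              then have "insert w R \<in> \<Delta>" "w \<notin> R" using F(1) by (auto simp: link_def)
              then have "w \<in> ?V - R" using S(4)[of "insert w R" "{w}"] by (simp add: vertices_def)
              then show "F \<in> (\<lambda>v. {v}) ` (?V - R)" using w by blast
            qed
            ultimately have "2 \<le> card ((\<lambda>v. {v}) ` (?V - R))" using finV by (metis card_mono finite_Diff finite_imageI)
            also have "\<dots> \<le> card (?V - R)" using finV by (intro card_image_le) simp
            also have "\<dots> = card ?V - 3" using c3 fR True SgV by (subst card_Diff_subset) auto
            finally show ?thesis by simp
          qed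
          then have T5: "card T = 5" by (rule T(4)[OF d4])
          have ip: "indep 5 p T" using p(4) d4 by simp
          have n5: "Suc d = 5" using d4 by simp
          show ?thesis
          proof (rule ridge_vanishes_small[OF \<Delta> T5 ip])
            show "R \<subseteq> T" using True T(1) by blast
            show "c (t, F) = 0" if "F \<in> faces \<Delta> 2" "\<not> F \<subseteq> T" for t F
              using nons[OF that(1)] that(2) T(1) by blast
            show "c \<in> FS (pairs 5 \<times> faces \<Delta> 2)" using cF unfolding n5 i2 .
            show "R \<in> faces \<Delta> 2" by (rule Ri)
          qed (use kill cyc in \<open>auto simp: n5 i2\<close>)
        qed
      qed
    qed
    show "c = 0"
    proof
      fix y :: "(nat \<times> nat) \<times> 'v set"
      obtain t R where y: "y = (t, R)" by (cases y)
      show "c y = 0 y"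
      proof (cases "R \<in> faces \<Delta> (int d - 2)")
        case False
        then have "y \<notin> pairs (Suc d) \<times> faces \<Delta> (int d - 2)" by (simp add: y)
        then have "c y = 0" using cF unfolding FS_def by blast
        then show ?thesis by simp
      qed (simp add: y all)
    qed
  qed
qed

section \<open>Counting edges\<close>

lemma sum_fst_product: "(\<Sum>x\<in>A \<times> {1..d}. g (fst x)) = d * (\<Sum>v\<in>A. g v :: nat)"
proof -
  have "(\<Sum>x\<in>A \<times> {1..d}. g (fst x)) = (\<Sum>(v, i)\<in>A \<times> {1..d}. g v)" by (intro sum.cong refl) auto
  also have "\<dots> = (\<Sum>v\<in>A. \<Sum>i\<in>{1..d}. g v)" by (rule sum.cartesian_product[symmetric])
  finally show ?thesis by (simp add: sum_distrib_left)
qed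

lemma lab_mem: "f \<in> lab L U \<Longrightarrow> l \<in> L \<Longrightarrow> (\<lambda>x. f (l, x)) \<in> U l"
  by (simp add: lab_def)

lemma FS_snd: "a \<in> FS (A \<times> B) \<Longrightarrow> (\<lambda>y. a (t, y)) \<in> FS B"
  by (simp add: FS_def)

locale counting =
  fixes \<Delta> :: "'v::linorder set set" and d :: nat and p :: "'v \<Rightarrow> nat \<Rightarrow> 'k::field"
  assumes \<Delta>: "simplicial_complex \<Delta>" and card_le: "\<And>F. F \<in> \<Delta> \<Longrightarrow> card F \<le> d"
    and edges: "\<And>e. e \<in> faces \<Delta> 1 \<Longrightarrow> spherical TYPE('k) \<Delta> d e"
    and p0: "\<And>v. v \<in> vertices \<Delta> \<Longrightarrow> p v 0 \<noteq> 0"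
    and ind: "\<And>F. F \<in> faces \<Delta> (int d - 1) \<Longrightarrow> indep (Suc d) p F"
    and rigid: "\<And>c. c \<in> FS (pairs (Suc d) \<times> faces \<Delta> (int d - 2)) \<Longrightarrow>
      (\<And>F v j. F \<in> faces \<Delta> (int d - 2) \<Longrightarrow> v \<in> F \<Longrightarrow> j < Suc d \<Longrightarrow> ctr (Suc d) (p v) (\<lambda>t. c (t, F)) j = 0) \<Longrightarrow>
      (\<And>t. t \<in> pairs (Suc d) \<Longrightarrow> boundary \<Delta> (\<lambda>F. c (t, F)) = 0) \<Longrightarrow> c = 0"
begin

abbreviation "n \<equiv> Suc d"
abbreviation "V \<equiv> vertices \<Delta>"
abbreviation "Ed \<equiv> faces \<Delta> 1"
abbreviation "Fc \<equiv> faces \<Delta> (int d - 1)"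
abbreviation "Rd \<equiv> faces \<Delta> (int d - 2)"
abbreviation "SF v \<equiv> star_faces \<Delta> {v} (int d - 1)"
abbreviation "SR v \<equiv> star_faces \<Delta> {v} (int d - 2)"
abbreviation Z :: "('v set \<Rightarrow> 'k) set" where "Z \<equiv> cycles \<Delta> (int d - 2)"

lemmas S = simplicial_complexD[OF \<Delta>]
lemmas linB = lin_boundary[OF S(1)]

lemma fin: "finite V" "finite Ed" "finite Fc" "finite Rd" "finite (SF v)" "finite (SR v)"
proof -
  show "finite V" by (rule inj_on_finite[of "\<lambda>v. {v}" _ \<Delta>]) (use S(1) in \<open>auto simp: vertices_def inj_on_def\<close>)
qed (use finite_faces[OF S(1)] finite_star_faces[OF S(1)] in auto)

definition res :: "'v \<Rightarrow> ('v set \<Rightarrow> 'k) \<Rightarrow> 'v set \<Rightarrow> 'k" where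
  "res v c F = (if F \<in> SR v then c F else 0)"

lemma lin_res: "lin (res v)"
  by (rule linI) (auto simp: res_def fun_eq_iff)

text \<open>Each coordinate of the equation at \<open>v\<close> takes its values here: boundaries of
  chains on the facets at \<open>v\<close>, plus global cycles, both restricted to the ridges at
  \<open>v\<close>. So at most \<open>dim (I v)\<close> equations per coordinate are
  independent.\<close>

definition I :: "'v \<Rightarrow> ('v set \<Rightarrow> 'k) set" where
  "I v = {x + y |x y. x \<in> (\<lambda>a. res v (boundary \<Delta> a)) ` FS (SF v) \<and> y \<in> res v ` Z}"

lemma subspace_I: "fs.subspace (I v)"
proof -
  have "lin (res v \<circ> boundary \<Delta>)" using linB lin_res by (rule Vector_Spaces.linear_compose)
  then have "fs.subspace ((res v \<circ> boundary \<Delta>) ` FS (SF v))"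
    by (rule fsp.linear_subspace_image[OF _ subspace_FS])
  moreover have "fs.subspace (res v ` Z)"
    by (rule fsp.linear_subspace_image[OF lin_res subspace_cycles[OF S(1)]])
  ultimately show ?thesis unfolding I_def o_def by (rule fs.subspace_sums)
qed

lemma I_FS: "I v \<subseteq> FS (SR v)"
  by (auto simp: I_def res_def FS_def)

lemma subspace_Z: "fs.subspace Z"
  by (rule subspace_cycles[OF S(1)])

lemma Z_FS: "Z \<subseteq> FS Rd"
  by (auto simp: cycles_eq)

text \<open>Labels of the unknowns: \<open>Inl t\<close> stands for entry \<open>t\<close> of the
  form-valued cycle \<open>Z\<close>, and \<open>Inr (v, i)\<close> for coordinate \<open>i\<close>
  of the functional-valued chain \<open>b v\<close>.\<close>

type_synonym 'w label = "(nat \<times> nat) + ('w \<times> nat)"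

definition L :: "'v label set" where "L = Inl ` pairs n \<union> Inr ` (V \<times> {1..d})"

definition U :: "'v label \<Rightarrow> ('v set \<Rightarrow> 'k) set" where
  "U l = (case l of Inl t \<Rightarrow> Z | Inr vi \<Rightarrow> FS (SF (fst vi)))"

definition UX :: "'v label \<Rightarrow> 'v set set" where
  "UX l = (case l of Inl t \<Rightarrow> Rd | Inr vi \<Rightarrow> SF (fst vi))"

lemma U: "finite L" "fs.subspace (U l)" "U l \<subseteq> FS (UX l)" "finite (UX l)"
  using finite_pairs fin subspace_Z subspace_FS Z_FS
  by (auto simp: L_def U_def UX_def split: sum.split)

lemma dim_E: "fs.dim (lab L U) = (n choose 2) * fs.dim Z + d * (\<Sum>v\<in>V. card (SF v))"
proof -
  have "fs.dim (lab L U) = (\<Sum>l\<in>L. fs.dim (U l))" by (rule dim_lab[OF U])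
  also have "\<dots> = (\<Sum>l\<in>Inl ` pairs n. fs.dim (U l)) + (\<Sum>l\<in>Inr ` (V \<times> {1..d}). fs.dim (U l))"
    unfolding L_def by (rule sum.union_disjoint) (use finite_pairs fin in auto)
  also have "(\<Sum>l\<in>Inl ` pairs n. fs.dim (U l)) = (n choose 2) * fs.dim Z"
    by (subst sum.reindex) (auto simp: U_def card_pairs)
  also have "(\<Sum>l\<in>Inr ` (V \<times> {1..d}). fs.dim (U l)) = (\<Sum>vi\<in>V \<times> {1..d}. card (SF (fst vi)))"
    by (subst sum.reindex) (auto simp: U_def dim_FS fin)
  also have "\<dots> = d * (\<Sum>v\<in>V. card (SF v))"
    by (rule sum_fst_product)
  finally show ?thesis .
qed

text \<open>A functional vanishing at \<open>p v\<close> is stored by its coordinates \<open>1..d\<close>; as \<open>p v 0 \<noteq> 0\<close>, they determine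
  coordinate 0, which \<open>ah\<close> restores.\<close>

definition Zf :: "('v label \<times> 'v set \<Rightarrow> 'k) \<Rightarrow> 'v set \<Rightarrow> nat \<times> nat \<Rightarrow> 'k" where
  "Zf f R t = f (Inl t, R)"

definition ah :: "('v label \<times> 'v set \<Rightarrow> 'k) \<Rightarrow> 'v \<Rightarrow> 'v set \<Rightarrow> nat \<Rightarrow> 'k" where
  "ah f v F i = (if i = 0 then - (\<Sum>j=1..d. p v j * f (Inr (v, j), F)) / p v 0 else f (Inr (v, i), F))"

text \<open>The defect in \<open>\<partial> (b v) = Z (p v, -)\<close>, taken in the coordinates
  \<open>1..d\<close>; the equation in coordinate 0 follows by \<open>boundary_ah\<close>.\<close>

definition \<Psi> :: "('v label \<times> 'v set \<Rightarrow> 'k) \<Rightarrow> ('v \<times> nat) \<times> 'v set \<Rightarrow> 'k" where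
  "\<Psi> f y = (case y of ((v, i), R) \<Rightarrow> if v \<in> V \<and> i \<in> {1..d} \<and> R \<in> SR v
    then boundary \<Delta> (\<lambda>F. f (Inr (v, i), F)) R - ctr n (p v) (Zf f R) i else 0)"

lemma boundary_add: "boundary \<Delta> (\<lambda>F. f F + g F) R = boundary \<Delta> f R + boundary \<Delta> g R"
  and boundary_scale: "boundary \<Delta> (\<lambda>F. c * f F) R = c * boundary \<Delta> f R"
  and boundary_sum: "boundary \<Delta> (\<lambda>F. \<Sum>i\<in>J. h i F) R = (\<Sum>i\<in>J. boundary \<Delta> (h i) R)"
proof -
  show "boundary \<Delta> (\<lambda>F. f F + g F) R = boundary \<Delta> f R + boundary \<Delta> g R"
    unfolding boundary_eq[OF S(1)] by (simp add: distrib_left sum.distrib)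
  show "boundary \<Delta> (\<lambda>F. c * f F) R = c * boundary \<Delta> f R"
    unfolding boundary_eq[OF S(1)] by (simp add: sum_distrib_left mult.left_commute)
  show "boundary \<Delta> (\<lambda>F. \<Sum>i\<in>J. h i F) R = (\<Sum>i\<in>J. boundary \<Delta> (h i) R)"
    unfolding boundary_eq[OF S(1)] sum_distrib_left by (rule sum.swap)
qed

lemma lin_\<Psi>: "lin \<Psi>"
  by (rule linI)
    (auto simp: \<Psi>_def Zf_def[abs_def] fun_eq_iff boundary_add boundary_scale ctr_add ctr_scale algebra_simps)

lemma ctr_cycle:
  assumes f: "f \<in> lab L U" and i: "i < n" shows "(\<lambda>R. ctr n q (Zf f R) i) \<in> Z"
proof -
  have Zin: "(\<lambda>R. f (Inl t, R)) \<in> Z" if "t \<in> pairs n" for t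
    using lab_mem[OF f, of "Inl t"] that by (simp add: L_def U_def)
  have "(\<lambda>R. alt (Zf f R) k i) \<in> Z" if "k < n" for k
  proof (cases k i rule: linorder_cases)
    case less
    then have "(k, i) \<in> pairs n" using i by (simp add: pairs_def)
    from Zin[OF this] show ?thesis using less by (simp add: alt_def Zf_def)
  next
    case equal
    then show ?thesis using fs.subspace_0[OF subspace_Z] by (simp add: zero_fun_def)
  next
    case greater
    then have "(i, k) \<in> pairs n" using that by (simp add: pairs_def)
    from fs.subspace_scale[OF subspace_Z Zin[OF this], of "-1"] show ?thesis using greater by (simp add: alt_def Zf_def)
  qed
  then have "(\<Sum>k<n. (\<lambda>R. q k * alt (Zf f R) k i)) \<in> Z"
    by (intro fs.subspace_sum[OF subspace_Z] fs.subspace_scale[OF subspace_Z]) auto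
  moreover have "(\<Sum>k<n. (\<lambda>R. q k * alt (Zf f R) k i)) = (\<lambda>R. ctr n q (Zf f R) i)"
    by (intro ext) (simp only: sum_fun_apply ctr_def)
  ultimately show ?thesis by simp
qed

lemma \<Psi>_image: "\<Psi> ` lab L U \<subseteq> lab (V \<times> {1..d}) (\<lambda>vi. I (fst vi))"
proof
  fix g assume "g \<in> \<Psi> ` lab L U"
  then obtain f where f: "f \<in> lab L U" "g = \<Psi> f" by blast
  have "(\<lambda>R. g ((v, i), R)) \<in> I v" if v: "v \<in> V" "i \<in> {1..d}" for v i
  proof -
    have 1: "(\<lambda>F. f (Inr (v, i), F)) \<in> FS (SF v)"
      using lab_mem[OF f(1), of "Inr (v, i)"] v by (simp add: L_def U_def image_iff)
    have 2: "(\<lambda>R. (-1) * ctr n (p v) (Zf f R) i) \<in> Z"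
      using v by (intro fs.subspace_scale[OF subspace_Z] ctr_cycle[OF f(1)]) auto
    have "(\<lambda>R. g ((v, i), R)) = res v (boundary \<Delta> (\<lambda>F. f (Inr (v, i), F))) + res v (\<lambda>R. (-1) * ctr n (p v) (Zf f R) i)"
      using v by (auto simp: f(2) \<Psi>_def res_def fun_eq_iff)
    then show ?thesis unfolding I_def using 1 2 by blast
  qed
  moreover have "g (vi, R) = 0" if "vi \<notin> V \<times> {1..d}" for vi R
    using that by (cases vi) (auto simp: f(2) \<Psi>_def)
  ultimately show "g \<in> lab (V \<times> {1..d}) (\<lambda>vi. I (fst vi))" by (auto simp: lab_def)
qed

lemma dim_kernel_\<Psi>: "fs.dim (lab L U) \<le> fs.dim {f \<in> lab L U. \<Psi> f = 0} + d * (\<Sum>v\<in>V. fs.dim (I v))"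
proof -
  have finVd: "finite (V \<times> {1..d})" using fin by simp
  have "fs.dim (lab L U) = fs.dim {f \<in> lab L U. \<Psi> f = 0} + fs.dim (\<Psi> ` lab L U)"
    by (rule rank_nullity[OF _ lab_FS[of L U UX] subspace_lab lin_\<Psi>]) (use U in auto)
  moreover have "fs.dim (\<Psi> ` lab L U) \<le> fs.dim (lab (V \<times> {1..d}) (\<lambda>vi. I (fst vi)))"
    by (rule dim_mono[OF _ lab_FS[of _ _ "\<lambda>vi. SR (fst vi)"] \<Psi>_image]) (use fin I_FS in auto)
  moreover have "fs.dim (lab (V \<times> {1..d}) (\<lambda>vi. I (fst vi))) = (\<Sum>vi\<in>V \<times> {1..d}. fs.dim (I (fst vi)))"
    by (rule dim_lab[OF finVd, of _ "\<lambda>vi. SR (fst vi)"]) (use fin I_FS subspace_I in auto)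
  moreover have "(\<Sum>vi\<in>V \<times> {1..d}. fs.dim (I (fst vi))) = d * (\<Sum>v\<in>V. fs.dim (I v))"
    by (rule sum_fst_product)
  ultimately show ?thesis by simp
qed

lemma dot_ah: "v \<in> V \<Longrightarrow> dot n (ah f v F) (p v) = 0"
proof -
  assume v: "v \<in> V"
  have "dot n (ah f v F) (p v) = ah f v F 0 * p v 0 + (\<Sum>j=1..d. ah f v F j * p v j)"
    unfolding dot_def by (simp only: lessThan_Suc_atMost atMost_atLeast0 sum.atLeast_Suc_atMost[of 0 d] le0 One_nat_def)
  also have "(\<Sum>j=1..d. ah f v F j * p v j) = (\<Sum>j=1..d. p v j * f (Inr (v, j), F))"
    by (intro sum.cong refl) (auto simp: ah_def)
  also have "ah f v F 0 * p v 0 = - (\<Sum>j=1..d. p v j * f (Inr (v, j), F))"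
    using p0[OF v] by (simp add: ah_def)
  finally show ?thesis by simp
qed

lemma ah_add: "ah (\<lambda>x. f x + g x) v F i = ah f v F i + ah g v F i"
  and ah_scale: "ah (\<lambda>x. c * f x) v F i = c * ah f v F i"
  by (auto simp: ah_def sum.distrib distrib_left add_divide_distrib diff_divide_distrib sum_distrib_left mult.left_commute)

text \<open>In coordinate 0 both sides depend on the other coordinates in the same way, since both
  are functionals vanishing at \<open>p v\<close>: the left one by the choice of \<open>ah\<close>,
  the right one because forms are alternating.\<close>

lemma boundary_ah:
  assumes f: "f \<in> lab L U" "\<Psi> f = 0" and v: "v \<in> V" and R: "R \<in> SR v" and i: "i < n"
  shows "boundary \<Delta> (\<lambda>F. ah f v F i) R = ctr n (p v) (Zf f R) i"
proof -
  have pos: "boundary \<Delta> (\<lambda>F. f (Inr (v, j), F)) R = ctr n (p v) (Zf f R) j" if "j \<in> {1..d}" for j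
  proof -
    have "\<Psi> f ((v, j), R) = 0" using f(2) by simp
    then show ?thesis using v R that by (simp add: \<Psi>_def)
  qed
  show ?thesis
  proof (cases "i = 0")
    case True
    let ?b = "\<Sum>j=1..d. p v j * ctr n (p v) (Zf f R) j"
    have "(\<lambda>F. ah f v F i) = (\<lambda>F. (- 1 / p v 0) * (\<Sum>j=1..d. p v j * f (Inr (v, j), F)))"
      using True by (simp add: ah_def fun_eq_iff)
    then have "boundary \<Delta> (\<lambda>F. ah f v F i) R = (- 1 / p v 0) * (\<Sum>j=1..d. p v j * boundary \<Delta> (\<lambda>F. f (Inr (v, j), F)) R)"
      by (simp only: boundary_scale boundary_sum)
    also have "(\<Sum>j=1..d. p v j * boundary \<Delta> (\<lambda>F. f (Inr (v, j), F)) R) = ?b"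
      by (intro sum.cong refl) (simp add: pos)
    finally have bd: "boundary \<Delta> (\<lambda>F. ah f v F i) R = (- 1 / p v 0) * ?b" .
    have "0 = dot n (ctr n (p v) (Zf f R)) (p v)" by (rule dot_ctr_self[symmetric])
    also have "\<dots> = ctr n (p v) (Zf f R) 0 * p v 0 + (\<Sum>j=1..d. ctr n (p v) (Zf f R) j * p v j)"
      unfolding dot_def by (simp only: lessThan_Suc_atMost atMost_atLeast0 sum.atLeast_Suc_atMost[of 0 d] le0 One_nat_def)
    also have "(\<Sum>j=1..d. ctr n (p v) (Zf f R) j * p v j) = ?b" by (simp add: mult.commute)
    finally have "?b = - (ctr n (p v) (Zf f R) 0 * p v 0)" by (simp add: add_eq_0_iff)
    then show ?thesis unfolding bd using True p0[OF v] by simp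
  next
    case False
    then show ?thesis using pos[of i] i by (simp add: ah_def)
  qed
qed

definition Fe :: "'v set \<Rightarrow> 'v set" where
  "Fe e = (SOME F. \<forall>c \<in> (rel_cycles \<Delta> e (int d - 1) :: ('v set \<Rightarrow> 'k) set). c F = 0 \<longrightarrow> c = 0)"

lemma Fe: assumes "e \<in> Ed" "c \<in> rel_cycles \<Delta> e (int d - 1)" "c (Fe e) = (0::'k)" shows "c = 0"
proof -
  have "\<exists>F. \<forall>c \<in> (rel_cycles \<Delta> e (int d - 1) :: ('v set \<Rightarrow> 'k) set). c F = 0 \<longrightarrow> c = 0"
    using assms(1) by (intro spherical_top_coordinate[OF \<Delta> _ edges card_le]) (auto simp: faces_def)
  from someI_ex[OF this] show ?thesis using assms(2,3) unfolding Fe_def by blast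
qed

text \<open>The edge numbers, each read at a facet that determines it; \<open>Min\<close> and
  \<open>Max\<close> merely name the two ends.\<close>

definition \<Omega> :: "('v label \<times> 'v set \<Rightarrow> 'k) \<Rightarrow> 'v set \<Rightarrow> 'k" where
  "\<Omega> f e = (if e \<in> Ed then dot n (ah f (Min e) (Fe e)) (p (Max e)) + dot n (ah f (Max e) (Fe e)) (p (Min e)) else 0)"

lemma lin_\<Omega>: "lin \<Omega>"
  by (rule linI)
    (auto simp: \<Omega>_def fun_eq_iff dot_def ah_add ah_scale plus_fun_def sum.distrib sum_distrib_left algebra_simps)

text \<open>The solution attached to a chain of forms on the facets: its boundary as
  \<open>Z\<close>, its contractions with the points as the chains \<open>b v\<close>.\<close>

definition \<Theta> :: "((nat \<times> nat) \<times> 'v set \<Rightarrow> 'k) \<Rightarrow> 'v label \<times> 'v set \<Rightarrow> 'k" where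
  "\<Theta> a y = (case y of (Inl t, R) \<Rightarrow> if t \<in> pairs n then boundary \<Delta> (\<lambda>F. a (t, F)) R else 0
    | (Inr (v, i), F) \<Rightarrow> if v \<in> V \<and> i \<in> {1..d} \<and> F \<in> SF v then ctr n (p v) (\<lambda>t. a (t, F)) i else 0)"

lemma lin_\<Theta>: "lin \<Theta>"
  by (rule linI)
    (auto simp: \<Theta>_def fun_eq_iff boundary_add boundary_scale ctr_add ctr_scale split: sum.split prod.split)

text \<open>At a ridge containing the edge, the boundary of the edge number is
  \<open>Z (p u, p v) + Z (p v, p u)\<close>, which is zero. The edge number is therefore a relative
  cycle, and vanishing at one well-chosen facet forces it to vanish at all of them.\<close>

lemma edge_condition:
  assumes f: "f \<in> lab L U" "\<Psi> f = 0" "\<Omega> f = 0" and uv: "u < v" "{u, v} \<in> Ed" and F: "F \<in> Fc" "{u, v} \<subseteq> F"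
  shows "dot n (ah f u F) (p v) + dot n (ah f v F) (p u) = 0"
proof -
  let ?e = "{u, v}"
  have V: "u \<in> V" "v \<in> V" using uv(2) S(4) by (auto simp: faces_def vertices_def)
  define h where "h F = (if F \<in> star_faces \<Delta> ?e (int d - 1) then dot n (ah f u F) (p v) + dot n (ah f v F) (p u) else 0)" for F
  have hF: "h \<in> FS (star_faces \<Delta> ?e (int d - 1))" by (auto simp: h_def FS_def)
  have "boundary \<Delta> h R = 0" if R: "?e \<subseteq> R" for R
  proof (cases "R \<in> Rd")
    case False
    have "h \<in> FS Fc" using hF by (auto simp: FS_def star_faces_def)
    then have "boundary \<Delta> h \<in> FS (faces \<Delta> (int d - 1 - 1))" by (rule boundary_FS[OF \<Delta>])
    then show ?thesis using False by (simp add: FS_def)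
  next
    case True
    have SR: "R \<in> SR u" "R \<in> SR v" using True R by (auto simp: star_faces_def)
    have st: "insert w R \<in> star_faces \<Delta> ?e (int d - 1)" if "w \<notin> R" "insert w R \<in> \<Delta>" for w
      using that True R S(3)[of R] by (auto simp: star_faces_def faces_def)
    have "boundary \<Delta> h R = boundary \<Delta> (\<lambda>F. dot n (ah f u F) (p v) + dot n (ah f v F) (p u)) R"
      unfolding boundary_eq[OF S(1)] by (intro sum.cong refl) (use st in \<open>auto simp: h_def\<close>)
    also have "\<dots> = boundary \<Delta> (\<lambda>F. (\<Sum>i<n. p v i * ah f u F i) + (\<Sum>i<n. p u i * ah f v F i)) R"
      by (simp only: dot_def mult.commute)
    also have "\<dots> = (\<Sum>i<n. p v i * boundary \<Delta> (\<lambda>F. ah f u F i) R) + (\<Sum>i<n. p u i * boundary \<Delta> (\<lambda>F. ah f v F i) R)"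
      by (simp only: boundary_add boundary_sum boundary_scale)
    also have "\<dots> = dot n (ctr n (p u) (Zf f R)) (p v) + dot n (ctr n (p v) (Zf f R)) (p u)"
      unfolding dot_def using boundary_ah[OF f(1,2) V(1) SR(1)] boundary_ah[OF f(1,2) V(2) SR(2)]
      by (simp add: mult.commute)
    also have "\<dots> = 0" by (subst dot_ctr_swap) simp
    finally show ?thesis .
  qed
  then have "h \<in> rel_cycles \<Delta> ?e (int d - 1)" using hF by (simp add: rel_cycles_def)
  moreover have "h (Fe ?e) = 0"
  proof -
    have "\<Omega> f ?e = 0" using f(3) by simp
    moreover have "Min ?e = u" "Max ?e = v" using uv(1) by auto
    ultimately show ?thesis using uv(2) by (simp add: \<Omega>_def h_def)
  qed
  ultimately have "h = 0" by (rule Fe[OF uv(2)])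
  then have "h F = 0" by simp
  then show ?thesis using F by (simp add: h_def star_faces_def)
qed

text \<open>The vertices of a facet are independent and the functionals on it satisfy the pairwise
  conditions, so they are contractions of one form \<open>A F\<close>. The difference
  \<open>c\<close> between \<open>Z\<close> and the boundary of these forms is a cycle, and its
  contraction with \<open>p v\<close> is \<open>Z (p v, -) - \<partial> (b v) = 0\<close>; hence
  \<open>rigid\<close> makes it vanish.\<close>

lemma kernel_in_\<Theta>:
  assumes f: "f \<in> lab L U" "\<Psi> f = 0" "\<Omega> f = 0" shows "f \<in> \<Theta> ` FS (pairs n \<times> Fc)"
proof -
  have "\<exists>A\<in>FS (pairs n). \<forall>v\<in>F. \<forall>j<n. ctr n (p v) A j = ah f v F j" if F: "F \<in> Fc" for F
  proof (rule form_exists[OF _ ind[OF F]])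
    have FD: "F \<in> \<Delta>" using F by (simp add: faces_def)
    show "finite F" using S(3)[OF FD] .
    have V: "v \<in> V" if "v \<in> F" for v using S(4)[OF FD, of "{v}"] that by (simp add: vertices_def)
    show self: "dot n (ah f v F) (p v) = 0" if "v \<in> F" for v by (rule dot_ah[OF V[OF that]])
    have E: "{u, v} \<in> Ed" if "u \<in> F" "v \<in> F" "u \<noteq> v" for u v
      using S(4)[OF FD, of "{u, v}"] that by (simp add: faces_def)
    show "dot n (ah f u F) (p v) + dot n (ah f v F) (p u) = 0" if uv: "u \<in> F" "v \<in> F" for u v
    proof (cases u v rule: linorder_cases)
      case less
      then show ?thesis using edge_condition[OF f less E F] uv by simp
    next
      case equal
      then show ?thesis using self[OF uv(1)] by simp
    next
      case greater
      have "dot n (ah f v F) (p u) + dot n (ah f u F) (p v) = 0"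
        using edge_condition[OF f greater E F] uv greater by simp
      then show ?thesis by (simp only: add.commute)
    qed
  qed
  then obtain A where A: "\<And>F. F \<in> Fc \<Longrightarrow> A F \<in> FS (pairs n)"
    "\<And>F v j. F \<in> Fc \<Longrightarrow> v \<in> F \<Longrightarrow> j < n \<Longrightarrow> ctr n (p v) (A F) j = ah f v F j" by metis
  define a where "a y = (if snd y \<in> Fc then A (snd y) (fst y) else 0)" for y
  have aF: "a \<in> FS (pairs n \<times> Fc)"
  proof -
    have "a y = 0" if "y \<notin> pairs n \<times> Fc" for y
      using A(1)[of "snd y"] that unfolding a_def FS_def by (cases y) auto
    then show ?thesis by (simp add: FS_def)
  qed
  have aA: "(\<lambda>t. a (t, F)) = A F" if "F \<in> Fc" for F using that by (simp add: a_def fun_eq_iff)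
  have fZ: "(\<lambda>R. f (Inl t, R)) \<in> Z" if "t \<in> pairs n" for t
    using lab_mem[OF f(1), of "Inl t"] that by (simp add: L_def U_def)
  define c where "c y = (case y of (t, R) \<Rightarrow> if t \<in> pairs n then f (Inl t, R) + (-1) * boundary \<Delta> (\<lambda>F. a (t, F)) R else 0)" for y
  have bdF: "boundary \<Delta> (\<lambda>F. a (t, F)) \<in> FS Rd" for t
  proof -
    have "(\<lambda>F. a (t, F)) \<in> FS Fc" by (auto simp: FS_def a_def)
    from boundary_FS[OF \<Delta> this] show ?thesis by simp
  qed
  have "c = 0"
  proof (rule rigid)
    show "c \<in> FS (pairs n \<times> Rd)"
    proof -
      have "c (t, R) = 0" if "(t, R) \<notin> pairs n \<times> Rd" for t R
      proof (cases "t \<in> pairs n")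
        case True
        then have "R \<notin> Rd" using that by simp
        then have "f (Inl t, R) = 0" "boundary \<Delta> (\<lambda>F. a (t, F)) R = 0"
          using subsetD[OF Z_FS fZ[OF True]] bdF[of t] by (auto simp: FS_def)
        then show ?thesis by (simp add: c_def)
      qed (simp add: c_def)
      then show ?thesis by (auto simp: FS_def)
    qed
    show "boundary \<Delta> (\<lambda>R. c (t, R)) = 0" if t: "t \<in> pairs n" for t
    proof
      fix H
      have "boundary \<Delta> (\<lambda>R. c (t, R)) H = boundary \<Delta> (\<lambda>R. f (Inl t, R)) H + (-1) * boundary \<Delta> (boundary \<Delta> (\<lambda>F. a (t, F))) H"
        using t by (simp only: c_def prod.case if_True boundary_add boundary_scale)
      also have "\<dots> = 0" using fZ[OF t] by (simp add: cycles_eq boundary_boundary[OF \<Delta>])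
      finally show "boundary \<Delta> (\<lambda>R. c (t, R)) H = 0 H" by simp
    qed
    fix R v j assume R: "R \<in> Rd" and v: "v \<in> R" and j: "j < n"
    have RD: "R \<in> \<Delta>" using R by (simp add: faces_def)
    have V: "v \<in> V" using S(4)[OF RD, of "{v}"] v by (simp add: vertices_def)
    have SRv: "R \<in> SR v" using R v by (simp add: star_faces_def)
    let ?N = "{w. w \<notin> R \<and> insert w R \<in> \<Delta>}"
    have inFc: "insert w R \<in> Fc" if "w \<in> ?N" for w using that R S(3)[OF RD] by (auto simp: faces_def)
    have "ctr n (p v) (\<lambda>t. c (t, R)) j = ctr n (p v) (\<lambda>t. Zf f R t + (-1) * (\<Sum>w\<in>?N. face_sign w (insert w R) * a (t, insert w R))) j"
    proof -
      have "alt (\<lambda>t. c (t, R)) i j = alt (\<lambda>t. Zf f R t + (-1) * (\<Sum>w\<in>?N. face_sign w (insert w R) * a (t, insert w R))) i j"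
        if "i < n" for i
        using that j by (auto simp: alt_def c_def Zf_def pairs_def boundary_eq[OF S(1)])
      then show ?thesis unfolding ctr_def by (intro sum.cong refl) simp
    qed
    also have "\<dots> = ctr n (p v) (Zf f R) j + (-1) * (\<Sum>w\<in>?N. face_sign w (insert w R) * ctr n (p v) (\<lambda>t. a (t, insert w R)) j)"
      unfolding ctr_add ctr_scale ctr_sum ..
    also have "(\<Sum>w\<in>?N. face_sign w (insert w R) * ctr n (p v) (\<lambda>t. a (t, insert w R)) j)
        = (\<Sum>w\<in>?N. face_sign w (insert w R) * ah f v (insert w R) j)"
    proof (intro sum.cong refl)
      fix w assume w: "w \<in> ?N"
      have "ctr n (p v) (\<lambda>t. a (t, insert w R)) j = ah f v (insert w R) j"
        unfolding aA[OF inFc[OF w]] using v j by (intro A(2)[OF inFc[OF w]]) auto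
      then show "face_sign w (insert w R) * ctr n (p v) (\<lambda>t. a (t, insert w R)) j = face_sign w (insert w R) * ah f v (insert w R) j"
        by simp
    qed
    also have "\<dots> = boundary \<Delta> (\<lambda>F. ah f v F j) R" by (simp only: boundary_eq[OF S(1)])
    also have "\<dots> = ctr n (p v) (Zf f R) j" by (rule boundary_ah[OF f(1,2) V SRv j])
    finally show "ctr n (p v) (\<lambda>t. c (t, R)) j = 0" by simp
  qed
  have "f y = \<Theta> a y" for y
  proof -
    obtain l F where y: "y = (l, F)" by (cases y)
    show ?thesis
    proof (cases l)
      case (Inl t)
      show ?thesis
      proof (cases "t \<in> pairs n")
        case True
        have "c (t, F) = 0" using \<open>c = 0\<close> by simp
        then show ?thesis using True by (simp add: y Inl \<Theta>_def c_def)
      next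
        case False
        then have "l \<notin> L" by (auto simp: L_def Inl)
        then have "f (l, F) = 0" using f(1) by (simp add: lab_def)
        then show ?thesis using False by (simp add: y Inl \<Theta>_def)
      qed
    next
      case (Inr vi)
      obtain v i where vi: "vi = (v, i)" by (cases vi)
      show ?thesis
      proof (cases "v \<in> V \<and> i \<in> {1..d}")
        case False
        then have "l \<notin> L" by (auto simp: L_def Inr vi)
        then have "f (l, F) = 0" using f(1) by (simp add: lab_def)
        then show ?thesis using False by (auto simp: y Inr vi \<Theta>_def)
      next
        case True
        then have lL: "l \<in> L" by (auto simp: L_def Inr vi)
        show ?thesis
        proof (cases "F \<in> SF v")
          case FS: True
          then have F: "F \<in> Fc" "v \<in> F" by (auto simp: star_faces_def)
          have "ctr n (p v) (\<lambda>t. a (t, F)) i = ah f v F i" unfolding aA[OF F(1)] using F True by (intro A(2)) auto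
          also have "\<dots> = f (Inr (v, i), F)" using True by (simp add: ah_def)
          finally show ?thesis using True FS by (simp add: y Inr vi \<Theta>_def)
        next
          case nF: False
          have "(\<lambda>F. f (l, F)) \<in> FS (SF v)" using lab_mem[OF f(1) lL] by (simp add: U_def Inr vi)
          then have "f (l, F) = 0" using nF by (simp add: FS_def)
          then show ?thesis using nF by (simp add: y Inr vi \<Theta>_def)
        qed
      qed
    qed
  qed
  then have "f = \<Theta> a" by (rule ext)
  then show ?thesis using aF by blast
qed

text \<open>Modulo the solutions without edge numbers, the solution space embeds into the functions
  on edges; the solutions without edge numbers come from \<open>\<Theta>\<close>. This upper bound
  meets the lower bound \<open>dim_kernel_\<Psi>\<close>.\<close>

theorem edge_inequality:
  "(n choose 2) * fs.dim Z + d * (\<Sum>v\<in>V. card (SF v)) \<le> card Ed + (n choose 2) * card Fc + d * (\<Sum>v\<in>V. fs.dim (I v))"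
proof -
  let ?Y = "{f \<in> lab L U. \<Psi> f = 0}"
  have finL: "finite (Sigma L UX)" using U by auto
  have sub: "?Y \<subseteq> FS (Sigma L UX)" using lab_FS[of L U UX] U(3) by blast
  have Y: "fs.subspace ?Y" by (intro subspace_kernel lin_\<Psi> subspace_lab U)
  have "fs.dim ?Y = fs.dim {f \<in> ?Y. \<Omega> f = 0} + fs.dim (\<Omega> ` ?Y)" by (rule rank_nullity[OF finL sub Y lin_\<Omega>])
  moreover have "fs.dim (\<Omega> ` ?Y) \<le> fs.dim (FS Ed :: ('v set \<Rightarrow> 'k) set)"
    by (rule dim_mono[OF fin(2) order_refl]) (auto simp: \<Omega>_def FS_def)
  moreover have "fs.dim (FS Ed :: ('v set \<Rightarrow> 'k) set) = card Ed" by (rule dim_FS[OF fin(2)])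
  moreover have "fs.dim {f \<in> ?Y. \<Omega> f = 0} \<le> fs.dim (\<Theta> ` FS (pairs n \<times> Fc))"
  proof (rule dim_mono)
    show "{f \<in> ?Y. \<Omega> f = 0} \<subseteq> \<Theta> ` FS (pairs n \<times> Fc)" using kernel_in_\<Theta> by blast
    show "\<Theta> ` FS (pairs n \<times> Fc) \<subseteq> FS (Sigma L UX)"
    proof
      fix g assume "g \<in> \<Theta> ` FS (pairs n \<times> Fc)"
      then obtain a where a: "a \<in> FS (pairs n \<times> Fc)" "g = \<Theta> a" by blast
      have bdF: "boundary \<Delta> (\<lambda>F. a (t, F)) \<in> FS Rd" for t
      proof -
        have "(\<lambda>F. a (t, F)) \<in> FS Fc" using a(1) by (rule FS_snd)
        from boundary_FS[OF \<Delta> this] show ?thesis by simp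
      qed
      have "g (l, F) = 0" if "(l, F) \<notin> Sigma L UX" for l F
        using that bdF by (cases l) (auto simp: a(2) \<Theta>_def L_def UX_def FS_def)
      then show "g \<in> FS (Sigma L UX)" by (auto simp: FS_def)
    qed
  qed (rule finL)
  moreover have "fs.dim (\<Theta> ` FS (pairs n \<times> Fc)) \<le> fs.dim (FS (pairs n \<times> Fc) :: ((nat \<times> nat) \<times> 'v set \<Rightarrow> 'k) set)"
    by (rule dim_inj_le[OF _ order_refl subspace_FS lin_\<Theta>]) (use finite_pairs fin in auto)
  moreover have "fs.dim (FS (pairs n \<times> Fc) :: ((nat \<times> nat) \<times> 'v set \<Rightarrow> 'k) set) = (n choose 2) * card Fc"
    by (subst dim_FS) (use finite_pairs fin card_pairs in \<open>auto simp: card_cartesian_product\<close>)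
  ultimately show ?thesis using dim_kernel_\<Psi> dim_E by linarith
qed

end

section \<open>The kernel of the sum of the inclusion maps\<close>

lemma mem_coset: "fs.subspace B \<Longrightarrow> y \<in> coset B f \<longleftrightarrow> y - f \<in> B"
proof
  assume "y \<in> coset B f"
  then obtain b where b: "b \<in> B" "y = (\<lambda>x. b x + f x)" by (auto simp: coset_def)
  then have "y - f = b" by (simp add: fun_eq_iff)
  then show "y - f \<in> B" using b by simp
next
  assume "y - f \<in> B"
  then show "y \<in> coset B f" unfolding coset_def by (rule rev_image_eqI) (simp add: fun_eq_iff)
qed

text \<open>The inclusion map on cosets therefore sends the relative class of a cocycle
  \<open>z\<close> to the absolute class of the same \<open>z\<close>.\<close>

lemma Union_coset:
  assumes B: "fs.subspace B" and B': "fs.subspace B'" "B' \<subseteq> B"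
  shows "(\<Union>f\<in>coset B' z. coset B f) = coset B z"
proof (intro equalityI subsetI)
  fix y assume "y \<in> (\<Union>f\<in>coset B' z. coset B f)"
  then obtain f where f: "f \<in> coset B' z" "y \<in> coset B f" by (rule UN_E)
  have "f - z \<in> B" "y - f \<in> B" using f B'(2) by (auto simp: mem_coset[OF B] mem_coset[OF B'(1)])
  then have "(y - f) + (f - z) \<in> B" by (intro fs.subspace_add[OF B])
  then show "y \<in> coset B z" by (simp add: mem_coset[OF B])
next
  fix y assume y: "y \<in> coset B z"
  have "z \<in> coset B' z" using fs.subspace_0[OF B'(1)] by (simp add: mem_coset[OF B'(1)])
  then show "y \<in> (\<Union>f\<in>coset B' z. coset B f)" by (rule UN_I) (rule y)
qed

lemma cocycles_eq: "cocycles \<Delta> A i = {f \<in> FS (faces \<Delta> i - A). coboundary \<Delta> f = 0}"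
  by (auto simp: cocycles_def cochains_def fun_space_def FS_def zero_fun_def)

lemma coboundaries_eq: "coboundaries \<Delta> A i = coboundary \<Delta> ` FS (faces \<Delta> (i - 1) - A)"
  by (simp add: coboundaries_def cochains_def fun_space_def FS_def)

lemma subspace_cocycles: "fs.subspace (cocycles \<Delta> A i)"
  unfolding cocycles_eq by (intro subspace_kernel lin_coboundary subspace_FS)

lemma subspace_coboundaries: "fs.subspace (coboundaries \<Delta> A i)"
  unfolding coboundaries_eq by (intro fsp.linear_subspace_image lin_coboundary subspace_FS)

lemma faces_minus_costar: "faces \<Delta> i - costar \<Delta> v = star_faces \<Delta> {v} i"
  by (auto simp: faces_def costar_def star_faces_def)

lemma coboundary_FS:
  assumes "simplicial_complex \<Delta>" "f \<in> FS (star_faces \<Delta> {v} (i - 1))"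
  shows "coboundary \<Delta> f \<in> FS (star_faces \<Delta> {v} i)"
proof -
  note S = simplicial_complexD[OF assms(1)]
  have "coboundary \<Delta> f F = 0" if F: "F \<notin> star_faces \<Delta> {v} i" for F
  proof (cases "F \<in> \<Delta>")
    case True
    have "f (F - {u}) = 0" if u: "u \<in> F" for u
    proof -
      have "F - {u} \<notin> star_faces \<Delta> {v} (i - 1)"
      proof
        assume G: "F - {u} \<in> star_faces \<Delta> {v} (i - 1)"
        have "card F = Suc (card (F - {u}))" using S(3)[OF True] u by (rule card.remove)
        then have "F \<in> star_faces \<Delta> {v} i" using G True by (auto simp: star_faces_def faces_def)
        then show False using F by blast
      qed
      then show ?thesis using assms(2) by (simp add: FS_def)
    qed
    then show ?thesis by (simp add: coboundary_def)
  qed (simp add: coboundary_def)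
  then show ?thesis by (simp add: FS_def)
qed

lemma coboundaries_costar:
  assumes "simplicial_complex \<Delta>"
  shows "coboundaries \<Delta> (costar \<Delta> v) i \<subseteq> cocycles \<Delta> (costar \<Delta> v) i \<inter> coboundaries \<Delta> {} i"
proof
  fix f assume "f \<in> coboundaries \<Delta> (costar \<Delta> v) i"
  then obtain g where g: "f = coboundary \<Delta> g" "g \<in> FS (star_faces \<Delta> {v} (i - 1))"
    unfolding coboundaries_eq faces_minus_costar by (rule imageE)
  have "coboundary \<Delta> f = 0" unfolding g(1) by (rule ext) (simp add: coboundary_coboundary[OF assms])
  then have "f \<in> cocycles \<Delta> (costar \<Delta> v) i"
    unfolding cocycles_eq faces_minus_costar using coboundary_FS[OF assms g(2)] g(1) by simp
  moreover have "g \<in> FS (faces \<Delta> (i - 1) - {})" using g(2) by (auto simp: FS_def star_faces_def)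
  then have "f \<in> coboundaries \<Delta> {} i" unfolding coboundaries_eq g(1) by (rule imageI)
  ultimately show "f \<in> cocycles \<Delta> (costar \<Delta> v) i \<inter> coboundaries \<Delta> {} i" by (rule IntI)
qed

lemma finite_vertices: "simplicial_complex \<Delta> \<Longrightarrow> finite (vertices \<Delta>)"
  by (rule inj_on_finite[of "\<lambda>v. {v}" _ \<Delta>]) (auto simp: vertices_def inj_on_def simplicial_complex_def)

lemma sum_support:
  assumes "finite D" "A \<subseteq> D" "\<And>x. x \<in> D \<Longrightarrow> x \<notin> A \<Longrightarrow> g x = (0::'k::field)"
  shows "(\<Sum>x\<in>A. g x) = (\<Sum>x\<in>D. g x)"
  by (rule sum.mono_neutral_left) (use assms in auto)

text \<open>Relative cycles are the annihilator of the relative coboundaries, by adjointness: the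
  boundary at a face containing \<open>v\<close> is tested with the coboundary of the indicator of
  that face.\<close>

lemma dim_coboundaries_costar:
  fixes \<Delta> :: "'v::linorder set set"
  assumes \<Delta>: "simplicial_complex \<Delta>"
  shows "fs.dim (rel_cycles \<Delta> {v} i :: ('v set \<Rightarrow> 'k::field) set)
    + fs.dim (coboundaries \<Delta> (costar \<Delta> v) i :: ('v set \<Rightarrow> 'k) set) = card (star_faces \<Delta> {v} i)"
proof -
  note S = simplicial_complexD[OF \<Delta>]
  let ?X = "star_faces \<Delta> {v} i"
  let ?B = "coboundaries \<Delta> (costar \<Delta> v) i :: ('v set \<Rightarrow> 'k) set"
  have fX: "finite ?X" by (rule finite_star_faces[OF S(1)])
  have XD: "?X \<subseteq> \<Delta>" by (auto simp: star_faces_def faces_def)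
  have pair: "(\<Sum>F\<in>?X. coboundary \<Delta> f F * c F) = (\<Sum>G\<in>\<Delta>. f G * boundary \<Delta> c G)"
    if c: "c \<in> FS ?X" for c and f :: "'v set \<Rightarrow> 'k"
    unfolding boundary_coboundary_adjoint[OF \<Delta>, symmetric]
    by (rule sum_support[OF S(1) XD]) (use c in \<open>simp add: FS_def\<close>)
  have "(rel_cycles \<Delta> {v} i :: ('v set \<Rightarrow> 'k) set) = {c \<in> FS ?X. \<forall>n\<in>?B. (\<Sum>x\<in>?X. n x * c x) = 0}"
  proof (intro equalityI subsetI)
    fix c :: "'v set \<Rightarrow> 'k" assume c: "c \<in> rel_cycles \<Delta> {v} i"
    then have cX: "c \<in> FS ?X" and bd: "\<And>H. {v} \<subseteq> H \<Longrightarrow> boundary \<Delta> c H = 0" by (auto simp: rel_cycles_def)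
    have "(\<Sum>x\<in>?X. n x * c x) = 0" if "n \<in> ?B" for n
    proof -
      from that have "n \<in> coboundary \<Delta> ` FS (star_faces \<Delta> {v} (i - 1))"
        unfolding coboundaries_eq faces_minus_costar .
      then obtain f where f: "n = coboundary \<Delta> f" "f \<in> FS (star_faces \<Delta> {v} (i - 1))" by (rule imageE)
      have "f G * boundary \<Delta> c G = 0" for G
        by (cases "{v} \<subseteq> G") (use bd f(2) in \<open>auto simp: FS_def star_faces_def\<close>)
      then show ?thesis unfolding f(1) pair[OF cX] by simp
    qed
    then show "c \<in> {c \<in> FS ?X. \<forall>n\<in>?B. (\<Sum>x\<in>?X. n x * c x) = 0}" using cX by blast
  next
    fix c :: "'v set \<Rightarrow> 'k" assume "c \<in> {c \<in> FS ?X. \<forall>n\<in>?B. (\<Sum>x\<in>?X. n x * c x) = 0}"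
    then have cX: "c \<in> FS ?X" and perp: "\<forall>n\<in>?B. (\<Sum>x\<in>?X. n x * c x) = 0" by auto
    have "boundary \<Delta> c H = 0" if H: "{v} \<subseteq> H" for H
    proof (cases "H \<in> star_faces \<Delta> {v} (i - 1)")
      case True
      have "unitf H \<in> FS (star_faces \<Delta> {v} (i - 1))" using True by (auto simp: FS_def unitf_def)
      then have "coboundary \<Delta> (unitf H) \<in> ?B" unfolding coboundaries_eq faces_minus_costar by (rule imageI)
      then have "0 = (\<Sum>x\<in>?X. coboundary \<Delta> (unitf H) x * c x)" using perp by simp
      also have "\<dots> = (\<Sum>G\<in>\<Delta>. boundary \<Delta> c G * unitf H G)" unfolding pair[OF cX] by (simp only: mult.commute)
      also have "\<dots> = boundary \<Delta> c H" by (rule sum_unitf[OF S(1)]) (use True in \<open>auto simp: star_faces_def faces_def\<close>)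
      finally show ?thesis by simp
    next
      case False
      have "c \<in> FS (faces \<Delta> i)" using cX by (auto simp: FS_def star_faces_def)
      then have "boundary \<Delta> c \<in> FS (faces \<Delta> (i - 1))" by (rule boundary_FS[OF \<Delta>])
      moreover have "H \<notin> faces \<Delta> (i - 1)" using False H by (auto simp: star_faces_def)
      ultimately show ?thesis unfolding FS_def by blast
    qed
    then show "c \<in> rel_cycles \<Delta> {v} i" using cX by (simp add: rel_cycles_def)
  qed
  moreover have "?B \<subseteq> FS ?X" using coboundaries_costar[OF \<Delta>] unfolding cocycles_eq faces_minus_costar by blast
  ultimately show ?thesis using dim_perp[OF fX, of ?B] by simp
qed

text \<open>If a sum of classes from independent subspaces is zero, each of them is zero, so the
  kernel of the sum map is the direct sum of the kernels of the single maps. The kernel at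
  \<open>v\<close> is the space of relative cocycles that are coboundaries in
  \<open>\<Delta>\<close>, modulo relative coboundaries; the nonzero scalars \<open>a v\<close> do
  not change it.\<close>

lemma kernel_dim_eq:
  fixes \<Delta> :: "'v::linorder set set" and a :: "'v \<Rightarrow> 'k::field"
  assumes \<Delta>: "simplicial_complex \<Delta>" and a: "\<And>v. v \<in> vertices \<Delta> \<Longrightarrow> a v \<noteq> 0"
    and ind: "independent_subspaces (cohomology \<Delta> {} i :: ('k, ('v set \<Rightarrow> 'k) set) module) (vertices \<Delta>)
        (\<lambda>v. incl_star \<Delta> i ` carrier (cohomology \<Delta> (costar \<Delta> v) i))"
  shows "kernel_dim a \<Delta> i + (\<Sum>v\<in>vertices \<Delta>. fs.dim (coboundaries \<Delta> (costar \<Delta> v) i :: ('v set \<Rightarrow> 'k) set))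
    = (\<Sum>v\<in>vertices \<Delta>. fs.dim (cocycles \<Delta> (costar \<Delta> v) i \<inter> coboundaries \<Delta> {} i :: ('v set \<Rightarrow> 'k) set))"
proof -
  note S = simplicial_complexD[OF \<Delta>]
  let ?V = "vertices \<Delta>"
  define B where "B = (coboundaries \<Delta> {} i :: ('v set \<Rightarrow> 'k) set)"
  define Bv where "Bv v = (coboundaries \<Delta> (costar \<Delta> v) i :: ('v set \<Rightarrow> 'k) set)" for v
  define Zv where "Zv v = (cocycles \<Delta> (costar \<Delta> v) i :: ('v set \<Rightarrow> 'k) set)" for v
  define N where "N v = Zv v \<inter> B" for v
  define H where "H = (cohomology \<Delta> {} i :: ('k, ('v set \<Rightarrow> 'k) set) module)"
  define Hv where "Hv v = (cohomology \<Delta> (costar \<Delta> v) i :: ('k, ('v set \<Rightarrow> 'k) set) module)" for v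
  have B: "fs.subspace B" and Bv: "\<And>v. fs.subspace (Bv v)" and Zv: "\<And>v. fs.subspace (Zv v)"
    unfolding B_def Bv_def Zv_def by (rule subspace_coboundaries subspace_cocycles)+
  have N: "fs.subspace (N v)" for v unfolding N_def by (rule fs.subspace_inter[OF Zv B])
  have BN: "Bv v \<subseteq> N v" for v unfolding Bv_def N_def Zv_def B_def by (rule coboundaries_costar[OF \<Delta>])
  have BvB: "Bv v \<subseteq> B" for v using BN[of v] by (auto simp: N_def)
  have Hv_car: "carrier (Hv v) = coset (Bv v) ` Zv v"
    and Hv_zero: "coset (Bv v) 0 = \<zero>\<^bsub>Hv v\<^esub>" "\<zero>\<^bsub>Hv v\<^esub> = Bv v"
    and Hv_add: "coset (Bv v) (f + g) = coset (Bv v) f \<oplus>\<^bsub>Hv v\<^esub> coset (Bv v) g"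
    and Hv_smult: "coset (Bv v) (\<lambda>x. c * f x) = c \<odot>\<^bsub>Hv v\<^esub> coset (Bv v) f" for v f g c
    unfolding Hv_def cohomology_def cochains_def Zv_def Bv_def
    by (intro quot_space_carrier quot_space_zero quot_space_add quot_space_smult subspace_coboundaries subspace_cocycles)+
  define Z where "Z = (cocycles \<Delta> {} i :: ('v set \<Rightarrow> 'k) set)"
  have Z: "fs.subspace Z" unfolding Z_def by (rule subspace_cocycles)
  have H_car: "carrier H = coset B ` Z"
    and H_zero: "coset B 0 = \<zero>\<^bsub>H\<^esub>" "\<zero>\<^bsub>H\<^esub> = B"
    and H_add: "coset B (f + g) = coset B f \<oplus>\<^bsub>H\<^esub> coset B g"
    and H_smult: "coset B (\<lambda>x. c * f x) = c \<odot>\<^bsub>H\<^esub> coset B f" for f g c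
    unfolding H_def cohomology_def cochains_def Z_def B_def
    by (intro quot_space_carrier quot_space_zero quot_space_add quot_space_smult subspace_coboundaries subspace_cocycles)+
  have ZvZ: "Zv v \<subseteq> Z" for v by (auto simp: Zv_def Z_def cocycles_eq FS_def)
  have incl: "incl_star \<Delta> i (coset (Bv v) z) = coset B z" for v z
    unfolding incl_star_def cochains_def a_r_coset_fun_space B_def[symmetric] by (rule Union_coset[OF B Bv BvB])
  have sum: "sum_incl_star a \<Delta> i x = coset B (\<Sum>v\<in>?V. (\<lambda>F. a v * z v F))"
    if "\<And>v. v \<in> ?V \<Longrightarrow> x v = coset (Bv v) (z v)" "\<And>v. v \<in> ?V \<Longrightarrow> z v \<in> Zv v" for x z
  proof -
    interpret H: vectorspace class_ring H by (rule vectorspace_image[OF Z H_car H_zero(1) H_add H_smult])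
    have mem: "(\<lambda>F. a v * z v F) \<in> Z" if "v \<in> ?V" for v
      using that \<open>\<And>v. v \<in> ?V \<Longrightarrow> z v \<in> Zv v\<close> ZvZ by (intro fs.subspace_scale[OF Z]) blast
    have "sum_incl_star a \<Delta> i x = finsum H (\<lambda>v. coset B (\<lambda>F. a v * z v F)) ?V"
      unfolding sum_incl_star_def H_def[symmetric]
    proof (rule H.finsum_cong')
      fix v assume v: "v \<in> ?V"
      show "a v \<odot>\<^bsub>H\<^esub> incl_star \<Delta> i (x v) = coset B (\<lambda>F. a v * z v F)"
        using that(1)[OF v] by (simp only: incl H_smult)
    qed (use mem in \<open>auto simp: H_car\<close>)
    also have "\<dots> = coset B (\<Sum>v\<in>?V. (\<lambda>F. a v * z v F))"
      by (rule finsum_image[OF Z H_car H_zero(1) H_add H_smult finite_vertices[OF \<Delta>] mem])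
    finally show ?thesis .
  qed
  define M where "M = direct_sum_space ?V Hv"
  define K where "K = M\<lparr>carrier := {x \<in> carrier M. sum_incl_star a \<Delta> i x = \<zero>\<^bsub>H\<^esub>}\<rparr>"
  define \<phi> where "\<phi> f = (\<lambda>v\<in>?V. coset (Bv v) (\<lambda>F. f (v, F)))" for f :: "'v \<times> 'v set \<Rightarrow> 'k"
  have K_simps: "\<zero>\<^bsub>K\<^esub> = (\<lambda>v\<in>?V. \<zero>\<^bsub>Hv v\<^esub>)" "x \<oplus>\<^bsub>K\<^esub> y = (\<lambda>v\<in>?V. x v \<oplus>\<^bsub>Hv v\<^esub> y v)"
    "c \<odot>\<^bsub>K\<^esub> x = (\<lambda>v\<in>?V. c \<odot>\<^bsub>Hv v\<^esub> x v)" for x y c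
    by (simp_all add: K_def M_def direct_sum_space_def)
  have U: "fs.subspace (lab ?V N)" by (rule subspace_lab) (rule N)
  have fX: "finite (Sigma ?V (\<lambda>v. star_faces \<Delta> {v} i))"
    by (intro finite_SigmaI finite_vertices \<Delta> finite_star_faces S(1))
  have NF: "N v \<subseteq> FS (star_faces \<Delta> {v} i)" for v by (auto simp: N_def Zv_def cocycles_eq faces_minus_costar)
  have "vs_dim K + fs.dim {f \<in> lab ?V N. \<phi> f = \<zero>\<^bsub>K\<^esub>} = fs.dim (lab ?V N)"
  proof (rule vs_dim_image[OF fX lab_FS[OF NF] U])
    show "carrier K = \<phi> ` lab ?V N"
    proof (intro equalityI subsetI)
      fix x assume "x \<in> carrier K"
      then have x: "x \<in> (\<Pi>\<^sub>E v\<in>?V. carrier (Hv v))" and s0: "sum_incl_star a \<Delta> i x = \<zero>\<^bsub>H\<^esub>"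
        by (auto simp: K_def M_def direct_sum_space_def)
      have "\<forall>v\<in>?V. \<exists>z. z \<in> Zv v \<and> x v = coset (Bv v) z" using PiE_mem[OF x] unfolding Hv_car by blast
      from bchoice[OF this] obtain z where z': "\<forall>v\<in>?V. z v \<in> Zv v \<and> x v = coset (Bv v) (z v)" by (elim exE) (rule that)
      then have z: "\<And>v. v \<in> ?V \<Longrightarrow> z v \<in> Zv v" "\<And>v. v \<in> ?V \<Longrightarrow> x v = coset (Bv v) (z v)" by auto
      interpret H: vectorspace class_ring H by (rule vectorspace_image[OF Z H_car H_zero(1) H_add H_smult])
      let ?y = "\<lambda>v\<in>?V. coset B (\<lambda>F. a v * z v F)"
      have mem: "(\<lambda>F. a v * z v F) \<in> Zv v" if "v \<in> ?V" for v by (rule fs.subspace_scale[OF Zv z(1)[OF that]])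
      have yP: "?y \<in> (\<Pi>\<^sub>E v\<in>?V. incl_star \<Delta> i ` carrier (Hv v))"
      proof (rule restrict_PiE_iff[THEN iffD2], rule ballI)
        fix v assume v: "v \<in> ?V"
        show "coset B (\<lambda>F. a v * z v F) \<in> incl_star \<Delta> i ` carrier (Hv v)"
          unfolding Hv_car incl[of v, symmetric] by (intro imageI mem[OF v])
      qed
      have "finsum H ?y ?V = finsum H (\<lambda>v. coset B (\<lambda>F. a v * z v F)) ?V"
        by (rule H.finsum_cong') (use mem ZvZ in \<open>auto simp: H_car\<close>)
      also have "\<dots> = coset B (\<Sum>v\<in>?V. (\<lambda>F. a v * z v F))"
        by (rule finsum_image[OF Z H_car H_zero(1) H_add H_smult finite_vertices[OF \<Delta>]]) (use mem ZvZ in blast)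
      also have "\<dots> = \<zero>\<^bsub>H\<^esub>" using sum[OF z(2) z(1)] s0 by simp
      finally have "finsum H ?y ?V = \<zero>\<^bsub>H\<^esub>" .
      then have y0: "\<forall>v\<in>?V. ?y v = \<zero>\<^bsub>H\<^esub>"
        using ind[unfolded independent_subspaces_def, folded H_def Hv_def, rule_format, OF yP] by blast
      have zB: "z v \<in> B" if v: "v \<in> ?V" for v
      proof -
        have "coset B (\<lambda>F. a v * z v F) = B" using y0[rule_format, OF v] v by (simp add: H_zero(2))
        then have "(\<lambda>F. a v * z v F) \<in> B" by (simp add: coset_eq_iff[OF B])
        then have "(\<lambda>F. inverse (a v) * (a v * z v F)) \<in> B" by (rule fs.subspace_scale[OF B])
        then show ?thesis using a[OF v] by (simp add: mult.assoc[symmetric])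
      qed
      define f where "f y = (if fst y \<in> ?V then z (fst y) (snd y) else 0)" for y
      have fz: "(\<lambda>F. f (v, F)) = z v" if "v \<in> ?V" for v using that by (simp add: f_def)
      have "f \<in> lab ?V N" unfolding lab_def using z(1) zB by (auto simp: fz N_def) (simp add: f_def)
      moreover have "x = \<phi> f"
      proof
        fix v show "x v = \<phi> f v"
          using z(2) PiE_arb[OF x] by (cases "v \<in> ?V") (auto simp: \<phi>_def fz)
      qed
      ultimately show "x \<in> \<phi> ` lab ?V N" by blast
    next
      fix x assume "x \<in> \<phi> ` lab ?V N"
      then obtain f where f: "x = \<phi> f" "f \<in> lab ?V N" by (rule imageE)
      have fN: "(\<lambda>F. f (v, F)) \<in> N v" if "v \<in> ?V" for v using f(2) that by (simp add: lab_def)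
      have "x \<in> (\<Pi>\<^sub>E v\<in>?V. carrier (Hv v))"
        unfolding f(1) \<phi>_def restrict_PiE_iff Hv_car using fN by (auto simp: N_def)
      moreover have "sum_incl_star a \<Delta> i x = coset B (\<Sum>v\<in>?V. (\<lambda>F. a v * f (v, F)))"
        by (rule sum) (use fN in \<open>auto simp: f(1) \<phi>_def N_def\<close>)
      moreover have "(\<Sum>v\<in>?V. (\<lambda>F. a v * f (v, F))) \<in> B"
      proof (rule fs.subspace_sum[OF B])
        fix v assume "v \<in> ?V"
        then have "(\<lambda>F. f (v, F)) \<in> B" using fN by (simp add: N_def)
        then show "(\<lambda>F. a v * f (v, F)) \<in> B" by (rule fs.subspace_scale[OF B])
      qed
      ultimately show "x \<in> carrier K"
        using coset_eq_iff[OF B] by (simp add: K_def M_def direct_sum_space_def H_zero(2))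
    qed
    show "\<phi> 0 = \<zero>\<^bsub>K\<^esub>"
      unfolding \<phi>_def K_simps by (rule restrict_ext) (use Hv_zero(1) in \<open>simp add: zero_fun_def\<close>)
    show "\<phi> (f + g) = \<phi> f \<oplus>\<^bsub>K\<^esub> \<phi> g" for f g
      unfolding \<phi>_def K_simps
    proof (rule restrict_ext)
      fix v assume v: "v \<in> ?V"
      have "coset (Bv v) (\<lambda>F. (f + g) (v, F)) = coset (Bv v) ((\<lambda>F. f (v, F)) + (\<lambda>F. g (v, F)))"
        by (simp add: plus_fun_def)
      then show "coset (Bv v) (\<lambda>F. (f + g) (v, F)) = (\<lambda>v\<in>?V. coset (Bv v) (\<lambda>F. f (v, F))) v
          \<oplus>\<^bsub>Hv v\<^esub> (\<lambda>v\<in>?V. coset (Bv v) (\<lambda>F. g (v, F))) v"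
        using v by (simp only: Hv_add restrict_apply')
    qed
    show "\<phi> (\<lambda>x. c * f x) = c \<odot>\<^bsub>K\<^esub> \<phi> f" for c f
      unfolding \<phi>_def K_simps
    proof (rule restrict_ext)
      fix v assume v: "v \<in> ?V"
      show "coset (Bv v) (\<lambda>F. c * f (v, F)) = c \<odot>\<^bsub>Hv v\<^esub> (\<lambda>v\<in>?V. coset (Bv v) (\<lambda>F. f (v, F))) v"
        using v by (simp only: Hv_smult restrict_apply')
    qed
  qed
  moreover have "{f \<in> lab ?V N. \<phi> f = \<zero>\<^bsub>K\<^esub>} = lab ?V Bv"
  proof (rule Set.set_eqI)
    fix f
    have "\<phi> f = \<zero>\<^bsub>K\<^esub> \<longleftrightarrow> (\<forall>v\<in>?V. coset (Bv v) (\<lambda>F. f (v, F)) = Bv v)"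
      unfolding \<phi>_def K_simps Hv_zero(2) by (auto simp: fun_eq_iff restrict_def)
    also have "\<dots> \<longleftrightarrow> (\<forall>v\<in>?V. (\<lambda>F. f (v, F)) \<in> Bv v)" by (simp only: coset_eq_iff[OF Bv])
    finally show "f \<in> {f \<in> lab ?V N. \<phi> f = \<zero>\<^bsub>K\<^esub>} \<longleftrightarrow> f \<in> lab ?V Bv" using BN by (auto simp: lab_def)
  qed
  moreover have "fs.dim (lab ?V N) = (\<Sum>v\<in>?V. fs.dim (N v))"
    by (rule dim_lab[OF finite_vertices[OF \<Delta>] N NF finite_star_faces[OF S(1)]])
  moreover have "fs.dim (lab ?V Bv) = (\<Sum>v\<in>?V. fs.dim (Bv v))"
    by (rule dim_lab[OF finite_vertices[OF \<Delta>] Bv order_trans[OF BN NF] finite_star_faces[OF S(1)]])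
  moreover have "kernel_dim a \<Delta> i = vs_dim K"
    by (simp add: kernel_dim_def Let_def K_def M_def H_def Hv_def[abs_def])
  ultimately show ?thesis unfolding N_def Zv_def B_def Bv_def by simp
qed

text \<open>A relative cocycle that is a coboundary in \<open>\<Delta>\<close> annihilates both
  parts of \<open>I v\<close>: the boundaries because it is a cocycle, the global cycles because it
  is a coboundary.\<close>

lemma (in counting) dim_I:
  assumes "v \<in> V"
  shows "fs.dim (I v) + fs.dim (cocycles \<Delta> (costar \<Delta> v) (int d - 2) \<inter> coboundaries \<Delta> {} (int d - 2) :: ('v set \<Rightarrow> 'k) set)
    \<le> card (SR v)"
proof -
  define W where "W = (cocycles \<Delta> (costar \<Delta> v) (int d - 2) \<inter> coboundaries \<Delta> {} (int d - 2) :: ('v set \<Rightarrow> 'k) set)"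
  have WF: "W \<subseteq> FS (SR v)" by (auto simp: W_def cocycles_eq faces_minus_costar)
  let ?P = "{f \<in> FS (SR v). \<forall>w\<in>W. (\<Sum>x\<in>SR v. w x * f x) = 0}"
  have SRD: "SR v \<subseteq> \<Delta>" by (auto simp: star_faces_def faces_def)
  have pair: "(\<Sum>x\<in>SR v. w x * res v c x) = (\<Sum>x\<in>\<Delta>. w x * c x)" if "w \<in> W" for w c
  proof -
    have "(\<Sum>x\<in>SR v. w x * res v c x) = (\<Sum>x\<in>SR v. w x * c x)" by (intro sum.cong refl) (simp add: res_def)
    also have "\<dots> = (\<Sum>x\<in>\<Delta>. w x * c x)"
      by (rule sum_support[OF S(1) SRD]) (use that WF in \<open>auto simp: FS_def\<close>)
    finally show ?thesis .
  qed
  have "I v \<subseteq> ?P"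
  proof
    fix f assume f: "f \<in> I v"
    then obtain b z where b: "b \<in> FS (SF v)" and z: "z \<in> Z" and feq: "f = res v (boundary \<Delta> b) + res v z"
      unfolding I_def by blast
    have "(\<Sum>x\<in>SR v. w x * f x) = 0" if w: "w \<in> W" for w
    proof -
      have w1: "coboundary \<Delta> w = 0" using w by (simp add: W_def cocycles_eq)
      obtain g where g: "w = coboundary \<Delta> g" using w by (auto simp: W_def coboundaries_eq)
      have "(\<Sum>x\<in>SR v. w x * f x) = (\<Sum>x\<in>\<Delta>. w x * boundary \<Delta> b x) + (\<Sum>x\<in>\<Delta>. w x * z x)"
        unfolding feq plus_fun_apply distrib_left sum.distrib pair[OF w] ..
      also have "(\<Sum>x\<in>\<Delta>. w x * boundary \<Delta> b x) = 0"
        unfolding boundary_coboundary_adjoint[OF \<Delta>, symmetric] w1 by simp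
      also have "(\<Sum>x\<in>\<Delta>. w x * z x) = 0"
        unfolding g boundary_coboundary_adjoint[OF \<Delta>] using z by (simp add: cycles_eq)
      finally show ?thesis by simp
    qed
    then show "f \<in> ?P" using I_FS f by blast
  qed
  then have "fs.dim (I v) \<le> fs.dim ?P" by (intro dim_mono[OF fin(6)]) auto
  then show ?thesis using dim_perp[OF fin(6) WF] unfolding W_def by simp
qed

text \<open>The top faces of the link correspond to the facets at \<open>v\<close>, and there are no
  boundaries in its top degree. The top cycles and the boundaries one degree below add up to the
  number of top faces, which leaves only the cycles of degree \<open>d - 3\<close>.\<close>

lemma dim_cycles_link:
  fixes \<Delta> :: "'v::linorder set set"
  assumes \<Delta>: "simplicial_complex \<Delta>" and card_le: "\<And>F. F \<in> \<Delta> \<Longrightarrow> card F \<le> d" and v: "{v} \<in> \<Delta>"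
  shows "int (betti TYPE('k::field) (link \<Delta> {v}) (int d - 2)) - int (betti TYPE('k) (link \<Delta> {v}) (int d - 3))
    = int (card (star_faces \<Delta> {v} (int d - 1))) - int (fs.dim (cycles (link \<Delta> {v}) (int d - 3) :: ('v set \<Rightarrow> 'k) set))"
proof -
  let ?L = "link \<Delta> {v}"
  note L = simplicial_complex_link[OF \<Delta> v] and S = simplicial_complexD[OF \<Delta>]
  note SL = simplicial_complexD[OF L]
  have cardU: "card (insert v F) = Suc (card F)" if "F \<in> ?L" for F
    using that SL(3)[OF that] by (subst card_insert_disjoint) (auto simp: link_def)
  have UD: "insert v F \<in> \<Delta>" "v \<notin> F" if "F \<in> ?L" for F using that by (auto simp: link_def)
  have "bij_betw (insert v) (faces ?L (int d - 2)) (star_faces \<Delta> {v} (int d - 1))"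
  proof (rule bij_betw_byWitness[where f'="\<lambda>F. F - {v}"])
    show "\<forall>F\<in>faces ?L (int d - 2). insert v F - {v} = F" using UD by (auto simp: faces_def)
    show "\<forall>F\<in>star_faces \<Delta> {v} (int d - 1). insert v (F - {v}) = F" by (auto simp: star_faces_def)
    show "insert v ` faces ?L (int d - 2) \<subseteq> star_faces \<Delta> {v} (int d - 1)"
      using UD cardU by (auto simp: faces_def star_faces_def)
    show "(\<lambda>F. F - {v}) ` star_faces \<Delta> {v} (int d - 1) \<subseteq> faces ?L (int d - 2)"
    proof
      fix G assume "G \<in> (\<lambda>F. F - {v}) ` star_faces \<Delta> {v} (int d - 1)"
      then obtain F where F: "G = F - {v}" "F \<in> \<Delta>" "v \<in> F" "int (card F) = int d" by (auto simp: star_faces_def faces_def)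
      have "card F = Suc (card G)" unfolding F(1) by (rule card.remove[OF S(3)[OF F(2)] F(3)])
      moreover have "G \<in> ?L" using F by (simp add: link_def insert_absorb)
      ultimately show "G \<in> faces ?L (int d - 2)" using F(4) by (simp add: faces_def)
    qed
  qed
  then have card: "card (faces ?L (int d - 2)) = card (star_faces \<Delta> {v} (int d - 1))" by (rule bij_betw_same_card)
  have "faces ?L (int d - 2 + 1) = {}"
  proof -
    have "card F < d" if "F \<in> ?L" for F using card_le[OF UD(1)[OF that]] cardU[OF that] by simp
    then show ?thesis by (force simp: faces_def)
  qed
  note top = boundaries_top[OF this SL(1), where ?'k='k]
  show ?thesis
    using betti_eq[OF L, of "int d - 2", where ?'k='k] betti_eq[OF L, of "int d - 3", where ?'k='k] top
      dim_cycles_boundaries[OF L, of "int d - 2", where ?'k='k] card by simp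
qed

lemma dim_cycles_codim1:
  fixes \<Delta> :: "'v::linorder set set"
  assumes \<Delta>: "simplicial_complex \<Delta>" and card_le: "\<And>F. F \<in> \<Delta> \<Longrightarrow> card F \<le> d"
  shows "int (fs.dim (cycles \<Delta> (int d - 2) :: ('v set \<Rightarrow> 'k::field) set)) - int (card (faces \<Delta> (int d - 1)))
    = int (betti TYPE('k) \<Delta> (int d - 2)) - int (betti TYPE('k) \<Delta> (int d - 1))"
proof -
  note S = simplicial_complexD[OF \<Delta>]
  have "faces \<Delta> (int d - 1 + 1) = {}" using card_le by (force simp: faces_def)
  note top = boundaries_top[OF this S(1), where ?'k='k]
  show ?thesis
    using betti_eq[OF \<Delta>, of "int d - 2", where ?'k='k] betti_eq[OF \<Delta>, of "int d - 1", where ?'k='k] top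
      dim_cycles_boundaries[OF \<Delta>, of "int d - 1", where ?'k='k] by simp
qed

lemma g2_eq:
  assumes \<Delta>: "simplicial_complex \<Delta>" and sdim: "sdim \<Delta> = int d - 1" and d: "2 \<le> d"
  shows "g2 \<Delta> = int (card (faces \<Delta> 1)) - int d * int (card (vertices \<Delta>)) + int (Suc d choose 2)"
proof -
  note S = simplicial_complexD[OF \<Delta>]
  have f0: "faces \<Delta> (-1) = {{}}" using S(2,3) by (auto simp: faces_def)
  have "faces \<Delta> 0 = (\<lambda>v. {v}) ` vertices \<Delta>" by (auto simp: faces_def vertices_def card_1_singleton_iff image_iff)
  then have f1: "card (faces \<Delta> 0) = card (vertices \<Delta>)" by (simp add: card_image)
  have nd: "nat (sdim \<Delta> + 1) = d" using sdim by simp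
  have h1: "h_num \<Delta> 1 = - int d + int (card (vertices \<Delta>))"
    unfolding h_num_def Let_def nd by (simp add: f0 f1)
  have h2: "h_num \<Delta> 2 = int (d choose 2) - int (d - 1) * int (card (vertices \<Delta>)) + int (card (faces \<Delta> 1))"
    unfolding h_num_def Let_def nd by (simp add: f0 f1 numeral_2_eq_2)
  have "Suc d choose 2 = (d choose 2) + d" by (simp add: numeral_2_eq_2)
  then show ?thesis unfolding g2_def h1 h2 using d by (simp add: of_nat_diff algebra_simps)
qed

theorem theorem4p9:
  fixes \<Delta> :: "'v::linorder set set" and a :: "'v \<Rightarrow> 'k::field" and d :: nat
  assumes "infinite (UNIV :: 'k set)"
    and "homologically_isolated_singularities TYPE('k) \<Delta>"
    and "sdim \<Delta> = int d - 1"
    and "\<forall>v\<in>vertices \<Delta>. a v \<noteq> 0"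
    and "d \<ge> 5 \<or> d = 4 \<and> card (singular_vertices TYPE('k) \<Delta>) \<le> 5"
  shows "g2 \<Delta> \<ge>
    int ((d + 1) choose 2) *
        (int (betti TYPE('k) \<Delta> (int d - 2)) - int (betti TYPE('k) \<Delta> (int d - 1)) + 1)
    + int d * int (kernel_dim a \<Delta> (int d - 2))
    - int d * (\<Sum>v\<in>vertices \<Delta>.
        int (betti TYPE('k) (link \<Delta> {v}) (int d - 3))
        - int (betti TYPE('k) (link \<Delta> {v}) (int d - 2)) + 1)"
proof -
  have iso: "isolated_singularities TYPE('k) \<Delta>"
    and independent: "\<forall>i. 0 \<le> i \<and> i \<le> sdim \<Delta> - 1 \<longrightarrow>
      independent_subspaces (cohomology \<Delta> {} i :: ('k, ('v set \<Rightarrow> 'k) set) module) (vertices \<Delta>)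
        (\<lambda>v. incl_star \<Delta> i ` carrier (cohomology \<Delta> (costar \<Delta> v) i))"
    using assms(2) unfolding homologically_isolated_singularities_def by (rule conjunct1, rule conjunct2)
  have \<Delta>: "simplicial_complex \<Delta>" and pure: "pure \<Delta>"
    and man: "\<forall>v\<in>vertices \<Delta>. homology_manifold TYPE('k) (link \<Delta> {v})"
    using iso by (auto simp: isolated_singularities_def)
  have d4: "4 \<le> d" using assms(5) by auto
  note card_le = card_face_le[OF \<Delta> pure assms(3)]
  obtain p :: "'v \<Rightarrow> nat \<Rightarrow> 'k" where p: "\<forall>v\<in>vertices \<Delta>. p v 0 \<noteq> 0" "\<forall>F\<in>faces \<Delta> (int d - 1). indep (Suc d) p F"
    "\<forall>c\<in>FS (pairs (Suc d) \<times> faces \<Delta> (int d - 2)).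
      (\<forall>F\<in>faces \<Delta> (int d - 2). \<forall>v\<in>F. \<forall>j<Suc d. ctr (Suc d) (p v) (\<lambda>t. c (t, F)) j = 0) \<longrightarrow>
      (\<forall>t\<in>pairs (Suc d). boundary \<Delta> (\<lambda>F. c (t, F)) = 0) \<longrightarrow> c = 0"
    using rigid_configuration[OF assms(1) iso assms(3,5)] by (elim exE conjE) (rule that)
  interpret counting \<Delta> d p
  proof
    show "spherical TYPE('k) \<Delta> d e" if "e \<in> faces \<Delta> 1" for e
      by (rule spherical_of_card_ge_2[OF \<Delta> pure assms(3) man]) (use that in \<open>auto simp: faces_def\<close>)
    show "c = 0" if c: "c \<in> FS (pairs (Suc d) \<times> faces \<Delta> (int d - 2))"
      and kill: "\<And>F v j. F \<in> faces \<Delta> (int d - 2) \<Longrightarrow> v \<in> F \<Longrightarrow> j < Suc d \<Longrightarrow> ctr (Suc d) (p v) (\<lambda>t. c (t, F)) j = 0"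
      and cyc: "\<And>t. t \<in> pairs (Suc d) \<Longrightarrow> boundary \<Delta> (\<lambda>F. c (t, F)) = 0" for c
      by (rule p(3)[rule_format, OF c kill cyc])
  qed (use \<Delta> card_le p(1,2) in auto)
  let ?W = "\<lambda>v. cocycles \<Delta> (costar \<Delta> v) (int d - 2) \<inter> coboundaries \<Delta> {} (int d - 2) :: ('v set \<Rightarrow> 'k) set"
  let ?B = "\<lambda>v. coboundaries \<Delta> (costar \<Delta> v) (int d - 2) :: ('v set \<Rightarrow> 'k) set"
  let ?b = "\<lambda>v i. int (betti TYPE('k) (link \<Delta> {v}) i)"
  \<comment> \<open>Degree \<open>d - 2\<close> equals \<open>sdim \<Delta> - 1\<close>, the last
    one in which independence is assumed.\<close>
  have ker: "kernel_dim a \<Delta> (int d - 2) + (\<Sum>v\<in>V. fs.dim (?B v)) = (\<Sum>v\<in>V. fs.dim (?W v))"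
    by (rule kernel_dim_eq[OF \<Delta>]) (use assms(3,4) independent d4 in auto)
  \<comment> \<open>The sum of \<open>dim (I v)\<close> and \<open>dim (?W v)\<close> is at most the
    number of ridges at \<open>v\<close>, which in turn is the dimension of the relative
    coboundaries plus that of the relative cycles. The latter are the \<open>(d-3)\<close>-cycles of
    the link, so \<open>dim_cycles_link\<close> applies.\<close>
  have star: "int (fs.dim (I v)) + int (fs.dim (?W v)) - int (fs.dim (?B v)) - int (card (SF v)) \<le> ?b v (int d - 3) - ?b v (int d - 2)"
    if v: "v \<in> V" for v
  proof -
    have vD: "{v} \<in> \<Delta>" using v by (simp add: vertices_def)
    show ?thesis
      using dim_I[OF v] dim_coboundaries_costar[OF \<Delta>, of v "int d - 2", where ?'k='k]
        dim_rel_cycles[OF \<Delta> vD, of "int d - 2", where ?'k='k] dim_cycles_link[OF \<Delta> card_le vD, where ?'k='k] by simp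
  qed
  have "(\<Sum>v\<in>V. int (fs.dim (I v)) + int (fs.dim (?W v)) - int (fs.dim (?B v)) - int (card (SF v)))
      \<le> (\<Sum>v\<in>V. ?b v (int d - 3) - ?b v (int d - 2))"
    by (rule sum_mono[OF star])
  then have "int (\<Sum>v\<in>V. fs.dim (I v)) + int (kernel_dim a \<Delta> (int d - 2)) - int (\<Sum>v\<in>V. card (SF v))
      \<le> (\<Sum>v\<in>V. ?b v (int d - 3) - ?b v (int d - 2))"
    using ker[symmetric, THEN arg_cong[of _ _ int]] by (simp add: sum.distrib sum_subtractf)
  from mult_left_mono[OF this, of "int d"]
  have "int d * int (\<Sum>v\<in>V. fs.dim (I v)) + int d * int (kernel_dim a \<Delta> (int d - 2)) - int d * int (\<Sum>v\<in>V. card (SF v))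
      \<le> int d * (\<Sum>v\<in>V. ?b v (int d - 3) - ?b v (int d - 2))" by (simp add: algebra_simps)
  moreover have "int (n choose 2) * int (fs.dim Z) + int d * int (\<Sum>v\<in>V. card (SF v))
      \<le> int (card Ed) + int (n choose 2) * int (card Fc) + int d * int (\<Sum>v\<in>V. fs.dim (I v))"
    using edge_inequality unfolding of_nat_mult[symmetric] of_nat_add[symmetric] of_nat_le_iff .
  moreover have "int (n choose 2) * int (fs.dim Z) - int (n choose 2) * int (card Fc)
      = int (n choose 2) * (int (betti TYPE('k) \<Delta> (int d - 2)) - int (betti TYPE('k) \<Delta> (int d - 1)))"
    using dim_cycles_codim1[OF \<Delta> card_le, where ?'k='k] by (simp only: right_diff_distrib[symmetric])
  \<comment> \<open>The summand 1 at every vertex accounts for the term \<open>- d f_0\<close> of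
    \<open>g2\<close>.\<close>
  moreover have "(\<Sum>v\<in>V. ?b v (int d - 3) - ?b v (int d - 2) + 1) = (\<Sum>v\<in>V. ?b v (int d - 3) - ?b v (int d - 2)) + int (card V)"
    by (simp add: sum.distrib)
  moreover have "g2 \<Delta> = int (card Ed) - int d * int (card V) + int (n choose 2)"
    by (rule g2_eq[OF \<Delta> assms(3)]) (use d4 in simp)
  ultimately show ?thesis unfolding Suc_eq_plus1[symmetric] by (simp only: distrib_left mult_1_right)
qed

end
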